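(* Let $X$ be an $N=1$ superconformal curve over $\Lambda$ and let $c\in\mathbb C$, $c\ne0$. The set of splittings of the extension $$0\to\mathrm{Ber}_X^{\otimes3}\to\mathcal K(1)_{\le3/2}^*\to\mathcal O_X\to0$$ is in one to one correspondence with the set of superprojective structures on $X$.
   Context: $\Lambda$ is a Grassmann algebra over $\mathbb C$; work in the complex analytic category. An $N=1$ superconformal curve over $\Lambda$ is a superspace $(X,\mathcal O_X)$ over $\Lambda$ whose reduction is a smooth compact connected curve, locally of the form $\mathcal O_X=\mathcal O_X^{\mathrm{red}}\otimes\Lambda[\theta]$, with an atlas of coordinates $(z_\alpha,\theta_\alpha)$ (called compatible with the superconformal structure) whose transition functions $z_\beta=F_{\beta,\alpha}(z_\alpha,\theta_\alpha)$, $\theta_\beta=\Psi_{\beta,\alpha}(z_\alpha,\theta_\alpha)$ satisfy $D_\alpha F=\Psi D_\alpha\Psi$, where $D_\alpha=\partial_{\theta_\alpha}+\theta_\alpha\partial_{z_\alpha}$. $\mathrm{Ber}_X$ is the Berezinian bundle, of rank $0|1$, with $[dz_\beta d\theta_\beta]=(D_\alpha\Psi_{\beta,\alpha})[dz_\alpha d\theta_\alpha]$. For an invertible even function $G$ the super-Schwarzian is $\sigma(G)=\frac{D^3G}{G}-2\frac{DG\,D^2G}{G^2}$. A superprojective structure on $X$ is a maximal atlas of coordinates compatible with the superconformal structure whose transition functions are of the form $$z'=\frac{az+b+\alpha\theta}{cz+d+\beta\theta},\qquad\theta'=\frac{\gamma z+\delta+e\theta}{cz+d+\beta\theta}$$ with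 even constants $a,b,c,d,e\in\Lambda$ and odd constants $\alpha,\beta,\gamma,\delta\in\Lambda$ such that the superdeterminant of $\begin{pmatrix} a & b & \alpha \\ c & d & \beta \\ \gamma & \delta & e \end{pmatrix}$ equals 1 (the superdeterminant of $\begin{pmatrix} K & L \\ M & P \end{pmatrix}$ is $\det(K-LP^{-1}M)\det(P)^{-1}$). Here the constant called $c$ in the fractional linear transformation is unrelated to the central charge $c$ of the claim. The bundle. $\mathcal K(1)_{\le3/2}$ is the rank $1|1$ vector bundle on $X$ associated with the span of the vacuum $|0\rangle$ and the odd superconformal vector $\tau$ in the Neveu-Schwarz vertex algebra of central charge $c$. Explicitly, in compatible coordinates it has a local frame consisting of an even element $|0\rangle_\alpha$ and an odd element $\tau_\alpha$, and on overlaps $$|0\rangle_\alpha=|0\rangle_\beta,\qquad\tau_\alpha=(D_\alpha\Psi_{\beta,\alpha})^3\tau_\beta+\frac c3\,\sigma(D_\alpha\Psi_{\beta,\alpha})\,|0\rangle_\beta$$ with $D=D_\alpha$ in $\sigma$. The extension in the claim is the dual of $0\to\mathcal O_X|0\rangle\to\mathcal K(1)_{\le3/2}\to\mathcal K(1)_{\le3/2}/\mathcal O_X|0\rangle\to0$. A splitting is an even $\mathcal O_X$-linear section of the surjection onto $\mathcal O_X$. *)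

theory Defs
  imports
    "HOL-Analysis.Analysis"
    "HOL-Algebra.QuotRing"
    "HOL-Library.Type_Length"
begin

section \<open>Grassmann algebras\<close>

text \<open>
  The Grassmann algebra over the complex numbers on the finitely many odd generators
  \<open>\<xi>\<^sub>i\<close>, \<open>i < LENGTH('n)\<close> (possibly none). An element is given by its coefficients:
  \<open>gcoef x S\<close> is the coefficient of the monomial \<open>\<xi>\<^sub>S\<close>, the product of the \<open>\<xi>\<^sub>i\<close>, \<open>i \<in> S\<close>, in
  increasing order.
\<close>

typedef (overloaded) 'n grassmann =
  "{f :: nat set \<Rightarrow> complex. \<forall>S. \<not> S \<subseteq> {..<LENGTH('n::len0)} \<longrightarrow> f S = 0}"
  morphisms gcoef Abs_grassmann
  by (rule exI[of _ "\<lambda>_. 0"]) simp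

lemma gcoef_outside: "\<not> S \<subseteq> {..<LENGTH('n::len0)} \<Longrightarrow> gcoef (x :: 'n grassmann) S = 0"
  using gcoef[of x] by blast

lemma grassmann_eqI:
  "(\<And>S. S \<subseteq> {..<LENGTH('n::len0)} \<Longrightarrow> gcoef x S = gcoef y S) \<Longrightarrow> x = (y :: 'n grassmann)"
  by (metis gcoef_inject gcoef_outside ext)

text \<open>\<open>\<xi>\<^sub>A \<xi>\<^sub>B = gsign A B * \<xi>\<^bsub>A \<union> B\<^esub>\<close> for disjoint \<open>A\<close> and \<open>B\<close>.\<close>

definition gsign :: "nat set \<Rightarrow> nat set \<Rightarrow> complex" where
  "gsign A B = (- 1) ^ card {(a, b). a \<in> A \<and> b \<in> B \<and> b < a}"

lemma gsign_empty [simp]: "gsign {} B = 1" "gsign A {} = 1"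
  by (simp_all add: gsign_def)

lemma gsign_Un_left:
  assumes "finite A" "finite B" "finite C" "A \<inter> B = {}"
  shows "gsign (A \<union> B) C = gsign A C * gsign B C"
proof -
  let ?I = "\<lambda>A C. {(a, b). a \<in> A \<and> b \<in> C \<and> b < (a::nat)}"
  have fin: "finite (?I A C)" "finite (?I B C)"
    using assms by (auto intro: finite_subset[of _ "A \<times> C"] finite_subset[of _ "B \<times> C"])
  have "?I (A \<union> B) C = ?I A C \<union> ?I B C" "?I A C \<inter> ?I B C = {}"
    using assms(4) by auto
  then show ?thesis
    unfolding gsign_def using fin by (simp add: card_Un_disjoint power_add)
qed

lemma gsign_Un_right:
  assumes "finite A" "finite B" "finite C" "B \<inter> C = {}"
  shows "gsign A (B \<union> C) = gsign A B * gsign A C"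
proof -
  let ?I = "\<lambda>A C. {(a, b). a \<in> A \<and> b \<in> C \<and> b < (a::nat)}"
  have fin: "finite (?I A B)" "finite (?I A C)"
    using assms by (auto intro: finite_subset[of _ "A \<times> B"] finite_subset[of _ "A \<times> C"])
  have "?I A (B \<union> C) = ?I A B \<union> ?I A C" "?I A B \<inter> ?I A C = {}"
    using assms(4) by auto
  then show ?thesis
    unfolding gsign_def using fin by (simp add: card_Un_disjoint power_add)
qed

instantiation grassmann :: (len0) ring_1
begin

definition zero_grassmann :: "'a grassmann" where
  "0 = Abs_grassmann (\<lambda>_. 0)"

definition one_grassmann :: "'a grassmann" where
  "1 = Abs_grassmann (\<lambda>S. if S = {} then 1 else 0)"

definition plus_grassmann :: "'a grassmann \<Rightarrow> 'a grassmann \<Rightarrow> 'a grassmann" where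
  "x + y = Abs_grassmann (\<lambda>S. gcoef x S + gcoef y S)"

definition uminus_grassmann :: "'a grassmann \<Rightarrow> 'a grassmann" where
  "- x = Abs_grassmann (\<lambda>S. - gcoef x S)"

definition minus_grassmann :: "'a grassmann \<Rightarrow> 'a grassmann \<Rightarrow> 'a grassmann" where
  "x - y = Abs_grassmann (\<lambda>S. gcoef x S - gcoef y S)"

definition times_grassmann :: "'a grassmann \<Rightarrow> 'a grassmann \<Rightarrow> 'a grassmann" where
  "x * y = Abs_grassmann (\<lambda>S. if S \<subseteq> {..<LENGTH('a)}
     then \<Sum>A\<in>Pow S. gsign A (S - A) * gcoef x A * gcoef y (S - A) else 0)"

lemma gcoef_simps:
  "gcoef (0 :: 'a grassmann) S = 0"
  "gcoef (1 :: 'a grassmann) S = (if S = {} then 1 else 0)"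
  "gcoef (x + y) S = gcoef x S + gcoef (y :: 'a grassmann) S"
  "gcoef (- x) S = - gcoef (x :: 'a grassmann) S"
  "gcoef (x - y) S = gcoef x S - gcoef (y :: 'a grassmann) S"
  unfolding zero_grassmann_def one_grassmann_def plus_grassmann_def uminus_grassmann_def
    minus_grassmann_def
  by (subst Abs_grassmann_inverse; simp add: gcoef_outside)+

lemma gcoef_times:
  "S \<subseteq> {..<LENGTH('a)} \<Longrightarrow> gcoef (x * y :: 'a grassmann) S =
     (\<Sum>A\<in>Pow S. gsign A (S - A) * gcoef x A * gcoef y (S - A))"
  unfolding times_grassmann_def by (subst Abs_grassmann_inverse) auto

lemma grassmann_mult_assoc: "(x * y) * z = x * (y * z)" for x y z :: "'a grassmann"
proof (rule grassmann_eqI)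
  fix S assume S: "S \<subseteq> {..<LENGTH('a)}"
  then have fin: "finite S" by (rule finite_subset) simp
  let ?t = "\<lambda>A B C. gsign A B * gsign A C * gsign B C * gcoef x A * gcoef y B * gcoef z C"
  have "gcoef ((x * y) * z) S = (\<Sum>U\<in>Pow S. \<Sum>A\<in>Pow U. ?t A (U - A) (S - U))"
    unfolding gcoef_times[OF S]
  proof (rule sum.cong[OF refl])
    fix U assume "U \<in> Pow S"
    then have U: "U \<subseteq> S" "U \<subseteq> {..<LENGTH('a)}" "finite U"
      using S fin finite_subset by auto
    show "gsign U (S - U) * gcoef (x * y) U * gcoef z (S - U) =
        (\<Sum>A\<in>Pow U. ?t A (U - A) (S - U))"
      unfolding gcoef_times[OF U(2)] sum_distrib_left sum_distrib_right
    proof (rule sum.cong[OF refl])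
      fix A assume "A \<in> Pow U"
      then have A: "A \<subseteq> U" "finite A" using U finite_subset by auto
      have "gsign (A \<union> (U - A)) (S - U) = gsign A (S - U) * gsign (U - A) (S - U)"
        by (rule gsign_Un_left) (use A U fin in auto)
      moreover have "A \<union> (U - A) = U" using A by auto
      ultimately show "gsign U (S - U) * (gsign A (U - A) * gcoef x A * gcoef y (U - A)) *
          gcoef z (S - U) = ?t A (U - A) (S - U)"
        by (simp add: mult_ac)
    qed
  qed
  also have "\<dots> = (\<Sum>(U, A)\<in>Sigma (Pow S) Pow. ?t A (U - A) (S - U))"
    using fin by (subst sum.Sigma) (auto intro: finite_subset)
  also have "\<dots> = (\<Sum>(A, B)\<in>Sigma (Pow S) (\<lambda>A. Pow (S - A)). ?t A B (S - A - B))"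
    by (rule sum.reindex_bij_witness[where i = "\<lambda>(A, B). (A \<union> B, A)" and j = "\<lambda>(U, A). (A, U - A)"])
      (auto simp: Un_absorb1 Diff_eq intro!: arg_cong2[where f = "(*)"] arg_cong[where f = "gcoef z"]
        arg_cong2[where f = gsign])
  also have "\<dots> = (\<Sum>A\<in>Pow S. \<Sum>B\<in>Pow (S - A). ?t A B (S - A - B))"
    using fin by (subst sum.Sigma) (auto intro: finite_subset)
  also have "\<dots> = gcoef (x * (y * z)) S"
    unfolding gcoef_times[OF S]
  proof (rule sum.cong[OF refl])
    fix A assume "A \<in> Pow S"
    then have A: "A \<subseteq> S" "S - A \<subseteq> {..<LENGTH('a)}" "finite A"
      using S fin finite_subset by auto
    show "(\<Sum>B\<in>Pow (S - A). ?t A B (S - A - B)) =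
        gsign A (S - A) * gcoef x A * gcoef (y * z) (S - A)"
      unfolding gcoef_times[OF A(2)] sum_distrib_left
    proof (rule sum.cong[OF refl])
      fix B assume "B \<in> Pow (S - A)"
      then have B: "B \<subseteq> S - A" "finite B" using fin by (auto intro: finite_subset)
      have "gsign A (B \<union> (S - A - B)) = gsign A B * gsign A (S - A - B)"
        by (rule gsign_Un_right) (use A B fin in auto)
      moreover have "B \<union> (S - A - B) = S - A" using B by auto
      ultimately show "?t A B (S - A - B) = gsign A (S - A) * gcoef x A *
          (gsign B (S - A - B) * gcoef y B * gcoef z (S - A - B))"
        by (simp add: mult_ac)
    qed
  qed
  finally show "gcoef ((x * y) * z) S = gcoef (x * (y * z)) S" .
qed

instance
proof
  fix a b c :: "'a grassmann"
  show "a * b * c = a * (b * c)" by (rule grassmann_mult_assoc)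
  show "a + b + c = a + (b + c)" "a + b = b + a" "0 + a = a" "- a + a = 0" "a - b = a + - b"
    by (rule grassmann_eqI; simp add: gcoef_simps)+
  show "(a + b) * c = a * c + b * c" "a * (b + c) = a * b + a * c"
    by (rule grassmann_eqI; simp add: gcoef_simps gcoef_times algebra_simps sum.distrib)+
  show "1 * a = a"
  proof (rule grassmann_eqI)
    fix S assume S: "S \<subseteq> {..<LENGTH('a)}"
    then have fin: "finite (Pow S)" by (auto intro: finite_subset)
    have "gcoef (1 * a) S = (\<Sum>A\<in>Pow S. if A = {} then gcoef a S else 0)"
      unfolding gcoef_times[OF S] by (rule sum.cong) (auto simp: gcoef_simps)
    then show "gcoef (1 * a) S = gcoef a S" using fin by (simp add: sum.delta)
  qed
  show "a * 1 = a"
  proof (rule grassmann_eqI)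
    fix S assume S: "S \<subseteq> {..<LENGTH('a)}"
    then have fin: "finite (Pow S)" by (auto intro: finite_subset)
    have "gcoef (a * 1) S = (\<Sum>A\<in>Pow S. if A = S then gcoef a S else 0)"
      unfolding gcoef_times[OF S] by (rule sum.cong) (auto simp: gcoef_simps)
    then show "gcoef (a * 1) S = gcoef a S" using fin by (simp add: sum.delta)
  qed
  have "gcoef (0 :: 'a grassmann) {} \<noteq> gcoef 1 {}" by (simp add: gcoef_simps)
  then show "(0 :: 'a grassmann) \<noteq> 1" by metis
qed

end

definition gconst :: "complex \<Rightarrow> 'n::len0 grassmann" where
  "gconst c = Abs_grassmann (\<lambda>S. if S = {} then c else 0)"

text \<open>Parities are booleans throughout: \<^const>\<open>False\<close> is even, \<^const>\<open>True\<close> is odd.\<close>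

definition gparity :: "bool \<Rightarrow> 'n::len0 grassmann set" where
  "gparity p = {x. \<forall>S. gcoef x S \<noteq> 0 \<longrightarrow> odd (card S) = p}"

text \<open>The parity involution, \<open>x \<mapsto> (-1)\<^bsup>|x|\<^esup> x\<close> on homogeneous \<open>x\<close>.\<close>

definition ginvol :: "'n::len0 grassmann \<Rightarrow> 'n grassmann" where
  "ginvol x = Abs_grassmann (\<lambda>S. (- 1) ^ card S * gcoef x S)"

lemma gcoef_ginvol: "gcoef (ginvol x) S = (- 1) ^ card S * gcoef x S"
  unfolding ginvol_def by (subst Abs_grassmann_inverse) (auto simp: gcoef_outside)

lemma ginvol_simps [simp]:
  "ginvol 0 = 0" "ginvol 1 = 1" "ginvol (x + y) = ginvol x + ginvol y" "ginvol (ginvol x) = x"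
  by (rule grassmann_eqI; simp add: gcoef_ginvol gcoef_simps algebra_simps
      flip: mult.assoc power_mult_distrib)+

lemma ginvol_mult [simp]: "ginvol (x * y) = ginvol x * ginvol (y :: 'n::len0 grassmann)"
proof (rule grassmann_eqI)
  fix S assume S: "S \<subseteq> {..<LENGTH('n)}"
  then have fin: "finite S" by (rule finite_subset) simp
  show "gcoef (ginvol (x * y)) S = gcoef (ginvol x * ginvol y) S"
    unfolding gcoef_ginvol gcoef_times[OF S] sum_distrib_left
  proof (rule sum.cong[OF refl])
    fix A assume "A \<in> Pow S"
    then have "card S = card A + card (S - A)"
      using fin by (metis PowD card_Diff_subset card_mono finite_subset le_add_diff_inverse)
    then show "(- 1) ^ card S * (gsign A (S - A) * gcoef x A * gcoef y (S - A)) =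
        gsign A (S - A) * ((- 1) ^ card A * gcoef x A) * ((- 1) ^ card (S - A) * gcoef y (S - A))"
      by (simp add: power_add)
  qed
qed


section \<open>Superfunctions\<close>

text \<open>\<open>SV a b\<close> is the element \<open>a + \<theta> b\<close> of \<open>\<Lambda>[\<theta>]\<close>, where \<open>a \<theta> = \<theta> ginvol a\<close>.\<close>

declare [[typedef_overloaded]]

datatype 'n superval = SV (sv0: "'n::len0 grassmann") (sv1: "'n grassmann")

declare [[typedef_overloaded = false]]

instantiation superval :: (len0) ring_1
begin

definition zero_superval :: "'a superval" where "0 = SV 0 0"
definition one_superval :: "'a superval" where "1 = SV 1 0"
definition plus_superval :: "'a superval \<Rightarrow> 'a superval \<Rightarrow> 'a superval" where
  "x + y = SV (sv0 x + sv0 y) (sv1 x + sv1 y)"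
definition uminus_superval :: "'a superval \<Rightarrow> 'a superval" where
  "- x = SV (- sv0 x) (- sv1 x)"
definition minus_superval :: "'a superval \<Rightarrow> 'a superval \<Rightarrow> 'a superval" where
  "x - y = SV (sv0 x - sv0 y) (sv1 x - sv1 y)"
definition times_superval :: "'a superval \<Rightarrow> 'a superval \<Rightarrow> 'a superval" where
  "x * y = SV (sv0 x * sv0 y) (sv1 x * sv0 y + ginvol (sv0 x) * sv1 y)"

instance
  by standard (auto simp: zero_superval_def one_superval_def plus_superval_def
    uminus_superval_def minus_superval_def times_superval_def algebra_simps)

end

definition svconst :: "'n::len0 grassmann \<Rightarrow> 'n superval" where
  "svconst a = SV a 0"

definition sv_theta :: "'n::len0 superval" where
  "sv_theta = SV 0 1"

definition sv_parity :: "bool \<Rightarrow> 'n::len0 superval set" where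
  "sv_parity p = {x. sv0 x \<in> gparity p \<and> sv1 x \<in> gparity (\<not> p)}"

definition is_unit_elt :: "'a::ring_1 \<Rightarrow> bool" where
  "is_unit_elt x \<longleftrightarrow> (\<exists>y. x * y = 1 \<and> y * x = 1)"

definition unit_inv :: "'a::ring_1 \<Rightarrow> 'a" where
  "unit_inv x = (THE y. x * y = 1 \<and> y * x = 1)"

definition gholomorphic_on :: "(complex \<Rightarrow> 'n::len0 grassmann) \<Rightarrow> complex set \<Rightarrow> bool" where
  "gholomorphic_on f V \<longleftrightarrow> (\<forall>S. (\<lambda>z. gcoef (f z) S) holomorphic_on V)"

definition gderiv :: "(complex \<Rightarrow> 'n::len0 grassmann) \<Rightarrow> complex \<Rightarrow> 'n grassmann" where
  "gderiv f z = Abs_grassmann (\<lambda>S. deriv (\<lambda>w. gcoef (f w) S) z)"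

text \<open>
  The superalgebra \<open>\<O>(V) \<otimes> \<Lambda>[\<theta>]\<close> of superfunctions \<open>f\<^sub>0(z) + \<theta> f\<^sub>1(z)\<close> on an open subset \<open>V\<close> of
  the complex plane; superfunctions are extended by \<open>0\<close> outside \<open>V\<close>.
\<close>

definition superfunctions :: "complex set \<Rightarrow> (complex \<Rightarrow> 'n::len0 superval) ring" where
  "superfunctions V =
    \<lparr> carrier = {f. gholomorphic_on (sv0 \<circ> f) V \<and> gholomorphic_on (sv1 \<circ> f) V \<and>
                   (\<forall>z. z \<notin> V \<longrightarrow> f z = 0)},
      mult = (\<lambda>f g z. f z * g z),
      one = (\<lambda>z. if z \<in> V then 1 else 0),
      zero = (\<lambda>_. 0),
      add = (\<lambda>f g z. f z + g z) \<rparr>"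

definition cut :: "complex set \<Rightarrow> (complex \<Rightarrow> 'n::len0 superval) \<Rightarrow> complex \<Rightarrow> 'n superval" where
  "cut V f = (\<lambda>z. if z \<in> V then f z else 0)"

definition superfunction_parity :: "bool \<Rightarrow> complex set \<Rightarrow> (complex \<Rightarrow> 'n::len0 superval) set" where
  "superfunction_parity p V = {f \<in> carrier (superfunctions V). \<forall>z\<in>V. f z \<in> sv_parity p}"

definition coord_z :: "complex set \<Rightarrow> complex \<Rightarrow> 'n::len0 superval" where
  "coord_z V = cut V (\<lambda>z. svconst (gconst z))"

definition coord_theta :: "complex set \<Rightarrow> complex \<Rightarrow> 'n::len0 superval" where
  "coord_theta V = cut V (\<lambda>_. sv_theta)"

text \<open>\<open>D = \<partial>\<^sub>\<theta> + \<theta> \<partial>\<^sub>z\<close>, so that \<open>D (f\<^sub>0 + \<theta> f\<^sub>1) = f\<^sub>1 + \<theta> f\<^sub>0'\<close>.\<close>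

definition superD :: "complex set \<Rightarrow> (complex \<Rightarrow> 'n::len0 superval) \<Rightarrow> complex \<Rightarrow> 'n superval" where
  "superD V f = cut V (\<lambda>z. SV (sv1 (f z)) (gderiv (sv0 \<circ> f) z))"

definition super_schwarzian ::
    "complex set \<Rightarrow> (complex \<Rightarrow> 'n::len0 superval) \<Rightarrow> complex \<Rightarrow> 'n superval" where
  "super_schwarzian V G = cut V (\<lambda>z.
     superD V (superD V (superD V G)) z * unit_inv (G z)
     - 2 * (superD V G z * superD V (superD V G) z * unit_inv (G z) ^ 2))"


section \<open>Superspaces\<close>

record (overloaded) ('p, 's, 'n::len0) superspace =
  space_of :: "'p topology"
  sect :: "'p set \<Rightarrow> 's ring"
  par :: "bool \<Rightarrow> 'p set \<Rightarrow> 's set"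
  scalar :: "'p set \<Rightarrow> 'n grassmann \<Rightarrow> 's"
  res :: "'p set \<Rightarrow> 'p set \<Rightarrow> 's \<Rightarrow> 's"

definition grassmann_ring :: "'n::len0 grassmann ring" where
  "grassmann_ring = \<lparr> carrier = UNIV, mult = (*), one = 1, zero = 0, add = (+) \<rparr>"

text \<open>A topological space with a sheaf of supercommutative \<open>\<Lambda>\<close>-superalgebras.\<close>

locale superspace =
  fixes X :: "('p, 's, 'n::len0, 'm) superspace_scheme" (structure)
  assumes sect_ring: "openin (space_of X) U \<Longrightarrow> ring (sect X U)"
    and par_subgroup: "openin (space_of X) U \<Longrightarrow> additive_subgroup (par X p U) (sect X U)"
    and par_decomp: "\<lbrakk>openin (space_of X) U; s \<in> carrier (sect X U)\<rbrakk> \<Longrightarrow>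
          \<exists>!(a, b). a \<in> par X False U \<and> b \<in> par X True U \<and> s = a \<oplus>\<^bsub>sect X U\<^esub> b"
    and par_mult: "\<lbrakk>openin (space_of X) U; a \<in> par X p U; b \<in> par X q U\<rbrakk> \<Longrightarrow>
          a \<otimes>\<^bsub>sect X U\<^esub> b \<in> par X (p \<noteq> q) U"
    and supercommutative: "\<lbrakk>openin (space_of X) U; a \<in> par X p U; b \<in> par X q U\<rbrakk> \<Longrightarrow>
          a \<otimes>\<^bsub>sect X U\<^esub> b =
            (if p \<and> q then \<ominus>\<^bsub>sect X U\<^esub> (b \<otimes>\<^bsub>sect X U\<^esub> a) else b \<otimes>\<^bsub>sect X U\<^esub> a)"
    and scalar_hom: "openin (space_of X) U \<Longrightarrow> scalar X U \<in> ring_hom grassmann_ring (sect X U)"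
    and scalar_parity: "\<lbrakk>openin (space_of X) U; x \<in> gparity p\<rbrakk> \<Longrightarrow> scalar X U x \<in> par X p U"
    and res_hom: "\<lbrakk>openin (space_of X) U; openin (space_of X) V; V \<subseteq> U\<rbrakk> \<Longrightarrow>
          res X U V \<in> ring_hom (sect X U) (sect X V)"
    and res_parity: "\<lbrakk>openin (space_of X) U; openin (space_of X) V; V \<subseteq> U; s \<in> par X p U\<rbrakk> \<Longrightarrow>
          res X U V s \<in> par X p V"
    and res_scalar: "\<lbrakk>openin (space_of X) U; openin (space_of X) V; V \<subseteq> U\<rbrakk> \<Longrightarrow>
          res X U V (scalar X U x) = scalar X V x"
    and res_id: "\<lbrakk>openin (space_of X) U; s \<in> carrier (sect X U)\<rbrakk> \<Longrightarrow> res X U U s = s"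
    and res_res: "\<lbrakk>openin (space_of X) U; openin (space_of X) V; openin (space_of X) W;
          W \<subseteq> V; V \<subseteq> U; s \<in> carrier (sect X U)\<rbrakk> \<Longrightarrow> res X V W (res X U V s) = res X U W s"
    and sheaf_locality: "\<lbrakk>\<And>U. U \<in> \<U> \<Longrightarrow> openin (space_of X) U;
          s \<in> carrier (sect X (\<Union>\<U>)); t \<in> carrier (sect X (\<Union>\<U>));
          \<And>U. U \<in> \<U> \<Longrightarrow> res X (\<Union>\<U>) U s = res X (\<Union>\<U>) U t\<rbrakk> \<Longrightarrow> s = t"
    and sheaf_gluing: "\<lbrakk>\<And>U. U \<in> \<U> \<Longrightarrow> openin (space_of X) U;
          \<And>U. U \<in> \<U> \<Longrightarrow> f U \<in> carrier (sect X U);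
          \<And>U V. \<lbrakk>U \<in> \<U>; V \<in> \<U>\<rbrakk> \<Longrightarrow> res X U (U \<inter> V) (f U) = res X V (U \<inter> V) (f V)\<rbrakk> \<Longrightarrow>
          \<exists>s\<in>carrier (sect X (\<Union>\<U>)). \<forall>U\<in>\<U>. res X (\<Union>\<U>) U s = f U"

text \<open>
  A system of coordinates on \<open>cdom \<kappa>\<close> is an isomorphism of the superspace \<open>cdom \<kappa>\<close> with an open
  subset of the complex superspace of dimension \<open>1|1\<close>: a homeomorphism \<open>cpt \<kappa>\<close> onto an open
  subset of the complex plane with an isomorphism \<open>cfun \<kappa>\<close> of sheaves of \<open>\<Lambda>\<close>-superalgebras,
  sending a section to its expression in the coordinates.
\<close>

record (overloaded) ('p, 's, 'n::len0) superchart =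
  cdom :: "'p set"
  cpt :: "'p \<Rightarrow> complex"
  cfun :: "'p set \<Rightarrow> 's \<Rightarrow> complex \<Rightarrow> 'n superval"

definition coordinates ::
    "('p, 's, 'n::len0, 'm) superspace_scheme \<Rightarrow> ('p, 's, 'n) superchart set" where
  "coordinates X = {\<kappa>.
     openin (space_of X) (cdom \<kappa>) \<and>
     cpt \<kappa> \<in> extensional (cdom \<kappa>) \<and>
     open (cpt \<kappa> ` cdom \<kappa>) \<and>
     homeomorphic_map (subtopology (space_of X) (cdom \<kappa>))
       (top_of_set (cpt \<kappa> ` cdom \<kappa>)) (cpt \<kappa>) \<and>
     (\<forall>W. \<not> (openin (space_of X) W \<and> W \<subseteq> cdom \<kappa>) \<longrightarrow> cfun \<kappa> W = undefined) \<and>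
     (\<forall>W. openin (space_of X) W \<and> W \<subseteq> cdom \<kappa> \<longrightarrow>
        cfun \<kappa> W \<in> extensional (carrier (sect X W)) \<and>
        cfun \<kappa> W \<in> ring_iso (sect X W) (superfunctions (cpt \<kappa> ` W)) \<and>
        (\<forall>p. cfun \<kappa> W ` par X p W \<subseteq> superfunction_parity p (cpt \<kappa> ` W)) \<and>
        (\<forall>x. cfun \<kappa> W (scalar X W x) = cut (cpt \<kappa> ` W) (\<lambda>_. svconst x)) \<and>
        (\<forall>W' s. openin (space_of X) W' \<and> W' \<subseteq> W \<and> s \<in> carrier (sect X W) \<longrightarrow>
           cfun \<kappa> W' (res X W W' s) = cut (cpt \<kappa> ` W') (cfun \<kappa> W s)))}"

definition coord_sect_z where
  "coord_sect_z X \<kappa> =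
     inv_into (carrier (sect X (cdom \<kappa>))) (cfun \<kappa> (cdom \<kappa>)) (coord_z (cpt \<kappa> ` cdom \<kappa>))"

definition coord_sect_theta where
  "coord_sect_theta X \<kappa> =
     inv_into (carrier (sect X (cdom \<kappa>))) (cfun \<kappa> (cdom \<kappa>)) (coord_theta (cpt \<kappa> ` cdom \<kappa>))"

definition overlap_image where
  "overlap_image \<alpha> \<beta> = cpt \<alpha> ` (cdom \<alpha> \<inter> cdom \<beta>)"

text \<open>The transition functions \<open>F\<^bsub>\<beta>,\<alpha>\<^esub>\<close> and \<open>\<Psi>\<^bsub>\<beta>,\<alpha>\<^esub>\<close>: the coordinates \<open>(z\<^sub>\<beta>, \<theta>\<^sub>\<beta>)\<close> in terms of
  \<open>(z\<^sub>\<alpha>, \<theta>\<^sub>\<alpha>)\<close>.\<close>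

definition trans_F ::
    "('p, 's, 'n::len0, 'm) superspace_scheme \<Rightarrow> ('p, 's, 'n) superchart \<Rightarrow> ('p, 's, 'n) superchart
      \<Rightarrow> complex \<Rightarrow> 'n superval" where
  "trans_F X \<beta> \<alpha> = cfun \<alpha> (cdom \<alpha> \<inter> cdom \<beta>)
     (res X (cdom \<beta>) (cdom \<alpha> \<inter> cdom \<beta>) (coord_sect_z X \<beta>))"

definition trans_Psi ::
    "('p, 's, 'n::len0, 'm) superspace_scheme \<Rightarrow> ('p, 's, 'n) superchart \<Rightarrow> ('p, 's, 'n) superchart
      \<Rightarrow> complex \<Rightarrow> 'n superval" where
  "trans_Psi X \<beta> \<alpha> = cfun \<alpha> (cdom \<alpha> \<inter> cdom \<beta>)
     (res X (cdom \<beta>) (cdom \<alpha> \<inter> cdom \<beta>) (coord_sect_theta X \<beta>))"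

definition trans_DPsi ::
    "('p, 's, 'n::len0, 'm) superspace_scheme \<Rightarrow> ('p, 's, 'n) superchart \<Rightarrow> ('p, 's, 'n) superchart
      \<Rightarrow> complex \<Rightarrow> 'n superval" where
  "trans_DPsi X \<beta> \<alpha> = superD (overlap_image \<alpha> \<beta>) (trans_Psi X \<beta> \<alpha>)"

definition superconformal_transition where
  "superconformal_transition X \<beta> \<alpha> \<longleftrightarrow>
     (\<forall>z\<in>overlap_image \<alpha> \<beta>.
        superD (overlap_image \<alpha> \<beta>) (trans_F X \<beta> \<alpha>) z = trans_Psi X \<beta> \<alpha> z * trans_DPsi X \<beta> \<alpha> z)"

definition superconformal_atlas where
  "superconformal_atlas X A \<longleftrightarrow>
     A \<subseteq> coordinates X \<and> (\<Union>\<kappa>\<in>A. cdom \<kappa>) = topspace (space_of X) \<and>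
     (\<forall>\<alpha>\<in>A. \<forall>\<beta>\<in>A. superconformal_transition X \<beta> \<alpha>)"


section \<open>Superconformal curves\<close>

record (overloaded) ('p, 's, 'n::len0) supercurve = "('p, 's, 'n::len0) superspace" +
  sc_atlas :: "('p, 's, 'n) superchart set"

text \<open>
  Local coordinates identify the reduction of \<open>X\<close> with an open subset of the complex plane and its
  sheaf of holomorphic functions, so they make the reduction a smooth curve.
\<close>

locale superconformal_curve = superspace X
  for X :: "('p, 's, 'n::len0) supercurve" (structure) +
  assumes nonempty: "topspace (space_of X) \<noteq> {}"
    and hausdorff: "Hausdorff_space (space_of X)"
    and compact: "compact_space (space_of X)"
    and connected: "connected_space (space_of X)"
    and atlas: "superconformal_atlas X (sc_atlas X)"

definition compatible :: "('p, 's, 'n::len0) supercurve \<Rightarrow> ('p, 's, 'n) superchart set" where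
  "compatible X = {\<kappa>. superconformal_atlas X (insert \<kappa> (sc_atlas X))}"


section \<open>Superprojective structures\<close>

text \<open>
  The superdeterminant of the matrix with rows \<open>(a, b, \<alpha>)\<close>, \<open>(c, d, \<beta>)\<close>, \<open>(\<gamma>, \<delta>, e)\<close>, for invertible
  \<open>e\<close>.
\<close>

definition sdet where
  "sdet a b \<alpha> c d \<beta> \<gamma> \<delta> e =
     ((a - \<alpha> * unit_inv e * \<gamma>) * (d - \<beta> * unit_inv e * \<delta>)
      - (b - \<alpha> * unit_inv e * \<delta>) * (c - \<beta> * unit_inv e * \<gamma>)) * unit_inv e"

text \<open>
  The transition functions are fractional linear near each point of the overlap: the constants are
  locally constant, as the overlap need not be connected.
\<close>

definition superprojective_transition ::
    "('p, 's, 'n::len0, 'm) superspace_scheme \<Rightarrow> ('p, 's, 'n) superchart \<Rightarrow> ('p, 's, 'n) superchart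
      \<Rightarrow> bool" where
  "superprojective_transition X \<beta>' \<alpha>' \<longleftrightarrow>
     (\<forall>x\<in>cdom \<alpha>' \<inter> cdom \<beta>'. \<exists>W. openin (space_of X) W \<and> x \<in> W \<and> W \<subseteq> cdom \<alpha>' \<inter> cdom \<beta>' \<and>
       (\<exists>a\<in>gparity False. \<exists>b\<in>gparity False. \<exists>c\<in>gparity False. \<exists>d\<in>gparity False.
        \<exists>e\<in>gparity False. \<exists>\<alpha>\<in>gparity True. \<exists>\<beta>\<in>gparity True. \<exists>\<gamma>\<in>gparity True. \<exists>\<delta>\<in>gparity True.
          is_unit_elt e \<and> sdet a b \<alpha> c d \<beta> \<gamma> \<delta> e = 1 \<and>
          (\<forall>z\<in>cpt \<alpha>' ` W.
             let Z = svconst (gconst z);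
                 den = svconst c * Z + svconst d + svconst \<beta> * sv_theta
             in is_unit_elt den \<and>
                trans_F X \<beta>' \<alpha>' z =
                  (svconst a * Z + svconst b + svconst \<alpha> * sv_theta) * unit_inv den \<and>
                trans_Psi X \<beta>' \<alpha>' z =
                  (svconst \<gamma> * Z + svconst \<delta> + svconst e * sv_theta) * unit_inv den)))"

definition superprojective_atlas ::
    "('p, 's, 'n::len0) supercurve \<Rightarrow> ('p, 's, 'n) superchart set \<Rightarrow> bool" where
  "superprojective_atlas X A \<longleftrightarrow>
     A \<subseteq> compatible X \<and> (\<Union>\<kappa>\<in>A. cdom \<kappa>) = topspace (space_of X) \<and>
     (\<forall>\<alpha>\<in>A. \<forall>\<beta>\<in>A. superprojective_transition X \<beta> \<alpha>)"

definition superprojective_structures ::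
    "('p, 's, 'n::len0) supercurve \<Rightarrow> ('p, 's, 'n) superchart set set" where
  "superprojective_structures X =
     {A. superprojective_atlas X A \<and> (\<forall>B. superprojective_atlas X B \<and> A \<subseteq> B \<longrightarrow> B = A)}"


section \<open>Sheaves of modules and extensions\<close>

text \<open>
  Sheaves of super modules over the structure sheaf. For supercommutative scalars a left module is
  the same as a right module; \<open>mact M U g m\<close> stands for \<open>g m\<close> or for \<open>m g\<close>, depending on \<open>M\<close>.
\<close>

record ('p, 's, 'm) omodule =
  msect :: "'p set \<Rightarrow> 'm set"
  mplus :: "'p set \<Rightarrow> 'm \<Rightarrow> 'm \<Rightarrow> 'm"
  mzero :: "'p set \<Rightarrow> 'm"
  mact :: "'p set \<Rightarrow> 's \<Rightarrow> 'm \<Rightarrow> 'm"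
  mpar :: "bool \<Rightarrow> 'p set \<Rightarrow> 'm set"
  mres :: "'p set \<Rightarrow> 'p set \<Rightarrow> 'm \<Rightarrow> 'm"

text \<open>The structure sheaf as a left module.\<close>

definition structure_module ::
    "('p, 's, 'n::len0, 'x) superspace_scheme \<Rightarrow> ('p, 's, 's) omodule" where
  "structure_module X =
    \<lparr> msect = (\<lambda>U. carrier (sect X U)),
      mplus = (\<lambda>U. add (sect X U)),
      mzero = (\<lambda>U. \<zero>\<^bsub>sect X U\<^esub>),
      mact = (\<lambda>U. mult (sect X U)),
      mpar = par X,
      mres = res X \<rparr>"

text \<open>Even morphisms of left modules, made extensional so that equal morphisms are equal functions.\<close>

definition even_morphisms ::
    "('p, 's, 'n::len0, 'x) superspace_scheme \<Rightarrow> ('p, 's, 'm) omodule \<Rightarrow> ('p, 's, 'k) omodule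
      \<Rightarrow> ('p set \<Rightarrow> 'm \<Rightarrow> 'k) set" where
  "even_morphisms X M N = {h.
     (\<forall>U. \<not> openin (space_of X) U \<longrightarrow> h U = undefined) \<and>
     (\<forall>U. openin (space_of X) U \<longrightarrow>
        h U \<in> extensional (msect M U) \<and>
        h U \<in> msect M U \<rightarrow> msect N U \<and>
        (\<forall>p. h U ` mpar M p U \<subseteq> mpar N p U) \<and>
        (\<forall>m\<in>msect M U. \<forall>m'\<in>msect M U. h U (mplus M U m m') = mplus N U (h U m) (h U m')) \<and>
        (\<forall>g\<in>carrier (sect X U). \<forall>m\<in>msect M U. h U (mact M U g m) = mact N U g (h U m)) \<and>
        (\<forall>V. \<forall>m\<in>msect M U. openin (space_of X) V \<and> V \<subseteq> U \<longrightarrow>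
           h V (mres M U V m) = mres N U V (h U m)))}"

text \<open>\<open>0 \<rightarrow> M \<rightarrow> N \<rightarrow> P \<rightarrow> 0\<close> is exact as a sequence of sheaves; surjectivity is local.\<close>

definition extension ::
    "('p, 's, 'n::len0, 'x) superspace_scheme \<Rightarrow> ('p, 's, 'm) omodule \<Rightarrow> ('p, 's, 'k) omodule
      \<Rightarrow> ('p, 's, 'l) omodule \<Rightarrow> ('p set \<Rightarrow> 'm \<Rightarrow> 'k) \<Rightarrow> ('p set \<Rightarrow> 'k \<Rightarrow> 'l) \<Rightarrow> bool" where
  "extension X M N P i q \<longleftrightarrow>
     i \<in> even_morphisms X M N \<and> q \<in> even_morphisms X N P \<and>
     (\<forall>U. openin (space_of X) U \<longrightarrow>
        inj_on (i U) (msect M U) \<and>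
        i U ` msect M U = {n \<in> msect N U. q U n = mzero P U} \<and>
        (\<forall>t\<in>msect P U. \<forall>x\<in>U. \<exists>V. openin (space_of X) V \<and> x \<in> V \<and> V \<subseteq> U \<and>
           mres P U V t \<in> q V ` msect N V))"

definition splittings ::
    "('p, 's, 'n::len0, 'x) superspace_scheme \<Rightarrow> ('p, 's, 'k) omodule \<Rightarrow> ('p, 's, 'l) omodule
      \<Rightarrow> ('p set \<Rightarrow> 'k \<Rightarrow> 'l) \<Rightarrow> ('p set \<Rightarrow> 'l \<Rightarrow> 'k) set" where
  "splittings X N P q = {s \<in> even_morphisms X P N.
     \<forall>U. openin (space_of X) U \<longrightarrow> (\<forall>t\<in>msect P U. q U (s U t) = t)}"

text \<open>
  The dual of a right module: right linear homomorphisms to the structure sheaf, that is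
  \<open>f (m g) = f m g\<close>, with the left module structure \<open>(g f) m = g (f m)\<close>. Sections over \<open>U\<close> are
  homomorphisms of sheaves on \<open>U\<close>.
\<close>

definition dual_module ::
    "('p, 's, 'n::len0, 'x) superspace_scheme \<Rightarrow> ('p, 's, 'm) omodule
      \<Rightarrow> ('p, 's, 'p set \<Rightarrow> 'm \<Rightarrow> 's) omodule" where
  "dual_module X M = (
    let opn = (\<lambda>U W. openin (space_of X) W \<and> W \<subseteq> U);
        mk = (\<lambda>U f W. if opn U W then restrict (f W) (msect M W) else undefined);
        Hom = (\<lambda>U. {f. f = mk U f \<and>
          (\<forall>W. opn U W \<longrightarrow>
             f W \<in> msect M W \<rightarrow> carrier (sect X W) \<and>
             (\<forall>m\<in>msect M W. \<forall>m'\<in>msect M W.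
                f W (mplus M W m m') = f W m \<oplus>\<^bsub>sect X W\<^esub> f W m') \<and>
             (\<forall>g\<in>carrier (sect X W). \<forall>m\<in>msect M W.
                f W (mact M W g m) = f W m \<otimes>\<^bsub>sect X W\<^esub> g) \<and>
             (\<forall>W'. \<forall>m\<in>msect M W. opn W W' \<longrightarrow> f W' (mres M W W' m) = res X W W' (f W m)))})
    in \<lparr> msect = Hom,
         mplus = (\<lambda>U f f'. mk U (\<lambda>W m. f W m \<oplus>\<^bsub>sect X W\<^esub> f' W m)),
         mzero = (\<lambda>U. mk U (\<lambda>W m. \<zero>\<^bsub>sect X W\<^esub>)),
         mact = (\<lambda>U g f. mk U (\<lambda>W m. res X U W g \<otimes>\<^bsub>sect X W\<^esub> f W m)),
         mpar = (\<lambda>p U. {f \<in> Hom U. \<forall>W q. opn U W \<longrightarrow> f W ` mpar M q W \<subseteq> par X (p \<noteq> q) W}),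
         mres = (\<lambda>U V f. mk V f) \<rparr>)"


section \<open>The bundles\<close>

text \<open>
  \<open>D\<^sub>\<alpha> \<Psi>\<^bsub>\<beta>,\<alpha>\<^esub>\<close> and \<open>\<sigma>(D\<^sub>\<alpha> \<Psi>\<^bsub>\<beta>,\<alpha>\<^esub>)\<close> as sections of the structure sheaf over an open subset \<open>W\<close> of the
  overlap.
\<close>

definition sect_of where
  "sect_of X \<alpha> W f = inv_into (carrier (sect X W)) (cfun \<alpha> W) (cut (cpt \<alpha> ` W) f)"

definition jac where
  "jac X \<beta> \<alpha> W = sect_of X \<alpha> W (trans_DPsi X \<beta> \<alpha>)"

definition schw where
  "schw X \<beta> \<alpha> W = sect_of X \<alpha> W (super_schwarzian (overlap_image \<alpha> \<beta>) (trans_DPsi X \<beta> \<alpha>))"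

text \<open>
  The \<open>k\<close>-th tensor power of the Berezinian bundle. The component \<open>w \<alpha>\<close> of a section \<open>w\<close> over \<open>U\<close> is
  its coefficient in \<open>w \<alpha> [dz\<^sub>\<alpha> d\<theta>\<^sub>\<alpha>]\<^sup>k\<close> on \<open>U \<inter> cdom \<alpha>\<close>; the frame has the parity of \<open>k\<close>.
\<close>

definition berezinian_power ::
    "nat \<Rightarrow> ('p, 's, 'n::len0) supercurve
      \<Rightarrow> ('p, 's, ('p, 's, 'n) superchart \<Rightarrow> 's) omodule" where
  "berezinian_power k X = (
    let S = (\<lambda>U. {w \<in> (\<Pi>\<^sub>E \<alpha>\<in>compatible X. carrier (sect X (U \<inter> cdom \<alpha>))).
          \<forall>\<alpha>\<in>compatible X. \<forall>\<beta>\<in>compatible X.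
            let W = U \<inter> cdom \<alpha> \<inter> cdom \<beta> in
            res X (U \<inter> cdom \<alpha>) W (w \<alpha>) =
              res X (U \<inter> cdom \<beta>) W (w \<beta>) \<otimes>\<^bsub>sect X W\<^esub> (jac X \<beta> \<alpha> W [^]\<^bsub>sect X W\<^esub> k)})
    in \<lparr> msect = S,
         mplus = (\<lambda>U w w'. \<lambda>\<alpha>\<in>compatible X. w \<alpha> \<oplus>\<^bsub>sect X (U \<inter> cdom \<alpha>)\<^esub> w' \<alpha>),
         mzero = (\<lambda>U. \<lambda>\<alpha>\<in>compatible X. \<zero>\<^bsub>sect X (U \<inter> cdom \<alpha>)\<^esub>),
         mact = (\<lambda>U g w. \<lambda>\<alpha>\<in>compatible X.
           res X U (U \<inter> cdom \<alpha>) g \<otimes>\<^bsub>sect X (U \<inter> cdom \<alpha>)\<^esub> w \<alpha>),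
         mpar = (\<lambda>p U. {w \<in> S U. \<forall>\<alpha>\<in>compatible X. w \<alpha> \<in> par X (p \<noteq> odd k) (U \<inter> cdom \<alpha>)}),
         mres = (\<lambda>U V w. \<lambda>\<alpha>\<in>compatible X. res X (U \<inter> cdom \<alpha>) (V \<inter> cdom \<alpha>) (w \<alpha>)) \<rparr>)"

text \<open>
  The bundle of rank \<open>1|1\<close> spanned by the vacuum and the superconformal vector, as a right module:
  the component \<open>s \<alpha> = (a, b)\<close> of a section \<open>s\<close> over \<open>U\<close> stands for \<open>|0\<rangle>\<^sub>\<alpha> a + \<tau>\<^sub>\<alpha> b\<close> on
  \<open>U \<inter> cdom \<alpha>\<close>. The relation between components is the one forced by
  \<open>\<tau>\<^sub>\<alpha> = (D\<^sub>\<alpha> \<Psi>\<^bsub>\<beta>,\<alpha>\<^esub>)\<^sup>3 \<tau>\<^sub>\<beta> + c/3 \<sigma>(D\<^sub>\<alpha> \<Psi>\<^bsub>\<beta>,\<alpha>\<^esub>) |0\<rangle>\<^sub>\<beta>\<close>; no signs occur as \<open>D\<^sub>\<alpha> \<Psi>\<^bsub>\<beta>,\<alpha>\<^esub>\<close> and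
  \<open>|0\<rangle>\<^sub>\<beta>\<close> are even.
\<close>

definition K_module ::
    "complex \<Rightarrow> ('p, 's, 'n::len0) supercurve
      \<Rightarrow> ('p, 's, ('p, 's, 'n) superchart \<Rightarrow> 's \<times> 's) omodule" where
  "K_module c X = (
    let S = (\<lambda>U. {s \<in> (\<Pi>\<^sub>E \<alpha>\<in>compatible X.
              carrier (sect X (U \<inter> cdom \<alpha>)) \<times> carrier (sect X (U \<inter> cdom \<alpha>))).
          \<forall>\<alpha>\<in>compatible X. \<forall>\<beta>\<in>compatible X.
            let W = U \<inter> cdom \<alpha> \<inter> cdom \<beta>; R = sect X W;
                a\<^sub>\<alpha> = res X (U \<inter> cdom \<alpha>) W (fst (s \<alpha>)); b\<^sub>\<alpha> = res X (U \<inter> cdom \<alpha>) W (snd (s \<alpha>));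
                a\<^sub>\<beta> = res X (U \<inter> cdom \<beta>) W (fst (s \<beta>)); b\<^sub>\<beta> = res X (U \<inter> cdom \<beta>) W (snd (s \<beta>))
            in a\<^sub>\<beta> = a\<^sub>\<alpha> \<oplus>\<^bsub>R\<^esub> (scalar X W (gconst (c / 3)) \<otimes>\<^bsub>R\<^esub> schw X \<beta> \<alpha> W \<otimes>\<^bsub>R\<^esub> b\<^sub>\<alpha>) \<and>
               b\<^sub>\<beta> = (jac X \<beta> \<alpha> W [^]\<^bsub>R\<^esub> (3::nat)) \<otimes>\<^bsub>R\<^esub> b\<^sub>\<alpha>})
    in \<lparr> msect = S,
         mplus = (\<lambda>U s t. \<lambda>\<alpha>\<in>compatible X. let R = sect X (U \<inter> cdom \<alpha>) in
           (fst (s \<alpha>) \<oplus>\<^bsub>R\<^esub> fst (t \<alpha>), snd (s \<alpha>) \<oplus>\<^bsub>R\<^esub> snd (t \<alpha>))),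
         mzero = (\<lambda>U. \<lambda>\<alpha>\<in>compatible X. (\<zero>\<^bsub>sect X (U \<inter> cdom \<alpha>)\<^esub>, \<zero>\<^bsub>sect X (U \<inter> cdom \<alpha>)\<^esub>)),
         mact = (\<lambda>U g s. \<lambda>\<alpha>\<in>compatible X.
           let R = sect X (U \<inter> cdom \<alpha>); h = res X U (U \<inter> cdom \<alpha>) g in
           (fst (s \<alpha>) \<otimes>\<^bsub>R\<^esub> h, snd (s \<alpha>) \<otimes>\<^bsub>R\<^esub> h)),
         mpar = (\<lambda>p U. {s \<in> S U. \<forall>\<alpha>\<in>compatible X.
           fst (s \<alpha>) \<in> par X p (U \<inter> cdom \<alpha>) \<and> snd (s \<alpha>) \<in> par X (\<not> p) (U \<inter> cdom \<alpha>)}),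
         mres = (\<lambda>U V s. \<lambda>\<alpha>\<in>compatible X.
           (res X (U \<inter> cdom \<alpha>) (V \<inter> cdom \<alpha>) (fst (s \<alpha>)),
            res X (U \<inter> cdom \<alpha>) (V \<inter> cdom \<alpha>) (snd (s \<alpha>)))) \<rparr>)"

definition vacuum where
  "vacuum X U = (\<lambda>\<alpha>\<in>compatible X. (\<one>\<^bsub>sect X (U \<inter> cdom \<alpha>)\<^esub>, \<zero>\<^bsub>sect X (U \<inter> cdom \<alpha>)\<^esub>))"

text \<open>The element \<open>\<tau>\<^sub>\<alpha>\<close> of the frame over \<open>cdom \<alpha>\<close>.\<close>

definition tau where
  "tau c X \<alpha> = (\<lambda>\<beta>\<in>compatible X.
     let W = cdom \<alpha> \<inter> cdom \<beta>; R = sect X W in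
     (scalar X W (gconst (c / 3)) \<otimes>\<^bsub>R\<^esub> schw X \<beta> \<alpha> W, jac X \<beta> \<alpha> W [^]\<^bsub>R\<^esub> (3::nat)))"

text \<open>
  The dual of the quotient by the vacuum is the cube of the Berezinian bundle: a section
  \<open>w \<alpha> [dz\<^sub>\<alpha> d\<theta>\<^sub>\<alpha>]\<^sup>3\<close> is the functional sending \<open>|0\<rangle>\<^sub>\<alpha> a + \<tau>\<^sub>\<alpha> b\<close> to \<open>w \<alpha> b\<close>.
\<close>

definition ber_incl where
  "ber_incl c X = (\<lambda>U. if openin (space_of X) U
     then \<lambda>w\<in>msect (berezinian_power 3 X) U. \<lambda>W. if openin (space_of X) W \<and> W \<subseteq> U
       then \<lambda>s\<in>msect (K_module c X) W.
         (THE t. t \<in> carrier (sect X W) \<and> (\<forall>\<alpha>\<in>compatible X.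
            res X W (W \<inter> cdom \<alpha>) t =
              res X (U \<inter> cdom \<alpha>) (W \<inter> cdom \<alpha>) (w \<alpha>) \<otimes>\<^bsub>sect X (W \<inter> cdom \<alpha>)\<^esub> snd (s \<alpha>)))
       else undefined
     else undefined)"

text \<open>The dual of the inclusion of the structure sheaf: restriction of functionals to the vacuum.\<close>

definition vac_eval where
  "vac_eval c X = (\<lambda>U. if openin (space_of X) U
     then \<lambda>f\<in>msect (dual_module X (K_module c X)) U. f U (vacuum X U)
     else undefined)"


section \<open>The correspondence\<close>

text \<open>
  The coordinates in which the splitting vanishes on the superconformal vector, that is, is given
  by the linear functional \<open>|0\<rangle>\<^sub>\<alpha> \<mapsto> 1\<close>, \<open>\<tau>\<^sub>\<alpha> \<mapsto> 0\<close>.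
\<close>

definition splitting_atlas where
  "splitting_atlas c X s = {\<alpha> \<in> compatible X.
     s (cdom \<alpha>) \<one>\<^bsub>sect X (cdom \<alpha>)\<^esub> (cdom \<alpha>) (tau c X \<alpha>) = \<zero>\<^bsub>sect X (cdom \<alpha>)\<^esub>}"

end

theory Submission
  imports Defs "HOL-Complex_Analysis.Complex_Analysis"
begin

text \<open>
  Write \<open>G = D\<^sub>\<alpha>\<Psi>\<^bsub>\<beta>,\<alpha>\<^esub>\<close> for the Jacobian factor of a change of coordinates. The proof rests on the
  identity \<open>\<sigma>(G) = - G D\<^sup>3(1/G)\<close> (\<open>super_schwarzian_eq\<close>), which turns the super-Schwarzian into a linear
  differential operator applied to \<open>1/G\<close>. It has three consequences.
  
  \<^item> \<open>\<sigma>\<close> is a cocycle, \<open>\<sigma>\<^bsub>\<gamma>,\<alpha>\<^esub> = \<sigma>\<^bsub>\<beta>,\<alpha>\<^esub> + G\<^bsub>\<beta>,\<alpha>\<^esub>\<^sup>3 \<sigma>\<^bsub>\<gamma>,\<beta>\<^esub>\<close> (\<open>schw_cocycle\<close>). This is the compatibility that makes the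
    gluing rule of the bundle consistent, so that the vacuum and \<open>\<tau>\<^sub>\<alpha>\<close> are sections of it.
  
  \<^item> \<open>\<sigma>(G) = 0\<close> says that \<open>1/G\<close> is killed by \<open>D\<^sup>3\<close>. As \<open>D\<^sup>2 = \<partial>\<^sub>z\<close>, this means that \<open>1/G\<close> is affine in \<open>z\<close>
    and \<open>\<theta>\<close>; the same then holds for \<open>F/G\<close> and \<open>\<Psi>/G\<close>. So the Schwarzian vanishes precisely for the
    fractional linear transformations, \<open>1/G\<close> being the denominator up to a constant
    (\<open>fractional_linear_imp_flat\<close>, \<open>flat_imp_fractional_linear\<close>, \<open>superprojective_transition_iff\<close>).
  
  \<^item> Every odd function \<open>h\<close> is locally a Schwarzian: solve the linear equation \<open>D\<^sup>3 y + h y = 0\<close> with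
    \<open>y\<close> even and invertible, and integrate \<open>D\<Psi> = 1/y\<close>, \<open>DF = \<Psi> D\<Psi>\<close>
    (\<open>superconformal_with_schwarzian\<close>, \<open>chart_with_schwarzian\<close>).
  
  The kernel of the evaluation of functionals at the vacuum consists of the functionals of the
  quotient by the vacuum. The values \<open>w\<^sub>\<alpha>\<close> of such a functional on \<open>\<tau>\<^sub>\<alpha>\<close> satisfy \<open>w\<^sub>\<alpha> = w\<^sub>\<beta> G\<^sup>3\<close>, the rule for the
  cube of the Berezinian bundle; locally any two values on the frame are possible. This gives the
  extension (\<open>dual_extension\<close>).
  
  By linearity a splitting is determined by the image \<open>\<omega>\<close> of \<open>1\<close>, an even functional with value \<open>1\<close> on the
  vacuum, and every such functional occurs (\<open>splittings_bij\<close>). It amounts to the odd functions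
  \<open>h\<^sub>\<alpha> = \<omega>(\<tau>\<^sub>\<alpha>)\<close>, subject to \<open>h\<^sub>\<alpha> = c/3 \<sigma>(G) + h\<^sub>\<beta> G\<^sup>3\<close> (\<open>tau_value_change\<close>). The superprojective structure of
  \<open>\<omega>\<close> consists of the coordinates with \<open>h\<^sub>\<alpha> = 0\<close>. Between two of these the rule reads \<open>c/3 \<sigma>(G) = 0\<close>, hence they
  are related by a fractional linear transformation, as \<open>c \<noteq> 0\<close>. They cover the curve, as \<open>\<beta>\<close> with
  \<open>\<sigma>(G) = 3/c h\<^sub>\<alpha>\<close> has \<open>h\<^sub>\<beta> = 0\<close>. The atlas is maximal, since \<open>\<sigma>(G) = 0\<close> carries \<open>h\<^sub>\<beta> = 0\<close> over to \<open>h\<^sub>\<alpha> = 0\<close>. Conversely,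
  on a superprojective atlas \<open>h\<^sub>\<alpha> = 0\<close> is a consistent family and determines \<open>\<omega>\<close> (\<open>functional_atlas_bij\<close>).
\<close>


section \<open>Supercommutative algebra\<close>

text \<open>
  A supercommutative ring is encoded by its parity involution: the even elements are its fixed points
  and the odd elements are those that it negates. The sign rule for an odd element is stated against
  arbitrary elements, which are not split into an even and an odd part in this way. That odd elements
  have square zero is an axiom because \<open>2\<close> may be a zero divisor.
\<close>

locale supercommutative_ring =
  fixes invol :: "'a::ring_1 \<Rightarrow> 'a"
  assumes inv_add: "invol (x + y) = invol x + invol y"
    and inv_mult: "invol (x * y) = invol x * invol y"
    and inv_inv: "invol (invol x) = x"
    and even_central: "invol x = x \<Longrightarrow> x * y = y * x"
    and odd_swap: "invol x = - x \<Longrightarrow> y * x = x * invol y"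
    and odd_square: "invol x = - x \<Longrightarrow> x * x = 0"
begin

lemma inv_zero: "invol 0 = 0"
  using inv_add[of 0 0] by simp

lemma inv_minus: "invol (- x) = - invol x"
proof -
  have "invol x + invol (- x) = 0" using inv_add[of x "- x"] inv_zero by simp
  then show ?thesis by (rule minus_unique[symmetric])
qed

lemma inv_diff: "invol (x - y) = invol x - invol y"
  using inv_add[of x "- y"] by (simp add: inv_minus)

lemma inv_one: "invol 1 = 1"
proof -
  have "invol 1 = invol 1 * invol (invol 1)" by (simp add: inv_inv)
  also have "\<dots> = invol (1 * invol 1)" by (simp only: inv_mult)
  finally show ?thesis by (simp add: inv_inv)
qed

lemmas inv_rules = inv_add inv_mult inv_zero inv_minus inv_diff inv_one

lemma even_inverse:
  assumes "invol x = x" "x * y = 1"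
  shows "invol y = y"
proof -
  have "x * invol y = 1" using inv_mult[of x y] assms inv_one by simp
  then have "y * (x * invol y) = y" by simp
  then show ?thesis using assms even_central[OF assms(1), of y] by (simp flip: mult.assoc)
qed

lemma even_commute: "invol x = x \<Longrightarrow> x * y = y * x" "invol y = y \<Longrightarrow> x * y = y * x"
  using even_central by metis+

lemma even_left_commute: "invol x = x \<Longrightarrow> x * (y * z) = y * (x * z)"
    "invol y = y \<Longrightarrow> x * (y * z) = y * (x * z)"
  using even_central[of x y] even_central[of y x] by (simp_all flip: mult.assoc)

text \<open>
  With atoms whose names are in alphabetical order, these rules bring every monomial into its
  normal form: even atoms are moved by ordered rewriting, and the rules \<open>odd_sort\<close>, instantiated
  with two odd atoms, sort the odd ones.
\<close>

lemmas even_ac = even_commute even_left_commute mult.assoc distrib_left distrib_right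
  left_diff_distrib right_diff_distrib

lemma odd_anticommute: "invol a = - a \<Longrightarrow> invol b = - b \<Longrightarrow> b * a = - (a * b)"
  using odd_swap[of a b] by simp

lemma odd_left_anticommute: "invol a = - a \<Longrightarrow> invol b = - b \<Longrightarrow> b * (a * z) = - (a * (b * z))"
  using odd_anticommute[of a b] by (simp flip: mult.assoc)

lemma odd_left_square: "invol a = - a \<Longrightarrow> a * (a * z) = 0"
  using odd_square[of a] by (simp flip: mult.assoc)

lemmas odd_sort = odd_anticommute odd_left_anticommute
lemmas odd_null = odd_square odd_left_square

end


section \<open>The Grassmann algebra\<close>

lemma gcoef_gconst: "gcoef (gconst c :: 'n::len0 grassmann) S = (if S = {} then c else 0)"
  unfolding gconst_def by (subst Abs_grassmann_inverse) auto

lemma gcoef_gconst_mult: "gcoef (gconst c * x) S = c * gcoef (x :: 'n::len0 grassmann) S"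
proof (cases "S \<subseteq> {..<LENGTH('n)}")
  case True
  then have fin: "finite (Pow S)" by (auto intro: finite_subset)
  have "gcoef (gconst c * x) S = (\<Sum>A\<in>Pow S. if A = {} then c * gcoef x S else 0)"
    unfolding gcoef_times[OF True] by (rule sum.cong) (auto simp: gcoef_gconst)
  then show ?thesis using fin by (simp add: sum.delta)
qed (simp add: gcoef_outside)

lemma gcoef_mult_gconst: "gcoef (x * gconst c) S = gcoef (x :: 'n::len0 grassmann) S * c"
proof (cases "S \<subseteq> {..<LENGTH('n)}")
  case True
  then have fin: "finite (Pow S)" by (auto intro: finite_subset)
  have "gcoef (x * gconst c) S = (\<Sum>A\<in>Pow S. if A = S then gcoef x S * c else 0)"
    unfolding gcoef_times[OF True] by (rule sum.cong) (auto simp: gcoef_gconst)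
  then show ?thesis using fin by (simp add: sum.delta)
qed (simp add: gcoef_outside)

lemma gcoef_sum: "gcoef (sum f A) S = (\<Sum>a\<in>A. gcoef (f a :: 'n::len0 grassmann) S)"
  by (induction A rule: infinite_finite_induct) (simp_all add: gcoef_simps)

lemma gconst_simps [simp]:
  "gconst 0 = 0" "gconst 1 = 1" "ginvol (gconst c) = gconst c"
  by (rule grassmann_eqI; simp add: gcoef_simps gcoef_gconst gcoef_ginvol)+

lemma gconst_hom:
  "gconst (c + d) = gconst c + gconst d" "gconst (c * d) = gconst c * gconst d"
  "gconst (- c) = - gconst c" "gconst (c - d) = gconst c - gconst d"
  by (rule grassmann_eqI; simp add: gcoef_simps gcoef_gconst gcoef_gconst_mult)+

lemma gconst_central: "gconst c * x = x * gconst c"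
  by (rule grassmann_eqI) (simp add: gcoef_gconst_mult gcoef_mult_gconst)

lemma gparity_even_iff: "x \<in> gparity False \<longleftrightarrow> ginvol x = x"
proof
  assume "x \<in> gparity False"
  then show "ginvol x = x"
    by (intro grassmann_eqI) (auto simp: gparity_def gcoef_ginvol)
next
  assume "ginvol x = x"
  then have "(- 1) ^ card S * gcoef x S = gcoef x S" for S
    by (metis gcoef_ginvol)
  then show "x \<in> gparity False"
    by (force simp: gparity_def minus_one_power_iff split: if_splits)
qed

lemma gparity_odd_iff: "x \<in> gparity True \<longleftrightarrow> ginvol x = - x"
proof
  assume "x \<in> gparity True"
  then show "ginvol x = - x"
    by (intro grassmann_eqI) (force simp: gparity_def gcoef_ginvol gcoef_simps minus_one_power_iff)
next
  assume "ginvol x = - x"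
  then have "(- 1) ^ card S * gcoef x S = - gcoef x S" for S
    by (metis gcoef_ginvol gcoef_simps(4))
  then show "x \<in> gparity True"
    by (force simp: gparity_def minus_one_power_iff split: if_splits)
qed

text \<open>
  Each pair of an index in \<open>A\<close> and one in \<open>B\<close> is an inversion for exactly one of the two orders.
\<close>

lemma gsign_swap:
  assumes "finite A" "finite B" "A \<inter> B = {}"
  shows "gsign A B = (- 1) ^ (card A * card B) * gsign B A"
proof -
  let ?I = "\<lambda>A B. {(a, b). a \<in> A \<and> b \<in> B \<and> b < (a::nat)}"
  have fin: "finite (?I A B)" "finite (?I B A)"
    using assms by (auto intro: finite_subset[of _ "A \<times> B"] finite_subset[of _ "B \<times> A"])
  have swap: "card (prod.swap ` ?I B A) = card (?I B A)"
    by (intro card_image) (auto simp: inj_on_def)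
  have "A \<times> B = ?I A B \<union> prod.swap ` ?I B A"
    using assms(3) by (force simp: image_iff)
  moreover have "?I A B \<inter> prod.swap ` ?I B A = {}" by auto
  ultimately have "card (A \<times> B) = card (?I A B) + card (?I B A)"
    using fin swap by (simp add: card_Un_disjoint)
  then have "card A * card B = card (?I A B) + card (?I B A)"
    by (simp add: card_cartesian_product)
  then have "(- 1) ^ (card A * card B) * gsign B A =
      ((- 1) ^ card (?I A B) * ((- 1) ^ card (?I B A) * (- 1) ^ card (?I B A)) :: complex)"
    by (simp add: gsign_def power_add)
  also have "\<dots> = gsign A B"
    by (simp add: gsign_def flip: power_mult_distrib)
  finally show ?thesis by simp
qed

lemma grassmann_mult_swap:
  fixes x y :: "'n::len0 grassmann"
  assumes "x \<in> gparity p"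
  shows "y * x = x * (if p then ginvol y else y)"
proof (rule grassmann_eqI)
  fix S assume S: "S \<subseteq> {..<LENGTH('n)}"
  then have fin: "finite S" by (rule finite_subset) simp
  have "gcoef (y * x) S = (\<Sum>A\<in>Pow S. gsign (S - A) A * gcoef y (S - A) * gcoef x A)"
    unfolding gcoef_times[OF S]
    by (rule sum.reindex_bij_witness[where i = "\<lambda>A. S - A" and j = "\<lambda>A. S - A"])
      (auto simp: double_diff)
  also have "\<dots> = gcoef (x * (if p then ginvol y else y)) S"
    unfolding gcoef_times[OF S]
  proof (rule sum.cong[OF refl])
    fix A assume A: "A \<in> Pow S"
    show "gsign (S - A) A * gcoef y (S - A) * gcoef x A =
        gsign A (S - A) * gcoef x A * gcoef (if p then ginvol y else y) (S - A)"
    proof (cases "gcoef x A = 0")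
      case False
      then have p: "odd (card A) = p" using assms by (auto simp: gparity_def)
      have "gsign (S - A) A = (- 1) ^ (card (S - A) * card A) * gsign A (S - A)"
        by (rule gsign_swap) (use A fin in \<open>auto intro: finite_subset\<close>)
      also have "(- 1 :: complex) ^ (card (S - A) * card A) =
          (if p then (- 1) ^ card (S - A) else 1)"
        using p by (auto simp: power_mult power_minus1_odd minus_one_power_iff)
      finally show ?thesis by (simp add: gcoef_ginvol)
    qed simp
  qed
  finally show "gcoef (y * x) S = gcoef (x * (if p then ginvol y else y)) S" .
qed

lemma grassmann_double_eq_0: "x = - x \<Longrightarrow> x = (0 :: 'n::len0 grassmann)"
proof (rule grassmann_eqI)
  fix S assume "x = - x"
  then have "gcoef x S = - gcoef x S" by (metis gcoef_simps(4))
  then show "gcoef x S = gcoef 0 S" by (simp add: gcoef_simps)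
qed

interpretation G: supercommutative_ring "ginvol :: 'n::len0 grassmann \<Rightarrow> 'n grassmann"
proof
  fix x y :: "'n grassmann"
  show "x * y = y * x" if "ginvol x = x"
    using grassmann_mult_swap[of x False y] that by (simp add: gparity_even_iff)
  show swap: "y * x = x * ginvol y" if "ginvol x = - x" for y
    using grassmann_mult_swap[of x True y] that by (simp add: gparity_odd_iff)
  show "x * x = 0" if "ginvol x = - x"
    using swap[OF that, of x] that by (intro grassmann_double_eq_0) simp
qed simp_all

declare G.inv_minus [simp] G.inv_diff [simp]

text \<open>The \<open>k\<close>-th power of the ideal generated by the odd generators.\<close>

definition gfilt :: "nat \<Rightarrow> 'n::len0 grassmann set" where
  "gfilt k = {x. \<forall>S. gcoef x S \<noteq> 0 \<longrightarrow> k \<le> card S}"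

lemma gfilt_0 [simp]: "x \<in> gfilt 0"
  by (simp add: gfilt_def)

lemma gfilt_zero [simp]: "0 \<in> gfilt k"
  by (simp add: gfilt_def gcoef_simps)

lemma gfilt_add: "x \<in> gfilt k \<Longrightarrow> y \<in> gfilt k \<Longrightarrow> x + y \<in> gfilt k"
  by (auto simp: gfilt_def gcoef_simps) (metis add.right_neutral)

lemma gfilt_minus: "x \<in> gfilt k \<Longrightarrow> - x \<in> gfilt k"
  by (auto simp: gfilt_def gcoef_simps)

lemma gfilt_ginvol: "x \<in> gfilt k \<Longrightarrow> ginvol x \<in> gfilt k"
  by (auto simp: gfilt_def gcoef_ginvol)

lemma gfilt_mono: "x \<in> gfilt k \<Longrightarrow> j \<le> k \<Longrightarrow> x \<in> gfilt j"
  by (force simp: gfilt_def)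

lemma gfilt_mult:
  fixes x y :: "'n::len0 grassmann"
  assumes "x \<in> gfilt j" "y \<in> gfilt k"
  shows "x * y \<in> gfilt (j + k)"
  unfolding gfilt_def
proof (intro CollectI allI impI)
  fix S assume nz: "gcoef (x * y) S \<noteq> 0"
  then have S: "S \<subseteq> {..<LENGTH('n)}" using gcoef_outside by blast
  then have fin: "finite S" by (rule finite_subset) simp
  from nz obtain A where A: "A \<in> Pow S" "gcoef x A \<noteq> 0" "gcoef y (S - A) \<noteq> 0"
    unfolding gcoef_times[OF S] by (metis (no_types, lifting) mult_eq_0_iff sum.neutral)
  then have "j \<le> card A" "k \<le> card (S - A)" using assms by (auto simp: gfilt_def)
  moreover have "card S = card A + card (S - A)"
    using fin A(1) by (metis PowD card_Diff_subset card_mono finite_subset le_add_diff_inverse)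
  ultimately show "j + k \<le> card S" by simp
qed

lemma gfilt_top: "x \<in> gfilt k \<Longrightarrow> k > LENGTH('n::len0) \<Longrightarrow> x = (0 :: 'n grassmann)"
proof (rule grassmann_eqI)
  fix S assume "x \<in> gfilt k" "k > LENGTH('n)" "S \<subseteq> {..<LENGTH('n)}"
  moreover from this have "card S \<le> LENGTH('n)"
    using card_mono[of "{..<LENGTH('n)}" S] by simp
  ultimately show "gcoef x S = gcoef 0 S"
    by (force simp: gfilt_def gcoef_simps)
qed

lemma gfilt_1_iff: "x \<in> gfilt 1 \<longleftrightarrow> gcoef x {} = 0"
proof -
  have "S = {}" if "gcoef x S \<noteq> 0" "card S = 0" for S
    using that gcoef_outside[of S x] by (meson card_0_eq finite_lessThan finite_subset)
  then show ?thesis by (force simp: gfilt_def Suc_le_eq)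
qed

lemma gcoef_mult_body: "gcoef (x * y) {} = gcoef x {} * gcoef (y :: 'n::len0 grassmann) {}"
  by (simp add: gcoef_times)

lemma odd_body: "ginvol x = - x \<Longrightarrow> gcoef x {} = 0"
  using gparity_odd_iff[of x] by (force simp: gparity_def)


lemma minus_eq_left_iff: "- a = b \<longleftrightarrow> a = - (b :: 'a::group_add)"
  by auto


section \<open>The algebra of values of superfunctions\<close>

lemma superval_sel [simp]:
  "sv0 0 = 0" "sv1 0 = 0" "sv0 1 = 1" "sv1 1 = 0"
  "sv0 (x + y) = sv0 x + sv0 y" "sv1 (x + y) = sv1 x + sv1 y"
  "sv0 (- x) = - sv0 x" "sv1 (- x) = - sv1 x"
  "sv0 (x - y) = sv0 x - sv0 y" "sv1 (x - y) = sv1 x - sv1 y"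
  "sv0 (x * y) = sv0 x * sv0 y" "sv1 (x * y) = sv1 x * sv0 y + ginvol (sv0 x) * sv1 y"
  by (simp_all add: zero_superval_def one_superval_def plus_superval_def
    uminus_superval_def minus_superval_def times_superval_def)

lemma svconst_sel [simp]: "sv0 (svconst a) = a" "sv1 (svconst a) = 0"
    "sv0 sv_theta = 0" "sv1 sv_theta = 1"
  by (simp_all add: svconst_def sv_theta_def)

lemma superval_eqI: "sv0 x = sv0 y \<Longrightarrow> sv1 x = sv1 y \<Longrightarrow> x = y"
  by (simp add: superval.expand)

lemma superval_eq_iff: "x = y \<longleftrightarrow> sv0 x = sv0 y \<and> sv1 x = sv1 y"
  using superval_eqI by auto

lemma svconst_hom:
  "svconst 0 = 0" "svconst 1 = 1" "svconst (a + b) = svconst a + svconst b"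
  "svconst (- a) = - svconst a" "svconst (a - b) = svconst a - svconst b"
  "svconst (a * b) = svconst a * svconst b"
  by (rule superval_eqI; simp)+

lemma superval_split: "x = svconst (sv0 x) + sv_theta * svconst (sv1 x)"
  by (rule superval_eqI; simp)

text \<open>The parity involution of \<open>\<Lambda>[\<theta>]\<close>.\<close>

definition svinvol :: "'n::len0 superval \<Rightarrow> 'n superval" where
  "svinvol x = SV (ginvol (sv0 x)) (- ginvol (sv1 x))"

lemma svinvol_sel [simp]: "sv0 (svinvol x) = ginvol (sv0 x)" "sv1 (svinvol x) = - ginvol (sv1 x)"
  by (simp_all add: svinvol_def)

lemma svinvol_const [simp]:
  "svinvol (svconst (gconst c)) = svconst (gconst c)" "svinvol sv_theta = - sv_theta"
  by (rule superval_eqI; simp)+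

lemma svinvol_svconst: "svinvol (svconst a) = svconst (ginvol a)"
  by (rule superval_eqI; simp)

lemma sv_parity_even_iff: "x \<in> sv_parity False \<longleftrightarrow> svinvol x = x"
  by (auto simp: sv_parity_def gparity_even_iff gparity_odd_iff superval_eq_iff minus_eq_left_iff)

lemma sv_parity_odd_iff: "x \<in> sv_parity True \<longleftrightarrow> svinvol x = - x"
  by (auto simp: sv_parity_def gparity_even_iff gparity_odd_iff superval_eq_iff)

interpretation S: supercommutative_ring "svinvol :: 'n::len0 superval \<Rightarrow> 'n superval"
proof
  fix x y :: "'n superval"
  show "svinvol (x + y) = svinvol x + svinvol y" "svinvol (x * y) = svinvol x * svinvol y"
    "svinvol (svinvol x) = x"
    by (rule superval_eqI; simp add: algebra_simps)+
  show "x * y = y * x" if "svinvol x = x"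
  proof -
    have x: "ginvol (sv0 x) = sv0 x" "ginvol (sv1 x) = - sv1 x"
      using that by (auto simp: superval_eq_iff minus_eq_left_iff)
    show ?thesis
      by (rule superval_eqI)
        (simp_all add: x G.even_central[OF x(1)] G.odd_swap[OF x(2)])
  qed
  show swap: "y * x = x * svinvol y" if "svinvol x = - x" for y
  proof -
    have x: "ginvol (sv0 x) = - sv0 x" "ginvol (sv1 x) = sv1 x"
      using that by (auto simp: superval_eq_iff)
    show ?thesis
      by (rule superval_eqI)
        (simp_all add: x G.even_central[OF x(2)] G.odd_swap[OF x(1)])
  qed
  show "x * x = 0" if "svinvol x = - x"
  proof -
    have "x * x = - (x * x)" using swap[OF that, of x] that by simp
    from arg_cong[OF this, of sv0, unfolded superval_sel(7)]
      arg_cong[OF this, of sv1, unfolded superval_sel(8)]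
    have "sv0 (x * x) = 0" "sv1 (x * x) = 0"
      using grassmann_double_eq_0 by blast+
    then show ?thesis by (intro superval_eqI) simp_all
  qed
qed

lemmas svinvol_simps [simp] = S.inv_rules S.inv_inv

definition sbody :: "'n::len0 superval \<Rightarrow> complex" where
  "sbody x = gcoef (sv0 x) {}"

lemma sbody_simps [simp]:
  "sbody 0 = 0" "sbody 1 = 1" "sbody (x + y) = sbody x + sbody y" "sbody (- x) = - sbody x"
  "sbody (x - y) = sbody x - sbody y" "sbody (x * y) = sbody x * sbody y"
  "sbody (svconst (gconst c)) = c"
  by (simp_all add: sbody_def gcoef_simps gcoef_mult_body gcoef_gconst)

definition svfilt :: "nat \<Rightarrow> 'n::len0 superval set" where
  "svfilt k = {x. sv0 x \<in> gfilt k \<and> sv1 x \<in> gfilt k}"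

lemma svfilt_0 [simp]: "x \<in> svfilt 0"
  by (simp add: svfilt_def)

lemma svfilt_zero [simp]: "0 \<in> svfilt k"
  by (simp add: svfilt_def)

lemma svfilt_add: "x \<in> svfilt k \<Longrightarrow> y \<in> svfilt k \<Longrightarrow> x + y \<in> svfilt k"
  by (simp add: svfilt_def gfilt_add)

lemma svfilt_minus: "x \<in> svfilt k \<Longrightarrow> - x \<in> svfilt k"
  by (simp add: svfilt_def gfilt_minus)

lemma svfilt_mono: "x \<in> svfilt k \<Longrightarrow> j \<le> k \<Longrightarrow> x \<in> svfilt j"
  by (auto simp: svfilt_def intro: gfilt_mono)

lemma svfilt_mult: "x \<in> svfilt j \<Longrightarrow> y \<in> svfilt k \<Longrightarrow> x * y \<in> svfilt (j + k)"
  by (auto simp: svfilt_def intro!: gfilt_add gfilt_mult gfilt_ginvol)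

lemma svfilt_sum: "(\<And>i. i \<in> I \<Longrightarrow> f i \<in> svfilt k) \<Longrightarrow> sum f I \<in> svfilt k"
  by (induction I rule: infinite_finite_induct) (simp_all add: svfilt_add)

lemma svfilt_power: "x \<in> svfilt 1 \<Longrightarrow> x ^ k \<in> svfilt k"
  by (induction k) (auto dest: svfilt_mult)

lemma svfilt_top: "x \<in> svfilt k \<Longrightarrow> k > LENGTH('n::len0) \<Longrightarrow> x = (0 :: 'n superval)"
  by (intro superval_eqI) (auto simp: svfilt_def dest: gfilt_top)

lemma svfilt_nilpotent:
  "x \<in> svfilt 1 \<Longrightarrow> k > LENGTH('n::len0) \<Longrightarrow> x ^ k = (0 :: 'n superval)"
  using svfilt_power svfilt_top by blast

lemma even_svfilt_1: "svinvol x = x \<Longrightarrow> sbody x = 0 \<Longrightarrow> x \<in> svfilt 1"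
  using odd_body[of "sv1 x"]
  by (auto simp: svfilt_def gfilt_1_iff sbody_def superval_eq_iff minus_eq_left_iff
      simp del: One_nat_def)

lemma unit_inv_eq:
  assumes "x * y = 1" "y * x = 1"
  shows "unit_inv x = (y :: 'a::ring_1)"
  unfolding unit_inv_def
proof (rule the_equality)
  fix w assume w: "x * w = 1 \<and> w * x = 1"
  then have "(y * x) * w = y" by (simp add: mult.assoc)
  then show "w = y" using assms by simp
qed (use assms in simp)

lemma is_unit_eltI: "x * y = 1 \<Longrightarrow> y * x = 1 \<Longrightarrow> is_unit_elt x"
  by (auto simp: is_unit_elt_def)

lemma unit_inv_mult: "is_unit_elt x \<Longrightarrow> x * unit_inv x = 1" "is_unit_elt x \<Longrightarrow> unit_inv x * x = 1"
  unfolding is_unit_elt_def using unit_inv_eq by metis+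


section \<open>Holomorphic superfunctions and the superderivative\<close>

lemma gcoef_gderiv: "gcoef (gderiv f z) S = deriv (\<lambda>w. gcoef (f w :: 'n::len0 grassmann) S) z"
  unfolding gderiv_def
  by (subst Abs_grassmann_inverse) (auto simp: gcoef_outside)

lemma gholomorphic_on_iff:
  "gholomorphic_on f V \<longleftrightarrow>
    (\<forall>S. S \<subseteq> {..<LENGTH('n)} \<longrightarrow> (\<lambda>z. gcoef (f z :: 'n::len0 grassmann) S) holomorphic_on V)"
proof -
  have "(\<lambda>z. gcoef (f z) S) holomorphic_on V" if "\<not> S \<subseteq> {..<LENGTH('n)}" for S
    using that by (simp add: gcoef_outside)
  then show ?thesis unfolding gholomorphic_on_def by blast
qed

lemma gholomorphic_simps:
  "gholomorphic_on (\<lambda>_. a) V"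
  "gholomorphic_on f V \<Longrightarrow> gholomorphic_on g V \<Longrightarrow> gholomorphic_on (\<lambda>z. f z + g z) V"
  "gholomorphic_on f V \<Longrightarrow> gholomorphic_on g V \<Longrightarrow> gholomorphic_on (\<lambda>z. f z - g z) V"
  "gholomorphic_on f V \<Longrightarrow> gholomorphic_on (\<lambda>z. - f z) V"
  "gholomorphic_on f V \<Longrightarrow> gholomorphic_on (\<lambda>z. ginvol (f z)) V"
  "gholomorphic_on f V \<Longrightarrow> gholomorphic_on g V \<Longrightarrow> gholomorphic_on (\<lambda>z. f z * g z) V"
  unfolding gholomorphic_on_iff
  by (auto simp: gcoef_simps gcoef_ginvol gcoef_times intro!: holomorphic_intros)
    (meson Diff_subset PowD dual_order.trans)

lemma gholomorphic_gconst:
  "h holomorphic_on V \<Longrightarrow> gholomorphic_on (\<lambda>z. gconst (h z) :: 'n::len0 grassmann) V"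
  unfolding gholomorphic_on_def gcoef_gconst
proof
  fix S :: "nat set"
  assume "h holomorphic_on V"
  then show "(\<lambda>z. if S = {} then h z else 0) holomorphic_on V" by (cases "S = {}") simp_all
qed

lemma gholomorphic_cong:
  "(\<And>z. z \<in> V \<Longrightarrow> f z = g z) \<Longrightarrow> gholomorphic_on f V \<longleftrightarrow> gholomorphic_on g V"
  unfolding gholomorphic_on_def by (simp cong: holomorphic_cong)

lemma gholomorphic_subset: "gholomorphic_on f V \<Longrightarrow> U \<subseteq> V \<Longrightarrow> gholomorphic_on f U"
  unfolding gholomorphic_on_def by (meson holomorphic_on_subset)

lemma gholomorphic_gderiv: "gholomorphic_on f V \<Longrightarrow> open V \<Longrightarrow> gholomorphic_on (gderiv f) V"
  unfolding gholomorphic_on_def gcoef_gderiv by (intro allI holomorphic_deriv) auto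

lemma gderiv_cong_ev: "eventually (\<lambda>w. f w = g w) (nhds z) \<Longrightarrow> gderiv f z = gderiv g z"
  by (rule grassmann_eqI) (auto simp: gcoef_gderiv intro!: deriv_cong_ev elim: eventually_mono)

lemma gderiv_const [simp]: "gderiv (\<lambda>_. a) z = 0"
  by (rule grassmann_eqI) (simp add: gcoef_gderiv gcoef_simps)

lemma gderiv_gconst: "gderiv (\<lambda>z. gconst (h z)) z = gconst (deriv h z)"
  by (rule grassmann_eqI) (simp add: gcoef_gderiv gcoef_gconst)

context
  fixes f :: "complex \<Rightarrow> 'n::len0 grassmann" and V z
  assumes f: "gholomorphic_on f V" and V: "open V" "z \<in> V"
begin

lemma gcoef_differentiable: "(\<lambda>z. gcoef (f z) S) field_differentiable at z"
  using f V unfolding gholomorphic_on_def by (meson holomorphic_on_imp_differentiable_at)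

lemma gderiv_minus: "gderiv (\<lambda>z. - f z) z = - gderiv f z"
  by (rule grassmann_eqI) (simp add: gcoef_gderiv gcoef_simps gcoef_differentiable)

lemma gderiv_ginvol: "gderiv (\<lambda>z. ginvol (f z)) z = ginvol (gderiv f z)"
  by (rule grassmann_eqI) (simp add: gcoef_gderiv gcoef_ginvol gcoef_differentiable)

end

context
  fixes f g :: "complex \<Rightarrow> 'n::len0 grassmann" and V z
  assumes f: "gholomorphic_on f V" and g: "gholomorphic_on g V" and V: "open V" "z \<in> V"
begin

lemmas gcoef_diff_fg = gcoef_differentiable[OF f V] gcoef_differentiable[OF g V]

lemma gderiv_add: "gderiv (\<lambda>z. f z + g z) z = gderiv f z + gderiv g z"
  by (rule grassmann_eqI) (simp add: gcoef_gderiv gcoef_simps gcoef_diff_fg)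

lemma gderiv_diff: "gderiv (\<lambda>z. f z - g z) z = gderiv f z - gderiv g z"
  by (rule grassmann_eqI) (simp add: gcoef_gderiv gcoef_simps gcoef_diff_fg)

lemma gderiv_mult: "gderiv (\<lambda>z. f z * g z) z = gderiv f z * g z + f z * gderiv g z"
proof (rule grassmann_eqI)
  fix S assume S: "S \<subseteq> {..<LENGTH('n)}"
  have "((\<lambda>z. \<Sum>A\<in>Pow S. gsign A (S - A) * gcoef (f z) A * gcoef (g z) (S - A)) has_field_derivative
      (\<Sum>A\<in>Pow S. gsign A (S - A) * deriv (\<lambda>z. gcoef (f z) A) z * gcoef (g z) (S - A) +
        gsign A (S - A) * gcoef (f z) A * deriv (\<lambda>z. gcoef (g z) (S - A)) z)) (at z)"
    by (rule derivative_eq_intros refl DERIV_deriv_iff_field_differentiable[THEN iffD2]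
      gcoef_diff_fg | simp add: algebra_simps)+
  then show "gcoef (gderiv (\<lambda>z. f z * g z) z) S = gcoef (gderiv f z * g z + f z * gderiv g z) S"
    using S by (simp add: gcoef_gderiv gcoef_simps gcoef_times DERIV_imp_deriv sum.distrib)
qed

end

text \<open>Superfunctions that are holomorphic on \<open>V\<close>, whatever their values outside \<open>V\<close>.\<close>

definition svhol :: "complex set \<Rightarrow> (complex \<Rightarrow> 'n::len0 superval) \<Rightarrow> bool" where
  "svhol V f \<longleftrightarrow> gholomorphic_on (\<lambda>z. sv0 (f z)) V \<and> gholomorphic_on (\<lambda>z. sv1 (f z)) V"

lemma superfunctions_carrier:
  "f \<in> carrier (superfunctions V) \<longleftrightarrow> svhol V f \<and> (\<forall>z. z \<notin> V \<longrightarrow> f z = 0)"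
  by (simp add: superfunctions_def svhol_def o_def)

text \<open>The superderivative without truncation to a domain.\<close>

definition sD :: "(complex \<Rightarrow> 'n::len0 superval) \<Rightarrow> complex \<Rightarrow> 'n superval" where
  "sD f z = SV (sv1 (f z)) (gderiv (\<lambda>w. sv0 (f w)) z)"

lemma superD_eq: "superD V f z = (if z \<in> V then sD f z else 0)"
  by (simp add: superD_def cut_def sD_def o_def)

lemma sD_sel [simp]: "sv0 (sD f z) = sv1 (f z)" "sv1 (sD f z) = gderiv (\<lambda>w. sv0 (f w)) z"
  by (simp_all add: sD_def)

lemma sD_cong_ev: "eventually (\<lambda>w. f w = g w) (nhds z) \<Longrightarrow> sD f z = sD g z"
  by (auto simp: superval_eq_iff intro: gderiv_cong_ev elim: eventually_mono
    dest: eventually_nhds_x_imp_x)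

lemma sD_cong:
  assumes "open V" "z \<in> V" "\<And>w. w \<in> V \<Longrightarrow> f w = g w"
  shows "sD f z = sD g z"
  by (rule sD_cong_ev) (use assms eventually_nhds in blast)

lemma svhol_const [simp]: "svhol V (\<lambda>_. a)"
  by (simp add: svhol_def gholomorphic_simps)

lemma svhol_svconst_gconst: "h holomorphic_on V \<Longrightarrow> svhol V (\<lambda>z. svconst (gconst (h z)))"
  by (simp add: svhol_def gholomorphic_simps gholomorphic_gconst)

lemma svhol_add: "svhol V f \<Longrightarrow> svhol V g \<Longrightarrow> svhol V (\<lambda>z. f z + g z)"
  by (simp add: svhol_def gholomorphic_simps)

lemma svhol_diff: "svhol V f \<Longrightarrow> svhol V g \<Longrightarrow> svhol V (\<lambda>z. f z - g z)"
  by (simp add: svhol_def gholomorphic_simps)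

lemma svhol_minus: "svhol V f \<Longrightarrow> svhol V (\<lambda>z. - f z)"
  by (simp add: svhol_def gholomorphic_simps)

lemma svhol_mult: "svhol V f \<Longrightarrow> svhol V g \<Longrightarrow> svhol V (\<lambda>z. f z * g z)"
  by (simp add: svhol_def gholomorphic_simps)

lemma svhol_power: "svhol V f \<Longrightarrow> svhol V (\<lambda>z. f z ^ k)"
  by (induction k) (simp_all add: svhol_mult)

lemma svhol_sum: "(\<And>i. i \<in> I \<Longrightarrow> svhol V (f i)) \<Longrightarrow> svhol V (\<lambda>z. \<Sum>i\<in>I. f i z)"
  by (induction I rule: infinite_finite_induct) (simp_all add: svhol_add)

lemma svhol_svinvol: "svhol V f \<Longrightarrow> svhol V (\<lambda>z. svinvol (f z))"
  by (simp add: svhol_def gholomorphic_simps)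

lemma svhol_sD: "svhol V f \<Longrightarrow> open V \<Longrightarrow> svhol V (sD f)"
  by (simp add: svhol_def gholomorphic_gderiv)

lemmas svhol_intros = svhol_const svhol_svconst_gconst svhol_add svhol_diff svhol_minus svhol_mult
  svhol_power svhol_sum svhol_svinvol svhol_sD

lemma svhol_cong: "(\<And>z. z \<in> V \<Longrightarrow> f z = g z) \<Longrightarrow> svhol V f \<longleftrightarrow> svhol V g"
  unfolding svhol_def by (simp cong: gholomorphic_cong)

lemma svhol_subset: "svhol V f \<Longrightarrow> U \<subseteq> V \<Longrightarrow> svhol U f"
  unfolding svhol_def by (meson gholomorphic_subset)

lemma cut_in_superfunctions: "svhol V f \<Longrightarrow> cut V f \<in> carrier (superfunctions V)"
  by (simp add: superfunctions_carrier cut_def cong: svhol_cong)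

lemma sD_const [simp]: "sD (\<lambda>_. a) z = SV (sv1 a) 0"
  by (simp add: superval_eq_iff)

context
  fixes f :: "complex \<Rightarrow> 'n::len0 superval" and V z
  assumes f: "svhol V f" and V: "open V" "z \<in> V"
begin

lemma sD_minus: "sD (\<lambda>z. - f z) z = - sD f z"
  using f V by (simp add: superval_eq_iff svhol_def gderiv_minus[where V = V])

lemma sD_svinvol: "sD (\<lambda>z. svinvol (f z)) z = - svinvol (sD f z)"
  using f V by (simp add: superval_eq_iff svhol_def gderiv_ginvol[where V = V])

end

context
  fixes f g :: "complex \<Rightarrow> 'n::len0 superval" and V z
  assumes f: "svhol V f" and g: "svhol V g" and V: "open V" "z \<in> V"
begin

lemma sD_add: "sD (\<lambda>z. f z + g z) z = sD f z + sD g z"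
  using f g V by (simp add: superval_eq_iff svhol_def gderiv_add[where V = V])

lemma sD_diff: "sD (\<lambda>z. f z - g z) z = sD f z - sD g z"
  using f g V by (simp add: superval_eq_iff svhol_def gderiv_diff[where V = V])

lemma sD_mult: "sD (\<lambda>z. f z * g z) z = sD f z * g z + svinvol (f z) * sD g z"
  using f g V by (simp add: superval_eq_iff svhol_def gderiv_mult[where V = V] algebra_simps)

end

lemma sD_even:
  assumes "svhol V f" "open V" "z \<in> V" "\<And>w. w \<in> V \<Longrightarrow> svinvol (f w) = f w"
  shows "svinvol (sD f z) = - sD f z"
proof -
  have "sD f z = - svinvol (sD f z)"
    using sD_svinvol[OF assms(1,2,3)] sD_cong[of V z "\<lambda>z. svinvol (f z)" f] assms by simp
  then show ?thesis by (metis minus_minus)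
qed

lemma sD_odd:
  assumes "svhol V f" "open V" "z \<in> V" "\<And>w. w \<in> V \<Longrightarrow> svinvol (f w) = - f w"
  shows "svinvol (sD f z) = sD f z"
  using sD_svinvol[OF assms(1,2,3)] sD_minus[OF assms(1,2,3)]
    sD_cong[of V z "\<lambda>z. svinvol (f z)" "\<lambda>z. - f z"] assms by simp

context
  fixes f g :: "complex \<Rightarrow> 'n::len0 superval" and V
  assumes f: "svhol V f" and g: "svhol V g" and V: "open V"
begin

lemma sD2_mult:
  assumes "z \<in> V"
  shows "sD (sD (\<lambda>z. f z * g z)) z = sD (sD f) z * g z + f z * sD (sD g) z"
proof -
  have "sD (sD (\<lambda>z. f z * g z)) z = sD (\<lambda>z. sD f z * g z + svinvol (f z) * sD g z) z"
    using f g V assms by (intro sD_cong[of V]) (auto simp: sD_mult[where V = V])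
  also have "\<dots> = sD (\<lambda>z. sD f z * g z) z + sD (\<lambda>z. svinvol (f z) * sD g z) z"
    using f g V assms by (intro sD_add[where V = V] svhol_intros)
  also have "sD (\<lambda>z. sD f z * g z) z = sD (sD f) z * g z + svinvol (sD f z) * sD g z"
    using f g V assms by (intro sD_mult[where V = V] svhol_intros)
  also have "sD (\<lambda>z. svinvol (f z) * sD g z) z =
      sD (\<lambda>z. svinvol (f z)) z * sD g z + svinvol (svinvol (f z)) * sD (sD g) z"
    using f g V assms by (intro sD_mult[where V = V] svhol_intros)
  also have "sD (\<lambda>z. svinvol (f z)) z = - svinvol (sD f z)"
    using f V assms by (intro sD_svinvol[where V = V])
  finally show ?thesis by simp
qed

lemma sD3_mult:
  assumes "z \<in> V"
  shows "sD (sD (sD (\<lambda>z. f z * g z))) z =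
    sD (sD (sD f)) z * g z + svinvol (sD (sD f) z) * sD g z
      + (sD f z * sD (sD g) z + svinvol (f z) * sD (sD (sD g)) z)"
proof -
  have "sD (sD (sD (\<lambda>z. f z * g z))) z = sD (\<lambda>z. sD (sD f) z * g z + f z * sD (sD g) z) z"
    using f g V assms by (intro sD_cong[of V]) (auto simp: sD2_mult)
  also have "\<dots> = sD (\<lambda>z. sD (sD f) z * g z) z + sD (\<lambda>z. f z * sD (sD g) z) z"
    using f g V assms by (intro sD_add[where V = V] svhol_intros)
  also have "sD (\<lambda>z. sD (sD f) z * g z) z =
      sD (sD (sD f)) z * g z + svinvol (sD (sD f) z) * sD g z"
    using f g V assms by (intro sD_mult[where V = V] svhol_intros)
  also have "sD (\<lambda>z. f z * sD (sD g) z) z = sD f z * sD (sD g) z + svinvol (f z) * sD (sD (sD g)) z"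
    using f g V assms by (intro sD_mult[where V = V] svhol_intros)
  finally show ?thesis .
qed

end


section \<open>The super-Schwarzian\<close>

lemma geometric_sum_ring: "(1 - x) * (\<Sum>i<n. x ^ i) = 1 - x ^ n" for x :: "'a::ring_1"
proof (induction n)
  case (Suc n)
  have "(1 - x) * (\<Sum>i<Suc n. x ^ i) = (1 - x ^ n) + (1 - x) * x ^ n"
    using Suc by (simp add: distrib_left)
  then show ?case by (simp add: left_diff_distrib)
qed simp

lemma SV_0_0 [simp]: "SV 0 0 = 0"
  by (simp add: zero_superval_def)

text \<open>
  After division by the body, \<open>1 - f\<close> is nilpotent, so the geometric series for the inverse is a finite
  sum.
\<close>

lemma svhol_inverse:
  fixes f :: "complex \<Rightarrow> 'n::len0 superval"
  assumes f: "svhol V f" and even: "\<And>z. z \<in> V \<Longrightarrow> svinvol (f z) = f z"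
    and body: "\<And>z. z \<in> V \<Longrightarrow> sbody (f z) \<noteq> 0"
  obtains g where "svhol V g" "\<And>z. z \<in> V \<Longrightarrow> svinvol (g z) = g z" "\<And>z. z \<in> V \<Longrightarrow> f z * g z = 1"
proof -
  define b where "b z = (svconst (gconst (inverse (sbody (f z)))) :: 'n superval)" for z
  define g where "g z = b z * (\<Sum>i<Suc LENGTH('n). (1 - f z * b z) ^ i)" for z
  have "(\<lambda>z. sbody (f z)) holomorphic_on V"
    using f by (simp add: sbody_def svhol_def gholomorphic_on_def)
  then have "svhol V b"
    unfolding b_def using body by (intro svhol_svconst_gconst holomorphic_intros) auto
  then have "svhol V g"
    unfolding g_def by (intro svhol_intros f) auto
  moreover have inv: "f z * g z = 1" if z: "z \<in> V" for z
  proof -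
    have "svinvol (b z) = b z" by (simp add: b_def)
    then have "1 - f z * b z \<in> svfilt 1"
      using even[OF z] body[OF z] by (intro even_svfilt_1) (simp_all, simp add: b_def)
    then have "(1 - f z * b z) ^ Suc LENGTH('n) = 0"
      by (rule svfilt_nilpotent) simp
    then show ?thesis
      using geometric_sum_ring[of "1 - f z * b z" "Suc LENGTH('n)"]
      by (simp only: g_def mult.assoc[symmetric]) simp
  qed
  moreover have "svinvol (g z) = g z" if z: "z \<in> V" for z
    using S.even_inverse[OF even[OF z] inv[OF z]] .
  ultimately show ?thesis using that by blast
qed

context supercommutative_ring
begin

text \<open>
  Here \<open>p\<close>, \<open>r\<close>, \<open>q\<close> stand for \<open>DG\<close>, \<open>D\<^sup>2G\<close>, \<open>D\<^sup>3G\<close> and \<open>p'\<close>, \<open>r'\<close>, \<open>q'\<close> for the same derivatives of \<open>L = 1/G\<close>. The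
  hypotheses are the derivatives of \<open>G L = 1\<close>.
\<close>

lemma schwarzian_identity:
  assumes ev: "invol G = G" "invol L = L" "invol r = r" "G * L = 1"
    and D1: "p * L + G * p' = 0" and D2: "r * L + G * r' = 0"
    and D3: "q * L + r * p' + (p * r' + G * q') = 0"
  shows "q * L - 2 * (p * r * L ^ 2) = - (G * q')"
proof -
  have LG: "L * G = 1" using ev even_central by metis
  have p': "p' = - (L * (p * L))"
  proof -
    have "G * p' = - (p * L)" using D1 by (simp add: eq_neg_iff_add_eq_0 add.commute)
    then have "L * (G * p') = L * (- (p * L))" by simp
    then show ?thesis using LG by (simp flip: mult.assoc)
  qed
  have r': "r' = - (L * (r * L))"
  proof -
    have "G * r' = - (r * L)" using D2 by (simp add: eq_neg_iff_add_eq_0 add.commute)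
    then have "L * (G * r') = L * (- (r * L))" by simp
    then show ?thesis using LG by (simp flip: mult.assoc)
  qed
  have "r * p' = - (p * r * L ^ 2)" "p * r' = - (p * r * L ^ 2)"
    unfolding p' r' using ev by (simp_all add: even_ac power2_eq_square)
  then have "q * L - p * r * L ^ 2 + (- (p * r * L ^ 2) + G * q') = 0"
    using D3 by simp
  then have "q * L - (p * r * L ^ 2 + p * r * L ^ 2) + G * q' = 0"
    by (simp add: algebra_simps)
  then show ?thesis by (simp add: eq_neg_iff_add_eq_0 mult_2)
qed

text \<open>
  The two sides of the cocycle condition after all derivatives are expanded: \<open>B\<close> and \<open>D\<close> are the inverses
  of the Jacobian factors \<open>A\<close> and \<open>C\<close>, and \<open>p\<close>, \<open>b\<close>, \<open>w\<close> and \<open>q\<close>, \<open>d\<close>, \<open>v\<close> are the first three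
  superderivatives of \<open>B\<close> and of \<open>D\<close>.
\<close>

lemma cocycle_identity:
  assumes ev: "invol A = A" "invol B = B" "invol C = C" "invol D = D"
    and inverse: "A * B = 1" "C * D = 1"
    and odd: "invol p = - p"
  shows "A * C * (w * D + b * q + (p * d + B * v)) =
      A * w + A ^ 3 * (C * (B * (p * (p * q + B * d) + B * (b * q + (- p) * d + (p * d + B * v)))))"
proof -
  have c: "A * (B * x) = x" "C * (D * x) = x" for x
    using inverse by (simp_all flip: mult.assoc)
  have "A * C * (w * D) = A * w" using ev c(2)[of w] inverse by (simp add: even_ac)
  then show ?thesis
    using ev odd_square[OF odd] odd_left_square[OF odd]
    by (simp add: even_ac power3_eq_cube c inverse)
qed

end

text \<open>
  For an even invertible \<open>G\<close> the super-Schwarzian is the linear expression \<open>- G D\<^sup>3 (1 / G)\<close>. So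
  the equation \<open>\<sigma>(G) = h\<close> is the linear equation \<open>D\<^sup>3 y + h y = 0\<close> for \<open>y = 1 / G\<close>.
\<close>

lemma super_schwarzian_eq:
  fixes G L :: "complex \<Rightarrow> 'n::len0 superval"
  assumes V: "open V" and hol: "svhol V G" "svhol V L"
    and even: "\<And>z. z \<in> V \<Longrightarrow> svinvol (G z) = G z" and inverse: "\<And>z. z \<in> V \<Longrightarrow> G z * L z = 1"
    and z: "z \<in> V"
  shows "super_schwarzian V G z = - (G z * sD (sD (sD L)) z)"
proof -
  have evL: "svinvol (L z) = L z" if "z \<in> V" for z
    using S.even_inverse[OF even[OF that] inverse[OF that]] .
  have LG: "L z * G z = 1" using S.even_central[OF even[OF z]] inverse[OF z] by metis
  have D: "superD V f z = sD f z" if "z \<in> V" for f :: "complex \<Rightarrow> 'n superval" and z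
    using that by (simp add: superD_eq)
  have D2: "superD V (superD V f) z = sD (sD f) z" if "z \<in> V" for f :: "complex \<Rightarrow> 'n superval" and z
    using that V by (simp add: D) (rule sD_cong[of V], auto simp: D)
  have D3: "superD V (superD V (superD V f)) z = sD (sD (sD f)) z" for f :: "complex \<Rightarrow> 'n superval"
    using z V by (simp add: D) (rule sD_cong[of V], auto simp: D2)
  have one1: "sD (\<lambda>z. G z * L z) w = 0" if "w \<in> V" for w
    using sD_cong[of V w "\<lambda>z. G z * L z" "\<lambda>_. 1"] inverse that V by simp
  have one2: "sD (sD (\<lambda>z. G z * L z)) w = 0" if "w \<in> V" for w
    using sD_cong[of V w "sD (\<lambda>z. G z * L z)" "\<lambda>_. svconst 0"] one1 that V by (simp add: svconst_hom)
  have one3: "sD (sD (sD (\<lambda>z. G z * L z))) z = 0"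
    using sD_cong[of V z "sD (sD (\<lambda>z. G z * L z))" "\<lambda>_. svconst 0"] one2 z V by (simp add: svconst_hom)
  have r: "svinvol (sD (sD G) z) = sD (sD G) z"
    by (rule sD_odd[OF svhol_sD[OF hol(1) V] V z]) (rule sD_even[OF hol(1) V _ even])
  have "unit_inv (G z) = L z" using unit_inv_eq inverse[OF z] LG by blast
  then have "super_schwarzian V G z = sD (sD (sD G)) z * L z - 2 * (sD G z * sD (sD G) z * L z ^ 2)"
    using z by (simp add: super_schwarzian_def cut_def D3 D2[OF z, of G] D[OF z, of G])
  also have "\<dots> = - (G z * sD (sD (sD L)) z)"
  proof (rule S.schwarzian_identity[where p' = "sD L z" and r' = "sD (sD L) z"])
    show "sD G z * L z + G z * sD L z = 0"
      using one1[OF z] sD_mult[OF hol V z] even[OF z] by simp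
    show "sD (sD G) z * L z + G z * sD (sD L) z = 0"
      using one2[OF z] sD2_mult[OF hol V z] by simp
    show "sD (sD (sD G)) z * L z + sD (sD G) z * sD L z +
        (sD G z * sD (sD L) z + G z * sD (sD (sD L)) z) = 0"
      using one3 sD3_mult[OF hol V z] even[OF z] r by simp
  qed (use even z evL inverse r in auto)
  finally show ?thesis .
qed

text \<open>
  The cocycle condition. Here \<open>K\<close> and \<open>L\<close> are the inverses of the two Jacobian factors \<open>J\<close> and \<open>H\<close>
  and \<open>K D\<close> is the superderivative of the intermediate coordinates.
\<close>

lemma schwarzian_cocycle:
  fixes J K H L :: "complex \<Rightarrow> 'n::len0 superval"
  assumes V: "open V" and hol: "svhol V K" "svhol V L"
    and even: "\<And>z. z \<in> V \<Longrightarrow> svinvol (J z) = J z" "\<And>z. z \<in> V \<Longrightarrow> svinvol (H z) = H z"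
    and inverse: "\<And>z. z \<in> V \<Longrightarrow> J z * K z = 1" "\<And>z. z \<in> V \<Longrightarrow> H z * L z = 1"
    and z: "z \<in> V"
  defines "E \<equiv> \<lambda>f z. K z * sD f z"
  shows "J z * H z * sD (sD (sD (\<lambda>z. K z * L z))) z =
    J z * sD (sD (sD K)) z + J z ^ 3 * (H z * E (E (E L)) z)"
proof -
  have evK: "svinvol (K z) = K z" if "z \<in> V" for z
    using S.even_inverse[OF even(1)[OF that] inverse(1)[OF that]] .
  have evL: "svinvol (L z) = L z" if "z \<in> V" for z
    using S.even_inverse[OF even(2)[OF that] inverse(2)[OF that]] .
  have p: "svinvol (sD K z) = - sD K z"
    by (rule sD_even[OF hol(1) V z evK])
  have b: "svinvol (sD (sD K) z) = sD (sD K) z"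
    by (rule sD_odd[OF svhol_sD[OF hol(1) V] V z]) (rule sD_even[OF hol(1) V _ evK])
  have "E (E L) w = K w * (sD K w * sD L w + K w * sD (sD L) w)" if w: "w \<in> V" for w
    using sD_mult[OF hol(1) svhol_sD[OF hol(2) V] V w] evK[OF w] by (simp add: E_def)
  then have "sD (E (E L)) z = sD (\<lambda>w. K w * (sD K w * sD L w + K w * sD (sD L) w)) z"
    by (intro sD_cong[OF V z])
  also have "\<dots> = sD K z * (sD K z * sD L z + K z * sD (sD L) z)
      + svinvol (K z) * sD (\<lambda>w. sD K w * sD L w + K w * sD (sD L) w) z"
    by (intro sD_mult[where V = V] svhol_intros V z hol)
  also have "sD (\<lambda>w. sD K w * sD L w + K w * sD (sD L) w) z =
      sD (\<lambda>w. sD K w * sD L w) z + sD (\<lambda>w. K w * sD (sD L) w) z"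
    by (intro sD_add[where V = V] svhol_intros V z hol)
  also have "sD (\<lambda>w. sD K w * sD L w) z = sD (sD K) z * sD L z + svinvol (sD K z) * sD (sD L) z"
    by (intro sD_mult[where V = V] svhol_intros V z hol)
  also have "sD (\<lambda>w. K w * sD (sD L) w) z = sD K z * sD (sD L) z + svinvol (K z) * sD (sD (sD L)) z"
    by (intro sD_mult[where V = V] svhol_intros V z hol)
  finally have E: "sD (E (E L)) z = sD K z * (sD K z * sD L z + K z * sD (sD L) z) +
      K z * (sD (sD K) z * sD L z + (- sD K z) * sD (sD L) z +
        (sD K z * sD (sD L) z + K z * sD (sD (sD L)) z))"
    using p evK[OF z] by simp
  have "E (E (E L)) z = K z * sD (E (E L)) z" by (simp add: E_def)
  then show ?thesis
    unfolding sD3_mult[OF hol V z] E b evK[OF z]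
    using S.cocycle_identity[of "J z" "K z" "H z" "L z" "sD K z"] even[OF z] evK[OF z] evL[OF z]
      inverse[OF z] p by simp
qed


section \<open>Fractional linear superconformal transformations\<close>

context supercommutative_ring
begin

text \<open>
  The odd constants \<open>p\<close>, \<open>q\<close>, \<open>r\<close>, \<open>s\<close> are the entries \<open>\<alpha>\<close>, \<open>\<beta>\<close>, \<open>\<gamma>\<close>, \<open>\<delta>\<close> of the matrix. The hypotheses \<open>rel\<close> compare
  coefficients in \<open>DF = \<Psi> D\<Psi>\<close> multiplied by the square of the denominator. The conclusions are the
  coefficients that enter the product of \<open>D\<Psi>\<close> with the denominator.
\<close>

lemma fractional_linear_relations:
  assumes ev: "invol a = a" "invol b = b" "invol c = c" "invol d = d" "invol e = e"
    and od: "invol p = - p" "invol q = - q"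
    and unit: "e * u = 1"
    and rel: "r * e = a * q - p * c" "s * e = b * q - p * d"
      "a * d - b * c - (p * q + p * q) = e * e - s * r"
  shows "r * q = - (u * (p * q)) * c" "s * q = - (u * (p * q)) * d" "r * d - s * c = e * q"
proof -
  have evu: "invol u = u" using even_inverse[OF ev(5) unit] .
  note sort = odd_sort[OF od] odd_null[OF od(1)] odd_null[OF od(2)]
  have eu: "u * (e * x) = x" "e * (u * x) = x" for x
    using unit even_central[OF ev(5), of u] by (simp_all flip: mult.assoc)
  have "u * (r * e) = r" "u * (s * e) = s"
    by (simp_all add: eu flip: even_central[OF ev(5), of r] even_central[OF ev(5), of s])
  then have r: "r = u * (a * q - p * c)" and s: "s = u * (b * q - p * d)"
    using rel by simp_all
  show "r * q = - (u * (p * q)) * c" "s * q = - (u * (p * q)) * d"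
    unfolding r s using ev evu by (simp_all add: even_ac sort)
  have "(a * d - b * c) * q = (e * e - s * r + (p * q + p * q)) * q"
    by (simp only: rel(3)[THEN diff_eq_eq[THEN iffD1]])
  also have "\<dots> = e * (e * q)"
    unfolding r s using ev evu by (simp add: even_ac sort)
  finally have "u * ((a * d - b * c) * q) = e * q" by (simp add: eu)
  moreover have "r * d - s * c = u * ((a * d - b * c) * q)"
    unfolding r s using ev evu by (simp add: even_ac sort)
  ultimately show "r * d - s * c = e * q" by simp
qed

text \<open>
  When the denominator is \<open>1 / D\<Psi>\<close> itself, the relations sharpen to these, and the matrix has
  superdeterminant \<open>1\<close>.
\<close>

lemma fractional_linear_sdet:
  assumes ev: "invol a = a" "invol b = b" "invol c = c" "invol d = d"
    and od: "invol p = - p" "invol q = - q"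
    and rel: "r = a * q - p * c" "s = b * q - p * d" "e = 1 - p * q" "a * d - b * c = 1 + p * q"
    and u: "u = 1 + p * q"
  shows "e * u = 1" "u * e = 1"
    "((a - p * u * r) * (d - q * u * s) - (b - p * u * s) * (c - q * u * r)) * u = 1"
proof -
  note sort = odd_sort[OF od] odd_null[OF od(1)] odd_null[OF od(2)]
  show "e * u = 1" "u * e = 1"
    unfolding rel(3) u by (simp_all add: mult.assoc distrib_left distrib_right left_diff_distrib
      right_diff_distrib sort)
  have "(a - p * u * r) * (d - q * u * s) - (b - p * u * s) * (c - q * u * r) =
      (a * d - b * c) * ((1 - p * q) * (1 - p * q))"
    unfolding rel(1,2) u using ev by (simp add: even_ac sort)
  then show "((a - p * u * r) * (d - q * u * s) - (b - p * u * s) * (c - q * u * r)) * u = 1"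
    unfolding rel(4) u by (simp add: mult.assoc distrib_left distrib_right left_diff_distrib
      right_diff_distrib sort)
qed

end

lemma affine_eq_zero:
  fixes p q :: "'n::len0 grassmann"
  assumes "open V" "z \<in> V" and zero: "\<And>w. w \<in> V \<Longrightarrow> p * gconst w + q = 0"
  shows "p = 0" "q = 0"
proof -
  obtain r where r: "r > 0" "ball z r \<subseteq> V" using assms(1,2) open_contains_ball by blast
  define w where "w = z + of_real (r / 2)"
  have "w \<in> V" using r by (auto simp: w_def dist_norm subset_eq)
  then have "(p * gconst w + q) - (p * gconst z + q) = 0"
    using zero[of w] zero[of z] assms(2) by simp
  then have "p * (gconst w - gconst z) = 0" by (simp add: right_diff_distrib)
  then have "p * gconst (w - z) * gconst (inverse (w - z)) = 0" by (simp add: gconst_hom)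
  moreover have "w - z \<noteq> 0" using r by (simp add: w_def)
  ultimately show p: "p = 0" by (simp add: mult.assoc flip: gconst_hom)
  show "q = 0" using zero[OF assms(2)] p by simp
qed

lemma affine_eq:
  fixes p q :: "'n::len0 grassmann"
  assumes "open V" "z \<in> V" "\<And>w. w \<in> V \<Longrightarrow> p * gconst w + q = p' * gconst w + q'"
  shows "p = p'" "q = q'"
proof -
  have "(p - p') * gconst w + (q - q') = 0" if "w \<in> V" for w
    using assms(3)[OF that] by (simp add: left_diff_distrib algebra_simps)
  then have "p - p' = 0" "q - q' = 0"
    using affine_eq_zero[OF assms(1,2), of "p - p'" "q - q'"] by blast+
  then show "p = p'" "q = q'" by auto
qed

lemma gholomorphic_affine: "gholomorphic_on (\<lambda>z. p * gconst z + q) V"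
  by (intro gholomorphic_simps gholomorphic_gconst holomorphic_intros)

lemma gderiv_affine: "gderiv (\<lambda>z. p * gconst z + q) z = (p :: 'n::len0 grassmann)"
proof -
  have "gholomorphic_on (\<lambda>z. gconst z :: 'n grassmann) UNIV"
    by (intro gholomorphic_gconst holomorphic_intros)
  then show ?thesis
    by (simp add: gderiv_add[where V = UNIV] gderiv_mult[where V = UNIV] gholomorphic_simps gderiv_gconst)
qed

lemma svhol_affine: "svhol V (\<lambda>z. SV (p * gconst z + q) r)"
  by (simp add: svhol_def gholomorphic_affine gholomorphic_simps)

lemma sD_affine: "sD (\<lambda>z. SV (p * gconst z + q) r) z = SV r p"
  by (simp add: superval_eq_iff gderiv_affine)

lemma sD3_affine: "sD (sD (sD (\<lambda>z. SV (p * gconst z + q) r))) z = 0"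
proof -
  have "sD (sD (\<lambda>z. SV (p * gconst z + q) r)) = (\<lambda>z. SV p 0)"
  proof -
    have "sD (\<lambda>z. SV (p * gconst z + q) r) = (\<lambda>z. SV r p)"
      by (rule ext) (rule sD_affine)
    then have "sD (sD (\<lambda>z. SV (p * gconst z + q) r)) = sD (\<lambda>z. SV r p)" by (simp only:)
    also have "\<dots> = (\<lambda>z. SV p 0)" by (rule ext) simp
    finally show ?thesis .
  qed
  then show ?thesis by simp
qed

lemma svconst_affine:
  "svconst a * svconst (gconst z) + svconst b + svconst r * sv_theta =
    SV (a * gconst z + b) (ginvol r)"
  by (simp add: superval_eq_iff)

text \<open>
  For a superconformal fractional linear transformation with denominator \<open>y\<close>, the relations between
  the constants that express superconformality imply that \<open>y D\<Psi>\<close> is a constant. So \<open>1 / D\<Psi>\<close> is a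
  constant multiple of \<open>y\<close>, which is affine.
\<close>

theorem fractional_linear_imp_flat:
  fixes F \<Psi> L :: "complex \<Rightarrow> 'n::len0 superval"
  assumes V: "open V" and hol: "svhol V F" "svhol V \<Psi>"
    and even: "a \<in> gparity False" "b \<in> gparity False" "c \<in> gparity False" "d \<in> gparity False"
      "e \<in> gparity False"
    and odd: "p \<in> gparity True" "q \<in> gparity True" "r \<in> gparity True" "s \<in> gparity True"
    and e: "is_unit_elt e"
    and den: "\<And>z. z \<in> V \<Longrightarrow> is_unit_elt (SV (c * gconst z + d) (- q))"
    and F: "\<And>z. z \<in> V \<Longrightarrow> F z = SV (a * gconst z + b) (- p) * unit_inv (SV (c * gconst z + d) (- q))"
    and \<Psi>: "\<And>z. z \<in> V \<Longrightarrow> \<Psi> z = SV (r * gconst z + s) e * unit_inv (SV (c * gconst z + d) (- q))"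
    and conformal: "\<And>z. z \<in> V \<Longrightarrow> sD F z = \<Psi> z * sD \<Psi> z"
    and L: "\<And>z. z \<in> V \<Longrightarrow> sD \<Psi> z * L z = 1" "\<And>z. z \<in> V \<Longrightarrow> L z * sD \<Psi> z = 1"
    and z: "z \<in> V"
  shows "sD (sD (sD L)) z = 0"
proof -
  note ev = even[unfolded gparity_even_iff] and od = odd[unfolded gparity_odd_iff]
  \<comment> \<open>the two numerators and the denominator as affine superfunctions; \<open>\<alpha> \<theta> = - \<theta> \<alpha>\<close> gives the signs\<close>
  define x where "x w = SV (a * gconst w + b) (- p)" for w
  define y where "y w = SV (c * gconst w + d) (- q)" for w
  define \<psi> where "\<psi> w = SV (r * gconst w + s) e" for w
  have holy: "svhol V y" unfolding y_def by (rule svhol_affine)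
  have Dx: "sD x w = SV (- p) a" and Dy: "sD y w = SV (- q) c" and D\<psi>: "sD \<psi> w = SV e r" for w
    unfolding x_def y_def \<psi>_def by (simp_all add: sD_affine)
  have evy: "svinvol (y w) = y w" and odDy: "svinvol (sD y w) = - sD y w"
    and od\<psi>: "svinvol (\<psi> w) = - \<psi> w" for w
    unfolding Dy by (auto simp: superval_eq_iff y_def \<psi>_def ev od)
  have unit: "unit_inv (y w) * y w = 1" "y w * unit_inv (y w) = 1" if "w \<in> V" for w
    using unit_inv_mult den[OF that] by (auto simp: y_def)
  have Fy: "F w * y w = x w" and \<Psi>y: "\<Psi> w * y w = \<psi> w" if "w \<in> V" for w
    using F[OF that] \<Psi>[OF that] unit[OF that] by (simp_all add: x_def y_def \<psi>_def mult.assoc)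
  have evF: "svinvol (F w) = F w" and od\<Psi>: "svinvol (\<Psi> w) = - \<Psi> w" if w: "w \<in> V" for w
  proof -
    have "svinvol (unit_inv (y w)) = unit_inv (y w)"
      using S.even_inverse[OF evy unit(2)[OF w]] .
    moreover have "svinvol (x w) = x w" by (auto simp: superval_eq_iff x_def ev od)
    ultimately show "svinvol (F w) = F w" "svinvol (\<Psi> w) = - \<Psi> w"
      using F[OF w] \<Psi>[OF w] od\<psi>[of w] by (simp_all flip: x_def y_def \<psi>_def)
  qed
  have F1: "sD F w * y w + F w * sD y w = sD x w" if w: "w \<in> V" for w
    using sD_cong[OF V w, of "\<lambda>w. F w * y w" x] Fy sD_mult[OF hol(1) holy V w] evF[OF w] by simp
  have \<Psi>1: "sD \<Psi> w * y w = sD \<psi> w + \<Psi> w * sD y w" if w: "w \<in> V" for w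
    using sD_cong[OF V w, of "\<lambda>w. \<Psi> w * y w" \<psi>] \<Psi>y sD_mult[OF hol(2) holy V w] od\<Psi>[OF w]
    by (simp add: algebra_simps)
  have rel: "sD x w * y w - x w * sD y w = \<psi> w * sD \<psi> w" if w: "w \<in> V" for w
  proof -
    have "sD x w * y w - x w * sD y w = sD F w * y w * y w"
      unfolding F1[OF w, symmetric] Fy[OF w, symmetric]
      using S.even_central[OF evy, of w "sD y w"] by (simp add: algebra_simps)
    also have "\<dots> = \<Psi> w * (sD \<Psi> w * y w) * y w"
      using conformal[OF w] by (simp add: mult.assoc)
    also have "\<dots> = (\<Psi> w * y w) * (sD \<Psi> w * y w)"
      using S.even_central[OF evy, of w "sD \<Psi> w * y w"] by (simp add: mult.assoc)
    also have "\<dots> = \<psi> w * sD \<psi> w + \<psi> w * \<Psi> w * sD y w"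
      unfolding \<Psi>1[OF w] \<Psi>y[OF w] by (simp add: algebra_simps)
    also have "\<psi> w * \<Psi> w = 0"
      unfolding \<Psi>y[OF w, symmetric]
      using S.even_central[OF evy, of w "\<Psi> w"] S.odd_left_square[OF od\<Psi>[OF w]] by (simp add: mult.assoc)
    finally show ?thesis by simp
  qed
  have "sv0 (sD x w * y w - x w * sD y w) = sv0 (\<psi> w * sD \<psi> w)"
    "sv1 (sD x w * y w - x w * sD y w) = sv1 (\<psi> w * sD \<psi> w)" if w: "w \<in> V" for w
    using rel[OF w] by simp_all
  then have rel0: "- p * (c * gconst w + d) + (a * gconst w + b) * q = (r * gconst w + s) * e"
    and rel1: "a * (c * gconst w + d) + p * - q - (p * q + (a * gconst w + b) * c) =
      e * e - (r * gconst w + s) * r" if w: "w \<in> V" for w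
    using w by (simp_all add: Dx Dy D\<psi>) (simp_all add: x_def y_def \<psi>_def od ev algebra_simps)
  have "(a * q - p * c) * gconst w + (b * q - p * d) = (r * e) * gconst w + s * e" if "w \<in> V" for w
    using rel0[OF that] gconst_central[of w q] gconst_central[of w e] by (simp add: algebra_simps)
  then have R12: "a * q - p * c = r * e" "b * q - p * d = s * e"
    using affine_eq[OF V z, of "a * q - p * c" "b * q - p * d" "r * e" "s * e"] by blast+
  have R3: "a * d - b * c - (p * q + p * q) = e * e - s * r"
  proof -
    have rr: "r * (gconst z * r) = 0" "r * r = 0"
      using G.odd_square[OF od(3)] gconst_central[of z r] by (simp_all flip: mult.assoc)
    then show ?thesis
      using rel1[OF z] gconst_central[of z c] gconst_central[of z r] by (simp add: algebra_simps)
  qed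
  obtain u where u: "e * u = 1" using e by (auto simp: is_unit_elt_def)
  note R = G.fractional_linear_relations[OF ev od(1,2) u R12[symmetric] R3]
  \<comment> \<open>the constant value of \<open>y D\<Psi>\<close>\<close>
  define E where "E = e + u * (p * q)"
  have evu: "ginvol u = u" using G.even_inverse[OF ev(5) u] .
  have Eq: "E * q = e * q"
    using G.odd_square[OF od(2)] by (simp add: E_def distrib_right mult.assoc)
  have evE: "ginvol E = E" by (simp add: E_def ev od evu)
  have "sD \<Psi> w * y w = svconst E" if w: "w \<in> V" for w
  proof -
    have "(sD \<Psi> w * y w) * y w = sD \<psi> w * y w + \<psi> w * sD y w"
      unfolding \<Psi>1[OF w] \<Psi>y[OF w, symmetric]
      using S.even_central[OF evy, of w "sD y w"] by (simp add: algebra_simps)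
    also have "\<dots> = svconst E * y w"
    proof (rule superval_eqI)
      have "e * (c * gconst w + d) - (r * q * gconst w + s * q) = E * (c * gconst w + d)"
        unfolding R(1,2) by (simp add: E_def algebra_simps)
      then show "sv0 (sD \<psi> w * y w + \<psi> w * sD y w) = sv0 (svconst E * y w)"
        using gconst_central[of w q] by (simp add: D\<psi> Dy) (simp add: y_def \<psi>_def algebra_simps)
      have "r * d - s * c - (e * q + e * q) = - (E * q)"
        unfolding R(3) Eq by simp
      then show "sv1 (sD \<psi> w * y w + \<psi> w * sD y w) = sv1 (svconst E * y w)"
        using gconst_central[of w c]
        by (simp add: D\<psi> Dy) (simp add: y_def \<psi>_def od ev evE algebra_simps)
    qed
    finally have "(sD \<Psi> w * y w) * (y w * unit_inv (y w)) = svconst E * (y w * unit_inv (y w))"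
      by (simp flip: mult.assoc)
    then show ?thesis using unit[OF w] by simp
  qed
  note E = this
  \<comment> \<open>\<open>E\<close> is invertible, since \<open>svconst E\<close> is the product of two invertible values\<close>
  define U where "U = sv0 (unit_inv (y z) * L z)"
  have "svconst E * (unit_inv (y z) * L z) = 1"
    unfolding E[OF z, symmetric] using L[OF z] unit[OF z] by (metis mult.assoc mult.left_neutral)
  then have "sv0 (svconst E * (unit_inv (y z) * L z)) = 1" by simp
  then have EU: "E * U = 1" by (simp add: U_def)
  have evU: "ginvol U = U" using G.even_inverse[OF evE EU] .
  have "L w = SV (U * c * gconst w + U * d) (- (U * q))" if w: "w \<in> V" for w
  proof -
    have "L w * svconst E = y w"
      unfolding E[OF w, symmetric] using L[OF w] by (simp flip: mult.assoc)
    then have "L w * svconst E * svconst U = y w * svconst U" by simp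
    then have "L w = y w * svconst U"
      using EU by (simp add: mult.assoc svconst_hom flip: svconst_hom(6))
    also have "\<dots> = svconst U * y w" using S.even_central[OF evy] .
    finally show ?thesis by (simp add: superval_eq_iff y_def evU algebra_simps)
  qed
  note Lw = this
  have D1: "sD L w = sD (\<lambda>w. SV (U * c * gconst w + U * d) (- (U * q))) w" if "w \<in> V" for w
    by (rule sD_cong[OF V that]) (rule Lw)
  have D2: "sD (sD L) w = sD (sD (\<lambda>w. SV (U * c * gconst w + U * d) (- (U * q)))) w" if "w \<in> V" for w
    by (rule sD_cong[OF V that]) (rule D1)
  have "sD (sD (sD L)) z = sD (sD (sD (\<lambda>w. SV (U * c * gconst w + U * d) (- (U * q))))) z"
    by (rule sD_cong[OF V z]) (rule D2)
  then show ?thesis by (simp only: sD3_affine)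
qed

lemma gderiv_zero_imp_const:
  fixes f :: "complex \<Rightarrow> 'n::len0 grassmann"
  assumes "gholomorphic_on f V" "open V" "connected V" "z \<in> V" "\<And>w. w \<in> V \<Longrightarrow> gderiv f w = 0"
    and "w \<in> V"
  shows "f w = f z"
proof (rule grassmann_eqI)
  fix S
  let ?h = "\<lambda>w. gcoef (f w) S"
  have "?h holomorphic_on V" using assms(1) by (simp add: gholomorphic_on_def)
  moreover have "deriv ?h w = 0" if "w \<in> V" for w
    using assms(5)[OF that] by (metis gcoef_gderiv gcoef_simps(1))
  ultimately have "(?h has_field_derivative 0) (at w)" if "w \<in> V" for w
    using that assms(2) by (metis holomorphic_derivI)
  then have "?h constant_on V"
    using has_field_derivative_0_imp_constant_on[OF _ assms(3,2)] by blast
  then show "?h w = ?h z" using assms(4,6) by (auto simp: constant_on_def)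
qed

text \<open>
  The components of \<open>D\<^sup>3 f\<close> are \<open>f\<^sub>1'\<close> and \<open>f\<^sub>0''\<close>, where \<open>f = f\<^sub>0 + \<theta> f\<^sub>1\<close>.
\<close>

lemma flat_imp_affine:
  fixes f :: "complex \<Rightarrow> 'n::len0 superval"
  assumes f: "svhol V f" and V: "open V" "connected V" "z \<in> V"
    and flat: "\<And>w. w \<in> V \<Longrightarrow> sD (sD (sD f)) w = 0"
  obtains p q r where "\<And>w. w \<in> V \<Longrightarrow> f w = SV (p * gconst w + q) r"
proof -
  let ?f0 = "\<lambda>w. sv0 (f w)" and ?f1 = "\<lambda>w. sv1 (f w)"
  have hol: "gholomorphic_on ?f0 V" "gholomorphic_on ?f1 V" using f by (auto simp: svhol_def)
  have zero: "gderiv ?f1 w = 0" "gderiv (gderiv ?f0) w = 0" if "w \<in> V" for w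
    using flat[OF that] by (simp_all add: superval_eq_iff)
  define p where "p = gderiv ?f0 z"
  have p: "gderiv ?f0 w = p" if "w \<in> V" for w
    unfolding p_def
    using gderiv_zero_imp_const[OF gholomorphic_gderiv[OF hol(1) V(1)] V zero(2) that] .
  have aff: "gholomorphic_on (\<lambda>w. p * gconst w + 0) V" by (rule gholomorphic_affine)
  define q where "q = ?f0 z - (p * gconst z + 0)"
  have "gderiv (\<lambda>w. ?f0 w - (p * gconst w + 0)) w = 0" if "w \<in> V" for w
    using gderiv_diff[OF hol(1) aff V(1) that] p[OF that] gderiv_affine[of p 0 w] by simp
  then have "?f0 w - (p * gconst w + 0) = q" if "w \<in> V" for w
    unfolding q_def
    using gderiv_zero_imp_const[OF gholomorphic_simps(3)[OF hol(1) aff] V _ that] by simp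
  moreover have "?f1 w = ?f1 z" if "w \<in> V" for w
    using gderiv_zero_imp_const[OF hol(2) V zero(1) that] .
  ultimately have "f w = SV (p * gconst w + q) (?f1 z)" if "w \<in> V" for w
    using that by (simp add: superval_eq_iff) (metis add.commute diff_add_cancel add.right_neutral)
  then show ?thesis using that by blast
qed

lemma affine_even:
  assumes "open V" "z \<in> V" "\<And>w. w \<in> V \<Longrightarrow> svinvol (SV (p * gconst w + q) r) = SV (p * gconst w + q) r"
  shows "ginvol p = p" "ginvol q = q" "ginvol r = - r"
proof -
  have "ginvol p * gconst w + ginvol q = p * gconst w + q" if "w \<in> V" for w
    using assms(3)[OF that] by (simp add: superval_eq_iff)
  then show "ginvol p = p" "ginvol q = q"
    using affine_eq[OF assms(1,2), of "ginvol p" "ginvol q" p q] by blast+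
  show "ginvol r = - r" using assms(3)[OF assms(2)] by (simp add: superval_eq_iff minus_eq_left_iff)
qed

lemma affine_odd:
  assumes "open V" "z \<in> V" "\<And>w. w \<in> V \<Longrightarrow> svinvol (SV (p * gconst w + q) r) = - SV (p * gconst w + q) r"
  shows "ginvol p = - p" "ginvol q = - q" "ginvol r = r"
proof -
  have "ginvol p * gconst w + ginvol q = (- p) * gconst w + (- q)" if "w \<in> V" for w
    using assms(3)[OF that] by (simp add: superval_eq_iff)
  then show "ginvol p = - p" "ginvol q = - q"
    using affine_eq[OF assms(1,2), of "ginvol p" "ginvol q" "- p" "- q"] by blast+
  show "ginvol r = r" using assms(3)[OF assms(2)] by (simp add: superval_eq_iff)
qed


text \<open>
  Conversely, if \<open>L = 1 / D\<Psi>\<close> is killed by \<open>D\<^sup>3\<close>, then so are \<open>\<Psi> L\<close> and \<open>F L\<close>, so these three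
  functions are affine; they are the denominator and the two numerators.
\<close>

lemma flat_numerators:
  fixes F \<Psi> L :: "complex \<Rightarrow> 'n::len0 superval"
  assumes V: "open V" and hol: "svhol V F" "svhol V \<Psi>" "svhol V L"
    and even: "\<And>z. z \<in> V \<Longrightarrow> svinvol (F z) = F z" and odd: "\<And>z. z \<in> V \<Longrightarrow> svinvol (\<Psi> z) = - \<Psi> z"
    and conformal: "\<And>z. z \<in> V \<Longrightarrow> sD F z = \<Psi> z * sD \<Psi> z"
    and L: "\<And>z. z \<in> V \<Longrightarrow> sD \<Psi> z * L z = 1"
    and flat: "\<And>z. z \<in> V \<Longrightarrow> sD (sD (sD L)) z = 0"
    and z: "z \<in> V"
  shows "sD (sD (sD (\<lambda>z. \<Psi> z * L z))) z = 0" "sD (sD (sD (\<lambda>z. F z * L z))) z = 0"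
    "sD (\<lambda>z. \<Psi> z * L z) z * L z = L z - (\<Psi> z * L z) * sD L z"
    "sD (\<lambda>z. F z * L z) z * L z = \<Psi> z * L z + (F z * L z) * sD L z"
proof -
  define G where "G = sD \<Psi>"
  have holG: "svhol V G" unfolding G_def by (intro svhol_intros hol V)
  have evG: "svinvol (G w) = G w" if "w \<in> V" for w
    unfolding G_def by (rule sD_odd[OF hol(2) V that odd])
  have GL: "G w * L w = 1" if "w \<in> V" for w using L[OF that] by (simp add: G_def)
  have evL: "svinvol (L w) = L w" if "w \<in> V" for w
    using S.even_inverse[OF evG[OF that] GL[OF that]] .
  have oddDG: "svinvol (sD G w) = - sD G w" if "w \<in> V" for w
    by (rule sD_even[OF holG V that evG])
  have oddDL: "svinvol (sD L w) = - sD L w" if "w \<in> V" for w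
    by (rule sD_even[OF hol(3) V that evL])
  have evD2G: "svinvol (sD (sD G) w) = sD (sD G) w" if "w \<in> V" for w
    by (rule sD_odd[OF svhol_sD[OF holG V] V that oddDG])
  have one1: "sD G w * L w + G w * sD L w = 0" if w: "w \<in> V" for w
    using sD_cong[OF V w, of "\<lambda>w. G w * L w" "\<lambda>_. 1"] GL sD_mult[OF holG hol(3) V w] evG[OF w] by simp
  have "sD (\<lambda>w. G w * L w) w = 0" if w: "w \<in> V" for w
    using sD_cong[OF V w, of "\<lambda>w. G w * L w" "\<lambda>_. 1"] GL by simp
  then have one2: "sD (sD G) z * L z + G z * sD (sD L) z = 0"
    using sD_cong[OF V z, of "sD (\<lambda>w. G w * L w)" "\<lambda>_. svconst 0"] sD2_mult[OF holG hol(3) V z]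
    by (simp add: svconst_hom)
  have DGDL: "sD G w * sD L w = 0" if w: "w \<in> V" for w
  proof -
    have LG: "L w * G w = 1" using GL[OF w] S.even_central[OF evG[OF w]] by metis
    have "sD G w * L w = - (G w * sD L w)" using one1[OF w] by (simp add: eq_neg_iff_add_eq_0)
    then have "sD G w * L w * G w = - (G w * sD L w) * G w" by simp
    then have "sD G w = - (G w * sD L w) * G w" using LG by (simp add: mult.assoc)
    then have "sD G w * sD L w = - (G w * (sD L w * (G w * sD L w)))"
      by (simp add: mult.assoc)
    also have "sD L w * (G w * sD L w) = 0"
      using S.even_central[OF evG[OF w], of "sD L w"] S.odd_left_square[OF oddDL[OF w]]
        S.odd_square[OF oddDL[OF w]] by simp
    finally show ?thesis by simp
  qed
  have DF: "sD F w = \<Psi> w * G w" if "w \<in> V" for w using conformal[OF that] by (simp add: G_def)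
  have D2F: "sD (sD F) w = G w * G w - \<Psi> w * sD G w" if w: "w \<in> V" for w
    using sD_cong[OF V w, of "sD F" "\<lambda>w. \<Psi> w * G w"] DF sD_mult[OF hol(2) holG V w] odd[OF w]
    by (simp add: G_def)
  have D3F: "sD (sD (sD F)) z = sD G z * G z + G z * sD G z - (G z * sD G z - \<Psi> z * sD (sD G) z)"
  proof -
    have "sD (sD (sD F)) z = sD (\<lambda>w. G w * G w - \<Psi> w * sD G w) z"
      using D2F by (intro sD_cong[OF V z])
    also have "\<dots> = sD (\<lambda>w. G w * G w) z - sD (\<lambda>w. \<Psi> w * sD G w) z"
      by (intro sD_diff[where V = V] svhol_intros V z hol holG)
    also have "sD (\<lambda>w. G w * G w) z = sD G z * G z + svinvol (G z) * sD G z"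
      by (intro sD_mult[where V = V] svhol_intros V z hol holG)
    also have "sD (\<lambda>w. \<Psi> w * sD G w) z = sD \<Psi> z * sD G z + svinvol (\<Psi> z) * sD (sD G) z"
      by (intro sD_mult[where V = V] svhol_intros V z hol holG)
    finally show ?thesis using odd[OF z] evG[OF z] by (simp add: G_def)
  qed
  have "sD (sD (sD (\<lambda>z. \<Psi> z * L z))) z =
      sD (sD G) z * L z + svinvol (sD G z) * sD L z + (G z * sD (sD L) z + svinvol (\<Psi> z) * 0)"
    using sD3_mult[OF hol(2,3) V z] flat[OF z] by (simp add: G_def)
  then show "sD (sD (sD (\<lambda>z. \<Psi> z * L z))) z = 0"
    using one2 oddDG[OF z] DGDL[OF z] by simp
  have c: "sD G z * G z = G z * sD G z" "L z * \<Psi> z = \<Psi> z * L z"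
    using S.even_central[OF evG[OF z]] S.even_central[OF evL[OF z]] by metis+
  have "svinvol (sD (sD F) z) = sD (sD F) z"
    using D2F[OF z] evG[OF z] oddDG[OF z] odd[OF z] by simp
  then have "sD (sD (sD (\<lambda>z. F z * L z))) z = sD (sD (sD F)) z * L z + sD (sD F) z * sD L z
      + (sD F z * sD (sD L) z + svinvol (F z) * 0)"
    by (simp only: sD3_mult[OF hol(1,3) V z] flat[OF z])
  also have "\<dots> = (G z * sD G z + \<Psi> z * sD (sD G) z) * L z + (G z * G z - \<Psi> z * sD G z) * sD L z
        + \<Psi> z * G z * sD (sD L) z"
    unfolding D3F D2F[OF z] DF[OF z] using c by (simp add: algebra_simps)
  also have "\<dots> = G z * (sD G z * L z + G z * sD L z) +
      \<Psi> z * (sD (sD G) z * L z + G z * sD (sD L) z) - \<Psi> z * (sD G z * sD L z)"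
    by (simp add: algebra_simps)
  finally show "sD (sD (sD (\<lambda>z. F z * L z))) z = 0"
    using one1[OF z] one2 DGDL[OF z] by simp
  have comm: "sD L z * L z = L z * sD L z" using S.even_central[OF evL[OF z]] by metis
  show "sD (\<lambda>z. \<Psi> z * L z) z * L z = L z - (\<Psi> z * L z) * sD L z"
    using sD_mult[OF hol(2,3) V z] GL[OF z] odd[OF z] comm
    by (simp add: distrib_right left_diff_distrib mult.assoc flip: G_def)
  show "sD (\<lambda>z. F z * L z) z * L z = \<Psi> z * L z + (F z * L z) * sD L z"
    using sD_mult[OF hol(1,3) V z] GL[OF z] even[OF z] DF[OF z] comm
    by (simp add: distrib_right mult.assoc flip: G_def)
qed

theorem flat_imp_fractional_linear:
  fixes F \<Psi> L :: "complex \<Rightarrow> 'n::len0 superval"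
  assumes V: "open V" "connected V" "z\<^sub>0 \<in> V" and hol: "svhol V F" "svhol V \<Psi>" "svhol V L"
    and even: "\<And>z. z \<in> V \<Longrightarrow> svinvol (F z) = F z" and odd: "\<And>z. z \<in> V \<Longrightarrow> svinvol (\<Psi> z) = - \<Psi> z"
    and conformal: "\<And>z. z \<in> V \<Longrightarrow> sD F z = \<Psi> z * sD \<Psi> z"
    and L: "\<And>z. z \<in> V \<Longrightarrow> sD \<Psi> z * L z = 1"
    and flat: "\<And>z. z \<in> V \<Longrightarrow> sD (sD (sD L)) z = 0"
  obtains a b c d e p q r s where
    "a \<in> gparity False" "b \<in> gparity False" "c \<in> gparity False" "d \<in> gparity False"
    "e \<in> gparity False" "p \<in> gparity True" "q \<in> gparity True" "r \<in> gparity True" "s \<in> gparity True"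
    "is_unit_elt e" "sdet a b p c d q r s e = 1"
    "\<And>z. z \<in> V \<Longrightarrow> is_unit_elt (SV (c * gconst z + d) (- q))"
    "\<And>z. z \<in> V \<Longrightarrow> F z = SV (a * gconst z + b) (- p) * unit_inv (SV (c * gconst z + d) (- q))"
    "\<And>z. z \<in> V \<Longrightarrow> \<Psi> z = SV (r * gconst z + s) e * unit_inv (SV (c * gconst z + d) (- q))"
proof -
  have holx: "svhol V (\<lambda>z. F z * L z)" and hol\<psi>: "svhol V (\<lambda>z. \<Psi> z * L z)"
    by (intro svhol_intros hol)+
  have evG: "svinvol (sD \<Psi> w) = sD \<Psi> w" if "w \<in> V" for w
    by (rule sD_odd[OF hol(2) V(1) that odd])
  have evL: "svinvol (L w) = L w" if "w \<in> V" for w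
    using S.even_inverse[OF evG[OF that] L[OF that]] .
  have LG: "L w * sD \<Psi> w = 1" if "w \<in> V" for w
    using L[OF that] S.even_central[OF evG[OF that]] by metis
  note N = flat_numerators[OF V(1) hol even odd conformal L flat]
  obtain c d q' where y: "\<And>w. w \<in> V \<Longrightarrow> L w = SV (c * gconst w + d) q'"
    using flat_imp_affine[OF hol(3) V flat] by blast
  obtain a b p' where x: "\<And>w. w \<in> V \<Longrightarrow> F w * L w = SV (a * gconst w + b) p'"
    using flat_imp_affine[OF holx V N(2)] by blast
  obtain r s e where \<psi>: "\<And>w. w \<in> V \<Longrightarrow> \<Psi> w * L w = SV (r * gconst w + s) e"
    using flat_imp_affine[OF hol\<psi> V N(1)] by blast
  define p q where "p = - p'" and "q = - q'"
  then have pq: "p' = - p" "q' = - q" by simp_all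
  have "svinvol (SV (c * gconst w + d) q') = SV (c * gconst w + d) q'" if "w \<in> V" for w
    using evL[OF that] y[OF that] by simp
  from affine_even[OF V(1,3), of c d q', OF this]
  have cd: "ginvol c = c" "ginvol d = d" "ginvol q' = - q'" by blast+
  have "svinvol (SV (a * gconst w + b) p') = SV (a * gconst w + b) p'" if "w \<in> V" for w
    unfolding x[OF that, symmetric] using evL[OF that] even[OF that] by simp
  from affine_even[OF V(1,3), of a b p', OF this]
  have ab: "ginvol a = a" "ginvol b = b" "ginvol p' = - p'" by blast+
  have "svinvol (SV (r * gconst w + s) e) = - SV (r * gconst w + s) e" if "w \<in> V" for w
    unfolding \<psi>[OF that, symmetric] using evL[OF that] odd[OF that] by simp
  from affine_odd[OF V(1,3), of r s e, OF this]
  have rs: "ginvol r = - r" "ginvol s = - s" "ginvol e = e" by blast+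
  have od: "ginvol p = - p" "ginvol q = - q" using ab cd by (simp_all add: pq minus_eq_left_iff)
  have Dy: "sD L w = SV q' c" if "w \<in> V" for w
    using sD_cong[OF V(1) that, of L "\<lambda>w. SV (c * gconst w + d) q'"] y by (simp add: sD_affine)
  have Dx: "sD (\<lambda>w. F w * L w) w = SV p' a" if "w \<in> V" for w
    using sD_cong[OF V(1) that, of "\<lambda>w. F w * L w" "\<lambda>w. SV (a * gconst w + b) p'"] x
    by (simp add: sD_affine)
  have D\<psi>: "sD (\<lambda>w. \<Psi> w * L w) w = SV e r" if "w \<in> V" for w
    using sD_cong[OF V(1) that, of "\<lambda>w. \<Psi> w * L w" "\<lambda>w. SV (r * gconst w + s) e"] \<psi>
    by (simp add: sD_affine)
  have relx: "SV (- p) a * SV (c * gconst w + d) (- q) =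
      SV (r * gconst w + s) e + SV (a * gconst w + b) (- p) * SV (- q) c"
    and rel\<psi>: "SV e r * SV (c * gconst w + d) (- q) =
      SV (c * gconst w + d) (- q) - SV (r * gconst w + s) e * SV (- q) c" if "w \<in> V" for w
    using N(3,4)[OF _ _ _ _ _ that] x y Dx Dy \<psi> D\<psi> that by (simp_all add: pq)
  have "(b * q - p * d) = s \<and> a * q - p * c = r"
  proof -
    have "(a * q - p * c) * gconst w + (b * q - p * d) = r * gconst w + s" if "w \<in> V" for w
      using arg_cong[OF relx[OF that], of sv0] gconst_central[of w q] by (simp add: algebra_simps)
    then show ?thesis
      using affine_eq[OF V(1,3), of "a * q - p * c" "b * q - p * d" r s] by blast
  qed
  then have r: "r = a * q - p * c" and s: "s = b * q - p * d" by simp_all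
  have \<Delta>: "a * d - b * c = e + (p * q + p * q)"
    using arg_cong[OF relx[OF V(3)], of sv1] gconst_central[of z\<^sub>0 c] od ab
    by (simp add: algebra_simps)
  \<comment> \<open>the factor \<open>c z\<^sub>0 + d\<close> is invertible, being the even component of \<open>1 / D\<Psi>\<close>, so this determines \<open>e\<close>\<close>
  have XY: "(e + p * q - 1) * (c * gconst z\<^sub>0 + d) = 0"
  proof -
    have "e * (c * gconst z\<^sub>0 + d) = (c * gconst z\<^sub>0 + d) + (r * gconst z\<^sub>0 + s) * q"
      using arg_cong[OF rel\<psi>[OF V(3)], of sv0] by (simp add: algebra_simps)
    moreover have rs_q: "r * q = - (p * q) * c" "s * q = - (p * q) * d"
      unfolding r s using cd ab od G.odd_square[OF od(2)]
        G.even_central[OF cd(1), of q] G.even_central[OF cd(2), of q]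
      by (simp_all add: left_diff_distrib mult.assoc)
    moreover have "(r * gconst z\<^sub>0 + s) * q = (r * q) * gconst z\<^sub>0 + s * q"
      using gconst_central[of z\<^sub>0 q] by (simp add: distrib_right mult.assoc)
    ultimately have "e * (c * gconst z\<^sub>0 + d) =
        (c * gconst z\<^sub>0 + d) + (- (p * q) * c * gconst z\<^sub>0 + - (p * q) * d)"
      by (simp only: rs_q)
    then show ?thesis by (simp add: algebra_simps)
  qed
  have YH: "(c * gconst z\<^sub>0 + d) * sv0 (sD \<Psi> z\<^sub>0) = 1"
    using arg_cong[OF LG[OF V(3)], of sv0] y[OF V(3)] by simp
  have "e + p * q - 1 = (e + p * q - 1) * ((c * gconst z\<^sub>0 + d) * sv0 (sD \<Psi> z\<^sub>0))"
    unfolding YH by simp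
  also have "\<dots> = 0" unfolding mult.assoc[symmetric] XY by simp
  finally have "e + p * q - 1 = 0" .
  then have e: "e = 1 - p * q" by (simp add: algebra_simps)
  have \<Delta>': "a * d - b * c = 1 + p * q" using \<Delta> e by simp
  define u where "u = 1 + p * q"
  note R = G.fractional_linear_sdet[OF ab(1,2) cd(1,2) od r s e \<Delta>' u_def]
  have u: "unit_inv e = u" using unit_inv_eq R(1,2) by blast
  show ?thesis
  proof (rule that)
    show "is_unit_elt e" using is_unit_eltI R(1,2) by blast
    show "sdet a b p c d q r s e = 1" using R(3) by (simp add: sdet_def u)
    fix w assume w: "w \<in> V"
    have "L w = SV (c * gconst w + d) (- q)" using y[OF w] by (simp add: pq)
    moreover have "unit_inv (L w) = sD \<Psi> w" using unit_inv_eq LG[OF w] L[OF w] by blast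
    moreover have "F w * L w * sD \<Psi> w = F w" "\<Psi> w * L w * sD \<Psi> w = \<Psi> w"
      using LG[OF w] by (simp_all add: mult.assoc)
    ultimately show "is_unit_elt (SV (c * gconst w + d) (- q))"
      "F w = SV (a * gconst w + b) (- p) * unit_inv (SV (c * gconst w + d) (- q))"
      "\<Psi> w = SV (r * gconst w + s) e * unit_inv (SV (c * gconst w + d) (- q))"
      using x[OF w] \<psi>[OF w] is_unit_eltI[OF LG[OF w] L[OF w]] by (simp_all add: pq)
  qed (use ab cd od rs in \<open>simp_all add: gparity_even_iff gparity_odd_iff\<close>)
qed


section \<open>Linear differential equations\<close>

text \<open>The power series coefficients of the solution of \<open>u\<^sub>i' = \<Sum>\<^sub>j a\<^sub>i\<^sub>j u\<^sub>j\<close> with initial value \<open>c\<close>.\<close>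

fun ode_coeff :: "'i set \<Rightarrow> ('i \<Rightarrow> 'i \<Rightarrow> nat \<Rightarrow> complex) \<Rightarrow> ('i \<Rightarrow> complex) \<Rightarrow> nat \<Rightarrow> 'i \<Rightarrow> complex" where
  "ode_coeff I a c 0 i = c i"
| "ode_coeff I a c (Suc n) i =
    (\<Sum>k\<in>{0..n}. \<Sum>j\<in>I. a i j k * ode_coeff I a c (n - k) j) / of_nat (Suc n)"

text \<open>
  If the coefficients of the equation are bounded by \<open>M K\<^sup>k\<close> with \<open>card I * M \<le> K\<close>, then the
  recursion preserves a bound by a geometric sequence of ratio \<open>K\<close>.
\<close>

lemma ode_coeff_bound:
  fixes K M :: real
  assumes "finite I" "K > 0" "M \<ge> 0" and K: "card I * M \<le> K"
    and a: "\<And>i j k. i \<in> I \<Longrightarrow> j \<in> I \<Longrightarrow> norm (a i j k) \<le> M * K ^ k"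
  shows "(\<Sum>i\<in>I. norm (ode_coeff I a c n i)) \<le> (\<Sum>i\<in>I. norm (c i)) * K ^ n"
proof (induction n rule: less_induct)
  case (less n)
  define C where "C = (\<Sum>i\<in>I. norm (c i))"
  have C: "C \<ge> 0" by (simp add: C_def sum_nonneg)
  show ?case
  proof (cases n)
    case (Suc m)
    have "norm (ode_coeff I a c n i) \<le> M * C * K ^ m" if i: "i \<in> I" for i
    proof -
      have "norm (\<Sum>k\<in>{0..m}. \<Sum>j\<in>I. a i j k * ode_coeff I a c (m - k) j) \<le>
          (\<Sum>k\<in>{0..m}. \<Sum>j\<in>I. M * K ^ k * norm (ode_coeff I a c (m - k) j))"
        by (intro sum_norm_le) (auto simp: norm_mult intro!: mult_right_mono a i)
      also have "\<dots> = (\<Sum>k\<in>{0..m}. M * K ^ k * (\<Sum>j\<in>I. norm (ode_coeff I a c (m - k) j)))"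
        by (simp add: sum_distrib_left)
      also have "\<dots> \<le> (\<Sum>k\<in>{0..m}. M * K ^ k * (C * K ^ (m - k)))"
        using assms less Suc by (intro sum_mono mult_left_mono) (auto simp: C_def)
      also have "\<dots> = (\<Sum>k\<in>{0..m}. M * C * K ^ m)"
        by (intro sum.cong) (auto simp flip: power_add)
      also have "\<dots> = real (Suc m) * (M * C * K ^ m)" by simp
      finally show ?thesis
        using Suc by (simp add: norm_divide pos_divide_le_eq mult_ac del: of_nat_Suc)
    qed
    then have "(\<Sum>i\<in>I. norm (ode_coeff I a c n i)) \<le> (\<Sum>i\<in>I. M * C * K ^ m)"
      by (rule sum_mono)
    also have "\<dots> = (card I * M) * (C * K ^ m)" by simp
    also have "\<dots> \<le> K * (C * K ^ m)" using K C assms by (intro mult_right_mono) auto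
    finally show ?thesis using Suc by (simp add: C_def mult_ac)
  qed simp
qed

text \<open>
  The power series with the coefficients of the recursion converges near \<open>z\<^sub>0\<close> and solves the equation.
\<close>

lemma linear_ode:
  fixes A :: "'i \<Rightarrow> 'i \<Rightarrow> complex \<Rightarrow> complex"
  assumes fin: "finite I" and R: "R > 0"
    and A: "\<And>i j. i \<in> I \<Longrightarrow> j \<in> I \<Longrightarrow> A i j holomorphic_on ball z\<^sub>0 R"
  obtains r u where "0 < r" "r \<le> R" "\<And>i. i \<in> I \<Longrightarrow> u i holomorphic_on ball z\<^sub>0 r"
    "\<And>i. i \<in> I \<Longrightarrow> u i z\<^sub>0 = c i"
    "\<And>i z. i \<in> I \<Longrightarrow> z \<in> ball z\<^sub>0 r \<Longrightarrow> deriv (u i) z = (\<Sum>j\<in>I. A i j z * u j z)"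
proof -
  define B where "B i j = fps_expansion (A i j) z\<^sub>0" for i j
  \<comment> \<open>on a smaller radius the Taylor coefficients of all entries obey one geometric bound\<close>
  define \<rho> where "\<rho> = R / 2"
  have \<rho>: "0 < \<rho>" "\<rho> < R" using R by (simp_all add: \<rho>_def)
  have A': "A i j holomorphic_on eball z\<^sub>0 (ereal R)" if "i \<in> I" "j \<in> I" for i j
    using A[OF that] by simp
  have radB: "fps_conv_radius (B i j) \<ge> R" if "i \<in> I" "j \<in> I" for i j
    unfolding B_def by (rule conv_radius_fps_expansion[OF A'[OF that]])
  have "\<exists>M. \<forall>k. norm (fps_nth (B i j) k) * \<rho> ^ k \<le> M" if ij: "i \<in> I" "j \<in> I" for i j
  proof -
    have "ereal (norm (of_real \<rho> :: complex)) < ereal R" using \<rho> by simp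
    then have "ereal (norm (of_real \<rho> :: complex)) < fps_conv_radius (B i j)"
      using radB[OF ij] by (rule less_le_trans)
    then have "summable (\<lambda>k. fps_nth (B i j) k * (of_real \<rho> :: complex) ^ k)"
      by (rule summable_fps)
    then have "Bseq (\<lambda>k. fps_nth (B i j) k * (of_real \<rho> :: complex) ^ k)"
      by (intro convergent_imp_Bseq) (auto simp: convergent_def dest: summable_LIMSEQ_zero)
    then obtain M where "\<And>k. norm (fps_nth (B i j) k * (of_real \<rho> :: complex) ^ k) \<le> M"
      by (rule BseqE) blast
    then show ?thesis using \<rho> by (auto simp: norm_mult norm_power)
  qed
  then obtain M' where M': "\<And>i j k. i \<in> I \<Longrightarrow> j \<in> I \<Longrightarrow> norm (fps_nth (B i j) k) * \<rho> ^ k \<le> M' i j"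
    by metis
  define M where "M = (\<Sum>i\<in>I. \<Sum>j\<in>I. \<bar>M' i j\<bar>)"
  have M: "M \<ge> 0" by (simp add: M_def sum_nonneg)
  have le_M: "M' i j \<le> M" if "i \<in> I" "j \<in> I" for i j
  proof -
    have "M' i j \<le> \<bar>M' i j\<bar>" by simp
    also have "\<dots> \<le> (\<Sum>j\<in>I. \<bar>M' i j\<bar>)" by (rule member_le_sum) (use that fin in auto)
    also have "\<dots> \<le> M" unfolding M_def
      by (rule member_le_sum[where f = "\<lambda>i. \<Sum>j\<in>I. \<bar>M' i j\<bar>"]) (use that fin in \<open>auto intro: sum_nonneg\<close>)
    finally show ?thesis .
  qed
  \<comment> \<open>a ratio that dominates both the Taylor coefficients and the recursion\<close>
  define K where "K = max (1 / \<rho>) (card I * M)"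
  have K: "K > 0" "card I * M \<le> K" "1 / \<rho> \<le> K" using \<rho> by (auto simp: K_def less_max_iff_disj)
  define a where "a i j k = fps_nth (B i j) k" for i j k
  have a: "norm (a i j k) \<le> M * K ^ k" if "i \<in> I" "j \<in> I" for i j k
  proof -
    have "norm (a i j k) = (norm (a i j k) * \<rho> ^ k) * (1 / \<rho>) ^ k"
      using \<rho> by (simp add: power_divide)
    also have "\<dots> \<le> M * K ^ k"
      using M'[OF that, of k] le_M[OF that] M K(3) \<rho> by (intro mult_mono power_mono) (auto simp: a_def)
    finally show ?thesis .
  qed
  define F where "F i = Abs_fps (\<lambda>n. ode_coeff I a c n i)" for i
  define r where "r = 1 / K"
  have r: "0 < r" "r \<le> \<rho>" using K \<rho> by (simp_all add: r_def field_simps)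
  define C where "C = (\<Sum>i\<in>I. norm (c i))"
  have radF: "fps_conv_radius (F i) \<ge> r" if i: "i \<in> I" for i
    unfolding fps_conv_radius_def
  proof (rule conv_radius_geI_ex')
    fix t :: real assume t: "0 < t" "ereal t < ereal r"
    have "norm (fps_nth (F i) n * of_real t ^ n) \<le> C * (K * t) ^ n" for n
    proof -
      have "norm (ode_coeff I a c n i) \<le> (\<Sum>i\<in>I. norm (ode_coeff I a c n i))"
        by (rule member_le_sum) (use i fin in auto)
      also have "\<dots> \<le> C * K ^ n" unfolding C_def by (rule ode_coeff_bound[OF fin K(1) M K(2) a])
      finally show ?thesis using t
        by (simp add: F_def norm_mult norm_power power_mult_distrib mult_right_mono flip: mult.assoc)
    qed
    moreover have "summable (\<lambda>n. C * (K * t) ^ n)"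
      using t K by (intro summable_mult summable_geometric) (auto simp: r_def field_simps)
    ultimately show "summable (\<lambda>n. fps_nth (F i) n * of_real t ^ n)"
      by - (rule summable_comparison_test'[where N = 0], assumption, simp)
  qed
  have radB': "fps_conv_radius (B i j) \<ge> r" if "i \<in> I" "j \<in> I" for i j
  proof -
    have "ereal r \<le> ereal R" using r \<rho> by simp
    then show ?thesis using radB[OF that] by (rule order.trans)
  qed
  have radBF: "fps_conv_radius (B i j * F j) \<ge> r" if ij: "i \<in> I" "j \<in> I" for i j
  proof -
    have "ereal r \<le> min (fps_conv_radius (B i j)) (fps_conv_radius (F j))"
      using radB'[OF ij] radF[OF ij(2)] by simp
    then show ?thesis using fps_conv_radius_mult by (rule order.trans)
  qed
  have deriv_F: "fps_deriv (F i) = (\<Sum>j\<in>I. B i j * F j)" if i: "i \<in> I" for i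
  proof (rule fps_ext)
    fix n
    have "fps_nth (fps_deriv (F i)) n = (\<Sum>k\<in>{0..n}. \<Sum>j\<in>I. a i j k * ode_coeff I a c (n - k) j)"
      by (simp add: F_def del: of_nat_Suc)
    also have "\<dots> = fps_nth (\<Sum>j\<in>I. B i j * F j) n"
      by (subst sum.swap) (simp add: fps_sum_nth fps_mult_nth F_def a_def)
    finally show "fps_nth (fps_deriv (F i)) n = fps_nth (\<Sum>j\<in>I. B i j * F j) n" .
  qed
  have eval_sum: "eval_fps (\<Sum>j\<in>J. B i j * F j) z = (\<Sum>j\<in>J. eval_fps (B i j) z * eval_fps (F j) z) \<and>
      fps_conv_radius (\<Sum>j\<in>J. B i j * F j) \<ge> r"
    if z: "norm z < r" and i: "i \<in> I" and J: "J \<subseteq> I" "finite J" for i J z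
    using J(2,1)
  proof (induction J rule: finite_induct)
    case (insert j J)
    then have j: "j \<in> I" and IH: "fps_conv_radius (\<Sum>j\<in>J. B i j * F j) \<ge> r"
      "eval_fps (\<Sum>j\<in>J. B i j * F j) z = (\<Sum>j\<in>J. eval_fps (B i j) z * eval_fps (F j) z)" by auto
    have lt: "ereal (norm z) < fps_conv_radius G" if "fps_conv_radius G \<ge> r" for G :: "complex fps"
    proof -
      have "ereal (norm z) < ereal r" using z by simp
      then show ?thesis using that by (rule less_le_trans)
    qed
    have "eval_fps (B i j * F j) z = eval_fps (B i j) z * eval_fps (F j) z"
      by (intro eval_fps_mult lt radF radB' i j)
    moreover have "fps_conv_radius (B i j * F j + (\<Sum>j\<in>J. B i j * F j)) \<ge> r"
    proof -
      have "ereal r \<le> min (fps_conv_radius (B i j * F j)) (fps_conv_radius (\<Sum>j\<in>J. B i j * F j))"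
        using IH radBF[OF i j] by simp
      then show ?thesis using fps_conv_radius_add by (rule order.trans)
    qed
    ultimately show ?case
      using insert(1,2) IH eval_fps_add[OF lt[OF radBF[OF i j]] lt[OF IH(1)]] by simp
  qed simp
  define u where "u i z = eval_fps (F i) (z - z\<^sub>0)" for i z
  have inr: "ereal (norm (z - z\<^sub>0)) < fps_conv_radius (F i)" if "i \<in> I" "z \<in> ball z\<^sub>0 r" for i z
  proof -
    have "ereal (norm (z - z\<^sub>0)) < ereal r" using that(2) by (simp add: dist_norm norm_minus_commute)
    then show ?thesis using radF[OF that(1)] by (rule less_le_trans)
  qed
  have du: "(u i has_field_derivative (\<Sum>j\<in>I. A i j z * u j z)) (at z)"
    if i: "i \<in> I" and z: "z \<in> ball z\<^sub>0 r" for i z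
  proof -
    have nz: "norm (z - z\<^sub>0) < r" using z by (simp add: dist_norm norm_minus_commute)
    have "(u i has_field_derivative eval_fps (fps_deriv (F i)) (z - z\<^sub>0) * (1 - 0)) (at z)"
      unfolding u_def
      by (rule DERIV_chain2[where f = "eval_fps (F i)" and g = "\<lambda>z. z - z\<^sub>0"])
        (intro has_field_derivative_eval_fps inr i z derivative_intros)+
    also have "eval_fps (fps_deriv (F i)) (z - z\<^sub>0) =
        (\<Sum>j\<in>I. eval_fps (B i j) (z - z\<^sub>0) * eval_fps (F j) (z - z\<^sub>0))"
      unfolding deriv_F[OF i] using eval_sum[OF nz i order.refl fin] by simp
    also have "\<dots> = (\<Sum>j\<in>I. A i j z * u j z)"
    proof (rule sum.cong[OF refl])
      fix j assume "j \<in> I"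
      then show "eval_fps (B i j) (z - z\<^sub>0) * eval_fps (F j) (z - z\<^sub>0) = A i j z * u j z"
        unfolding B_def u_def using z r \<rho>
        by (subst eval_fps_expansion[OF A'[OF i]]) (auto simp: eball_def in_eball_iff)
    qed
    finally show ?thesis by simp
  qed
  show ?thesis
  proof
    show "0 < r" "r \<le> R" using r \<rho> by auto
    show "u i holomorphic_on ball z\<^sub>0 r" if "i \<in> I" for i
      unfolding holomorphic_on_def field_differentiable_def
      using du[OF that] has_field_derivative_at_within by blast
    show "u i z\<^sub>0 = c i" if "i \<in> I" for i by (simp add: u_def eval_fps_at_0 F_def)
    show "deriv (u i) z = (\<Sum>j\<in>I. A i j z * u j z)" if "i \<in> I" "z \<in> ball z\<^sub>0 r" for i z
      using du[OF that] by (rule DERIV_imp_deriv)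
  qed
qed

text \<open>
  In components a linear system over \<open>\<Lambda>\<close> is a complex linear system, whose unknowns are indexed by pairs of
  an unknown of the given system and a set of odd generators.
\<close>

lemma grassmann_linear_ode:
  fixes B :: "'i \<Rightarrow> 'i \<Rightarrow> complex \<Rightarrow> 'n::len0 grassmann"
  assumes fin: "finite I" and R: "R > 0"
    and B: "\<And>i j. i \<in> I \<Longrightarrow> j \<in> I \<Longrightarrow> gholomorphic_on (B i j) (ball z\<^sub>0 R)"
  obtains r w where "0 < r" "r \<le> R" "\<And>i. i \<in> I \<Longrightarrow> gholomorphic_on (w i) (ball z\<^sub>0 r)"
    "\<And>i. i \<in> I \<Longrightarrow> w i z\<^sub>0 = c i"
    "\<And>i z. i \<in> I \<Longrightarrow> z \<in> ball z\<^sub>0 r \<Longrightarrow> gderiv (w i) z = (\<Sum>j\<in>I. B i j z * w j z)"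
proof -
  define P where "P = Pow {..<LENGTH('n)}"
  have finP: "finite P" by (simp add: P_def)
  define A where "A = (\<lambda>(i, S) (j, T) z. if T \<subseteq> S then gsign (S - T) T * gcoef (B i j z) (S - T) else 0)"
  have "A x y holomorphic_on ball z\<^sub>0 R" if "x \<in> I \<times> P" "y \<in> I \<times> P" for x y
    using B[of "fst x" "fst y"] that
    by (cases x; cases y; cases "snd y \<subseteq> snd x")
      (auto simp: A_def gholomorphic_on_def intro!: holomorphic_intros)
  then obtain r u where r: "0 < r" "r \<le> R" and u: "\<And>x. x \<in> I \<times> P \<Longrightarrow> u x holomorphic_on ball z\<^sub>0 r"
    "\<And>x. x \<in> I \<times> P \<Longrightarrow> u x z\<^sub>0 = gcoef (c (fst x)) (snd x)"
    "\<And>x z. x \<in> I \<times> P \<Longrightarrow> z \<in> ball z\<^sub>0 r \<Longrightarrow> deriv (u x) z = (\<Sum>y\<in>I \<times> P. A x y z * u y z)"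
    using linear_ode[of "I \<times> P" R A z\<^sub>0 "\<lambda>x. gcoef (c (fst x)) (snd x)"] fin finP R by blast
  define w where "w i z = (Abs_grassmann (\<lambda>S. if S \<in> P then u (i, S) z else 0) :: 'n grassmann)" for i z
  have w: "gcoef (w i z) S = (if S \<in> P then u (i, S) z else 0)" for i z S
    unfolding w_def by (subst Abs_grassmann_inverse) (auto simp: P_def)
  show ?thesis
  proof (rule that[OF r])
    fix i assume i: "i \<in> I"
    show "gholomorphic_on (w i) (ball z\<^sub>0 r)"
      unfolding gholomorphic_on_iff w using u(1) i by (auto simp: P_def cong: holomorphic_cong)
    show "w i z\<^sub>0 = c i"
      by (rule grassmann_eqI) (use u(2) i in \<open>auto simp: w P_def\<close>)
    fix z assume z: "z \<in> ball z\<^sub>0 r"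
    show "gderiv (w i) z = (\<Sum>j\<in>I. B i j z * w j z)"
    proof (rule grassmann_eqI)
      fix S assume S: "S \<subseteq> {..<LENGTH('n)}"
      then have SP: "S \<in> P" "Pow S \<subseteq> P" by (auto simp: P_def)
      have "gcoef (gderiv (w i) z) S = deriv (u (i, S)) z"
        using SP by (simp add: gcoef_gderiv w)
      also have "\<dots> = (\<Sum>y\<in>I \<times> P. A (i, S) y z * u y z)" using u(3) i SP z by auto
      also have "\<dots> = (\<Sum>j\<in>I. \<Sum>T\<in>P. A (i, S) (j, T) z * u (j, T) z)"
        by (subst sum.cartesian_product) (auto intro: sum.cong)
      also have "\<dots> = (\<Sum>j\<in>I. \<Sum>T\<in>Pow S. gsign (S - T) T * gcoef (B i j z) (S - T) * gcoef (w j z) T)"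
        using SP finP
        by (intro sum.cong refl sum.mono_neutral_cong_right) (auto simp: A_def w)
      also have "\<dots> = (\<Sum>j\<in>I. gcoef (B i j z * w j z) S)"
        unfolding gcoef_times[OF S]
        by (intro sum.cong refl sum.reindex_bij_witness[where i = "\<lambda>T. S - T" and j = "\<lambda>T. S - T"])
          (auto simp: double_diff)
      finally show "gcoef (gderiv (w i) z) S = gcoef (\<Sum>j\<in>I. B i j z * w j z) S"
        by (simp add: gcoef_sum)
    qed
  qed
qed

text \<open>
  For \<open>y = y\<^sub>0 + \<theta> y\<^sub>1\<close> and \<open>h = h\<^sub>0 + \<theta> h\<^sub>1\<close> the equation \<open>D\<^sup>3 y = - h y\<close> is the system \<open>y\<^sub>1' = - h\<^sub>0 y\<^sub>0\<close>,
  \<open>y\<^sub>0'' = - (h\<^sub>1 y\<^sub>0 + h\<^sub>0\<^sup>* y\<^sub>1)\<close>, where \<open>h\<^sub>0\<^sup>*\<close> is the image of \<open>h\<^sub>0\<close> under the parity involution.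
\<close>

lemma super_ode:
  fixes h :: "complex \<Rightarrow> 'n::len0 superval"
  assumes h: "svhol (ball z\<^sub>0 R) h" and R: "R > 0" and odd: "\<And>z. z \<in> ball z\<^sub>0 R \<Longrightarrow> svinvol (h z) = - h z"
  obtains r y where "0 < r" "r \<le> R" "svhol (ball z\<^sub>0 r) y" "sbody (y z\<^sub>0) = 1"
    "\<And>z. z \<in> ball z\<^sub>0 r \<Longrightarrow> svinvol (y z) = y z"
    "\<And>z. z \<in> ball z\<^sub>0 r \<Longrightarrow> sD (sD (sD y)) z = - (h z * y z)"
proof -
  define h0 h1 where "h0 z = sv0 (h z)" and "h1 z = sv1 (h z)" for z
  have hol: "gholomorphic_on h0 (ball z\<^sub>0 R)" "gholomorphic_on h1 (ball z\<^sub>0 R)"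
    using h by (simp_all add: svhol_def h0_def[abs_def] h1_def[abs_def])
  \<comment> \<open>the unknowns \<open>0, 1, 2\<close> are \<open>y\<^sub>0\<close>, \<open>y\<^sub>0'\<close> and \<open>y\<^sub>1\<close>\<close>
  define B :: "nat \<Rightarrow> nat \<Rightarrow> complex \<Rightarrow> 'n grassmann" where
    "B i j z = (if i = 0 then (if j = 1 then 1 else 0)
      else if i = 1 then (if j = 0 then - h1 z else if j = 2 then - ginvol (h0 z) else 0)
      else (if j = 0 then - h0 z else 0))" for i j z
  have "gholomorphic_on (B i j) (ball z\<^sub>0 R)" if "i \<in> {0,1,2}" "j \<in> {0,1,2}" for i j
    using that unfolding B_def by (auto intro!: gholomorphic_simps hol)
  then obtain r w where r: "0 < r" "r \<le> R" and w: "\<And>i. i \<in> {0,1,2} \<Longrightarrow> gholomorphic_on (w i) (ball z\<^sub>0 r)"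
    "\<And>i. i \<in> {0,1,2} \<Longrightarrow> w i z\<^sub>0 = (if i = 0 then 1 else 0)"
    "\<And>i z. i \<in> {0,1,2} \<Longrightarrow> z \<in> ball z\<^sub>0 r \<Longrightarrow> gderiv (w i) z = (\<Sum>j\<in>{0,1,2}. B i j z * w j z)"
    using grassmann_linear_ode[of "{0,1,2}" R B z\<^sub>0 "\<lambda>i. if i = 0 then 1 else 0"] R by blast
  define y where "y z = SV (w 0 z) (w 2 z)" for z
  let ?V = "ball z\<^sub>0 r"
  have V: "open ?V" by simp
  have y: "svhol ?V y" using w(1) by (simp add: svhol_def y_def)
  have g0: "gderiv (w 0) z = w 1 z" "gderiv (w 1) z = - (h1 z * w 0 z + ginvol (h0 z) * w 2 z)"
    "gderiv (w 2) z = - (h0 z * w 0 z)" if "z \<in> ?V" for z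
    using w(3)[OF _ that] by (simp_all add: B_def)
  have Dy: "sD y z = SV (w 2 z) (w 1 z)" if "z \<in> ?V" for z
    using g0(1)[OF that] by (simp add: superval_eq_iff y_def)
  have D2y: "sD (sD y) z = SV (w 1 z) (gderiv (w 2) z)" if "z \<in> ?V" for z
    using sD_cong[OF V that, of "sD y" "\<lambda>z. SV (w 2 z) (w 1 z)"] Dy by (simp add: superval_eq_iff)
  have D3y: "sD (sD (sD y)) z = - (h z * y z)" if z: "z \<in> ?V" for z
    using sD_cong[OF V z, of "sD (sD y)" "\<lambda>z. SV (w 1 z) (gderiv (w 2) z)"] D2y g0[OF z]
    by (simp add: superval_eq_iff y_def h0_def h1_def)
  \<comment> \<open>the even part of a solution is a solution, as \<open>h\<close> is odd\<close>
  define k :: "'n superval" where "k = svconst (gconst (1 / 2))"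
  have k: "svinvol k = k" by (simp add: k_def)
  have hk: "svhol ?V (\<lambda>z. k)" by simp
  define y' where "y' z = svinvol (y z)" for z
  have y': "svhol ?V y'" unfolding y'_def by (intro svhol_intros y)
  have Dy': "sD y' z = - svinvol (sD y z)" if "z \<in> ?V" for z
    unfolding y'_def by (rule sD_svinvol[OF y V that])
  have D2y': "sD (sD y') z = svinvol (sD (sD y) z)" if z: "z \<in> ?V" for z
  proof -
    have "sD (sD y') z = sD (\<lambda>z. - svinvol (sD y z)) z"
      by (rule sD_cong[OF V z]) (rule Dy')
    also have "\<dots> = - sD (\<lambda>z. svinvol (sD y z)) z"
      by (rule sD_minus[OF _ V z]) (intro svhol_intros y V)
    also have "\<dots> = svinvol (sD (sD y) z)"
      using sD_svinvol[OF svhol_sD[OF y V] V z] by simp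
    finally show ?thesis .
  qed
  have D3y': "sD (sD (sD y')) z = - (h z * y' z)" if z: "z \<in> ?V" for z
  proof -
    have "sD (sD (sD y')) z = sD (\<lambda>z. svinvol (sD (sD y) z)) z"
      by (rule sD_cong[OF V z]) (rule D2y')
    also have "\<dots> = - svinvol (sD (sD (sD y)) z)"
      by (rule sD_svinvol[OF _ V z]) (intro svhol_intros y V)
    finally show ?thesis using odd[of z] z r D3y[OF z] by (simp add: y'_def)
  qed
  define Y where "Y z = k * (y z + y' z)" for z
  have Y: "svhol ?V Y" unfolding Y_def by (intro svhol_intros y y')
  have lin: "sD (\<lambda>z. k * (f z + g z)) z = k * (sD f z + sD g z)"
    if "svhol ?V f" "svhol ?V g" "z \<in> ?V" for f g :: "complex \<Rightarrow> 'n superval" and z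
    using sD_mult[OF hk svhol_add[OF that(1,2)] V that(3)] sD_add[OF that(1,2) V that(3)] k
    by (simp add: k_def)
  have D1: "sD Y z = k * (sD y z + sD y' z)" if "z \<in> ?V" for z
    unfolding Y_def by (rule lin[OF y y' that])
  have D2: "sD (sD Y) z = k * (sD (sD y) z + sD (sD y') z)" if "z \<in> ?V" for z
    using sD_cong[OF V that, of "sD Y" "\<lambda>z. k * (sD y z + sD y' z)"] D1
      lin[OF svhol_sD[OF y V] svhol_sD[OF y' V] that] by simp
  have D3: "sD (sD (sD Y)) z = k * (sD (sD (sD y)) z + sD (sD (sD y')) z)" if "z \<in> ?V" for z
    using sD_cong[OF V that, of "sD (sD Y)" "\<lambda>z. k * (sD (sD y) z + sD (sD y') z)"] D2
      lin[OF svhol_sD[OF svhol_sD[OF y V] V] svhol_sD[OF svhol_sD[OF y' V] V] that] by simp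
  show ?thesis
  proof (rule that[OF r Y])
    have "sbody (y z\<^sub>0) = 1" "sbody (y' z\<^sub>0) = 1"
      using w(2)[of 0] by (simp_all add: sbody_def y_def y'_def gcoef_simps)
    then show "sbody (Y z\<^sub>0) = 1" by (simp add: Y_def k_def)
    show "svinvol (Y z) = Y z" for z by (simp add: Y_def y'_def k add.commute)
    show "sD (sD (sD Y)) z = - (h z * Y z)" if z: "z \<in> ?V" for z
    proof -
      have "sD (sD (sD Y)) z = - (k * (h z * y z + h z * y' z))"
        unfolding D3[OF z] D3y[OF z] D3y'[OF z] by (simp add: algebra_simps)
      also have "\<dots> = - (k * (h z * (y z + y' z)))" by (simp only: distrib_left)
      also have "\<dots> = - (h z * Y z)"
        using S.even_left_commute(1)[OF k, of "h z" "y z + y' z"] by (simp only: Y_def)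
      finally show ?thesis .
    qed
  qed
qed

text \<open>
  \<open>DP = f\<close> means \<open>P\<^sub>1 = f\<^sub>0\<close> and \<open>P\<^sub>0' = f\<^sub>1\<close>; a disc is used for the existence of a primitive of \<open>f\<^sub>1\<close>.
\<close>

lemma super_primitive:
  fixes f :: "complex \<Rightarrow> 'n::len0 superval"
  assumes f: "svhol (ball z\<^sub>0 r) f"
  obtains P where "svhol (ball z\<^sub>0 r) P" "\<And>z. z \<in> ball z\<^sub>0 r \<Longrightarrow> sD P z = f z"
proof -
  have "\<exists>p. \<forall>z\<in>ball z\<^sub>0 r. (p has_field_derivative gcoef (sv1 (f z)) S) (at z)" for S
  proof -
    have "(\<lambda>z. gcoef (sv1 (f z)) S) holomorphic_on ball z\<^sub>0 r"
      using f by (simp add: svhol_def gholomorphic_on_def)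
    then obtain p where
      p: "\<And>z. z \<in> ball z\<^sub>0 r \<Longrightarrow> (p has_field_derivative gcoef (sv1 (f z)) S) (at z within ball z\<^sub>0 r)"
      using holomorphic_convex_primitive'[OF convex_ball open_ball] by blast
    have "(p has_field_derivative gcoef (sv1 (f z)) S) (at z)" if "z \<in> ball z\<^sub>0 r" for z
      using p[OF that] at_within_open[OF that open_ball] by simp
    then show ?thesis by blast
  qed
  then obtain p where p: "\<And>S z. z \<in> ball z\<^sub>0 r \<Longrightarrow> (p S has_field_derivative gcoef (sv1 (f z)) S) (at z)"
    by metis
  define q where "q z = (Abs_grassmann (\<lambda>S. if S \<subseteq> {..<LENGTH('n)} then p S z else 0) :: 'n grassmann)" for z
  have q: "gcoef (q z) S = (if S \<subseteq> {..<LENGTH('n)} then p S z else 0)" for z S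
    unfolding q_def by (subst Abs_grassmann_inverse) auto
  have "gholomorphic_on q (ball z\<^sub>0 r)"
  proof -
    have "p S holomorphic_on ball z\<^sub>0 r" for S
      unfolding holomorphic_on_def field_differentiable_def
      using p has_field_derivative_at_within by blast
    then show ?thesis unfolding gholomorphic_on_iff q by simp
  qed
  moreover have "gderiv q z = sv1 (f z)" if "z \<in> ball z\<^sub>0 r" for z
    by (rule grassmann_eqI) (use p[OF that] in \<open>simp add: gcoef_gderiv q DERIV_imp_deriv\<close>)
  ultimately show ?thesis
    using f by (intro that[of "\<lambda>z. SV (q z) (sv0 (f z))"]) (auto simp: svhol_def superval_eq_iff)
qed

text \<open>
  The part of the opposite parity of any primitive is again a primitive. It is taken outside the disc
  too, which is why the parity of \<open>P\<close> holds everywhere.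
\<close>

lemma super_primitive_parity:
  fixes f :: "complex \<Rightarrow> 'n::len0 superval"
  assumes f: "svhol (ball z\<^sub>0 r) f"
    and parity: "\<And>z. z \<in> ball z\<^sub>0 r \<Longrightarrow> svinvol (f z) = (if p then - f z else f z)"
  obtains P where "svhol (ball z\<^sub>0 r) P" "\<And>z. z \<in> ball z\<^sub>0 r \<Longrightarrow> sD P z = f z"
    "\<And>z. svinvol (P z) = (if p then P z else - P z)"
proof -
  let ?V = "ball z\<^sub>0 r"
  have V: "open ?V" by simp
  obtain Q where Q: "svhol ?V Q" "\<And>z. z \<in> ?V \<Longrightarrow> sD Q z = f z" using super_primitive[OF f] by blast
  define k :: "'n superval" where "k = svconst (gconst (1 / 2))"
  have k: "svinvol k = k" "k + k = 1" by (simp_all add: k_def superval_eq_iff flip: gconst_hom(1))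
  define Q' where "Q' z = (if p then svinvol (Q z) else - svinvol (Q z))" for z
  have Q': "svhol ?V Q'" unfolding Q'_def by (cases p) (auto intro!: svhol_intros Q)
  have DQ': "sD Q' z = f z" if z: "z \<in> ?V" for z
    using sD_svinvol[OF Q(1) V z] sD_minus[OF svhol_svinvol[OF Q(1)] V z] Q(2)[OF z] parity[OF z]
    unfolding Q'_def by (cases p) auto
  show ?thesis
  proof (rule that[of "\<lambda>z. k * (Q z + Q' z)"])
    show "svhol ?V (\<lambda>z. k * (Q z + Q' z))" by (intro svhol_intros Q Q')
    show "sD (\<lambda>z. k * (Q z + Q' z)) z = f z" if z: "z \<in> ?V" for z
    proof -
      have "sD (\<lambda>z. k * (Q z + Q' z)) z = k * (f z + f z)"
        using sD_mult[OF svhol_const svhol_add[OF Q(1) Q'] V z, of k] sD_add[OF Q(1) Q' V z] k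
          Q(2)[OF z] DQ'[OF z] by (simp add: k_def)
      also have "\<dots> = (k + k) * f z" by (simp only: distrib_left distrib_right)
      finally show ?thesis using k by simp
    qed
    show "svinvol (k * (Q z + Q' z)) = (if p then k * (Q z + Q' z) else - (k * (Q z + Q' z)))" for z
      using k by (simp add: Q'_def algebra_simps)
  qed
qed

text \<open>
  Solving \<open>D\<^sup>3 y + h y = 0\<close> and integrating \<open>1 / y\<close> twice gives a superconformal change of coordinates
  with prescribed super-Schwarzian \<open>h\<close>.
\<close>

theorem superconformal_with_schwarzian:
  fixes h :: "complex \<Rightarrow> 'n::len0 superval"
  assumes V: "open V" "z\<^sub>0 \<in> V" and h: "svhol V h" "\<And>z. z \<in> V \<Longrightarrow> svinvol (h z) = - h z"
  obtains r F \<Psi> L where "r > 0" "ball z\<^sub>0 r \<subseteq> V"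
    "svhol (ball z\<^sub>0 r) F" "svhol (ball z\<^sub>0 r) \<Psi>" "svhol (ball z\<^sub>0 r) L"
    "\<And>z. svinvol (F z) = F z" "\<And>z. svinvol (\<Psi> z) = - \<Psi> z"
    "\<And>z. z \<in> ball z\<^sub>0 r \<Longrightarrow> sD F z = \<Psi> z * sD \<Psi> z"
    "\<And>z. z \<in> ball z\<^sub>0 r \<Longrightarrow> svinvol (L z) = L z"
    "\<And>z. z \<in> ball z\<^sub>0 r \<Longrightarrow> sD \<Psi> z * L z = 1"
    "\<And>z. z \<in> ball z\<^sub>0 r \<Longrightarrow> sD (sD (sD L)) z = - (h z * L z)"
proof -
  obtain R where R: "R > 0" "ball z\<^sub>0 R \<subseteq> V" using V open_contains_ball by blast
  have odd: "svinvol (h z) = - h z" if "z \<in> ball z\<^sub>0 R" for z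
    using h(2) R(2) that by blast
  obtain r' L where r': "0 < r'" "r' \<le> R" and L: "svhol (ball z\<^sub>0 r') L" "sbody (L z\<^sub>0) = 1"
    "\<And>z. z \<in> ball z\<^sub>0 r' \<Longrightarrow> svinvol (L z) = L z"
    "\<And>z. z \<in> ball z\<^sub>0 r' \<Longrightarrow> sD (sD (sD L)) z = - (h z * L z)"
    using super_ode[OF svhol_subset[OF h(1) R(2)] R(1) odd] by blast
  have "(\<lambda>z. sbody (L z)) holomorphic_on ball z\<^sub>0 r'"
    using L(1) by (simp add: sbody_def svhol_def gholomorphic_on_def)
  then have "continuous_on (ball z\<^sub>0 r') (\<lambda>z. sbody (L z))"
    by (rule holomorphic_on_imp_continuous_on)
  then have "continuous (at z\<^sub>0) (\<lambda>z. sbody (L z))"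
    using r' by (simp add: continuous_on_eq_continuous_at)
  then obtain s where s: "s > 0" "\<And>z. dist z\<^sub>0 z < s \<Longrightarrow> sbody (L z) \<noteq> 0"
    using continuous_at_avoid[of z\<^sub>0 "\<lambda>z. sbody (L z)" 0] L(2) by auto
  define r where "r = min r' s"
  have r: "0 < r" "ball z\<^sub>0 r \<subseteq> ball z\<^sub>0 r'" "ball z\<^sub>0 r \<subseteq> V"
    using r' s(1) R by (auto simp: r_def subset_eq)
  have body: "sbody (L z) \<noteq> 0" if "z \<in> ball z\<^sub>0 r" for z
    using s(2)[of z] that by (simp add: r_def)
  have L': "svhol (ball z\<^sub>0 r) L" "\<And>z. z \<in> ball z\<^sub>0 r \<Longrightarrow> svinvol (L z) = L z"
    using L svhol_subset r(2) by blast+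
  obtain G where G: "svhol (ball z\<^sub>0 r) G" "\<And>z. z \<in> ball z\<^sub>0 r \<Longrightarrow> svinvol (G z) = G z"
    "\<And>z. z \<in> ball z\<^sub>0 r \<Longrightarrow> L z * G z = 1"
    using svhol_inverse[OF L' body] by blast
  obtain \<Psi> where \<Psi>: "svhol (ball z\<^sub>0 r) \<Psi>" "\<And>z. z \<in> ball z\<^sub>0 r \<Longrightarrow> sD \<Psi> z = G z"
    "\<And>z. svinvol (\<Psi> z) = - \<Psi> z"
    using super_primitive_parity[OF G(1), of False] G(2) by auto
  have "svinvol (\<Psi> z * G z) = (if True then - (\<Psi> z * G z) else \<Psi> z * G z)" if "z \<in> ball z\<^sub>0 r" for z
    using \<Psi>(3) G(2)[OF that] by simp
  then obtain F where F: "svhol (ball z\<^sub>0 r) F" "\<And>z. z \<in> ball z\<^sub>0 r \<Longrightarrow> sD F z = \<Psi> z * G z"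
    "\<And>z. svinvol (F z) = F z"
    using super_primitive_parity[OF svhol_mult[OF \<Psi>(1) G(1)], of True] by auto
  show ?thesis
  proof (rule that[OF r(1,3) F(1) \<Psi>(1) L'(1) F(3) \<Psi>(3)])
    fix z assume z: "z \<in> ball z\<^sub>0 r"
    show "sD F z = \<Psi> z * sD \<Psi> z" "svinvol (L z) = L z" using F(2) \<Psi>(2) L'(2) z by auto
    show "sD \<Psi> z * L z = 1"
      using \<Psi>(2)[OF z] G(3)[OF z] S.even_central[OF G(2)[OF z], of "L z"] by simp
    show "sD (sD (sD L)) z = - (h z * L z)" using L(4) r(2) z by blast
  qed
qed


section \<open>Substitution of superfunctions\<close>

definition taylor_coeff :: "(complex \<Rightarrow> 'n::len0 grassmann) \<Rightarrow> complex \<Rightarrow> nat \<Rightarrow> 'n grassmann" where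
  "taylor_coeff f w k = gconst (1 / fact k) * (gderiv ^^ k) f w"

lemma gcoef_gderiv_funpow: "gcoef ((gderiv ^^ k) f w) S = (deriv ^^ k) (\<lambda>w. gcoef (f w) S) w"
proof (induction k arbitrary: w)
  case (Suc k)
  have "gcoef ((gderiv ^^ Suc k) f w) S = deriv (\<lambda>w. gcoef ((gderiv ^^ k) f w) S) w"
    by (simp add: gcoef_gderiv)
  then show ?case by (simp add: Suc.IH)
qed simp

lemma gcoef_taylor_coeff: "gcoef (taylor_coeff f w k) S = (deriv ^^ k) (\<lambda>w. gcoef (f w) S) w / fact k"
  by (simp add: taylor_coeff_def gcoef_gconst_mult gcoef_gderiv_funpow)

lemma taylor_coeff_0 [simp]: "taylor_coeff f w 0 = f w"
  by (simp add: taylor_coeff_def)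

lemma taylor_coeff_cong:
  assumes "open U" "w \<in> U" "\<And>x. x \<in> U \<Longrightarrow> f x = g x"
  shows "taylor_coeff f w k = taylor_coeff g w k"
proof (rule grassmann_eqI)
  fix S
  have "\<forall>\<^sub>F x in nhds w. gcoef (f x) S = gcoef (g x) S"
    using assms by (auto simp: eventually_nhds intro!: exI[of _ U])
  then show "gcoef (taylor_coeff f w k) S = gcoef (taylor_coeff g w k) S"
    by (simp add: gcoef_taylor_coeff higher_deriv_cong_ev)
qed

context
  fixes f g :: "complex \<Rightarrow> 'n::len0 grassmann" and U w
  assumes f: "gholomorphic_on f U" and g: "gholomorphic_on g U" and U: "open U" "w \<in> U"
begin

lemma taylor_coeff_add: "taylor_coeff (\<lambda>w. f w + g w) w k = taylor_coeff f w k + taylor_coeff g w k"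
  using f g U by (intro grassmann_eqI)
    (simp add: gcoef_taylor_coeff gcoef_simps gholomorphic_on_def higher_deriv_add[of _ U] add_divide_distrib)

lemma taylor_coeff_mult:
  "taylor_coeff (\<lambda>w. f w * g w) w k = (\<Sum>i\<le>k. taylor_coeff f w i * taylor_coeff g w (k - i))"
proof (rule grassmann_eqI)
  fix S assume S: "S \<subseteq> {..<LENGTH('n)}"
  then have fin: "finite (Pow S)" by (auto intro: finite_subset)
  let ?f = "\<lambda>A w. gcoef (f w) A" and ?g = "\<lambda>A w. gcoef (g w) A"
  have hol: "?f A holomorphic_on U" "?g A holomorphic_on U" for A
    using f g by (auto simp: gholomorphic_on_def)
  have sums: "(deriv ^^ k) (\<lambda>w. \<Sum>A\<in>P. gsign A (S - A) * (?f A w * ?g (S - A) w)) w =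
      (\<Sum>A\<in>P. gsign A (S - A) * (deriv ^^ k) (\<lambda>w. ?f A w * ?g (S - A) w) w)" if "finite P" for P
    using that
  proof (induction P rule: finite_induct)
    case empty
    show ?case by (cases k) (simp_all del: funpow.simps add: higher_deriv_const)
  next
    case (insert A P)
    then show ?case
      using U by (simp add: higher_deriv_add[of _ U] higher_deriv_cmult[of _ U] hol
        holomorphic_on_mult holomorphic_on_sum)
  qed
  have "gcoef (taylor_coeff (\<lambda>w. f w * g w) w k) S =
      (\<Sum>A\<in>Pow S. gsign A (S - A) * ((deriv ^^ k) (\<lambda>w. ?f A w * ?g (S - A) w) w / fact k))"
    using sums[OF fin] by (simp add: gcoef_taylor_coeff gcoef_times[OF S] mult.assoc sum_divide_distrib)
  also have "\<dots> = (\<Sum>A\<in>Pow S. \<Sum>i\<le>k. gsign A (S - A) *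
      ((deriv ^^ i) (?f A) w / fact i) * ((deriv ^^ (k - i)) (?g (S - A)) w / fact (k - i)))"
  proof (intro sum.cong refl)
    fix A
    have "(deriv ^^ k) (\<lambda>w. ?f A w * ?g (S - A) w) w / fact k =
        (\<Sum>i\<le>k. of_nat (k choose i) * (deriv ^^ i) (?f A) w * (deriv ^^ (k - i)) (?g (S - A)) w / fact k)"
      by (subst higher_deriv_mult[OF hol U]) (simp add: sum_divide_distrib atLeast0AtMost)
    also have "\<dots> = (\<Sum>i\<le>k. ((deriv ^^ i) (?f A) w / fact i) * ((deriv ^^ (k - i)) (?g (S - A)) w / fact (k - i)))"
      by (intro sum.cong refl) (simp add: binomial_fact field_simps)
    finally show "gsign A (S - A) * ((deriv ^^ k) (\<lambda>w. ?f A w * ?g (S - A) w) w / fact k) =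
      (\<Sum>i\<le>k. gsign A (S - A) * ((deriv ^^ i) (?f A) w / fact i) *
        ((deriv ^^ (k - i)) (?g (S - A)) w / fact (k - i)))"
      by (simp add: sum_distrib_left mult.assoc)
  qed
  also have "\<dots> = gcoef (\<Sum>i\<le>k. taylor_coeff f w i * taylor_coeff g w (k - i)) S"
    by (subst sum.swap) (simp add: gcoef_sum gcoef_times[OF S] gcoef_taylor_coeff)
  finally show "gcoef (taylor_coeff (\<lambda>w. f w * g w) w k) S =
    gcoef (\<Sum>i\<le>k. taylor_coeff f w i * taylor_coeff g w (k - i)) S" .
qed

lemma taylor_coeff_ginvol: "taylor_coeff (\<lambda>w. ginvol (f w)) w k = ginvol (taylor_coeff f w k)"
  using f U by (intro grassmann_eqI)
    (simp add: gcoef_taylor_coeff gcoef_ginvol gholomorphic_on_def higher_deriv_cmult[of _ U])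

lemma taylor_coeff_gfilt:
  assumes "\<And>w. w \<in> U \<Longrightarrow> f w \<in> gfilt j"
  shows "taylor_coeff f w k \<in> gfilt j"
  unfolding gfilt_def
proof (intro CollectI allI impI, rule ccontr)
  fix S assume nz: "gcoef (taylor_coeff f w k) S \<noteq> 0" and "\<not> j \<le> card S"
  then have "gcoef (f x) S = 0" if "x \<in> U" for x using assms[OF that] by (auto simp: gfilt_def)
  then have "\<forall>\<^sub>F x in nhds w. gcoef (f x) S = 0"
    using U by (auto simp: eventually_nhds intro!: exI[of _ U])
  then have "(deriv ^^ k) (\<lambda>x. gcoef (f x) S) w = (deriv ^^ k) (\<lambda>x. 0) w"
    by (intro higher_deriv_cong_ev) auto
  then show False using nz by (simp add: gcoef_taylor_coeff higher_deriv_const)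
qed

end

lemma taylor_coeff_const: "taylor_coeff (\<lambda>_. a) w k = (if k = 0 then a else 0)"
  by (rule grassmann_eqI) (simp add: gcoef_taylor_coeff higher_deriv_const gcoef_simps)

lemma taylor_coeff_gconst: "taylor_coeff gconst w k =
    (if k = 0 then gconst w else if k = 1 then 1 else 0)"
  by (rule grassmann_eqI)
    (auto simp: gcoef_taylor_coeff gcoef_gconst higher_deriv_const higher_deriv_ident gcoef_simps)

text \<open>
  The value \<open>f(F)\<close> of a function of \<open>z\<close> with values in \<open>\<Lambda>\<close> at an even element \<open>F\<close>: the Taylor
  expansion of \<open>f\<close> at the body of \<open>F\<close>, which is finite.
\<close>

definition taylor_subst :: "'n::len0 superval \<Rightarrow> (complex \<Rightarrow> 'n grassmann) \<Rightarrow> 'n superval" where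
  "taylor_subst x f = (\<Sum>k\<le>LENGTH('n).
     svconst (taylor_coeff f (sbody x) k) * (x - svconst (gconst (sbody x))) ^ k)"

definition super_subst :: "'n::len0 superval \<Rightarrow> 'n superval \<Rightarrow> (complex \<Rightarrow> 'n superval) \<Rightarrow> 'n superval" where
  "super_subst x \<xi> f = taylor_subst x (\<lambda>w. sv0 (f w)) + \<xi> * taylor_subst x (\<lambda>w. sv1 (f w))"

text \<open>
  The product of two Taylor expansions in a nilpotent central element, needed for \<open>(f g)(F) = f(F) g(F)\<close>.
\<close>

lemma truncated_product:
  fixes \<nu> :: "'a::ring_1"
  assumes comm: "\<And>x. \<nu> * x = x * \<nu>" and nil: "\<And>k. k > N \<Longrightarrow> \<nu> ^ k = 0"
  shows "(\<Sum>k\<le>N. a k * \<nu> ^ k) * (\<Sum>k\<le>N. b k * \<nu> ^ k) = (\<Sum>k\<le>N. (\<Sum>i\<le>k. a i * b (k - i)) * \<nu> ^ k)"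
proof -
  have comm': "\<nu> ^ k * x = x * \<nu> ^ k" for k x
    by (induction k) (simp_all add: mult.assoc, metis comm mult.assoc)
  have "(\<Sum>k\<le>N. a k * \<nu> ^ k) * (\<Sum>k\<le>N. b k * \<nu> ^ k) =
      (\<Sum>(i, j)\<in>{..N} \<times> {..N}. a i * b j * \<nu> ^ (i + j))"
    unfolding sum_product sum.cartesian_product
  proof (intro sum.cong refl, clarify)
    fix i j
    have "a i * \<nu> ^ i * (b j * \<nu> ^ j) = a i * (\<nu> ^ i * b j) * \<nu> ^ j" by (simp add: mult.assoc)
    also have "\<dots> = a i * (b j * \<nu> ^ i) * \<nu> ^ j" by (simp only: comm'[of i "b j"])
    finally show "a i * \<nu> ^ i * (b j * \<nu> ^ j) = a i * b j * \<nu> ^ (i + j)"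
      by (simp add: mult.assoc power_add)
  qed
  also have "\<dots> = (\<Sum>(i, j)\<in>{(i, j). i + j \<le> N}. a i * b j * \<nu> ^ (i + j))"
    by (intro sum.mono_neutral_right) (auto, rule ccontr, simp add: nil not_le)
  also have "\<dots> = (\<Sum>k\<le>N. \<Sum>i\<le>k. a i * b (k - i) * \<nu> ^ (i + (k - i)))"
    by (rule sum.triangle_reindex_eq)
  also have "\<dots> = (\<Sum>k\<le>N. (\<Sum>i\<le>k. a i * b (k - i)) * \<nu> ^ k)"
    by (simp add: sum_distrib_right)
  finally show ?thesis .
qed

lemma svconst_sum: "svconst (sum f A) = (\<Sum>i\<in>A. svconst (f i))"
  by (induction A rule: infinite_finite_induct) (simp_all add: svconst_hom)

lemma super_subst_cong:
  assumes "open U" "sbody x \<in> U" "\<And>w. w \<in> U \<Longrightarrow> f w = g w"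
  shows "super_subst x \<xi> f = super_subst x \<xi> g"
proof -
  have "taylor_coeff (\<lambda>w. sv0 (f w)) (sbody x) k = taylor_coeff (\<lambda>w. sv0 (g w)) (sbody x) k"
    "taylor_coeff (\<lambda>w. sv1 (f w)) (sbody x) k = taylor_coeff (\<lambda>w. sv1 (g w)) (sbody x) k" for k
    by (rule taylor_coeff_cong[OF assms(1,2)]; simp add: assms(3))+
  then show ?thesis by (simp add: super_subst_def taylor_subst_def)
qed

lemma taylor_subst_const: "taylor_subst x (\<lambda>_. a) = svconst a"
proof -
  have "taylor_subst x (\<lambda>_. a) = (\<Sum>k\<le>LENGTH('a). if k = 0 then svconst a else 0)"
    unfolding taylor_subst_def by (intro sum.cong) (auto simp: taylor_coeff_const svconst_hom)
  then show ?thesis by simp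
qed

context
  fixes x :: "'n::len0 superval" and U
  assumes even: "svinvol x = x" and U: "open U" "sbody x \<in> U"
begin

lemma nilpotent_part:
  "x - svconst (gconst (sbody x)) \<in> svfilt 1"
  "svinvol (x - svconst (gconst (sbody x))) = x - svconst (gconst (sbody x))"
  using even even_svfilt_1[of "x - svconst (gconst (sbody x))"] by simp_all

lemma taylor_subst_gconst: "taylor_subst x gconst = x"
proof (cases "LENGTH('n) = 0")
  case True
  then have "x - svconst (gconst (sbody x)) = 0" using svfilt_top[OF nilpotent_part(1)] by simp
  then show ?thesis using True by (simp add: taylor_subst_def taylor_coeff_gconst)
next
  case False
  have "taylor_subst x gconst = (\<Sum>k\<in>{0, 1}. svconst (taylor_coeff gconst (sbody x) k) *
      (x - svconst (gconst (sbody x))) ^ k)"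
    unfolding taylor_subst_def using False
    by (intro sum.mono_neutral_right) (auto simp: taylor_coeff_gconst svconst_hom)
  then show ?thesis by (simp add: taylor_coeff_gconst svconst_hom)
qed

context
  fixes f g :: "complex \<Rightarrow> 'n grassmann"
  assumes f: "gholomorphic_on f U" and g: "gholomorphic_on g U"
begin

lemma taylor_subst_add: "taylor_subst x (\<lambda>w. f w + g w) = taylor_subst x f + taylor_subst x g"
  by (simp add: taylor_subst_def taylor_coeff_add[OF f g U] svconst_hom distrib_right sum.distrib)

lemma taylor_subst_mult: "taylor_subst x (\<lambda>w. f w * g w) = taylor_subst x f * taylor_subst x g"
proof -
  define \<nu> where "\<nu> = x - svconst (gconst (sbody x))"
  have "\<nu> * y = y * \<nu>" "k > LENGTH('n) \<Longrightarrow> \<nu> ^ k = 0" for y k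
    using S.even_central nilpotent_part svfilt_nilpotent unfolding \<nu>_def by blast+
  then have "taylor_subst x f * taylor_subst x g = (\<Sum>k\<le>LENGTH('n).
      (\<Sum>i\<le>k. svconst (taylor_coeff f (sbody x) i) * svconst (taylor_coeff g (sbody x) (k - i))) * \<nu> ^ k)"
    unfolding taylor_subst_def \<nu>_def[symmetric] by (rule truncated_product)
  then show ?thesis
    by (simp add: taylor_subst_def taylor_coeff_mult[OF f g U] svconst_sum svconst_hom \<nu>_def)
qed

lemma taylor_subst_ginvol: "taylor_subst x (\<lambda>w. ginvol (f w)) = svinvol (taylor_subst x f)"
proof -
  define \<nu> where "\<nu> = x - svconst (gconst (sbody x))"
  have \<nu>: "svinvol (\<nu> ^ k) = \<nu> ^ k" for k
    using nilpotent_part(2) unfolding \<nu>_def[symmetric] by (induction k) simp_all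
  have sum: "svinvol (sum h I) = (\<Sum>i\<in>I. svinvol (h i))" for h :: "nat \<Rightarrow> 'n superval" and I
    by (induction I rule: infinite_finite_induct) simp_all
  show ?thesis
    unfolding taylor_subst_def \<nu>_def[symmetric]
    by (simp add: sum \<nu> svinvol_svconst taylor_coeff_ginvol[OF f f U])
qed

text \<open>Modulo higher powers of the odd generators, \<open>f(F)\<close> is \<open>f\<close> at the body of \<open>F\<close>.\<close>

lemma taylor_subst_leading:
  assumes "\<And>w. w \<in> U \<Longrightarrow> f w \<in> gfilt j"
  shows "taylor_subst x f - svconst (f (sbody x)) \<in> svfilt (Suc j)"
proof -
  define \<nu> where "\<nu> = x - svconst (gconst (sbody x))"
  define t where "t k = svconst (taylor_coeff f (sbody x) k) * \<nu> ^ k" for k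
  have "taylor_subst x f = t 0 + (\<Sum>k\<in>{1..LENGTH('n)}. t k)"
    unfolding taylor_subst_def \<nu>_def[symmetric] t_def[symmetric]
    by (simp add: sum.atLeast1_atMost_eq sum.atMost_shift lessThan_Suc_atMost[symmetric]
      del: sum.lessThan_Suc) (simp add: sum.lessThan_Suc_shift lessThan_Suc_atMost[symmetric] del: sum.lessThan_Suc)
  then have "taylor_subst x f - svconst (f (sbody x)) = (\<Sum>k\<in>{1..LENGTH('n)}. t k)"
    by (simp add: t_def)
  also have "\<dots> \<in> svfilt (Suc j)"
  proof (rule svfilt_sum)
    fix k assume k: "k \<in> {1..LENGTH('n)}"
    have "svconst (taylor_coeff f (sbody x) k) \<in> svfilt j"
      using taylor_coeff_gfilt[OF f f U assms] by (simp add: svfilt_def)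
    then have "t k \<in> svfilt (j + k)"
      unfolding t_def using svfilt_power[OF nilpotent_part(1)] by (auto simp: \<nu>_def intro: svfilt_mult)
    then show "t k \<in> svfilt (Suc j)" by (rule svfilt_mono) (use k in auto)
  qed
  finally show ?thesis .
qed

end

end

lemma super_subst_svconst: "super_subst x \<xi> (\<lambda>_. svconst a) = svconst a"
  by (simp add: super_subst_def taylor_subst_const svconst_hom)

lemma super_subst_theta: "super_subst x \<xi> (\<lambda>_. sv_theta) = \<xi>"
  by (simp add: super_subst_def taylor_subst_const svconst_hom)

context
  fixes x \<xi> :: "'n::len0 superval" and U
  assumes even: "svinvol x = x" and odd: "svinvol \<xi> = - \<xi>" and U: "open U" "sbody x \<in> U"
begin

lemma super_subst_z: "super_subst x \<xi> (\<lambda>w. svconst (gconst w)) = x"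
proof -
  have "taylor_subst x (\<lambda>w. gconst w) = x" by (rule taylor_subst_gconst[OF even U])
  then show ?thesis by (simp add: super_subst_def taylor_subst_const svconst_hom)
qed

context
  fixes f g :: "complex \<Rightarrow> 'n superval"
  assumes f: "svhol U f" and g: "svhol U g"
begin

lemma super_subst_add: "super_subst x \<xi> (\<lambda>w. f w + g w) = super_subst x \<xi> f + super_subst x \<xi> g"
  using f g even U by (simp add: super_subst_def svhol_def taylor_subst_add[where U = U] distrib_left)

lemma super_subst_mult: "super_subst x \<xi> (\<lambda>w. f w * g w) = super_subst x \<xi> f * super_subst x \<xi> g"
proof -
  let ?T = "taylor_subst x"
  have hol: "gholomorphic_on (\<lambda>w. sv0 (f w)) U" "gholomorphic_on (\<lambda>w. sv1 (f w)) U"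
    "gholomorphic_on (\<lambda>w. sv0 (g w)) U" "gholomorphic_on (\<lambda>w. sv1 (g w)) U"
    using f g by (auto simp: svhol_def)
  note mult = taylor_subst_mult[OF even U]
  have swap: "y * (\<xi> * z) = \<xi> * (svinvol y * z)" for y z
    using S.odd_swap[OF odd, of y] by (simp flip: mult.assoc)
  have "super_subst x \<xi> (\<lambda>w. f w * g w) = ?T (\<lambda>w. sv0 (f w)) * ?T (\<lambda>w. sv0 (g w)) +
      \<xi> * (?T (\<lambda>w. sv1 (f w)) * ?T (\<lambda>w. sv0 (g w)) +
        svinvol (?T (\<lambda>w. sv0 (f w))) * ?T (\<lambda>w. sv1 (g w)))"
    unfolding super_subst_def superval_sel
    using taylor_subst_add[OF even U gholomorphic_simps(6)[OF hol(2,3)]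
        gholomorphic_simps(6)[OF gholomorphic_simps(5)[OF hol(1)] hol(4)]]
      mult[OF hol(1,3)] mult[OF hol(2,3)] mult[OF gholomorphic_simps(5)[OF hol(1)] hol(4)]
      taylor_subst_ginvol[OF even U hol(1) hol(1)] by simp
  also have "\<dots> = super_subst x \<xi> f * super_subst x \<xi> g"
  proof -
    have "?T (\<lambda>w. sv0 (f w)) * (\<xi> * ?T (\<lambda>w. sv1 (g w))) =
        \<xi> * (svinvol (?T (\<lambda>w. sv0 (f w))) * ?T (\<lambda>w. sv1 (g w)))" by (rule swap)
    moreover have "\<xi> * (?T (\<lambda>w. sv1 (f w)) * (\<xi> * ?T (\<lambda>w. sv1 (g w)))) = 0"
      unfolding swap[of "?T (\<lambda>w. sv1 (f w))"] by (rule S.odd_left_square[OF odd])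
    ultimately show ?thesis
      unfolding super_subst_def by (simp add: distrib_left distrib_right mult.assoc)
  qed
  finally show ?thesis .
qed

lemma super_subst_svinvol:
  "super_subst x \<xi> (\<lambda>w. svinvol (f w)) = svinvol (super_subst x \<xi> f)"
proof -
  have hol: "gholomorphic_on (\<lambda>w. sv0 (f w)) U" "gholomorphic_on (\<lambda>w. sv1 (f w)) U"
    using f by (auto simp: svhol_def)
  have "taylor_subst x (\<lambda>w. - ginvol (sv1 (f w))) = - taylor_subst x (\<lambda>w. ginvol (sv1 (f w)))"
    using taylor_subst_mult[OF even U gholomorphic_simps(1)[of "- 1"] gholomorphic_simps(5)[OF hol(2)]]
    by (simp add: taylor_subst_const svconst_hom)
  then show ?thesis
    using taylor_subst_ginvol[OF even U hol(1) hol(1)] taylor_subst_ginvol[OF even U hol(2) hol(2)] odd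
    by (simp add: super_subst_def)
qed

text \<open>The leading term of a substitution with body \<open>(z, \<theta>) \<mapsto> (\<phi>(z), g(z) \<theta>)\<close>.\<close>

lemma super_subst_leading:
  assumes "\<And>w. w \<in> U \<Longrightarrow> f w \<in> svfilt j"
  shows "super_subst x \<xi> f - SV (sv0 (f (sbody x))) (gconst (gcoef (sv1 \<xi>) {}) * sv1 (f (sbody x)))
    \<in> svfilt (Suc j)"
proof -
  let ?f0 = "\<lambda>w. sv0 (f w)" and ?f1 = "\<lambda>w. sv1 (f w)"
  let ?\<gamma> = "gconst (gcoef (sv1 \<xi>) {})"
  have hol: "gholomorphic_on ?f0 U" "gholomorphic_on ?f1 U" using f by (auto simp: svhol_def)
  have "\<xi> - SV 0 ?\<gamma> \<in> svfilt 1"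
    using odd odd_body[of "sv0 \<xi>"]
    by (auto simp: svfilt_def gfilt_1_iff gcoef_simps gcoef_gconst superval_eq_iff simp del: One_nat_def)
  moreover have "svconst (?f1 (sbody x)) \<in> svfilt j"
    using assms[OF U(2)] by (simp add: svfilt_def)
  ultimately have "(\<xi> - SV 0 ?\<gamma>) * svconst (?f1 (sbody x)) \<in> svfilt (Suc j)"
    using svfilt_mult by fastforce
  moreover have "taylor_subst x ?f0 - svconst (?f0 (sbody x)) \<in> svfilt (Suc j)"
    "taylor_subst x ?f1 - svconst (?f1 (sbody x)) \<in> svfilt (Suc j)"
    using assms hol by (intro taylor_subst_leading[OF even U, where g = "\<lambda>_. 0"]; auto simp: svfilt_def gholomorphic_simps)+
  moreover from this(2) have "\<xi> * (taylor_subst x ?f1 - svconst (?f1 (sbody x))) \<in> svfilt (Suc j)"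
    using svfilt_mult[OF svfilt_0] by fastforce
  ultimately have "(taylor_subst x ?f0 - svconst (?f0 (sbody x))) +
      (\<xi> * (taylor_subst x ?f1 - svconst (?f1 (sbody x))) + (\<xi> - SV 0 ?\<gamma>) * svconst (?f1 (sbody x)))
      \<in> svfilt (Suc j)"
    by (intro svfilt_add)
  also have "(taylor_subst x ?f0 - svconst (?f0 (sbody x))) +
      (\<xi> * (taylor_subst x ?f1 - svconst (?f1 (sbody x))) + (\<xi> - SV 0 ?\<gamma>) * svconst (?f1 (sbody x))) =
      super_subst x \<xi> f - (svconst (?f0 (sbody x)) + SV 0 ?\<gamma> * svconst (?f1 (sbody x)))"
    by (simp add: super_subst_def algebra_simps)
  also have "svconst (?f0 (sbody x)) + SV 0 ?\<gamma> * svconst (?f1 (sbody x)) =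
      SV (?f0 (sbody x)) (?\<gamma> * ?f1 (sbody x))"
    by (simp add: superval_eq_iff)
  finally show ?thesis .
qed

end

end


text \<open>
  A substitution whose body \<open>(\<phi>(z), g(z) \<theta>)\<close> is invertible is invertible: modulo the next power of
  the ideal of odd generators it agrees with the substitution of its body, so an inverse is found
  by successive approximation, which stops as the ideal is nilpotent.
\<close>

locale super_substitution =
  fixes V :: "complex set" and F \<Psi> :: "complex \<Rightarrow> 'n::len0 superval"
  assumes open_V: "open V" and hol: "svhol V F" "svhol V \<Psi>"
    and even: "\<And>z. z \<in> V \<Longrightarrow> svinvol (F z) = F z" and odd: "\<And>z. z \<in> V \<Longrightarrow> svinvol (\<Psi> z) = - \<Psi> z"
    and inj: "inj_on (\<lambda>z. sbody (F z)) V" and slope: "\<And>z. z \<in> V \<Longrightarrow> gcoef (sv1 (\<Psi> z)) {} \<noteq> 0"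
begin

definition body :: "complex \<Rightarrow> complex" where "body z = sbody (F z)"

definition subst :: "(complex \<Rightarrow> 'n superval) \<Rightarrow> complex \<Rightarrow> 'n superval" where
  "subst f z = super_subst (F z) (\<Psi> z) f"

lemma body_holomorphic: "body holomorphic_on V"
  using hol(1) by (simp add: body_def[abs_def] sbody_def svhol_def gholomorphic_on_def)

lemma body_inj: "inj_on body V"
  using inj by (simp add: body_def[abs_def])

lemma body_open: "open W \<Longrightarrow> W \<subseteq> V \<Longrightarrow> open (body ` W)"
  using open_mapping_thm3 body_holomorphic body_inj
  by (meson holomorphic_on_subset inj_on_subset)

lemma subst_cong:
  assumes "open W" "W \<subseteq> V" "z \<in> W" "\<And>w. w \<in> body ` W \<Longrightarrow> f w = g w"
  shows "subst f z = subst g z"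
  unfolding subst_def
  by (rule super_subst_cong[OF body_open[OF assms(1,2)]]) (use assms(3,4) in \<open>auto simp: body_def\<close>)

context
  fixes W assumes W: "open W" "W \<subseteq> V"
begin

lemma point:
  assumes "z \<in> W"
  shows "svinvol (F z) = F z" "svinvol (\<Psi> z) = - \<Psi> z" "open (body ` W)" "sbody (F z) \<in> body ` W"
  using even odd body_open W assms by (auto simp: body_def)

lemma subst_add:
  "svhol (body ` W) f \<Longrightarrow> svhol (body ` W) g \<Longrightarrow> z \<in> W \<Longrightarrow>
    subst (\<lambda>w. f w + g w) z = subst f z + subst g z"
  unfolding subst_def using point by (intro super_subst_add)

lemma subst_mult:
  "svhol (body ` W) f \<Longrightarrow> svhol (body ` W) g \<Longrightarrow> z \<in> W \<Longrightarrow>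
    subst (\<lambda>w. f w * g w) z = subst f z * subst g z"
  unfolding subst_def using point by (intro super_subst_mult)

lemma subst_svinvol:
  "svhol (body ` W) f \<Longrightarrow> z \<in> W \<Longrightarrow> subst (\<lambda>w. svinvol (f w)) z = svinvol (subst f z)"
  unfolding subst_def using point by (intro super_subst_svinvol)

lemma subst_svconst: "subst (\<lambda>_. svconst a) z = svconst a"
  by (simp add: subst_def super_subst_svconst)

lemma subst_theta: "subst (\<lambda>_. sv_theta) z = \<Psi> z"
  by (simp add: subst_def super_subst_theta)

lemma subst_z: "z \<in> W \<Longrightarrow> subst (\<lambda>w. svconst (gconst w)) z = F z"
  unfolding subst_def using point by (intro super_subst_z)

lemma gholomorphic_comp_body:
  assumes "gholomorphic_on f (body ` W)"
  shows "gholomorphic_on (\<lambda>z. f (body z)) W"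
proof -
  have "body holomorphic_on W" using body_holomorphic W(2) by (rule holomorphic_on_subset)
  then show ?thesis
    using assms unfolding gholomorphic_on_def
    by (auto intro!: holomorphic_on_compose[unfolded o_def, of body])
qed

lemma taylor_subst_hol:
  assumes f: "gholomorphic_on f (body ` W)"
  shows "svhol W (\<lambda>z. taylor_subst (F z) f)"
proof -
  have F: "svhol W F" using hol(1) W(2) by (rule svhol_subset)
  have "body holomorphic_on W" using body_holomorphic W(2) by (rule holomorphic_on_subset)
  then have b: "svhol W (\<lambda>z. svconst (gconst (body z)))" by (rule svhol_svconst_gconst)
  have "gholomorphic_on ((gderiv ^^ k) f) (body ` W)" for k
    by (induction k) (simp_all add: f gholomorphic_gderiv body_open W)
  then have "gholomorphic_on (\<lambda>z. taylor_coeff f (body z) k) W" for k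
    unfolding taylor_coeff_def by (intro gholomorphic_simps gholomorphic_comp_body)
  then have "svhol W (\<lambda>z. svconst (taylor_coeff f (body z) k))" for k
    by (simp add: svhol_def gholomorphic_simps)
  then show ?thesis
    unfolding taylor_subst_def body_def[symmetric] by (intro svhol_intros F b)
qed

lemma subst_hol:
  assumes f: "svhol (body ` W) f"
  shows "svhol W (subst f)"
proof -
  have "svhol W \<Psi>" using hol(2) W(2) by (rule svhol_subset)
  then show ?thesis
    using f unfolding subst_def[abs_def] super_subst_def
    by (intro svhol_add svhol_mult taylor_subst_hol) (simp_all add: svhol_def)
qed

text \<open>
  The substitution of the body \<open>(\<phi>(z), g(z) \<theta>)\<close>.
\<close>

definition leading :: "(complex \<Rightarrow> 'n superval) \<Rightarrow> complex \<Rightarrow> 'n superval" where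
  "leading f z = SV (sv0 (f (body z))) (gconst (gcoef (sv1 (\<Psi> z)) {}) * sv1 (f (body z)))"

lemma subst_leading:
  assumes "svhol (body ` W) f" "\<And>w. w \<in> body ` W \<Longrightarrow> f w \<in> svfilt j" "z \<in> W"
  shows "subst f z - leading f z \<in> svfilt (Suc j)"
  unfolding subst_def leading_def body_def[of z]
  using super_subst_leading[OF point[OF assms(3)] assms(1,1,2)] .

lemma gfilt_gconst_cancel:
  assumes "gconst c * x \<in> gfilt k" "c \<noteq> 0"
  shows "x \<in> gfilt k"
  using assms by (auto simp: gfilt_def gcoef_gconst_mult)

text \<open>
  Injectivity: if \<open>f\<close> lies in a power of the ideal, then the leading term of its substitution shows that
  it lies in the next one.
\<close>

lemma subst_zero:
  assumes f: "svhol (body ` W) f" and zero: "\<And>z. z \<in> W \<Longrightarrow> subst f z = 0" and w: "w \<in> body ` W"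
  shows "f w = 0"
proof -
  have "\<forall>w\<in>body ` W. f w \<in> svfilt j" for j
  proof (induction j)
    case (Suc j)
    show ?case
    proof
      fix w assume "w \<in> body ` W"
      then obtain z where z: "z \<in> W" "w = body z" by blast
      have "subst f z - leading f z \<in> svfilt (Suc j)" by (rule subst_leading[OF f _ z(1)]) (use Suc in blast)
      then have "leading f z \<in> svfilt (Suc j)" using zero[OF z(1)] svfilt_minus by fastforce
      then show "f w \<in> svfilt (Suc j)"
        using slope[of z] z W(2) gfilt_gconst_cancel by (auto simp: svfilt_def leading_def)
    qed
  qed simp
  then have "f w \<in> svfilt (Suc LENGTH('n))" using w by blast
  then show ?thesis by (rule svfilt_top) simp
qed

lemma leading_inverse:
  assumes t: "svhol W t" and filt: "\<And>z. z \<in> W \<Longrightarrow> t z \<in> svfilt j"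
  obtains f where "svhol (body ` W) f" "\<And>z. z \<in> W \<Longrightarrow> leading f z = t z"
    "\<And>w. w \<in> body ` W \<Longrightarrow> f w \<in> svfilt j"
proof -
  obtain \<psi> where \<psi>: "\<psi> holomorphic_on body ` W" "\<And>z. z \<in> W \<Longrightarrow> \<psi> (body z) = z"
    using holomorphic_has_inverse[of body W] body_holomorphic body_inj W
    by (metis holomorphic_on_subset inj_on_subset)
  have inW: "\<psi> w \<in> W" if "w \<in> body ` W" for w using \<psi>(2) that by auto
  have comp: "gholomorphic_on (\<lambda>w. h (\<psi> w)) (body ` W)" if "gholomorphic_on h W"
    for h :: "complex \<Rightarrow> 'n grassmann"
  proof -
    have "(\<lambda>z. gcoef (h z) S) holomorphic_on \<psi> ` body ` W" for S
      using that inW unfolding gholomorphic_on_def by (meson holomorphic_on_subset image_subsetI)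
    then show ?thesis
      unfolding gholomorphic_on_def using holomorphic_on_compose[OF \<psi>(1)] by (auto simp: o_def)
  qed
  define g where "g z = inverse (gcoef (sv1 (\<Psi> z)) {})" for z
  have "(\<lambda>z. gcoef (sv1 (\<Psi> z)) {}) holomorphic_on W"
    using svhol_subset[OF hol(2) W(2)] by (simp add: svhol_def gholomorphic_on_def)
  then have g: "gholomorphic_on (\<lambda>z. gconst (g z) :: 'n grassmann) W"
    unfolding g_def using slope W(2) by (intro gholomorphic_gconst holomorphic_on_inverse) auto
  define f where "f w = SV (sv0 (t (\<psi> w))) (gconst (g (\<psi> w)) * sv1 (t (\<psi> w)))" for w
  show ?thesis
  proof (rule that[of f])
    have "gholomorphic_on (\<lambda>z. sv0 (t z)) W" "gholomorphic_on (\<lambda>z. gconst (g z) * sv1 (t z)) W"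
      using t by (auto simp: svhol_def intro: gholomorphic_simps g)
    from this[THEN comp] show "svhol (body ` W) f" by (simp add: svhol_def f_def)
    show "leading f z = t z" if "z \<in> W" for z
      using slope[of z] W(2) that \<psi>(2)[OF that]
      by (auto simp: leading_def f_def superval_eq_iff g_def simp flip: mult.assoc gconst_hom)
    show "f w \<in> svfilt j" if "w \<in> body ` W" for w
      using filt[OF inW[OF that]] gfilt_mult[OF gfilt_0] by (fastforce simp: svfilt_def f_def)
  qed
qed

text \<open>
  Given a preimage up to an error in a power of the ideal, adding a preimage of the error under the
  substitution of the body leaves an error in the next power.
\<close>

lemma subst_surj:
  assumes t: "svhol W t"
  obtains f where "svhol (body ` W) f" "\<And>z. z \<in> W \<Longrightarrow> subst f z = t z"
proof -
  have "\<exists>f. svhol (body ` W) f \<and> (\<forall>z\<in>W. t z - subst f z \<in> svfilt j)" for j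
  proof (induction j)
    case 0
    show ?case by (rule exI[of _ "\<lambda>_. 0"]) simp
  next
    case (Suc j)
    then obtain f where f: "svhol (body ` W) f" "\<And>z. z \<in> W \<Longrightarrow> t z - subst f z \<in> svfilt j" by blast
    have "svhol W (\<lambda>z. t z - subst f z)" by (intro svhol_intros t subst_hol f)
    then obtain e where e: "svhol (body ` W) e" "\<And>z. z \<in> W \<Longrightarrow> leading e z = t z - subst f z"
      "\<And>w. w \<in> body ` W \<Longrightarrow> e w \<in> svfilt j"
      using leading_inverse f(2) by blast
    have "t z - subst (\<lambda>w. f w + e w) z \<in> svfilt (Suc j)" if z: "z \<in> W" for z
    proof -
      have "- (subst e z - leading e z) \<in> svfilt (Suc j)"
        by (rule svfilt_minus[OF subst_leading[OF e(1,3) z]])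
      then show ?thesis
        using subst_add[OF f(1) e(1) z] e(2)[OF z] by (simp add: algebra_simps)
    qed
    moreover have "svhol (body ` W) (\<lambda>w. f w + e w)" by (intro svhol_intros f e)
    ultimately show ?case by blast
  qed
  then obtain f where f: "svhol (body ` W) f" "\<And>z. z \<in> W \<Longrightarrow> t z - subst f z \<in> svfilt (Suc LENGTH('n))"
    by metis
  show ?thesis
  proof (rule that[OF f(1)])
    show "subst f z = t z" if "z \<in> W" for z using svfilt_top[OF f(2)[OF that]] by simp
  qed
qed

text \<open>
  Members of the ring of superfunctions vanish outside the domain, hence the truncation.
\<close>

lemma subst_bij:
  "bij_betw (\<lambda>f. cut W (subst f)) (carrier (superfunctions (body ` W))) (carrier (superfunctions W))"
proof (rule bij_betw_imageI)
  show "inj_on (\<lambda>f. cut W (subst f)) (carrier (superfunctions (body ` W)))"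
  proof (rule inj_onI)
    fix f g :: "complex \<Rightarrow> 'n superval"
    assume f: "f \<in> carrier (superfunctions (body ` W))" and g: "g \<in> carrier (superfunctions (body ` W))"
      and eq: "cut W (subst f) = cut W (subst g)"
    then have hfg: "svhol (body ` W) f" "svhol (body ` W) g" by (simp_all add: superfunctions_carrier)
    have hn: "svhol (body ` W) (\<lambda>w. - g w)" by (intro svhol_intros hfg)
    have "subst (\<lambda>w. f w + - g w) z = 0" if z: "z \<in> W" for z
    proof -
      have "subst (\<lambda>w. - g w) z + subst g z = subst (\<lambda>w. - g w + g w) z"
        using subst_add[OF hn hfg(2) z] by simp
      also have "\<dots> = 0" using subst_svconst[of 0] by (simp add: svconst_hom)
      finally show ?thesis
        using subst_add[OF hfg(1) hn z] fun_cong[OF eq, of z] z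
        by (simp add: cut_def eq_neg_iff_add_eq_0 add.commute)
    qed
    then have "f w + - g w = 0" if "w \<in> body ` W" for w
      using subst_zero[OF svhol_add[OF hfg(1) hn] _ that] by blast
    then show "f = g" using f g by (auto simp: superfunctions_carrier fun_eq_iff) (metis right_minus_eq)
  qed
  show "(\<lambda>f. cut W (subst f)) ` carrier (superfunctions (body ` W)) = carrier (superfunctions W)"
  proof (intro equalityI subsetI)
    fix t :: "complex \<Rightarrow> 'n superval" assume t: "t \<in> carrier (superfunctions W)"
    then obtain f where f: "svhol (body ` W) f" "\<And>z. z \<in> W \<Longrightarrow> subst f z = t z"
      using subst_surj by (auto simp: superfunctions_carrier)
    have "subst (cut (body ` W) f) z = subst f z" if "z \<in> W" for z
      by (rule subst_cong[OF W that]) (simp add: cut_def)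
    then have "t = cut W (subst (cut (body ` W) f))"
      using f t by (auto simp: superfunctions_carrier cut_def fun_eq_iff)
    then show "t \<in> (\<lambda>f. cut W (subst f)) ` carrier (superfunctions (body ` W))"
      using cut_in_superfunctions[OF f(1)] by blast
  qed (auto simp: superfunctions_carrier[of _ "body ` W"] intro!: cut_in_superfunctions subst_hol)
qed

end

end


section \<open>Sections in coordinates\<close>

text \<open>
  The quotient extends holomorphically to \<open>c\<close>, with the derivative as its value there.
\<close>

lemma holomorphic_difference_quotient:
  fixes f :: "complex \<Rightarrow> 'n::len0 superval"
  assumes f: "svhol V f" and V: "open V" "c \<in> V"
  obtains g where "svhol V g" "\<And>w. f w - f c = svconst (gconst (w - c)) * g w"
    "sD f c = svconst (sv1 (f c)) + sv_theta * g c"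
proof -
  define q where "q h w = (if w = c then deriv h c else (h w - h c) / (w - c))" for h :: "complex \<Rightarrow> complex" and w
  have q: "q h holomorphic_on V" if "h holomorphic_on V" for h
    unfolding q_def using pole_lemma[OF that] V by (simp add: interior_open)
  define Q where "Q k w = (Abs_grassmann (\<lambda>S. if S \<subseteq> {..<LENGTH('n)} then q (\<lambda>w. gcoef (k w) S) w else 0) :: 'n grassmann)"
    for k :: "complex \<Rightarrow> 'n grassmann" and w
  have Q: "gcoef (Q k w) S = (if S \<subseteq> {..<LENGTH('n)} then q (\<lambda>w. gcoef (k w) S) w else 0)" for k w S
    unfolding Q_def by (subst Abs_grassmann_inverse) auto
  have hol: "gholomorphic_on (Q k) V" if "gholomorphic_on k V" for k
    using that unfolding gholomorphic_on_iff Q by (auto intro: q)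
  have eq: "k w - k c = gconst (w - c) * Q k w" for k w
    by (rule grassmann_eqI) (simp add: gcoef_simps gcoef_gconst_mult Q q_def)
  have deriv: "Q k c = gderiv k c" for k
    by (rule grassmann_eqI) (simp add: Q q_def gcoef_gderiv)
  define g where "g w = SV (Q (\<lambda>w. sv0 (f w)) w) (Q (\<lambda>w. sv1 (f w)) w)" for w
  show ?thesis
  proof (rule that[of g])
    show "svhol V g" using f by (simp add: svhol_def g_def hol)
    show "f w - f c = svconst (gconst (w - c)) * g w" for w
      using eq[of "\<lambda>w. sv0 (f w)" w] eq[of "\<lambda>w. sv1 (f w)" w] by (simp add: superval_eq_iff g_def)
    show "sD f c = svconst (sv1 (f c)) + sv_theta * g c"
      by (simp add: superval_eq_iff g_def deriv)
  qed
qed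

context superconformal_curve
begin

abbreviation opn :: "'p set \<Rightarrow> bool" where "opn W \<equiv> openin (space_of X) W"

lemma opn_Int [intro]: "opn U \<Longrightarrow> opn V \<Longrightarrow> opn (U \<inter> V)"
  by (rule openin_Int)

lemma sect_closed [simp]:
  assumes "opn W"
  shows "\<zero>\<^bsub>sect X W\<^esub> \<in> carrier (sect X W)" "\<one>\<^bsub>sect X W\<^esub> \<in> carrier (sect X W)"
    "a \<in> carrier (sect X W) \<Longrightarrow> b \<in> carrier (sect X W) \<Longrightarrow> a \<oplus>\<^bsub>sect X W\<^esub> b \<in> carrier (sect X W)"
    "a \<in> carrier (sect X W) \<Longrightarrow> b \<in> carrier (sect X W) \<Longrightarrow> a \<otimes>\<^bsub>sect X W\<^esub> b \<in> carrier (sect X W)"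
    "a \<in> carrier (sect X W) \<Longrightarrow> \<ominus>\<^bsub>sect X W\<^esub> a \<in> carrier (sect X W)"
    "a \<in> carrier (sect X W) \<Longrightarrow> a [^]\<^bsub>sect X W\<^esub> (k::nat) \<in> carrier (sect X W)"
    "scalar X W x \<in> carrier (sect X W)"
proof -
  interpret R: ring "sect X W" by (rule sect_ring[OF assms])
  show "\<zero>\<^bsub>sect X W\<^esub> \<in> carrier (sect X W)" "\<one>\<^bsub>sect X W\<^esub> \<in> carrier (sect X W)" by auto
  show "a \<in> carrier (sect X W) \<Longrightarrow> b \<in> carrier (sect X W) \<Longrightarrow> a \<oplus>\<^bsub>sect X W\<^esub> b \<in> carrier (sect X W)"
    "a \<in> carrier (sect X W) \<Longrightarrow> b \<in> carrier (sect X W) \<Longrightarrow> a \<otimes>\<^bsub>sect X W\<^esub> b \<in> carrier (sect X W)"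
    "a \<in> carrier (sect X W) \<Longrightarrow> \<ominus>\<^bsub>sect X W\<^esub> a \<in> carrier (sect X W)"
    "a \<in> carrier (sect X W) \<Longrightarrow> a [^]\<^bsub>sect X W\<^esub> (k::nat) \<in> carrier (sect X W)" by auto
  show "scalar X W x \<in> carrier (sect X W)"
    using ring_hom_closed[OF scalar_hom[OF assms], of x] by (simp add: grassmann_ring_def)
qed

lemma par_closed: "opn W \<Longrightarrow> a \<in> par X p W \<Longrightarrow> a \<in> carrier (sect X W)"
  using par_subgroup additive_subgroup.a_Hcarr by metis

lemma res_simps [simp]:
  assumes "opn U" "opn V" "V \<subseteq> U"
  shows "res X U V \<zero>\<^bsub>sect X U\<^esub> = \<zero>\<^bsub>sect X V\<^esub>" "res X U V \<one>\<^bsub>sect X U\<^esub> = \<one>\<^bsub>sect X V\<^esub>"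
    "a \<in> carrier (sect X U) \<Longrightarrow> res X U V a \<in> carrier (sect X V)"
    "a \<in> carrier (sect X U) \<Longrightarrow> b \<in> carrier (sect X U) \<Longrightarrow>
      res X U V (a \<oplus>\<^bsub>sect X U\<^esub> b) = res X U V a \<oplus>\<^bsub>sect X V\<^esub> res X U V b"
    "a \<in> carrier (sect X U) \<Longrightarrow> b \<in> carrier (sect X U) \<Longrightarrow>
      res X U V (a \<otimes>\<^bsub>sect X U\<^esub> b) = res X U V a \<otimes>\<^bsub>sect X V\<^esub> res X U V b"
    "a \<in> carrier (sect X U) \<Longrightarrow> res X U V (a [^]\<^bsub>sect X U\<^esub> (k::nat)) = res X U V a [^]\<^bsub>sect X V\<^esub> k"
proof -
  interpret ring_hom_ring "sect X U" "sect X V" "res X U V"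
    using res_hom[OF assms] sect_ring assms by (auto intro!: ring_hom_ringI2)
  show "res X U V \<zero>\<^bsub>sect X U\<^esub> = \<zero>\<^bsub>sect X V\<^esub>" "res X U V \<one>\<^bsub>sect X U\<^esub> = \<one>\<^bsub>sect X V\<^esub>"
    "a \<in> carrier (sect X U) \<Longrightarrow> res X U V a \<in> carrier (sect X V)"
    "a \<in> carrier (sect X U) \<Longrightarrow> b \<in> carrier (sect X U) \<Longrightarrow>
      res X U V (a \<oplus>\<^bsub>sect X U\<^esub> b) = res X U V a \<oplus>\<^bsub>sect X V\<^esub> res X U V b"
    "a \<in> carrier (sect X U) \<Longrightarrow> b \<in> carrier (sect X U) \<Longrightarrow>
      res X U V (a \<otimes>\<^bsub>sect X U\<^esub> b) = res X U V a \<otimes>\<^bsub>sect X V\<^esub> res X U V b"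
    "a \<in> carrier (sect X U) \<Longrightarrow> res X U V (a [^]\<^bsub>sect X U\<^esub> (k::nat)) = res X U V a [^]\<^bsub>sect X V\<^esub> k"
    by (auto simp: hom_nat_pow)
qed

definition in_chart :: "('p, 's, 'n) superchart \<Rightarrow> 'p set \<Rightarrow> bool" where
  "in_chart \<kappa> W \<longleftrightarrow> \<kappa> \<in> coordinates X \<and> opn W \<and> W \<subseteq> cdom \<kappa>"

lemma in_chart_opn: "in_chart \<kappa> W \<Longrightarrow> opn W"
  by (simp add: in_chart_def)

lemma in_chart_subset: "in_chart \<kappa> W \<Longrightarrow> opn W' \<Longrightarrow> W' \<subseteq> W \<Longrightarrow> in_chart \<kappa> W'"
  by (auto simp: in_chart_def)

lemma coordinates_opn: "\<kappa> \<in> coordinates X \<Longrightarrow> opn (cdom \<kappa>)"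
  by (simp add: coordinates_def)

lemma coordinates_top:
  assumes "\<kappa> \<in> coordinates X"
  shows "inj_on (cpt \<kappa>) (cdom \<kappa>)" "open (cpt \<kappa> ` cdom \<kappa>)"
    "homeomorphic_map (subtopology (space_of X) (cdom \<kappa>)) (top_of_set (cpt \<kappa> ` cdom \<kappa>)) (cpt \<kappa>)"
proof -
  show hm: "homeomorphic_map (subtopology (space_of X) (cdom \<kappa>)) (top_of_set (cpt \<kappa> ` cdom \<kappa>)) (cpt \<kappa>)"
    and "open (cpt \<kappa> ` cdom \<kappa>)" using assms by (simp_all add: coordinates_def)
  have "topspace (subtopology (space_of X) (cdom \<kappa>)) = cdom \<kappa>"
    using openin_subset[OF coordinates_opn[OF assms]] by auto
  then show "inj_on (cpt \<kappa>) (cdom \<kappa>)" using homeomorphic_imp_injective_map[OF hm] by simp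
qed

lemma cpt_open: "in_chart \<kappa> W \<Longrightarrow> open (cpt \<kappa> ` W)"
proof -
  assume W: "in_chart \<kappa> W"
  then have \<kappa>: "\<kappa> \<in> coordinates X" by (simp add: in_chart_def)
  have "openin (subtopology (space_of X) (cdom \<kappa>)) W"
    using W by (auto simp: in_chart_def openin_open_subtopology coordinates_opn)
  then have "openin (top_of_set (cpt \<kappa> ` cdom \<kappa>)) (cpt \<kappa> ` W)"
    using homeomorphic_imp_open_map[OF coordinates_top(3)[OF \<kappa>]] by (simp add: open_map_def)
  then show ?thesis using coordinates_top(2)[OF \<kappa>] openin_open_trans by blast
qed

lemma cpt_preimage:
  assumes \<kappa>: "\<kappa> \<in> coordinates X" and B: "open B" "B \<subseteq> cpt \<kappa> ` cdom \<kappa>"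
  defines "W \<equiv> {x \<in> cdom \<kappa>. cpt \<kappa> x \<in> B}"
  shows "in_chart \<kappa> W" "cpt \<kappa> ` W = B"
proof -
  have "continuous_map (subtopology (space_of X) (cdom \<kappa>)) (top_of_set (cpt \<kappa> ` cdom \<kappa>)) (cpt \<kappa>)"
    using homeomorphic_imp_continuous_map[OF coordinates_top(3)[OF \<kappa>]] .
  moreover have "openin (top_of_set (cpt \<kappa> ` cdom \<kappa>)) B"
    using B by (auto simp: openin_open_eq coordinates_top(2)[OF \<kappa>])
  moreover have "topspace (subtopology (space_of X) (cdom \<kappa>)) = cdom \<kappa>"
    using openin_subset[OF coordinates_opn[OF \<kappa>]] by auto
  ultimately have "openin (subtopology (space_of X) (cdom \<kappa>)) W"
    unfolding W_def using openin_continuous_map_preimage by fastforce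
  then have "opn W" using openin_trans_full coordinates_opn[OF \<kappa>] by blast
  then show "in_chart \<kappa> W" using \<kappa> by (auto simp: in_chart_def W_def)
  show "cpt \<kappa> ` W = B" using B(2) by (auto simp: W_def)
qed

context
  fixes \<kappa> W assumes \<kappa>: "in_chart \<kappa> W"
begin

lemma cfun_iso: "cfun \<kappa> W \<in> ring_iso (sect X W) (superfunctions (cpt \<kappa> ` W))"
  using \<kappa> by (simp add: in_chart_def coordinates_def)

lemma cfun_bij: "bij_betw (cfun \<kappa> W) (carrier (sect X W)) (carrier (superfunctions (cpt \<kappa> ` W)))"
  using cfun_iso by (simp add: ring_iso_def)

lemma cfun_carrier: "s \<in> carrier (sect X W) \<Longrightarrow> cfun \<kappa> W s \<in> carrier (superfunctions (cpt \<kappa> ` W))"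
  using cfun_bij bij_betwE by blast

lemma cfun_hol: "s \<in> carrier (sect X W) \<Longrightarrow> svhol (cpt \<kappa> ` W) (cfun \<kappa> W s)"
  using cfun_carrier by (simp add: superfunctions_carrier)

lemma cfun_outside: "s \<in> carrier (sect X W) \<Longrightarrow> z \<notin> cpt \<kappa> ` W \<Longrightarrow> cfun \<kappa> W s z = 0"
  using cfun_carrier by (simp add: superfunctions_carrier)

lemma cfun_eqI:
  assumes "s \<in> carrier (sect X W)" "t \<in> carrier (sect X W)"
    "\<And>z. z \<in> cpt \<kappa> ` W \<Longrightarrow> cfun \<kappa> W s z = cfun \<kappa> W t z"
  shows "s = t"
proof -
  have "cfun \<kappa> W s = cfun \<kappa> W t" using assms cfun_outside by (metis ext)
  then show ?thesis using cfun_bij assms(1,2) by (auto simp: bij_betw_def inj_on_def)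
qed

lemma cfun_add: "a \<in> carrier (sect X W) \<Longrightarrow> b \<in> carrier (sect X W) \<Longrightarrow>
    cfun \<kappa> W (a \<oplus>\<^bsub>sect X W\<^esub> b) z = cfun \<kappa> W a z + cfun \<kappa> W b z"
  using cfun_iso by (simp add: ring_iso_def ring_hom_def superfunctions_def)

lemma cfun_mult: "a \<in> carrier (sect X W) \<Longrightarrow> b \<in> carrier (sect X W) \<Longrightarrow>
    cfun \<kappa> W (a \<otimes>\<^bsub>sect X W\<^esub> b) z = cfun \<kappa> W a z * cfun \<kappa> W b z"
  using cfun_iso by (simp add: ring_iso_def ring_hom_def superfunctions_def)

lemma cfun_one: "z \<in> cpt \<kappa> ` W \<Longrightarrow> cfun \<kappa> W \<one>\<^bsub>sect X W\<^esub> z = 1"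
  using cfun_iso by (simp add: ring_iso_def ring_hom_def superfunctions_def)

lemma cfun_zero: "cfun \<kappa> W \<zero>\<^bsub>sect X W\<^esub> z = 0"
proof -
  interpret R: ring "sect X W" using sect_ring in_chart_opn \<kappa> by blast
  have "cfun \<kappa> W \<zero>\<^bsub>sect X W\<^esub> z = cfun \<kappa> W \<zero>\<^bsub>sect X W\<^esub> z + cfun \<kappa> W \<zero>\<^bsub>sect X W\<^esub> z"
    by (subst cfun_add[symmetric]) simp_all
  then show ?thesis by simp
qed

lemma cfun_uminus:
  assumes "a \<in> carrier (sect X W)"
  shows "cfun \<kappa> W (\<ominus>\<^bsub>sect X W\<^esub> a) z = - cfun \<kappa> W a z"
proof -
  interpret R: ring "sect X W" using sect_ring in_chart_opn \<kappa> by blast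
  have "cfun \<kappa> W (\<ominus>\<^bsub>sect X W\<^esub> a) z + cfun \<kappa> W a z = 0"
    using assms by (subst cfun_add[symmetric]) (simp_all add: cfun_zero R.l_neg)
  then show ?thesis by (rule eq_neg_iff_add_eq_0[THEN iffD2])
qed

lemma cfun_cube: "a \<in> carrier (sect X W) \<Longrightarrow>
    cfun \<kappa> W (a [^]\<^bsub>sect X W\<^esub> (3::nat)) z = cfun \<kappa> W a z ^ 3"
proof -
  assume a: "a \<in> carrier (sect X W)"
  interpret R: ring "sect X W" using sect_ring in_chart_opn \<kappa> by blast
  show ?thesis
    using a by (simp add: numeral_3_eq_3 cfun_mult mult.assoc)
qed

lemma cfun_scalar: "z \<in> cpt \<kappa> ` W \<Longrightarrow> cfun \<kappa> W (scalar X W x) z = svconst x"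
  using \<kappa> by (simp add: in_chart_def coordinates_def cut_def)

lemma cfun_res: "opn W' \<Longrightarrow> W' \<subseteq> W \<Longrightarrow> s \<in> carrier (sect X W) \<Longrightarrow> z \<in> cpt \<kappa> ` W' \<Longrightarrow>
    cfun \<kappa> W' (res X W W' s) z = cfun \<kappa> W s z"
  using \<kappa> by (auto simp: in_chart_def coordinates_def cut_def)

lemma sect_of:
  assumes "svhol (cpt \<kappa> ` W) f"
  shows "sect_of X \<kappa> W f \<in> carrier (sect X W)"
    "z \<in> cpt \<kappa> ` W \<Longrightarrow> cfun \<kappa> W (sect_of X \<kappa> W f) z = f z"
proof -
  have "cut (cpt \<kappa> ` W) f \<in> cfun \<kappa> W ` carrier (sect X W)"
    using cut_in_superfunctions[OF assms] cfun_bij by (simp add: bij_betw_def)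
  then have "cfun \<kappa> W (sect_of X \<kappa> W f) = cut (cpt \<kappa> ` W) f" "sect_of X \<kappa> W f \<in> carrier (sect X W)"
    unfolding sect_of_def by (auto intro: f_inv_into_f inv_into_into)
  then show "sect_of X \<kappa> W f \<in> carrier (sect X W)"
    "z \<in> cpt \<kappa> ` W \<Longrightarrow> cfun \<kappa> W (sect_of X \<kappa> W f) z = f z" by (simp_all add: cut_def)
qed

lemma par_iff: "s \<in> par X p W \<longleftrightarrow> s \<in> carrier (sect X W) \<and>
    (\<forall>z\<in>cpt \<kappa> ` W. svinvol (cfun \<kappa> W s z) = (if p then - cfun \<kappa> W s z else cfun \<kappa> W s z))"
proof -
  have opn: "opn W" using \<kappa> by (rule in_chart_opn)
  have parity: "svinvol (cfun \<kappa> W s z) = (if p then - cfun \<kappa> W s z else cfun \<kappa> W s z)"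
    if "s \<in> par X p W" "z \<in> cpt \<kappa> ` W" for s p z
  proof -
    have "cfun \<kappa> W ` par X p W \<subseteq> superfunction_parity p (cpt \<kappa> ` W)"
      using \<kappa> by (simp add: in_chart_def coordinates_def)
    then have "cfun \<kappa> W s z \<in> sv_parity p" using that by (auto simp: superfunction_parity_def)
    then show ?thesis by (cases p) (simp_all add: sv_parity_even_iff sv_parity_odd_iff)
  qed
  have "s \<in> par X p W" if s: "s \<in> carrier (sect X W)"
    and val: "\<And>z. z \<in> cpt \<kappa> ` W \<Longrightarrow> svinvol (cfun \<kappa> W s z) = (if p then - cfun \<kappa> W s z else cfun \<kappa> W s z)"
  proof -
    interpret R: ring "sect X W" by (rule sect_ring[OF opn])
    obtain a b where ab: "a \<in> par X False W" "b \<in> par X True W" "s = a \<oplus>\<^bsub>sect X W\<^esub> b"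
      using par_decomp[OF opn s] by auto
    have car: "a \<in> carrier (sect X W)" "b \<in> carrier (sect X W)" using ab par_closed opn by auto
    have dbl: "x = 0" if "x = - x" for x :: "'n superval"
      using arg_cong[OF that, of sv0] arg_cong[OF that, of sv1]
      by (intro superval_eqI) (simp_all add: grassmann_double_eq_0)
    have va: "svinvol (cfun \<kappa> W a z) = cfun \<kappa> W a z" and vb: "svinvol (cfun \<kappa> W b z) = - cfun \<kappa> W b z"
      and vs: "cfun \<kappa> W s z = cfun \<kappa> W a z + cfun \<kappa> W b z" if "z \<in> cpt \<kappa> ` W" for z
      using parity[OF ab(1) that] parity[OF ab(2) that] ab(3) cfun_add[OF car] by auto
    show ?thesis
    proof (cases p)
      case True
      have "cfun \<kappa> W a z = 0" if "z \<in> cpt \<kappa> ` W" for z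
      proof (rule dbl)
        have "cfun \<kappa> W a z + - cfun \<kappa> W b z = - cfun \<kappa> W a z + - cfun \<kappa> W b z"
          using val[OF that] True va[OF that] vb[OF that] vs[OF that] by simp
        then show "cfun \<kappa> W a z = - cfun \<kappa> W a z" by (simp only: add_right_cancel)
      qed
      then have "a = \<zero>\<^bsub>sect X W\<^esub>" by (intro cfun_eqI car) (simp_all add: cfun_zero)
      then show ?thesis using ab True car by simp
    next
      case False
      have "cfun \<kappa> W b z = 0" if "z \<in> cpt \<kappa> ` W" for z
      proof (rule dbl)
        have "cfun \<kappa> W a z + - cfun \<kappa> W b z = cfun \<kappa> W a z + cfun \<kappa> W b z"
          using val[OF that] False va[OF that] vb[OF that] vs[OF that] by simp
        then show "cfun \<kappa> W b z = - cfun \<kappa> W b z" by (simp only: add_left_cancel)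
      qed
      then have "b = \<zero>\<^bsub>sect X W\<^esub>" by (intro cfun_eqI car) (simp_all add: cfun_zero)
      then show ?thesis using ab False car by simp
    qed
  qed
  then show ?thesis using parity par_closed[OF opn] by blast
qed

end

lemmas cfun_simps = cfun_add cfun_mult cfun_one cfun_zero cfun_uminus cfun_cube cfun_scalar cfun_res

text \<open>The derivation \<open>D\<^sub>\<kappa>\<close> on sections, and the coordinates as sections.\<close>

definition dsec :: "('p, 's, 'n) superchart \<Rightarrow> 'p set \<Rightarrow> 's \<Rightarrow> 's" where
  "dsec \<kappa> W s = sect_of X \<kappa> W (sD (cfun \<kappa> W s))"

definition zsec :: "('p, 's, 'n) superchart \<Rightarrow> 'p set \<Rightarrow> 's" where
  "zsec \<kappa> W = sect_of X \<kappa> W (\<lambda>z. svconst (gconst z))"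

definition tsec :: "('p, 's, 'n) superchart \<Rightarrow> 'p set \<Rightarrow> 's" where
  "tsec \<kappa> W = sect_of X \<kappa> W (\<lambda>_. sv_theta)"

context
  fixes \<kappa> W assumes \<kappa>: "in_chart \<kappa> W"
begin

lemma dsec:
  assumes "s \<in> carrier (sect X W)"
  shows "dsec \<kappa> W s \<in> carrier (sect X W)"
    "z \<in> cpt \<kappa> ` W \<Longrightarrow> cfun \<kappa> W (dsec \<kappa> W s) z = sD (cfun \<kappa> W s) z"
  unfolding dsec_def using sect_of[OF \<kappa> svhol_sD[OF cfun_hol[OF \<kappa> assms] cpt_open[OF \<kappa>]]] by auto

lemma zsec: "zsec \<kappa> W \<in> carrier (sect X W)"
    "z \<in> cpt \<kappa> ` W \<Longrightarrow> cfun \<kappa> W (zsec \<kappa> W) z = svconst (gconst z)"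
  unfolding zsec_def using sect_of[OF \<kappa> svhol_svconst_gconst[OF holomorphic_on_ident]] by blast+

lemma tsec: "tsec \<kappa> W \<in> carrier (sect X W)"
    "z \<in> cpt \<kappa> ` W \<Longrightarrow> cfun \<kappa> W (tsec \<kappa> W) z = sv_theta"
  unfolding tsec_def using sect_of[OF \<kappa>, of "\<lambda>_. sv_theta"] by auto

lemma zsec_even: "zsec \<kappa> W \<in> par X False W"
  by (simp add: par_iff[OF \<kappa>] zsec)

lemma tsec_odd: "tsec \<kappa> W \<in> par X True W"
  by (simp add: par_iff[OF \<kappa>] tsec)

lemma dsec_parity:
  assumes s: "s \<in> par X p W"
  shows "dsec \<kappa> W s \<in> par X (\<not> p) W"
proof -
  have car: "s \<in> carrier (sect X W)"
    and val: "\<And>z. z \<in> cpt \<kappa> ` W \<Longrightarrow> svinvol (cfun \<kappa> W s z) = (if p then - cfun \<kappa> W s z else cfun \<kappa> W s z)"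
    using s by (auto simp: par_iff[OF \<kappa>])
  have "svinvol (cfun \<kappa> W (dsec \<kappa> W s) z) =
      (if \<not> p then - cfun \<kappa> W (dsec \<kappa> W s) z else cfun \<kappa> W (dsec \<kappa> W s) z)"
    if z: "z \<in> cpt \<kappa> ` W" for z
    using sD_even[OF cfun_hol[OF \<kappa> car] cpt_open[OF \<kappa>] z] sD_odd[OF cfun_hol[OF \<kappa> car] cpt_open[OF \<kappa>] z]
      val dsec(2)[OF car z] by (cases p) simp_all
  then show ?thesis using dsec(1)[OF car] by (auto simp: par_iff[OF \<kappa>])
qed

lemma dsec_tsec: "dsec \<kappa> W (tsec \<kappa> W) = \<one>\<^bsub>sect X W\<^esub>"
proof (rule cfun_eqI[OF \<kappa>])
  show "dsec \<kappa> W (tsec \<kappa> W) \<in> carrier (sect X W)" by (intro dsec tsec)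
  fix z assume z: "z \<in> cpt \<kappa> ` W"
  have "sD (cfun \<kappa> W (tsec \<kappa> W)) z = sD (\<lambda>_. sv_theta) z"
    by (rule sD_cong[OF cpt_open[OF \<kappa>] z]) (rule tsec)
  then show "cfun \<kappa> W (dsec \<kappa> W (tsec \<kappa> W)) z = cfun \<kappa> W \<one>\<^bsub>sect X W\<^esub> z"
    using z by (simp add: dsec tsec cfun_one[OF \<kappa>] superval_eq_iff)
qed (use in_chart_opn \<kappa> in simp)

lemma dsec_zsec: "dsec \<kappa> W (zsec \<kappa> W) = tsec \<kappa> W"
proof (rule cfun_eqI[OF \<kappa>])
  show "dsec \<kappa> W (zsec \<kappa> W) \<in> carrier (sect X W)" by (intro dsec zsec)
  fix z assume z: "z \<in> cpt \<kappa> ` W"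
  have "sD (cfun \<kappa> W (zsec \<kappa> W)) z = sD (\<lambda>z. svconst (gconst z)) z"
    by (rule sD_cong[OF cpt_open[OF \<kappa>] z]) (rule zsec)
  then show "cfun \<kappa> W (dsec \<kappa> W (zsec \<kappa> W)) z = cfun \<kappa> W (tsec \<kappa> W) z"
    using z by (simp add: dsec zsec tsec superval_eq_iff gderiv_gconst)
qed (rule tsec)

end

lemma res_dsec:
  assumes \<kappa>: "in_chart \<kappa> W" and W': "opn W'" "W' \<subseteq> W" and s: "s \<in> carrier (sect X W)"
  shows "res X W W' (dsec \<kappa> W s) = dsec \<kappa> W' (res X W W' s)"
proof -
  have opn: "opn W" and \<kappa>': "in_chart \<kappa> W'"
    using \<kappa> W' by (auto intro: in_chart_opn in_chart_subset)
  have rs: "res X W W' s \<in> carrier (sect X W')" using s W' opn by simp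
  show ?thesis
  proof (rule cfun_eqI[OF \<kappa>'])
    show "res X W W' (dsec \<kappa> W s) \<in> carrier (sect X W')" using dsec(1)[OF \<kappa> s] W' opn by simp
    show "dsec \<kappa> W' (res X W W' s) \<in> carrier (sect X W')" by (rule dsec(1)[OF \<kappa>' rs])
    fix z assume z: "z \<in> cpt \<kappa> ` W'"
    then have zW: "z \<in> cpt \<kappa> ` W" using W' by blast
    have "sD (cfun \<kappa> W s) z = sD (cfun \<kappa> W' (res X W W' s)) z"
      by (rule sD_cong[OF cpt_open[OF \<kappa>'] z]) (simp add: cfun_res[OF \<kappa> W' s])
    then show "cfun \<kappa> W' (res X W W' (dsec \<kappa> W s)) z = cfun \<kappa> W' (dsec \<kappa> W' (res X W W' s)) z"
      using cfun_res[OF \<kappa> W' dsec(1)[OF \<kappa> s] z] dsec(2)[OF \<kappa> s zW] dsec(2)[OF \<kappa>' rs z] by simp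
  qed
qed

lemma res_zsec:
  assumes \<kappa>: "in_chart \<kappa> W" and W': "opn W'" "W' \<subseteq> W"
  shows "res X W W' (zsec \<kappa> W) = zsec \<kappa> W'" "res X W W' (tsec \<kappa> W) = tsec \<kappa> W'"
proof -
  have opn: "opn W" and \<kappa>': "in_chart \<kappa> W'"
    using \<kappa> W' by (auto intro: in_chart_opn in_chart_subset)
  have "z \<in> cpt \<kappa> ` W" if "z \<in> cpt \<kappa> ` W'" for z using that W' by blast
  then show "res X W W' (zsec \<kappa> W) = zsec \<kappa> W'" "res X W W' (tsec \<kappa> W) = tsec \<kappa> W'"
    using opn W' zsec[OF \<kappa>] zsec[OF \<kappa>'] tsec[OF \<kappa>] tsec[OF \<kappa>'] cfun_res[OF \<kappa> W']
    by (auto intro!: cfun_eqI[OF \<kappa>'])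
qed


section \<open>The chain rule and superconformal changes of coordinates\<close>

text \<open>Superconformality of the coordinates \<open>\<beta>\<close> relative to \<open>\<alpha>\<close> on \<open>W\<close>: \<open>D\<^sub>\<alpha> z\<^sub>\<beta> = \<theta>\<^sub>\<beta> D\<^sub>\<alpha> \<theta>\<^sub>\<beta>\<close>.\<close>

definition conf :: "('p, 's, 'n) superchart \<Rightarrow> ('p, 's, 'n) superchart \<Rightarrow> 'p set \<Rightarrow> bool" where
  "conf \<beta> \<alpha> W \<longleftrightarrow> dsec \<alpha> W (zsec \<beta> W) = tsec \<beta> W \<otimes>\<^bsub>sect X W\<^esub> dsec \<alpha> W (tsec \<beta> W)"

text \<open>
  At a point of coordinate \<open>c\<close>, write \<open>s = a + \<theta>\<^sub>\<beta> b + (z\<^sub>\<beta> - c) g\<close> with constants \<open>a\<close>, \<open>b\<close>. Both sides of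
  the chain rule are derivations with the same values at \<open>z\<^sub>\<beta>\<close> and \<open>\<theta>\<^sub>\<beta>\<close>, and the term
  \<open>(z\<^sub>\<beta> - c) D\<^sub>\<alpha> g\<close> vanishes at the point. So no formula for the composition of superfunctions is
  involved.
\<close>

theorem chain_rule:
  assumes \<alpha>: "in_chart \<alpha> W" and \<beta>: "in_chart \<beta> W" and conf: "conf \<beta> \<alpha> W" and s: "s \<in> carrier (sect X W)"
  shows "dsec \<alpha> W s = dsec \<alpha> W (tsec \<beta> W) \<otimes>\<^bsub>sect X W\<^esub> dsec \<beta> W s"
proof (rule cfun_eqI[OF \<beta>])
  let ?R = "sect X W" and ?A = "cfun \<alpha> W" and ?B = "cfun \<beta> W"
  have opn [simp]: "opn W" using \<alpha> by (rule in_chart_opn)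
  have [simp]: "tsec \<beta> W \<in> carrier ?R" "zsec \<beta> W \<in> carrier ?R" using tsec zsec \<beta> by auto
  have dA [simp]: "dsec \<alpha> W t \<in> carrier ?R" if "t \<in> carrier ?R" for t using dsec(1)[OF \<alpha> that] .
  have dB [simp]: "dsec \<beta> W t \<in> carrier ?R" if "t \<in> carrier ?R" for t using dsec(1)[OF \<beta> that] .
  define J where "J = dsec \<alpha> W (tsec \<beta> W)"
  have J [simp]: "J \<in> carrier ?R" by (simp add: J_def)
  show "dsec \<alpha> W s \<in> carrier ?R" "dsec \<alpha> W (tsec \<beta> W) \<otimes>\<^bsub>?R\<^esub> dsec \<beta> W s \<in> carrier ?R" using s by simp_all
  fix c assume c: "c \<in> cpt \<beta> ` W"
  have VB: "open (cpt \<beta> ` W)" and VA: "open (cpt \<alpha> ` W)" using cpt_open \<alpha> \<beta> by auto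
  obtain g where g: "svhol (cpt \<beta> ` W) g" "\<And>w. ?B s w - ?B s c = svconst (gconst (w - c)) * g w"
    "sD (?B s) c = svconst (sv1 (?B s c)) + sv_theta * g c"
    using holomorphic_difference_quotient[OF cfun_hol[OF \<beta> s] VB c] by blast
  define a b where "a = sv0 (?B s c)" and "b = sv1 (?B s c)"
  define q where "q = sect_of X \<beta> W g"
  have q [simp]: "q \<in> carrier ?R" unfolding q_def by (rule sect_of(1)[OF \<beta> g(1)])
  have Bq: "?B q w = g w" if "w \<in> cpt \<beta> ` W" for w
    unfolding q_def by (rule sect_of(2)[OF \<beta> g(1) that])
  define u where "u = zsec \<beta> W \<oplus>\<^bsub>?R\<^esub> scalar X W (gconst (- c))"
  have u [simp]: "u \<in> carrier ?R" by (simp add: u_def)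
  note B = cfun_simps[OF \<beta>] and A = cfun_simps[OF \<alpha>]
  have split: "s = scalar X W a \<oplus>\<^bsub>?R\<^esub> (tsec \<beta> W \<otimes>\<^bsub>?R\<^esub> scalar X W b \<oplus>\<^bsub>?R\<^esub> u \<otimes>\<^bsub>?R\<^esub> q)"
  proof (rule cfun_eqI[OF \<beta> s])
    fix w assume w: "w \<in> cpt \<beta> ` W"
    have "?B s w = ?B s c + svconst (gconst (w - c)) * g w" using g(2)[of w] by (simp add: algebra_simps)
    also have "?B s c = svconst a + sv_theta * svconst b"
      unfolding a_def b_def by (rule superval_split)
    finally show "?B s w = ?B (scalar X W a \<oplus>\<^bsub>?R\<^esub> (tsec \<beta> W \<otimes>\<^bsub>?R\<^esub> scalar X W b \<oplus>\<^bsub>?R\<^esub> u \<otimes>\<^bsub>?R\<^esub> q)) w"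
      using w by (simp add: B u_def zsec(2)[OF \<beta>] tsec(2)[OF \<beta>] Bq gconst_hom svconst_hom add.assoc)
  qed simp
  have evF: "svinvol (?A (zsec \<beta> W) z) = ?A (zsec \<beta> W) z" and od\<Psi>: "svinvol (?A (tsec \<beta> W) z) = - ?A (tsec \<beta> W) z"
    and evJ: "svinvol (?A J z) = ?A J z" if "z \<in> cpt \<alpha> ` W" for z
    using zsec_even[OF \<beta>] tsec_odd[OF \<beta>] dsec_parity[OF \<alpha> tsec_odd[OF \<beta>]] that
    by (auto simp: par_iff[OF \<alpha>] J_def)
  have DF: "sD (?A (zsec \<beta> W)) z = ?A (tsec \<beta> W) z * ?A J z" and D\<Psi>: "sD (?A (tsec \<beta> W)) z = ?A J z"
    if z: "z \<in> cpt \<alpha> ` W" for z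
  proof -
    show "sD (?A (tsec \<beta> W)) z = ?A J z" using dsec(2)[OF \<alpha> _ z, of "tsec \<beta> W"] by (simp add: J_def)
    show "sD (?A (zsec \<beta> W)) z = ?A (tsec \<beta> W) z * ?A J z"
      using dsec(2)[OF \<alpha> _ z, of "zsec \<beta> W"] conf by (simp add: conf_def A flip: J_def)
  qed
  have "dsec \<alpha> W s = J \<otimes>\<^bsub>?R\<^esub> scalar X W b \<oplus>\<^bsub>?R\<^esub>
      (tsec \<beta> W \<otimes>\<^bsub>?R\<^esub> J \<otimes>\<^bsub>?R\<^esub> q \<oplus>\<^bsub>?R\<^esub> u \<otimes>\<^bsub>?R\<^esub> dsec \<alpha> W q)"
  proof (rule cfun_eqI[OF \<alpha>])
    fix z assume z: "z \<in> cpt \<alpha> ` W"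
    let ?F = "?A (zsec \<beta> W)" and ?\<Psi> = "?A (tsec \<beta> W)"
    have hol: "svhol (cpt \<alpha> ` W) ?F" "svhol (cpt \<alpha> ` W) ?\<Psi>" "svhol (cpt \<alpha> ` W) (?A q)"
      using cfun_hol[OF \<alpha>] by auto
    have "sD (?A s) z = sD (\<lambda>z. svconst a + (?\<Psi> z * svconst b + (?F z + svconst (gconst (- c))) * ?A q z)) z"
      by (rule sD_cong[OF VA z], subst split) (simp add: A u_def)
    also have "\<dots> = sD (\<lambda>z. svconst a) z +
        sD (\<lambda>z. ?\<Psi> z * svconst b + (?F z + svconst (gconst (- c))) * ?A q z) z"
      by (intro sD_add[where V = "cpt \<alpha> ` W"] svhol_intros hol VA z)
    also have "sD (\<lambda>z. ?\<Psi> z * svconst b + (?F z + svconst (gconst (- c))) * ?A q z) z =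
        sD (\<lambda>z. ?\<Psi> z * svconst b) z + sD (\<lambda>z. (?F z + svconst (gconst (- c))) * ?A q z) z"
      by (intro sD_add[where V = "cpt \<alpha> ` W"] svhol_intros hol VA z)
    also have "sD (\<lambda>z. ?\<Psi> z * svconst b) z = sD ?\<Psi> z * svconst b + svinvol (?\<Psi> z) * sD (\<lambda>z. svconst b) z"
      by (intro sD_mult[where V = "cpt \<alpha> ` W"] svhol_intros hol VA z)
    also have "sD (\<lambda>z. (?F z + svconst (gconst (- c))) * ?A q z) z =
        sD (\<lambda>z. ?F z + svconst (gconst (- c))) z * ?A q z +
          svinvol (?F z + svconst (gconst (- c))) * sD (?A q) z"
      by (intro sD_mult[where V = "cpt \<alpha> ` W"] svhol_intros hol VA z)
    also have "sD (\<lambda>z. ?F z + svconst (gconst (- c))) z = sD ?F z + sD (\<lambda>z. svconst (gconst (- c))) z"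
      by (intro sD_add[where V = "cpt \<alpha> ` W"] svhol_intros hol VA z)
    finally have "sD (?A s) z = ?A J z * svconst b + (?\<Psi> z * ?A J z * ?A q z +
        (?F z + svconst (gconst (- c))) * sD (?A q) z)"
      using DF[OF z] D\<Psi>[OF z] evF[OF z] by simp
    then show "?A (dsec \<alpha> W s) z = ?A (J \<otimes>\<^bsub>?R\<^esub> scalar X W b \<oplus>\<^bsub>?R\<^esub>
        (tsec \<beta> W \<otimes>\<^bsub>?R\<^esub> J \<otimes>\<^bsub>?R\<^esub> q \<oplus>\<^bsub>?R\<^esub> u \<otimes>\<^bsub>?R\<^esub> dsec \<alpha> W q)) z"
      using z dsec(2)[OF \<alpha> s z] dsec(2)[OF \<alpha> q z] by (simp add: A u_def)
  qed (use s in simp_all)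
  then have "?B (dsec \<alpha> W s) c = ?B J c * svconst b + sv_theta * ?B J c * g c"
    using c by (simp add: B u_def zsec(2)[OF \<beta>] tsec(2)[OF \<beta>] Bq gconst_hom svconst_hom)
  also have "sv_theta * ?B J c = ?B J c * sv_theta"
  proof -
    have "J \<in> par X False W" using dsec_parity[OF \<alpha> tsec_odd[OF \<beta>]] by (simp add: J_def)
    then have "svinvol (?B J c) = ?B J c" using c by (auto simp: par_iff[OF \<beta>])
    then show ?thesis using S.even_central by metis
  qed
  also have "?B J c * svconst b + ?B J c * sv_theta * g c = ?B J c * sD (?B s) c"
    unfolding g(3) b_def by (simp add: distrib_left mult.assoc)
  finally show "?B (dsec \<alpha> W s) c = ?B (dsec \<alpha> W (tsec \<beta> W) \<otimes>\<^bsub>?R\<^esub> dsec \<beta> W s) c"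
    using c s dsec(2)[OF \<beta> s c] by (simp add: B flip: J_def)
qed

lemma even_commute_sect:
  assumes "opn W" "a \<in> par X False W" "b \<in> carrier (sect X W)"
  shows "a \<otimes>\<^bsub>sect X W\<^esub> b = b \<otimes>\<^bsub>sect X W\<^esub> a"
proof -
  interpret R: ring "sect X W" by (rule sect_ring[OF assms(1)])
  obtain b0 b1 where b: "b0 \<in> par X False W" "b1 \<in> par X True W" "b = b0 \<oplus>\<^bsub>sect X W\<^esub> b1"
    using par_decomp[OF assms(1,3)] by auto
  have "a \<in> carrier (sect X W)" "b0 \<in> carrier (sect X W)" "b1 \<in> carrier (sect X W)"
    using par_closed[OF assms(1)] assms(2) b by auto
  then show ?thesis
    using supercommutative[OF assms(1,2) b(1)] supercommutative[OF assms(1,2) b(2)]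
    by (simp add: b(3) R.l_distr R.r_distr)
qed

context
  fixes \<alpha> \<beta> W
  assumes \<alpha>: "in_chart \<alpha> W" and \<beta>: "in_chart \<beta> W" and conf: "conf \<beta> \<alpha> W"
begin

lemma jacobian_even: "dsec \<alpha> W (tsec \<beta> W) \<in> par X False W"
  using dsec_parity[OF \<alpha> tsec_odd[OF \<beta>]] by simp

lemma jacobian_inverse:
  "dsec \<alpha> W (tsec \<beta> W) \<otimes>\<^bsub>sect X W\<^esub> dsec \<beta> W (tsec \<alpha> W) = \<one>\<^bsub>sect X W\<^esub>"
  "dsec \<beta> W (tsec \<alpha> W) \<otimes>\<^bsub>sect X W\<^esub> dsec \<alpha> W (tsec \<beta> W) = \<one>\<^bsub>sect X W\<^esub>"
proof -
  have opn: "opn W" using \<alpha> by (rule in_chart_opn)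
  show 1: "dsec \<alpha> W (tsec \<beta> W) \<otimes>\<^bsub>sect X W\<^esub> dsec \<beta> W (tsec \<alpha> W) = \<one>\<^bsub>sect X W\<^esub>"
    using chain_rule[OF \<alpha> \<beta> conf tsec(1)[OF \<alpha>]] dsec_tsec[OF \<alpha>] by simp
  show "dsec \<beta> W (tsec \<alpha> W) \<otimes>\<^bsub>sect X W\<^esub> dsec \<alpha> W (tsec \<beta> W) = \<one>\<^bsub>sect X W\<^esub>"
    using 1 even_commute_sect[OF opn jacobian_even dsec(1)[OF \<beta> tsec(1)[OF \<alpha>]]] by simp
qed

lemma conf_sym: "conf \<alpha> \<beta> W"
proof -
  let ?R = "sect X W" and ?J = "dsec \<alpha> W (tsec \<beta> W)" and ?K = "dsec \<beta> W (tsec \<alpha> W)"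
  have opn: "opn W" using \<alpha> by (rule in_chart_opn)
  interpret R: ring ?R by (rule sect_ring[OF opn])
  have car: "?J \<in> carrier ?R" "?K \<in> carrier ?R" "dsec \<beta> W (zsec \<alpha> W) \<in> carrier ?R" "tsec \<alpha> W \<in> carrier ?R"
    using dsec(1)[OF \<alpha>] dsec(1)[OF \<beta>] tsec(1)[OF \<alpha>] tsec(1)[OF \<beta>] zsec(1)[OF \<alpha>] by auto
  have "?J \<otimes>\<^bsub>?R\<^esub> dsec \<beta> W (zsec \<alpha> W) = tsec \<alpha> W"
    using chain_rule[OF \<alpha> \<beta> conf zsec(1)[OF \<alpha>]] dsec_zsec[OF \<alpha>] by simp
  then have "?K \<otimes>\<^bsub>?R\<^esub> (?J \<otimes>\<^bsub>?R\<^esub> dsec \<beta> W (zsec \<alpha> W)) = ?K \<otimes>\<^bsub>?R\<^esub> tsec \<alpha> W" by simp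
  then have "dsec \<beta> W (zsec \<alpha> W) = ?K \<otimes>\<^bsub>?R\<^esub> tsec \<alpha> W"
    using car jacobian_inverse(2) by (simp flip: R.m_assoc)
  also have "\<dots> = tsec \<alpha> W \<otimes>\<^bsub>?R\<^esub> ?K"
    using even_commute_sect[OF opn _ car(4)] dsec_parity[OF \<beta> tsec_odd[OF \<alpha>]] by simp
  finally show ?thesis by (simp add: conf_def)
qed

end

lemma conf_trans:
  assumes \<alpha>: "in_chart \<alpha> W" and \<beta>: "in_chart \<beta> W" and \<gamma>: "in_chart \<gamma> W"
    and conf: "conf \<gamma> \<beta> W" "conf \<beta> \<alpha> W"
  shows "conf \<gamma> \<alpha> W"
proof -
  let ?R = "sect X W" and ?J = "dsec \<alpha> W (tsec \<beta> W)"
  have opn: "opn W" using \<alpha> by (rule in_chart_opn)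
  interpret R: ring ?R by (rule sect_ring[OF opn])
  have car: "?J \<in> carrier ?R" "tsec \<gamma> W \<in> carrier ?R" "dsec \<beta> W (tsec \<gamma> W) \<in> carrier ?R"
    using dsec(1)[OF \<alpha>] dsec(1)[OF \<beta>] tsec(1)[OF \<beta>] tsec(1)[OF \<gamma>] by auto
  have "dsec \<alpha> W (zsec \<gamma> W) = ?J \<otimes>\<^bsub>?R\<^esub> (tsec \<gamma> W \<otimes>\<^bsub>?R\<^esub> dsec \<beta> W (tsec \<gamma> W))"
    using chain_rule[OF \<alpha> \<beta> conf(2) zsec(1)[OF \<gamma>]] conf(1) by (simp add: conf_def)
  also have "\<dots> = tsec \<gamma> W \<otimes>\<^bsub>?R\<^esub> (?J \<otimes>\<^bsub>?R\<^esub> dsec \<beta> W (tsec \<gamma> W))"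
    using car even_commute_sect[OF opn jacobian_even[OF \<alpha> \<beta> conf(2)] car(2)]
    by (simp flip: R.m_assoc)
  also have "\<dots> = tsec \<gamma> W \<otimes>\<^bsub>?R\<^esub> dsec \<alpha> W (tsec \<gamma> W)"
    using chain_rule[OF \<alpha> \<beta> conf(2) tsec(1)[OF \<gamma>]] by simp
  finally show ?thesis by (simp add: conf_def)
qed

lemma conf_refl: "in_chart \<alpha> W \<Longrightarrow> conf \<alpha> \<alpha> W"
proof -
  assume \<alpha>: "in_chart \<alpha> W"
  interpret R: ring "sect X W" using sect_ring in_chart_opn \<alpha> by blast
  show ?thesis using tsec(1)[OF \<alpha>] by (simp add: conf_def dsec_zsec[OF \<alpha>] dsec_tsec[OF \<alpha>])
qed

lemma conf_subset:
  assumes "in_chart \<alpha> W" "in_chart \<beta> W" "conf \<beta> \<alpha> W" "opn W'" "W' \<subseteq> W"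
  shows "conf \<beta> \<alpha> W'"
proof -
  have opn: "opn W" using assms(1) by (rule in_chart_opn)
  have car: "tsec \<beta> W \<in> carrier (sect X W)" "zsec \<beta> W \<in> carrier (sect X W)"
    using tsec(1)[OF assms(2)] zsec(1)[OF assms(2)] by auto
  have "res X W W' (dsec \<alpha> W (zsec \<beta> W)) = res X W W' (tsec \<beta> W \<otimes>\<^bsub>sect X W\<^esub> dsec \<alpha> W (tsec \<beta> W))"
    using assms(3) by (simp add: conf_def)
  then show ?thesis
    using car opn assms(4,5) dsec(1)[OF assms(1)]
    by (simp add: conf_def res_dsec[OF assms(1)] res_zsec[OF assms(2)])
qed

lemma sect_local_eqI:
  assumes "opn U" "s \<in> carrier (sect X U)" "t \<in> carrier (sect X U)"
    and "\<And>x. x \<in> U \<Longrightarrow> \<exists>W. opn W \<and> x \<in> W \<and> W \<subseteq> U \<and> res X U W s = res X U W t"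
  shows "s = t"
proof -
  define \<U> where "\<U> = {W. opn W \<and> W \<subseteq> U \<and> res X U W s = res X U W t}"
  have "\<Union>\<U> = U" using assms(4) by (fastforce simp: \<U>_def)
  then show ?thesis
    using sheaf_locality[of \<U> s t] assms(2,3) by (auto simp: \<U>_def)
qed

lemma conf_local:
  assumes \<alpha>: "in_chart \<alpha> W" and \<beta>: "in_chart \<beta> W"
    and loc: "\<And>x. x \<in> W \<Longrightarrow> \<exists>W'. opn W' \<and> x \<in> W' \<and> W' \<subseteq> W \<and> conf \<beta> \<alpha> W'"
  shows "conf \<beta> \<alpha> W"
proof -
  have opn: "opn W" using \<alpha> by (rule in_chart_opn)
  have car: "tsec \<beta> W \<in> carrier (sect X W)" "zsec \<beta> W \<in> carrier (sect X W)"
    using tsec(1)[OF \<beta>] zsec(1)[OF \<beta>] by auto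
  show ?thesis
    unfolding conf_def
  proof (rule sect_local_eqI[OF opn])
    fix x assume "x \<in> W"
    then obtain W' where W': "opn W'" "x \<in> W'" "W' \<subseteq> W" "conf \<beta> \<alpha> W'" using loc by blast
    then have "res X W W' (dsec \<alpha> W (zsec \<beta> W)) = res X W W' (tsec \<beta> W \<otimes>\<^bsub>sect X W\<^esub> dsec \<alpha> W (tsec \<beta> W))"
      using car opn dsec(1)[OF \<alpha>]
      by (simp add: conf_def res_dsec[OF \<alpha>] res_zsec[OF \<beta>])
    then show "\<exists>W'. opn W' \<and> x \<in> W' \<and> W' \<subseteq> W \<and> res X W W' (dsec \<alpha> W (zsec \<beta> W)) =
        res X W W' (tsec \<beta> W \<otimes>\<^bsub>sect X W\<^esub> dsec \<alpha> W (tsec \<beta> W))"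
      using W' by blast
  qed (use car opn dsec(1)[OF \<alpha>] in simp_all)
qed

context
  fixes \<alpha> \<beta>
  assumes \<alpha>: "\<alpha> \<in> coordinates X" and \<beta>: "\<beta> \<in> coordinates X"
begin

lemma overlap_in_chart: "in_chart \<alpha> (cdom \<alpha> \<inter> cdom \<beta>)" "in_chart \<beta> (cdom \<alpha> \<inter> cdom \<beta>)"
  using \<alpha> \<beta> coordinates_opn by (auto simp: in_chart_def)

lemma coord_sections:
  "coord_sect_z X \<beta> = zsec \<beta> (cdom \<beta>)" "coord_sect_theta X \<beta> = tsec \<beta> (cdom \<beta>)"
  by (simp_all add: coord_sect_z_def coord_sect_theta_def zsec_def tsec_def sect_of_def coord_z_def
    coord_theta_def)

lemma trans_F_Psi:
  "trans_F X \<beta> \<alpha> = cfun \<alpha> (cdom \<alpha> \<inter> cdom \<beta>) (zsec \<beta> (cdom \<alpha> \<inter> cdom \<beta>))"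
  "trans_Psi X \<beta> \<alpha> = cfun \<alpha> (cdom \<alpha> \<inter> cdom \<beta>) (tsec \<beta> (cdom \<alpha> \<inter> cdom \<beta>))"
proof -
  have "in_chart \<beta> (cdom \<beta>)" using \<beta> coordinates_opn by (auto simp: in_chart_def)
  note r = res_zsec[OF this in_chart_opn[OF overlap_in_chart(1)] Int_lower2]
  show "trans_F X \<beta> \<alpha> = cfun \<alpha> (cdom \<alpha> \<inter> cdom \<beta>) (zsec \<beta> (cdom \<alpha> \<inter> cdom \<beta>))"
    "trans_Psi X \<beta> \<alpha> = cfun \<alpha> (cdom \<alpha> \<inter> cdom \<beta>) (tsec \<beta> (cdom \<alpha> \<inter> cdom \<beta>))"
    by (simp_all add: trans_F_def trans_Psi_def coord_sections r)
qed

lemma superconformal_transition_iff: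
  "superconformal_transition X \<beta> \<alpha> \<longleftrightarrow> conf \<beta> \<alpha> (cdom \<alpha> \<inter> cdom \<beta>)"
proof -
  let ?O = "cdom \<alpha> \<inter> cdom \<beta>"
  let ?R = "sect X ?O"
  note O = overlap_in_chart
  have opn: "opn ?O" using O(1) by (rule in_chart_opn)
  have car: "tsec \<beta> ?O \<in> carrier ?R" "zsec \<beta> ?O \<in> carrier ?R" using tsec(1)[OF O(2)] zsec(1)[OF O(2)] by auto
  have "conf \<beta> \<alpha> ?O \<longleftrightarrow> (\<forall>z\<in>cpt \<alpha> ` ?O. cfun \<alpha> ?O (dsec \<alpha> ?O (zsec \<beta> ?O)) z =
      cfun \<alpha> ?O (tsec \<beta> ?O \<otimes>\<^bsub>?R\<^esub> dsec \<alpha> ?O (tsec \<beta> ?O)) z)"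
    unfolding conf_def using cfun_eqI[OF O(1)] car dsec(1)[OF O(1)] opn
    by (metis sect_closed(4))
  also have "\<dots> \<longleftrightarrow> superconformal_transition X \<beta> \<alpha>"
    unfolding superconformal_transition_def overlap_image_def trans_DPsi_def trans_F_Psi
    using car dsec[OF O(1)] by (intro ball_cong refl) (simp add: cfun_mult[OF O(1)] superD_eq)
  finally show ?thesis by simp
qed

end

end


section \<open>Compatible coordinates\<close>

lemma sD3_cong:
  assumes "open V" "z \<in> V" "\<And>w. w \<in> V \<Longrightarrow> f w = g w"
  shows "sD (sD (sD f)) z = sD (sD (sD g)) z"
proof -
  have 1: "sD f w = sD g w" if "w \<in> V" for w by (rule sD_cong[OF assms(1) that assms(3)])
  have 2: "sD (sD f) w = sD (sD g) w" if "w \<in> V" for w by (rule sD_cong[OF assms(1) that 1])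
  show ?thesis by (rule sD_cong[OF assms(1,2) 2])
qed

context superconformal_curve
begin

lemma compatible_coordinates: "\<kappa> \<in> compatible X \<Longrightarrow> \<kappa> \<in> coordinates X"
  by (simp add: compatible_def superconformal_atlas_def)

lemma atlas_compatible: "\<kappa> \<in> sc_atlas X \<Longrightarrow> \<kappa> \<in> compatible X"
  using atlas by (simp add: compatible_def insert_absorb)

lemma atlas_cover: "x \<in> topspace (space_of X) \<Longrightarrow> \<exists>\<kappa>\<in>sc_atlas X. x \<in> cdom \<kappa>"
  using atlas by (auto simp: superconformal_atlas_def)

lemma compatible_in_chart: "\<kappa> \<in> compatible X \<Longrightarrow> in_chart \<kappa> W \<longleftrightarrow> opn W \<and> W \<subseteq> cdom \<kappa>"
  using compatible_coordinates by (auto simp: in_chart_def)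

lemma compatible_opn: "\<kappa> \<in> compatible X \<Longrightarrow> opn (cdom \<kappa>)"
  using compatible_coordinates coordinates_opn by blast

text \<open>
  Compatibility refers to the given atlas, so two compatible systems are compared through a member of
  the atlas near each point.
\<close>

lemma compatible_conf:
  assumes \<alpha>: "\<alpha> \<in> compatible X" and \<beta>: "\<beta> \<in> compatible X" and W: "opn W" "W \<subseteq> cdom \<alpha>" "W \<subseteq> cdom \<beta>"
  shows "conf \<beta> \<alpha> W"
proof (rule conf_local)
  show "in_chart \<alpha> W" "in_chart \<beta> W" using \<alpha> \<beta> W by (simp_all add: compatible_in_chart)
  fix x assume x: "x \<in> W"
  then have "x \<in> topspace (space_of X)" using W(1) openin_subset by blast
  then obtain \<kappa> where \<kappa>: "\<kappa> \<in> sc_atlas X" "x \<in> cdom \<kappa>" using atlas_cover by blast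
  note coord = compatible_coordinates[OF \<alpha>] compatible_coordinates[OF \<beta>]
    compatible_coordinates[OF atlas_compatible[OF \<kappa>(1)]]
  have "superconformal_transition X \<kappa> \<alpha>" "superconformal_transition X \<beta> \<kappa>"
    using \<alpha> \<beta> \<kappa>(1) by (auto simp: compatible_def superconformal_atlas_def)
  then have c: "conf \<kappa> \<alpha> (cdom \<alpha> \<inter> cdom \<kappa>)" "conf \<beta> \<kappa> (cdom \<kappa> \<inter> cdom \<beta>)"
    using coord by (simp_all add: superconformal_transition_iff)
  have W': "opn (W \<inter> cdom \<kappa>)" using W(1) coordinates_opn[OF coord(3)] by blast
  have "conf \<kappa> \<alpha> (W \<inter> cdom \<kappa>)"
    by (rule conf_subset[OF overlap_in_chart[OF coord(1,3)] c(1) W']) (use W in auto)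
  moreover have "conf \<beta> \<kappa> (W \<inter> cdom \<kappa>)"
    by (rule conf_subset[OF overlap_in_chart[OF coord(3,2)] c(2) W']) (use W in auto)
  ultimately have "conf \<beta> \<alpha> (W \<inter> cdom \<kappa>)"
    using coord W W' by (intro conf_trans[of \<alpha> _ \<kappa> \<beta>]) (auto simp: in_chart_def)
  then show "\<exists>W'. opn W' \<and> x \<in> W' \<and> W' \<subseteq> W \<and> conf \<beta> \<alpha> W'" using W' x \<kappa>(2) by blast
qed

lemma compatibleI:
  assumes \<beta>: "\<beta> \<in> coordinates X"
    and conf: "\<And>\<kappa>. \<kappa> \<in> sc_atlas X \<Longrightarrow> conf \<kappa> \<beta> (cdom \<kappa> \<inter> cdom \<beta>)"
  shows "\<beta> \<in> compatible X"
proof -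
  have "superconformal_transition X \<kappa> \<beta>" "superconformal_transition X \<beta> \<kappa>"
    if \<kappa>: "\<kappa> \<in> sc_atlas X" for \<kappa>
  proof -
    note coord = compatible_coordinates[OF atlas_compatible[OF \<kappa>]] \<beta>
    note O = overlap_in_chart[OF coord]
    show "superconformal_transition X \<kappa> \<beta>"
      using conf[OF \<kappa>] coord by (simp add: superconformal_transition_iff Int_commute)
    show "superconformal_transition X \<beta> \<kappa>"
      using conf_sym[OF O(2,1) conf[OF \<kappa>]] coord by (simp add: superconformal_transition_iff)
  qed
  moreover have "superconformal_transition X \<beta> \<beta>"
    using conf_refl \<beta> coordinates_opn by (auto simp: superconformal_transition_iff in_chart_def)
  ultimately have "superconformal_atlas X (insert \<beta> (sc_atlas X))"
    using atlas \<beta> openin_subset[OF coordinates_opn[OF \<beta>]] by (auto simp: superconformal_atlas_def)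
  then show ?thesis by (simp add: compatible_def)
qed

definition in_charts :: "('p, 's, 'n) superchart \<Rightarrow> ('p, 's, 'n) superchart \<Rightarrow> 'p set \<Rightarrow> bool" where
  "in_charts \<alpha> \<beta> W \<longleftrightarrow> \<alpha> \<in> compatible X \<and> \<beta> \<in> compatible X \<and> opn W \<and> W \<subseteq> cdom \<alpha> \<and> W \<subseteq> cdom \<beta>"

lemma in_charts_sym: "in_charts \<alpha> \<beta> W \<Longrightarrow> in_charts \<beta> \<alpha> W"
  by (auto simp: in_charts_def)

lemma in_chartsD: "in_charts \<alpha> \<beta> W \<Longrightarrow> in_chart \<alpha> W" "in_charts \<alpha> \<beta> W \<Longrightarrow> in_chart \<beta> W"
    "in_charts \<alpha> \<beta> W \<Longrightarrow> conf \<beta> \<alpha> W" "in_charts \<alpha> \<beta> W \<Longrightarrow> opn W"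
  using compatible_conf compatible_in_chart by (auto simp: in_charts_def)

context
  fixes \<alpha> \<beta> W assumes W: "in_charts \<alpha> \<beta> W"
begin

lemma overlap: "in_charts \<alpha> \<beta> (cdom \<alpha> \<inter> cdom \<beta>)" "W \<subseteq> cdom \<alpha> \<inter> cdom \<beta>"
  using W compatible_opn by (auto simp: in_charts_def)

lemma trans_DPsi_eq: "trans_DPsi X \<beta> \<alpha> =
    cfun \<alpha> (cdom \<alpha> \<inter> cdom \<beta>) (dsec \<alpha> (cdom \<alpha> \<inter> cdom \<beta>) (tsec \<beta> (cdom \<alpha> \<inter> cdom \<beta>)))"
proof
  fix z
  let ?O = "cdom \<alpha> \<inter> cdom \<beta>"
  note O = in_chartsD[OF overlap(1)]
  have coord: "\<alpha> \<in> coordinates X" "\<beta> \<in> coordinates X"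
    using W compatible_coordinates by (auto simp: in_charts_def)
  have "dsec \<alpha> ?O (tsec \<beta> ?O) \<in> carrier (sect X ?O)"
    using dsec(1)[OF O(1)] tsec(1)[OF O(2)] by blast
  then show "trans_DPsi X \<beta> \<alpha> z = cfun \<alpha> ?O (dsec \<alpha> ?O (tsec \<beta> ?O)) z"
    using dsec(2)[OF O(1) tsec(1)[OF O(2)]] cfun_outside[OF O(1)]
    by (simp add: trans_DPsi_def overlap_image_def trans_F_Psi[OF coord] superD_eq)
qed

lemma sect_of_cong:
  assumes "s \<in> carrier (sect X W)" "\<And>z. z \<in> cpt \<alpha> ` W \<Longrightarrow> f z = cfun \<alpha> W s z"
  shows "sect_of X \<alpha> W f = s"
proof (rule cfun_eqI[OF in_chartsD(1)[OF W]])
  have "svhol (cpt \<alpha> ` W) f"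
    using cfun_hol[OF in_chartsD(1)[OF W] assms(1)] assms(2) by (simp cong: svhol_cong)
  then show "sect_of X \<alpha> W f \<in> carrier (sect X W)"
    "z \<in> cpt \<alpha> ` W \<Longrightarrow> cfun \<alpha> W (sect_of X \<alpha> W f) z = cfun \<alpha> W s z" for z
    using sect_of[OF in_chartsD(1)[OF W]] assms(2) by auto
qed (rule assms)

lemma jac_eq: "jac X \<beta> \<alpha> W = dsec \<alpha> W (tsec \<beta> W)"
proof -
  let ?O = "cdom \<alpha> \<inter> cdom \<beta>"
  note O = in_chartsD[OF overlap(1)] and W' = in_chartsD[OF W]
  have car: "dsec \<alpha> ?O (tsec \<beta> ?O) \<in> carrier (sect X ?O)" "tsec \<beta> ?O \<in> carrier (sect X ?O)"
    using dsec(1)[OF O(1)] tsec(1)[OF O(2)] by auto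
  have "res X ?O W (dsec \<alpha> ?O (tsec \<beta> ?O)) = dsec \<alpha> W (tsec \<beta> W)"
    using res_dsec[OF O(1) W'(4) overlap(2) car(2)] res_zsec[OF O(2) W'(4) overlap(2)] by simp
  then show ?thesis
    unfolding jac_def trans_DPsi_eq
    using dsec(1)[OF W'(1) tsec(1)[OF W'(2)]] cfun_res[OF O(1) W'(4) overlap(2) car(1)]
    by (intro sect_of_cong) simp_all
qed

lemma jac_par: "jac X \<beta> \<alpha> W \<in> par X False W"
  unfolding jac_eq using jacobian_even in_chartsD[OF W] by blast

lemma jac_carrier: "jac X \<beta> \<alpha> W \<in> carrier (sect X W)"
  using par_closed[OF in_chartsD(4)[OF W] jac_par] .

lemma jac_value: "z \<in> cpt \<alpha> ` W \<Longrightarrow> svinvol (cfun \<alpha> W (jac X \<beta> \<alpha> W) z) = cfun \<alpha> W (jac X \<beta> \<alpha> W) z"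
  using jac_par by (auto simp: par_iff[OF in_chartsD(1)[OF W]])

end

lemma jac_inverse:
  assumes "in_charts \<alpha> \<beta> W"
  shows "jac X \<beta> \<alpha> W \<otimes>\<^bsub>sect X W\<^esub> jac X \<alpha> \<beta> W = \<one>\<^bsub>sect X W\<^esub>"
  using jacobian_inverse(1) in_chartsD[OF assms]
  by (simp add: jac_eq[OF assms] jac_eq[OF in_charts_sym[OF assms]])

lemma jac_comp:
  assumes "in_charts \<alpha> \<beta> W" "in_charts \<beta> \<gamma> W"
  shows "jac X \<gamma> \<alpha> W = jac X \<beta> \<alpha> W \<otimes>\<^bsub>sect X W\<^esub> jac X \<gamma> \<beta> W"
proof -
  have "in_charts \<alpha> \<gamma> W" using assms by (simp add: in_charts_def)
  then show ?thesis
    using chain_rule[OF in_chartsD(1-3)[OF assms(1)] tsec(1)[OF in_chartsD(2)[OF assms(2)]]] assms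
    by (simp add: jac_eq)
qed

lemma jac_res:
  assumes "in_charts \<alpha> \<beta> W" "opn W'" "W' \<subseteq> W"
  shows "res X W W' (jac X \<beta> \<alpha> W) = jac X \<beta> \<alpha> W'"
proof -
  have "in_charts \<alpha> \<beta> W'" using assms by (auto simp: in_charts_def)
  then show ?thesis
    using res_dsec[OF in_chartsD(1)[OF assms(1)] assms(2,3) tsec(1)[OF in_chartsD(2)[OF assms(1)]]]
      res_zsec[OF in_chartsD(2)[OF assms(1)] assms(2,3)] assms
    by (simp add: jac_eq)
qed

lemma jac_self: "in_charts \<alpha> \<alpha> W \<Longrightarrow> jac X \<alpha> \<alpha> W = \<one>\<^bsub>sect X W\<^esub>"
  by (simp add: jac_eq dsec_tsec[OF in_chartsD(1)])

text \<open>
  \<open>super_schwarzian_eq\<close> for sections; the inverse of a Jacobian factor is the Jacobian factor of the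
  inverse change of coordinates.
\<close>

lemma schw_eq:
  assumes W: "in_charts \<alpha> \<beta> W"
  shows "schw X \<beta> \<alpha> W = \<ominus>\<^bsub>sect X W\<^esub> (jac X \<beta> \<alpha> W \<otimes>\<^bsub>sect X W\<^esub>
    dsec \<alpha> W (dsec \<alpha> W (dsec \<alpha> W (jac X \<alpha> \<beta> W))))"
proof -
  let ?O = "cdom \<alpha> \<inter> cdom \<beta>"
  note ov = overlap(1)[OF W] overlap(2)[OF W]
  note O = in_chartsD[OF ov(1)] and W' = in_chartsD[OF W]
  note jO = jac_carrier[OF ov(1)] jac_carrier[OF in_charts_sym[OF ov(1)]]
  note jW = jac_carrier[OF W] jac_carrier[OF in_charts_sym[OF W]]
  let ?G = "cfun \<alpha> ?O (jac X \<beta> \<alpha> ?O)" and ?L = "cfun \<alpha> ?O (jac X \<alpha> \<beta> ?O)"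
  have G: "trans_DPsi X \<beta> \<alpha> = ?G" by (simp add: trans_DPsi_eq[OF W] jac_eq[OF ov(1)])
  have GL: "?G z * ?L z = 1" if "z \<in> cpt \<alpha> ` ?O" for z
    using arg_cong[OF jac_inverse[OF ov(1)], of "\<lambda>s. cfun \<alpha> ?O s z"] cfun_mult[OF O(1) jO]
      cfun_one[OF O(1) that] by simp
  have d1: "dsec \<alpha> W (jac X \<alpha> \<beta> W) \<in> carrier (sect X W)" by (rule dsec(1)[OF W'(1) jW(2)])
  have d2: "dsec \<alpha> W (dsec \<alpha> W (jac X \<alpha> \<beta> W)) \<in> carrier (sect X W)" by (rule dsec(1)[OF W'(1) d1])
  have d3: "dsec \<alpha> W (dsec \<alpha> W (dsec \<alpha> W (jac X \<alpha> \<beta> W))) \<in> carrier (sect X W)" by (rule dsec(1)[OF W'(1) d2])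
  show ?thesis
    unfolding schw_def G overlap_image_def
  proof (rule sect_of_cong[OF W])
    fix z assume z: "z \<in> cpt \<alpha> ` W"
    then have zO: "z \<in> cpt \<alpha> ` ?O" using ov(2) by blast
    have V: "open (cpt \<alpha> ` W)" using W'(1) by (rule cpt_open)
    have "super_schwarzian (cpt \<alpha> ` ?O) ?G z = - (?G z * sD (sD (sD ?L)) z)"
      by (rule super_schwarzian_eq[OF cpt_open[OF O(1)] cfun_hol[OF O(1) jO(1)] cfun_hol[OF O(1) jO(2)]
        jac_value[OF ov(1)] GL zO])
    also have "?G z = cfun \<alpha> W (jac X \<beta> \<alpha> W) z"
      using cfun_res[OF O(1) W'(4) ov(2) jO(1) z] jac_res[OF ov(1) W'(4) ov(2)] by simp
    also have "sD (sD (sD ?L)) z = sD (sD (sD (cfun \<alpha> W (jac X \<alpha> \<beta> W)))) z"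
      using cfun_res[OF O(1) W'(4) ov(2) jO(2)] jac_res[OF in_charts_sym[OF ov(1)] W'(4) ov(2)]
      by (intro sD3_cong[OF V z]) simp
    also have "\<dots> = cfun \<alpha> W (dsec \<alpha> W (dsec \<alpha> W (dsec \<alpha> W (jac X \<alpha> \<beta> W)))) z"
    proof -
      have 1: "sD (cfun \<alpha> W (jac X \<alpha> \<beta> W)) w = cfun \<alpha> W (dsec \<alpha> W (jac X \<alpha> \<beta> W)) w" if "w \<in> cpt \<alpha> ` W" for w
        by (rule dsec(2)[OF W'(1) jW(2) that, symmetric])
      have 2: "sD (sD (cfun \<alpha> W (jac X \<alpha> \<beta> W))) w = cfun \<alpha> W (dsec \<alpha> W (dsec \<alpha> W (jac X \<alpha> \<beta> W))) w"
        if w: "w \<in> cpt \<alpha> ` W" for w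
        using sD_cong[OF V w, of "sD (cfun \<alpha> W (jac X \<alpha> \<beta> W))"] 1 dsec(2)[OF W'(1) d1 w] by metis
      show ?thesis
        using sD_cong[OF V z, of "sD (sD (cfun \<alpha> W (jac X \<alpha> \<beta> W)))"] 2 dsec(2)[OF W'(1) d2 z] by metis
    qed
    finally show "super_schwarzian (cpt \<alpha> ` ?O) ?G z = cfun \<alpha> W (\<ominus>\<^bsub>sect X W\<^esub> (jac X \<beta> \<alpha> W \<otimes>\<^bsub>sect X W\<^esub>
        dsec \<alpha> W (dsec \<alpha> W (dsec \<alpha> W (jac X \<alpha> \<beta> W))))) z"
      using jW d3 W'(4) by (simp add: cfun_simps[OF W'(1)])
  qed (use jW d3 W'(4) in simp)
qed

lemma schw_par:
  assumes W: "in_charts \<alpha> \<beta> W"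
  shows "schw X \<beta> \<alpha> W \<in> par X True W"
proof -
  note W' = in_chartsD[OF W]
  have "dsec \<alpha> W (dsec \<alpha> W (dsec \<alpha> W (jac X \<alpha> \<beta> W))) \<in> par X True W"
    using dsec_parity[OF W'(1) dsec_parity[OF W'(1) dsec_parity[OF W'(1) jac_par[OF in_charts_sym[OF W]]]]]
    by simp
  then have "jac X \<beta> \<alpha> W \<otimes>\<^bsub>sect X W\<^esub> dsec \<alpha> W (dsec \<alpha> W (dsec \<alpha> W (jac X \<alpha> \<beta> W))) \<in> par X True W"
    using par_mult[OF W'(4) jac_par[OF W]] by fastforce
  then show ?thesis
    using schw_eq[OF W] W'(4) by (auto simp: par_iff[OF W'(1)] cfun_uminus[OF W'(1)])
qed

lemma schw_carrier:
  assumes "in_charts \<alpha> \<beta> W"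
  shows "schw X \<beta> \<alpha> W \<in> carrier (sect X W)"
  using par_closed[OF in_chartsD(4)[OF assms] schw_par[OF assms]] .

lemma schw_value:
  assumes W: "in_charts \<alpha> \<beta> W" and z: "z \<in> cpt \<alpha> ` W"
  shows "cfun \<alpha> W (schw X \<beta> \<alpha> W) z =
    - (cfun \<alpha> W (jac X \<beta> \<alpha> W) z * sD (sD (sD (cfun \<alpha> W (jac X \<alpha> \<beta> W)))) z)"
proof -
  note W' = in_chartsD[OF W]
  note jW = jac_carrier[OF W] jac_carrier[OF in_charts_sym[OF W]]
  have V: "open (cpt \<alpha> ` W)" using W'(1) by (rule cpt_open)
  define d1 d2 where "d1 = dsec \<alpha> W (jac X \<alpha> \<beta> W)" and "d2 = dsec \<alpha> W d1"
  have d: "d1 \<in> carrier (sect X W)" "d2 \<in> carrier (sect X W)" "dsec \<alpha> W d2 \<in> carrier (sect X W)"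
    using dsec(1)[OF W'(1)] jW by (auto simp: d1_def d2_def)
  have 1: "cfun \<alpha> W d1 w = sD (cfun \<alpha> W (jac X \<alpha> \<beta> W)) w" if "w \<in> cpt \<alpha> ` W" for w
    unfolding d1_def by (rule dsec(2)[OF W'(1) jW(2) that])
  have 2: "cfun \<alpha> W d2 w = sD (sD (cfun \<alpha> W (jac X \<alpha> \<beta> W))) w" if w: "w \<in> cpt \<alpha> ` W" for w
    unfolding d2_def dsec(2)[OF W'(1) d(1) w] by (rule sD_cong[OF V w 1])
  have "cfun \<alpha> W (dsec \<alpha> W d2) z = sD (sD (sD (cfun \<alpha> W (jac X \<alpha> \<beta> W)))) z"
    unfolding dsec(2)[OF W'(1) d(2) z] by (rule sD_cong[OF V z 2])
  then show ?thesis
    using schw_eq[OF W] jW d W'(4) by (simp add: cfun_simps[OF W'(1)] d1_def d2_def)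
qed

lemma schw_res:
  assumes W: "in_charts \<alpha> \<beta> W" and W': "opn W'" "W' \<subseteq> W"
  shows "res X W W' (schw X \<beta> \<alpha> W) = schw X \<beta> \<alpha> W'"
proof -
  have c: "in_charts \<alpha> \<beta> W'" using assms by (auto simp: in_charts_def)
  note 1 = in_chartsD[OF W] and 2 = in_chartsD[OF c]
  note j = jac_carrier[OF W] jac_carrier[OF in_charts_sym[OF W]]
  show ?thesis
  proof (rule cfun_eqI[OF 2(1)])
    show "res X W W' (schw X \<beta> \<alpha> W) \<in> carrier (sect X W')" "schw X \<beta> \<alpha> W' \<in> carrier (sect X W')"
      using schw_carrier[OF W] schw_carrier[OF c] 1(4) W' by simp_all
    fix z assume z: "z \<in> cpt \<alpha> ` W'"
    then have zW: "z \<in> cpt \<alpha> ` W" using W' by blast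
    have "sD (sD (sD (cfun \<alpha> W (jac X \<alpha> \<beta> W)))) z = sD (sD (sD (cfun \<alpha> W' (jac X \<alpha> \<beta> W')))) z"
      using cfun_res[OF 1(1) W' j(2)] jac_res[OF in_charts_sym[OF W] W']
      by (intro sD3_cong[OF cpt_open[OF 2(1)] z]) simp
    moreover have "cfun \<alpha> W (jac X \<beta> \<alpha> W) z = cfun \<alpha> W' (jac X \<beta> \<alpha> W') z"
      using cfun_res[OF 1(1) W' j(1) z] jac_res[OF W W'] by simp
    ultimately show "cfun \<alpha> W' (res X W W' (schw X \<beta> \<alpha> W)) z = cfun \<alpha> W' (schw X \<beta> \<alpha> W') z"
      using cfun_res[OF 1(1) W' schw_carrier[OF W] z] schw_value[OF W zW] schw_value[OF c z] by simp
  qed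
qed

lemma schw_self: "in_charts \<alpha> \<alpha> W \<Longrightarrow> schw X \<alpha> \<alpha> W = \<zero>\<^bsub>sect X W\<^esub>"
proof -
  assume W: "in_charts \<alpha> \<alpha> W"
  note W' = in_chartsD[OF W]
  show ?thesis
  proof (rule cfun_eqI[OF W'(1) schw_carrier[OF W]])
    fix z assume z: "z \<in> cpt \<alpha> ` W"
    have "sD (sD (sD (cfun \<alpha> W \<one>\<^bsub>sect X W\<^esub>))) z = sD (sD (sD (\<lambda>_. 1))) z"
      by (rule sD3_cong[OF cpt_open[OF W'(1)] z]) (rule cfun_one[OF W'(1)])
    also have "sD (\<lambda>_. 1 :: 'n superval) = (\<lambda>_. 0)" by (rule ext) simp
    also have "sD (\<lambda>_. 0 :: 'n superval) = (\<lambda>_. 0)" by (rule ext) simp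
    finally show "cfun \<alpha> W (schw X \<alpha> \<alpha> W) z = cfun \<alpha> W \<zero>\<^bsub>sect X W\<^esub> z"
      using schw_value[OF W z] by (simp add: jac_self[OF W] cfun_zero[OF W'(1)])
  qed (use W' in simp)
qed

text \<open>
  By the chain rule \<open>D\<^sub>\<beta>\<close> is \<open>D\<^sub>\<alpha>\<close> divided by the Jacobian factor, so that both sides can be expanded in the
  coordinates \<open>\<alpha>\<close>.
\<close>

theorem schw_cocycle:
  assumes ab: "in_charts \<alpha> \<beta> W" and bc: "in_charts \<beta> \<gamma> W"
  shows "schw X \<gamma> \<alpha> W = schw X \<beta> \<alpha> W \<oplus>\<^bsub>sect X W\<^esub>
    (jac X \<beta> \<alpha> W [^]\<^bsub>sect X W\<^esub> (3::nat)) \<otimes>\<^bsub>sect X W\<^esub> schw X \<gamma> \<beta> W"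
proof -
  let ?R = "sect X W" and ?A = "cfun \<alpha> W"
  have ac: "in_charts \<alpha> \<gamma> W" using ab bc by (simp add: in_charts_def)
  note \<alpha> = in_chartsD(1)[OF ab] and \<beta> = in_chartsD(2)[OF ab] and opn [simp] = in_chartsD(4)[OF ab]
  note s = schw_carrier[OF ab] schw_carrier[OF bc] schw_carrier[OF ac]
  note j = jac_carrier[OF ab] jac_carrier[OF bc] jac_carrier[OF in_charts_sym[OF ab]]
    jac_carrier[OF in_charts_sym[OF bc]]
  have V: "open (cpt \<alpha> ` W)" using \<alpha> by (rule cpt_open)
  define J K H L where "J = ?A (jac X \<beta> \<alpha> W)" and "K = ?A (jac X \<alpha> \<beta> W)"
    and "H = ?A (jac X \<gamma> \<beta> W)" and "L = ?A (jac X \<beta> \<gamma> W)"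
  note defs = J_def K_def H_def L_def
  have hol: "svhol (cpt \<alpha> ` W) K" "svhol (cpt \<alpha> ` W) L" unfolding defs using cfun_hol[OF \<alpha>] j by auto
  have evJ: "svinvol (J z) = J z" and evH: "svinvol (H z) = H z" if "z \<in> cpt \<alpha> ` W" for z
    using jac_par[OF ab] jac_par[OF bc] that by (auto simp: par_iff[OF \<alpha>] defs)
  have JK: "J z * K z = 1" and HL: "H z * L z = 1" if "z \<in> cpt \<alpha> ` W" for z
    using arg_cong[OF jac_inverse[OF ab], of "\<lambda>s. ?A s z"] arg_cong[OF jac_inverse[OF bc], of "\<lambda>s. ?A s z"]
      cfun_mult[OF \<alpha> j(1,3)] cfun_mult[OF \<alpha> j(2,4)] cfun_one[OF \<alpha> that] by (simp_all add: defs)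
  \<comment> \<open>\<open>D\<^sub>\<beta>\<close> in the coordinates \<open>\<alpha>\<close>\<close>
  define E where "E f z = K z * sD f z" for f :: "complex \<Rightarrow> 'n superval" and z
  have D\<beta>: "?A (dsec \<beta> W s) z = E (?A s) z" if s: "s \<in> carrier ?R" and z: "z \<in> cpt \<alpha> ` W" for s z
  proof -
    have "dsec \<beta> W s = jac X \<alpha> \<beta> W \<otimes>\<^bsub>?R\<^esub> dsec \<alpha> W s"
      using chain_rule[OF \<beta> \<alpha> in_chartsD(3)[OF in_charts_sym[OF ab]] s]
      by (simp add: jac_eq[OF in_charts_sym[OF ab]])
    then show ?thesis
      using cfun_mult[OF \<alpha> j(3) dsec(1)[OF \<alpha> s]] dsec(2)[OF \<alpha> s z] by (simp add: E_def defs)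
  qed
  have E_cong: "E f z = E g z" if "\<And>w. w \<in> cpt \<alpha> ` W \<Longrightarrow> f w = g w" "z \<in> cpt \<alpha> ` W" for f g z
    unfolding E_def using sD_cong[OF V that(2,1)] by simp
  define d1 d2 where "d1 = dsec \<beta> W (jac X \<beta> \<gamma> W)" and "d2 = dsec \<beta> W d1"
  have d: "d1 \<in> carrier ?R" "d2 \<in> carrier ?R" "dsec \<beta> W d2 \<in> carrier ?R"
    using dsec(1)[OF \<beta>] j by (auto simp: d1_def d2_def)
  have 1: "?A d1 z = E L z" if "z \<in> cpt \<alpha> ` W" for z
    unfolding d1_def using D\<beta>[OF j(4) that] by (simp add: defs)
  have 2: "?A d2 z = E (E L) z" if "z \<in> cpt \<alpha> ` W" for z
    unfolding d2_def using D\<beta>[OF d(1) that] E_cong[OF 1 that] by simp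
  have 3: "?A (dsec \<beta> W d2) z = E (E (E L)) z" if "z \<in> cpt \<alpha> ` W" for z
    using D\<beta>[OF d(2) that] E_cong[OF 2 that] by simp
  show ?thesis
  proof (rule cfun_eqI[OF \<alpha> s(3)])
    show "schw X \<beta> \<alpha> W \<oplus>\<^bsub>?R\<^esub> (jac X \<beta> \<alpha> W [^]\<^bsub>?R\<^esub> (3::nat)) \<otimes>\<^bsub>?R\<^esub> schw X \<gamma> \<beta> W \<in> carrier ?R"
      using s j by simp
    fix z assume z: "z \<in> cpt \<alpha> ` W"
    have "sD (sD (sD (?A (jac X \<alpha> \<gamma> W)))) z = sD (sD (sD (\<lambda>z. K z * L z))) z"
    proof (rule sD3_cong[OF V z])
      fix w assume w: "w \<in> cpt \<alpha> ` W"
      have "svinvol (L w) = L w" using S.even_inverse[OF evH[OF w] HL[OF w]] .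
      then have "L w * K w = K w * L w" using S.even_central by metis
      then show "?A (jac X \<alpha> \<gamma> W) w = K w * L w"
        using jac_comp[OF in_charts_sym[OF bc] in_charts_sym[OF ab]] cfun_mult[OF \<alpha> j(4,3)]
        by (simp add: defs)
    qed
    moreover have "?A (jac X \<gamma> \<alpha> W) z = J z * H z"
      using jac_comp[OF ab bc] cfun_mult[OF \<alpha> j(1,2)] by (simp add: defs)
    ultimately have "?A (schw X \<gamma> \<alpha> W) z = - (J z * H z * sD (sD (sD (\<lambda>z. K z * L z))) z)"
      using schw_value[OF ac z] by simp
    also have "\<dots> = - (J z * sD (sD (sD K)) z) + J z ^ 3 * - (H z * E (E (E L)) z)"
      using schwarzian_cocycle[OF V hol evJ evH JK HL z] by (simp add: E_def[abs_def])
    also have "- (J z * sD (sD (sD K)) z) = ?A (schw X \<beta> \<alpha> W) z"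
      using schw_value[OF ab z] by (simp add: defs)
    also have "- (H z * E (E (E L)) z) = ?A (schw X \<gamma> \<beta> W) z"
      using schw_eq[OF bc] 3[OF z] d j
      by (simp add: cfun_uminus[OF \<alpha>] cfun_mult[OF \<alpha>] d1_def d2_def defs)
    finally show "?A (schw X \<gamma> \<alpha> W) z =
        ?A (schw X \<beta> \<alpha> W \<oplus>\<^bsub>?R\<^esub> (jac X \<beta> \<alpha> W [^]\<^bsub>?R\<^esub> (3::nat)) \<otimes>\<^bsub>?R\<^esub> schw X \<gamma> \<beta> W) z"
      using s j by (simp add: cfun_simps[OF \<alpha>] defs)
  qed
qed

section \<open>Vanishing and prescription of the super-Schwarzian\<close>

text \<open>
  In terms of \<open>L = 1 / D\<Psi>\<close> the Schwarzian vanishes if and only if \<open>D\<^sup>3 L = 0\<close>. The constants of the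
  fractional linear transformation are found on discs, which are connected.
\<close>

theorem superprojective_transition_iff:
  assumes \<alpha>: "\<alpha> \<in> compatible X" and \<beta>: "\<beta> \<in> compatible X"
  shows "superprojective_transition X \<beta> \<alpha> \<longleftrightarrow>
    schw X \<beta> \<alpha> (cdom \<alpha> \<inter> cdom \<beta>) = \<zero>\<^bsub>sect X (cdom \<alpha> \<inter> cdom \<beta>)\<^esub>"
proof -
  let ?O = "cdom \<alpha> \<inter> cdom \<beta>"
  have ov: "in_charts \<alpha> \<beta> ?O" using \<alpha> \<beta> compatible_opn by (auto simp: in_charts_def)
  note O = in_chartsD[OF ov]
  note j = jac_carrier[OF ov] jac_carrier[OF in_charts_sym[OF ov]]
  note coord = compatible_coordinates[OF \<alpha>] compatible_coordinates[OF \<beta>]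
  define F \<Psi> L where "F = trans_F X \<beta> \<alpha>" and "\<Psi> = trans_Psi X \<beta> \<alpha>" and "L = cfun \<alpha> ?O (jac X \<alpha> \<beta> ?O)"
  have F: "F = cfun \<alpha> ?O (zsec \<beta> ?O)" and \<Psi>: "\<Psi> = cfun \<alpha> ?O (tsec \<beta> ?O)"
    by (simp_all add: F_def \<Psi>_def trans_F_Psi[OF coord])
  have hol: "svhol (cpt \<alpha> ` ?O) F" "svhol (cpt \<alpha> ` ?O) \<Psi>" "svhol (cpt \<alpha> ` ?O) L"
    unfolding F \<Psi> L_def using cfun_hol[OF O(1)] zsec(1)[OF O(2)] tsec(1)[OF O(2)] j by auto
  have evF: "svinvol (F z) = F z" and od\<Psi>: "svinvol (\<Psi> z) = - \<Psi> z" if "z \<in> cpt \<alpha> ` ?O" for z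
    using zsec_even[OF O(2)] tsec_odd[OF O(2)] that by (auto simp: par_iff[OF O(1)] F \<Psi>)
  have D\<Psi>: "sD \<Psi> z = cfun \<alpha> ?O (jac X \<beta> \<alpha> ?O) z" if "z \<in> cpt \<alpha> ` ?O" for z
    using dsec(2)[OF O(1) tsec(1)[OF O(2)] that] by (simp add: \<Psi> jac_eq[OF ov])
  have conformal: "sD F z = \<Psi> z * sD \<Psi> z" if z: "z \<in> cpt \<alpha> ` ?O" for z
  proof -
    have "superconformal_transition X \<beta> \<alpha>"
      using O(3) coord by (simp add: superconformal_transition_iff)
    moreover obtain x where "x \<in> ?O" "z = cpt \<alpha> x" using z by blast
    ultimately show ?thesis
      by (simp add: superconformal_transition_def trans_DPsi_def overlap_image_def superD_eq F_def \<Psi>_def)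
  qed
  have inverse: "sD \<Psi> z * L z = 1" "L z * sD \<Psi> z = 1" if z: "z \<in> cpt \<alpha> ` ?O" for z
  proof -
    show 1: "sD \<Psi> z * L z = 1"
      using arg_cong[OF jac_inverse[OF ov], of "\<lambda>s. cfun \<alpha> ?O s z"] cfun_mult[OF O(1) j]
        cfun_one[OF O(1) z] by (simp add: L_def D\<Psi>[OF z])
    then show "L z * sD \<Psi> z = 1"
      using S.even_central[OF jac_value[OF ov z], of "L z"] by (simp add: D\<Psi>[OF z])
  qed
  have schw: "cfun \<alpha> ?O (schw X \<beta> \<alpha> ?O) z = - (sD \<Psi> z * sD (sD (sD L)) z)" if z: "z \<in> cpt \<alpha> ` ?O" for z
    using schw_value[OF ov z] by (simp add: D\<Psi>[OF z] L_def)
  show ?thesis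
  proof
    assume proj: "superprojective_transition X \<beta> \<alpha>"
    show "schw X \<beta> \<alpha> ?O = \<zero>\<^bsub>sect X ?O\<^esub>"
    proof (rule cfun_eqI[OF O(1) schw_carrier[OF ov]])
      fix z assume z: "z \<in> cpt \<alpha> ` ?O"
      then obtain x where x: "x \<in> ?O" "z = cpt \<alpha> x" by blast
      obtain W a b c d e p q r s where W: "opn W" "x \<in> W" "W \<subseteq> ?O"
        and par: "a \<in> gparity False" "b \<in> gparity False" "c \<in> gparity False" "d \<in> gparity False"
          "e \<in> gparity False" "p \<in> gparity True" "q \<in> gparity True" "r \<in> gparity True" "s \<in> gparity True"
        and e: "is_unit_elt e"
        and form: "\<forall>z\<in>cpt \<alpha> ` W.
          is_unit_elt (svconst c * svconst (gconst z) + svconst d + svconst q * sv_theta) \<and>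
          trans_F X \<beta> \<alpha> z = (svconst a * svconst (gconst z) + svconst b + svconst p * sv_theta) *
            unit_inv (svconst c * svconst (gconst z) + svconst d + svconst q * sv_theta) \<and>
          trans_Psi X \<beta> \<alpha> z = (svconst r * svconst (gconst z) + svconst s + svconst e * sv_theta) *
            unit_inv (svconst c * svconst (gconst z) + svconst d + svconst q * sv_theta)"
        using bspec[OF proj[unfolded superprojective_transition_def Let_def] x(1)]
        by (elim exE conjE bexE) (rule that; assumption)
      have inv: "ginvol p = - p" "ginvol q = - q" "ginvol e = e"
        using par by (simp_all add: gparity_even_iff gparity_odd_iff)
      have form': "is_unit_elt (SV (c * gconst z + d) (- q))"
        "F z = SV (a * gconst z + b) (- p) * unit_inv (SV (c * gconst z + d) (- q))"
        "\<Psi> z = SV (r * gconst z + s) e * unit_inv (SV (c * gconst z + d) (- q))"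
        if "z \<in> cpt \<alpha> ` W" for z
        using bspec[OF form that] unfolding svconst_affine inv F_def \<Psi>_def by simp_all
      have WO: "z \<in> cpt \<alpha> ` ?O" if "z \<in> cpt \<alpha> ` W" for z using that W(3) by blast
      have V: "open (cpt \<alpha> ` W)" using cpt_open in_chart_subset[OF O(1) W(1,3)] by blast
      have zW: "z \<in> cpt \<alpha> ` W" using x W(2) by blast
      have sub: "cpt \<alpha> ` W \<subseteq> cpt \<alpha> ` ?O" using W(3) by blast
      have "sD (sD (sD L)) z = 0"
        by (rule fractional_linear_imp_flat[OF V svhol_subset[OF hol(1) sub] svhol_subset[OF hol(2) sub] par e])
          (erule form' conformal[OF WO] inverse[OF WO] | rule zW)+
      then show "cfun \<alpha> ?O (schw X \<beta> \<alpha> ?O) z = cfun \<alpha> ?O \<zero>\<^bsub>sect X ?O\<^esub> z"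
        using schw[OF z] by (simp add: cfun_zero[OF O(1)])
    qed (use O(4) in simp)
  next
    assume zero: "schw X \<beta> \<alpha> ?O = \<zero>\<^bsub>sect X ?O\<^esub>"
    have flat: "sD (sD (sD L)) z = 0" if z: "z \<in> cpt \<alpha> ` ?O" for z
    proof -
      have "sD \<Psi> z * sD (sD (sD L)) z = 0"
        using schw[OF z] zero by (simp add: cfun_zero[OF O(1)])
      then have "L z * (sD \<Psi> z * sD (sD (sD L)) z) = 0" by simp
      then show ?thesis using inverse(2)[OF z] by (simp flip: mult.assoc)
    qed
    show "superprojective_transition X \<beta> \<alpha>"
      unfolding superprojective_transition_def
    proof
      fix x assume x: "x \<in> ?O"
      have "open (cpt \<alpha> ` ?O)" using cpt_open O(1) by blast
      then obtain t where t: "t > 0" "ball (cpt \<alpha> x) t \<subseteq> cpt \<alpha> ` ?O" using x open_contains_ball by blast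
      let ?V = "ball (cpt \<alpha> x) t"
      define W where "W = {y \<in> cdom \<alpha>. cpt \<alpha> y \<in> ?V}"
      have "in_chart \<alpha> W" and cW: "cpt \<alpha> ` W = ?V"
        unfolding W_def using cpt_preimage[OF coord(1), of ?V] t by auto
      then have W: "opn W" "x \<in> W" using x t by (auto simp: W_def in_chart_def)
      have "W \<subseteq> ?O"
      proof
        fix y assume y: "y \<in> W"
        then obtain y' where y': "y' \<in> ?O" "cpt \<alpha> y' = cpt \<alpha> y" using t by (force simp: W_def)
        then have "y' = y" using coordinates_top(1)[OF coord(1)] y by (auto simp: W_def inj_on_def)
        then show "y \<in> ?O" using y' by simp
      qed
      have VO: "z \<in> cpt \<alpha> ` ?O" if "z \<in> ?V" for z using that t by blast
      have centre: "cpt \<alpha> x \<in> ?V" using t by simp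
      obtain a b c d e p q r s where
        par: "a \<in> gparity False" "b \<in> gparity False" "c \<in> gparity False" "d \<in> gparity False"
          "e \<in> gparity False" "p \<in> gparity True" "q \<in> gparity True" "r \<in> gparity True" "s \<in> gparity True"
        and e: "is_unit_elt e" and sdet: "sdet a b p c d q r s e = 1"
        and form: "\<And>z. z \<in> ?V \<Longrightarrow> is_unit_elt (SV (c * gconst z + d) (- q))"
          "\<And>z. z \<in> ?V \<Longrightarrow> F z = SV (a * gconst z + b) (- p) * unit_inv (SV (c * gconst z + d) (- q))"
          "\<And>z. z \<in> ?V \<Longrightarrow> \<Psi> z = SV (r * gconst z + s) e * unit_inv (SV (c * gconst z + d) (- q))"
        using flat_imp_fractional_linear[OF open_ball connected_ball centre svhol_subset[OF hol(1) t(2)]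
          svhol_subset[OF hol(2) t(2)] svhol_subset[OF hol(3) t(2)] evF[OF VO] od\<Psi>[OF VO]
          conformal[OF VO] inverse(1)[OF VO] flat[OF VO]]
        by blast
      have inv: "ginvol p = - p" "ginvol q = - q" "ginvol e = e"
        using par by (simp_all add: gparity_even_iff gparity_odd_iff)
      have projective: "\<forall>z\<in>cpt \<alpha> ` W. let Z = svconst (gconst z);
                 den = svconst c * Z + svconst d + svconst q * sv_theta
             in is_unit_elt den \<and>
                trans_F X \<beta> \<alpha> z = (svconst a * Z + svconst b + svconst p * sv_theta) * unit_inv den \<and>
                trans_Psi X \<beta> \<alpha> z = (svconst r * Z + svconst s + svconst e * sv_theta) * unit_inv den"
        using form unfolding Let_def svconst_affine inv cW F_def \<Psi>_def by blast
      show "\<exists>W. opn W \<and> x \<in> W \<and> W \<subseteq> ?O \<and>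
       (\<exists>a\<in>gparity False. \<exists>b\<in>gparity False. \<exists>c\<in>gparity False. \<exists>d\<in>gparity False.
        \<exists>e\<in>gparity False. \<exists>\<alpha>'\<in>gparity True. \<exists>\<beta>'\<in>gparity True. \<exists>\<gamma>\<in>gparity True. \<exists>\<delta>\<in>gparity True.
          is_unit_elt e \<and> sdet a b \<alpha>' c d \<beta>' \<gamma> \<delta> e = 1 \<and>
          (\<forall>z\<in>cpt \<alpha> ` W. let Z = svconst (gconst z);
                 den = svconst c * Z + svconst d + svconst \<beta>' * sv_theta
             in is_unit_elt den \<and>
                trans_F X \<beta> \<alpha> z = (svconst a * Z + svconst b + svconst \<alpha>' * sv_theta) * unit_inv den \<and>
                trans_Psi X \<beta> \<alpha> z = (svconst \<gamma> * Z + svconst \<delta> + svconst e * sv_theta) * unit_inv den))"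
        by (rule exI[of _ W], intro conjI, rule W(1), rule W(2), rule \<open>W \<subseteq> ?O\<close>,
          rule bexI[OF _ par(1)], rule bexI[OF _ par(2)], rule bexI[OF _ par(3)],
          rule bexI[OF _ par(4)], rule bexI[OF _ par(5)], rule bexI[OF _ par(6)],
          rule bexI[OF _ par(7)], rule bexI[OF _ par(8)], rule bexI[OF _ par(9)],
          intro conjI, rule e, rule sdet, rule projective)
    qed
  qed
qed

text \<open>
  Near any point, coordinates with a prescribed super-Schwarzian relative to \<open>\<alpha>\<close>: solve the
  differential equation, restrict to a disc on which the body of the solution is injective, and
  transport sections by substitution.
\<close>

theorem chart_with_schwarzian:
  assumes \<alpha>: "\<alpha> \<in> compatible X" and x: "x \<in> cdom \<alpha>" and h: "h \<in> par X True (cdom \<alpha>)"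
  obtains \<beta> where "\<beta> \<in> compatible X" "x \<in> cdom \<beta>" "cdom \<beta> \<subseteq> cdom \<alpha>"
    "schw X \<beta> \<alpha> (cdom \<beta>) = res X (cdom \<alpha>) (cdom \<beta>) h"
proof -
  note coord = compatible_coordinates[OF \<alpha>] and opn\<alpha> = compatible_opn[OF \<alpha>]
  have ch: "in_chart \<alpha> (cdom \<alpha>)" using coord opn\<alpha> by (simp add: in_chart_def)
  have hcar: "h \<in> carrier (sect X (cdom \<alpha>))" using par_closed[OF opn\<alpha> h] .
  let ?h = "cfun \<alpha> (cdom \<alpha>) h"
  have oddh: "svinvol (?h z) = - ?h z" if "z \<in> cpt \<alpha> ` cdom \<alpha>" for z
    using h that by (auto simp: par_iff[OF ch])
  have "cpt \<alpha> x \<in> cpt \<alpha> ` cdom \<alpha>" using x by blast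
  then obtain r F \<Psi> L where r: "r > 0" "ball (cpt \<alpha> x) r \<subseteq> cpt \<alpha> ` cdom \<alpha>"
    and hol: "svhol (ball (cpt \<alpha> x) r) F" "svhol (ball (cpt \<alpha> x) r) \<Psi>" "svhol (ball (cpt \<alpha> x) r) L"
    and evF: "\<And>z. svinvol (F z) = F z" and od\<Psi>: "\<And>z. svinvol (\<Psi> z) = - \<Psi> z"
    and DF: "\<And>z. z \<in> ball (cpt \<alpha> x) r \<Longrightarrow> sD F z = \<Psi> z * sD \<Psi> z"
    and evL: "\<And>z. z \<in> ball (cpt \<alpha> x) r \<Longrightarrow> svinvol (L z) = L z"
    and L: "\<And>z. z \<in> ball (cpt \<alpha> x) r \<Longrightarrow> sD \<Psi> z * L z = 1"
    and ode: "\<And>z. z \<in> ball (cpt \<alpha> x) r \<Longrightarrow> sD (sD (sD L)) z = - (?h z * L z)"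
    using superconformal_with_schwarzian[OF cpt_open[OF ch] _ cfun_hol[OF ch hcar] oddh] by blast
  let ?B = "ball (cpt \<alpha> x) r"
  \<comment> \<open>the body of \<open>F\<close> has the square of the body of \<open>D\<Psi>\<close> as its derivative, so it is locally injective\<close>
  have body\<Psi>: "gcoef (sv1 (\<Psi> z)) {} \<noteq> 0" if "z \<in> ?B" for z
  proof -
    have "sbody (sD \<Psi> z * L z) = 1" using L[OF that] by simp
    then show ?thesis by (auto simp: sbody_def gcoef_mult_body)
  qed
  have "(\<lambda>z. sbody (F z)) holomorphic_on ?B"
    using hol(1) by (simp add: sbody_def svhol_def gholomorphic_on_def)
  moreover have "deriv (\<lambda>z. sbody (F z)) (cpt \<alpha> x) \<noteq> 0"
  proof -
    have c: "cpt \<alpha> x \<in> ?B" using r by simp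
    have "ginvol (sv0 (\<Psi> (cpt \<alpha> x))) = - sv0 (\<Psi> (cpt \<alpha> x))"
      using od\<Psi>[of "cpt \<alpha> x"] by (simp add: superval_eq_iff)
    from odd_body[OF this]
    have "gcoef (sv1 (sD F (cpt \<alpha> x))) {} = gcoef (sv1 (\<Psi> (cpt \<alpha> x))) {} * gcoef (sv1 (\<Psi> (cpt \<alpha> x))) {}"
      unfolding DF[OF c] by (simp add: gcoef_simps gcoef_mult_body gcoef_ginvol)
    then show ?thesis using body\<Psi>[OF c] by (simp add: gcoef_gderiv sbody_def)
  qed
  ultimately obtain r' where r': "r' > 0" "ball (cpt \<alpha> x) r' \<subseteq> ?B"
    and inj: "inj_on (\<lambda>z. sbody (F z)) (ball (cpt \<alpha> x) r')"
    using has_complex_derivative_locally_injective[of "\<lambda>z. sbody (F z)" ?B "cpt \<alpha> x"] r(1) by auto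
  let ?V = "ball (cpt \<alpha> x) r'"
  interpret T: super_substitution ?V F \<Psi>
  proof
    show "svhol ?V F" "svhol ?V \<Psi>" using hol r'(2) svhol_subset by blast+
    show "gcoef (sv1 (\<Psi> z)) {} \<noteq> 0" if "z \<in> ?V" for z using body\<Psi> that r'(2) by blast
  qed (use evF od\<Psi> inj in auto)
  define U where "U = {y \<in> cdom \<alpha>. cpt \<alpha> y \<in> ?V}"
  have U: "in_chart \<alpha> U" "cpt \<alpha> ` U = ?V"
    unfolding U_def using cpt_preimage[OF coord, of ?V] r r' by auto
  have opnU: "opn U" and Usub: "U \<subseteq> cdom \<alpha>" and xU: "x \<in> U"
    using U(1) x r' by (auto simp: in_chart_def U_def)
  have sub: "in_chart \<alpha> W" "open (cpt \<alpha> ` W)" "cpt \<alpha> ` W \<subseteq> ?V" if "opn W" "W \<subseteq> U" for W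
  proof -
    show "in_chart \<alpha> W" using in_chart_subset[OF U(1) that] .
    then show "open (cpt \<alpha> ` W)" by (rule cpt_open)
    show "cpt \<alpha> ` W \<subseteq> ?V" using that U(2) by blast
  qed
  \<comment> \<open>\<open>\<Phi> W\<close> expresses a function of the new coordinates in the old ones\<close>
  define \<Phi> where "\<Phi> W f = cut (cpt \<alpha> ` W) (T.subst f)" for W f
  \<comment> \<open>the coordinates \<open>\<beta>\<close> with \<open>z\<^sub>\<beta> = F\<close> and \<open>\<theta>\<^sub>\<beta> = \<Psi>\<close> in terms of \<open>\<alpha>\<close>\<close>
  define \<beta> where "\<beta> = \<lparr> cdom = U, cpt = restrict (\<lambda>y. T.body (cpt \<alpha> y)) U,
    cfun = (\<lambda>W. if opn W \<and> W \<subseteq> U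
      then restrict (\<lambda>s. inv_into (carrier (superfunctions (T.body ` cpt \<alpha> ` W))) (\<Phi> W) (cfun \<alpha> W s))
        (carrier (sect X W))
      else undefined) \<rparr>"
  have cdom: "cdom \<beta> = U" by (simp add: \<beta>_def)
  have cpt: "cpt \<beta> ` W = T.body ` cpt \<alpha> ` W" if "W \<subseteq> U" for W
    using that by (auto simp: \<beta>_def image_image restrict_def subset_iff cong: image_cong_simp)
  have bij\<Phi>: "bij_betw (\<Phi> W) (carrier (superfunctions (cpt \<beta> ` W))) (carrier (superfunctions (cpt \<alpha> ` W)))"
    if W: "opn W" "W \<subseteq> U" for W
    unfolding \<Phi>_def[abs_def] cpt[OF W(2)] using T.subst_bij[OF sub(2,3)[OF W]] .
  have cf: "cfun \<beta> W s \<in> carrier (superfunctions (cpt \<beta> ` W))" "\<Phi> W (cfun \<beta> W s) = cfun \<alpha> W s"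
    if W: "opn W" "W \<subseteq> U" and s: "s \<in> carrier (sect X W)" for W s
  proof -
    have "cfun \<alpha> W s \<in> \<Phi> W ` carrier (superfunctions (cpt \<beta> ` W))"
      using cfun_carrier[OF sub(1)[OF W] s] bij\<Phi>[OF W] by (simp add: bij_betw_def)
    moreover have "cfun \<beta> W s = inv_into (carrier (superfunctions (cpt \<beta> ` W))) (\<Phi> W) (cfun \<alpha> W s)"
      using W s by (simp add: \<beta>_def cpt[OF W(2), unfolded \<beta>_def, simplified])
    ultimately show "cfun \<beta> W s \<in> carrier (superfunctions (cpt \<beta> ` W))" "\<Phi> W (cfun \<beta> W s) = cfun \<alpha> W s"
      by (simp_all add: inv_into_into f_inv_into_f)
  qed
  have cf_hol: "svhol (T.body ` cpt \<alpha> ` W) (cfun \<beta> W s)"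
    if W: "opn W" "W \<subseteq> U" and s: "s \<in> carrier (sect X W)" for W s
    using cf(1)[OF W s] by (simp add: superfunctions_carrier cpt[OF W(2)])
  have subst: "T.subst (cfun \<beta> W s) z = cfun \<alpha> W s z"
    if W: "opn W" "W \<subseteq> U" and s: "s \<in> carrier (sect X W)" and z: "z \<in> cpt \<alpha> ` W" for W s z
    using fun_cong[OF cf(2)[OF W s], of z] z by (simp add: \<Phi>_def cut_def)
  have uniq: "cfun \<beta> W s = f"
    if W: "opn W" "W \<subseteq> U" and s: "s \<in> carrier (sect X W)" and f: "f \<in> carrier (superfunctions (cpt \<beta> ` W))"
      and eq: "\<And>z. z \<in> cpt \<alpha> ` W \<Longrightarrow> T.subst f z = cfun \<alpha> W s z" for W s f
  proof -
    have "\<Phi> W f = \<Phi> W (cfun \<beta> W s)"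
      using eq subst[OF W s] by (auto simp: \<Phi>_def cut_def fun_eq_iff)
    then show ?thesis using bij\<Phi>[OF W] cf(1)[OF W s] f by (auto simp: bij_betw_def inj_on_def)
  qed
  have lift: "cfun \<beta> W s = cut (cpt \<beta> ` W) f"
    if W: "opn W" "W \<subseteq> U" and s: "s \<in> carrier (sect X W)" and f: "svhol (cpt \<beta> ` W) f"
      and eq: "\<And>z. z \<in> cpt \<alpha> ` W \<Longrightarrow> T.subst f z = cfun \<alpha> W s z" for W s f
  proof (rule uniq[OF W s cut_in_superfunctions[OF f]])
    fix z assume z: "z \<in> cpt \<alpha> ` W"
    have "T.subst (cut (cpt \<beta> ` W) f) z = T.subst f z"
      by (rule T.subst_cong[OF sub(2,3)[OF W] z]) (simp add: cut_def cpt[OF W(2)])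
    then show "T.subst (cut (cpt \<beta> ` W) f) z = cfun \<alpha> W s z" using eq[OF z] by simp
  qed
  have coord\<beta>: "\<beta> \<in> coordinates X"
    unfolding coordinates_def mem_Collect_eq
  proof (intro conjI allI impI)
    show "opn (cdom \<beta>)" using opnU cdom by simp
    show "cpt \<beta> \<in> extensional (cdom \<beta>)" by (simp add: \<beta>_def)
    show openV: "open (cpt \<beta> ` cdom \<beta>)"
      unfolding cdom cpt[OF order.refl] U(2) by (rule T.body_open) auto
    show "homeomorphic_map (subtopology (space_of X) (cdom \<beta>)) (top_of_set (cpt \<beta> ` cdom \<beta>)) (cpt \<beta>)"
      unfolding cdom
    proof (rule bijective_open_imp_homeomorphic_map)
      have top: "topspace (subtopology (space_of X) U) = U"
        using openin_subset[OF opnU] by auto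
      have opns: "opn W \<and> W \<subseteq> U" if "openin (subtopology (space_of X) U) W" for W
        using that openin_open_subtopology[OF opnU] by blast
      show "open_map (subtopology (space_of X) U) (top_of_set (cpt \<beta> ` U)) (cpt \<beta>)"
        unfolding open_map_def
      proof (intro allI impI)
        fix W assume "openin (subtopology (space_of X) U) W"
        then have W: "opn W" "W \<subseteq> U" using opns by auto
        then have "open (cpt \<beta> ` W)" unfolding cpt[OF W(2)] by (intro T.body_open sub W)
        then show "openin (top_of_set (cpt \<beta> ` U)) (cpt \<beta> ` W)"
          using W by (auto intro: open_subset)
      qed
      show "continuous_map (subtopology (space_of X) U) (top_of_set (cpt \<beta> ` U)) (cpt \<beta>)"
      proof -
        have "continuous_map (subtopology (space_of X) (cdom \<alpha>)) (top_of_set (cpt \<alpha> ` cdom \<alpha>)) (cpt \<alpha>)"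
          using homeomorphic_imp_continuous_map[OF coordinates_top(3)[OF coord]] .
        then have "continuous_map (subtopology (space_of X) U) euclidean (cpt \<alpha>)"
          by (intro continuous_map_from_subtopology_mono[OF continuous_map_into_fulltopology Usub])
        moreover have "cpt \<alpha> \<in> topspace (subtopology (space_of X) U) \<rightarrow> ?V"
          unfolding top using U(2) by blast
        ultimately have "continuous_map (subtopology (space_of X) U) (top_of_set ?V) (cpt \<alpha>)"
          by (simp add: continuous_map_in_subtopology)
        moreover have "continuous_map (top_of_set ?V) euclidean T.body"
          using T.body_holomorphic holomorphic_on_imp_continuous_on by (simp add: continuous_map_iff_continuous)
        ultimately have "continuous_map (subtopology (space_of X) U) euclidean (T.body \<circ> cpt \<alpha>)"
          by (rule continuous_map_compose)
        then have "continuous_map (subtopology (space_of X) U) euclidean (cpt \<beta>)"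
          by (rule continuous_map_eq) (simp add: \<beta>_def top)
        then show ?thesis using top by (simp add: continuous_map_in_subtopology)
      qed
      show "cpt \<beta> ` topspace (subtopology (space_of X) U) = topspace (top_of_set (cpt \<beta> ` U))"
        using top by simp
      have "inj_on (cpt \<alpha>) U" using coordinates_top(1)[OF coord] Usub by (rule inj_on_subset)
      then have "inj_on (T.body \<circ> cpt \<alpha>) U" using T.body_inj U(2) by (intro comp_inj_on) auto
      then have "inj_on (cpt \<beta>) U" by (simp add: \<beta>_def o_def inj_on_def)
      then show "inj_on (cpt \<beta>) (topspace (subtopology (space_of X) U))" using top by simp
    qed
    show "cfun \<beta> W = undefined" if "\<not> (opn W \<and> W \<subseteq> cdom \<beta>)" for W
      using that by (auto simp: \<beta>_def)
    fix W assume "opn W \<and> W \<subseteq> cdom \<beta>"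
    then have W: "opn W" "W \<subseteq> U" using cdom by auto
    note chW = sub(1)[OF W]
    have S: "T.subst (\<lambda>w. cfun \<beta> W s w + cfun \<beta> W t w) z = T.subst (cfun \<beta> W s) z + T.subst (cfun \<beta> W t) z"
      "T.subst (\<lambda>w. cfun \<beta> W s w * cfun \<beta> W t w) z = T.subst (cfun \<beta> W s) z * T.subst (cfun \<beta> W t) z"
      if st: "s \<in> carrier (sect X W)" "t \<in> carrier (sect X W)" and z: "z \<in> cpt \<alpha> ` W" for s t z
    proof -
      note hst = cf_hol[OF W st(1)] cf_hol[OF W st(2)]
      show "T.subst (\<lambda>w. cfun \<beta> W s w + cfun \<beta> W t w) z = T.subst (cfun \<beta> W s) z + T.subst (cfun \<beta> W t) z"
        by (rule T.subst_add[OF sub(2,3)[OF W] hst z])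
      show "T.subst (\<lambda>w. cfun \<beta> W s w * cfun \<beta> W t w) z = T.subst (cfun \<beta> W s) z * T.subst (cfun \<beta> W t) z"
        by (rule T.subst_mult[OF sub(2,3)[OF W] hst z])
    qed
    have hol\<beta>: "svhol (cpt \<beta> ` W) (cfun \<beta> W s)" if "s \<in> carrier (sect X W)" for s
      unfolding cpt[OF W(2)] by (rule cf_hol[OF W that])
    have zero\<beta>: "cfun \<beta> W s z = 0" if "s \<in> carrier (sect X W)" "z \<notin> cpt \<beta> ` W" for s z
      using cf(1)[OF W that(1)] that(2) by (simp add: superfunctions_carrier)
    show "cfun \<beta> W \<in> extensional (carrier (sect X W))" using W by (simp add: \<beta>_def)
    show "cfun \<beta> W \<in> ring_iso (sect X W) (superfunctions (cpt \<beta> ` W))"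
      unfolding ring_iso_def mem_Collect_eq
    proof
      show "cfun \<beta> W \<in> ring_hom (sect X W) (superfunctions (cpt \<beta> ` W))"
      proof (rule ring_hom_memI)
        show "cfun \<beta> W s \<in> carrier (superfunctions (cpt \<beta> ` W))" if "s \<in> carrier (sect X W)" for s
          using cf(1)[OF W that] .
        fix s t assume st: "s \<in> carrier (sect X W)" "t \<in> carrier (sect X W)"
        have "cfun \<beta> W (s \<otimes>\<^bsub>sect X W\<^esub> t) = cut (cpt \<beta> ` W) (\<lambda>w. cfun \<beta> W s w * cfun \<beta> W t w)"
          using st W by (intro lift svhol_intros hol\<beta>) (simp_all add: S subst cfun_mult[OF chW])
        then show "cfun \<beta> W (s \<otimes>\<^bsub>sect X W\<^esub> t) = cfun \<beta> W s \<otimes>\<^bsub>superfunctions (cpt \<beta> ` W)\<^esub> cfun \<beta> W t"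
          using zero\<beta> st by (auto simp: superfunctions_def cut_def fun_eq_iff)
        have "cfun \<beta> W (s \<oplus>\<^bsub>sect X W\<^esub> t) = cut (cpt \<beta> ` W) (\<lambda>w. cfun \<beta> W s w + cfun \<beta> W t w)"
          using st W by (intro lift svhol_intros hol\<beta>) (simp_all add: S subst cfun_add[OF chW])
        then show "cfun \<beta> W (s \<oplus>\<^bsub>sect X W\<^esub> t) = cfun \<beta> W s \<oplus>\<^bsub>superfunctions (cpt \<beta> ` W)\<^esub> cfun \<beta> W t"
          using zero\<beta> st by (auto simp: superfunctions_def cut_def fun_eq_iff)
      next
        have "cfun \<beta> W \<one>\<^bsub>sect X W\<^esub> = cut (cpt \<beta> ` W) (\<lambda>w. svconst 1)"
        proof (rule lift[OF W])
          fix z assume z: "z \<in> cpt \<alpha> ` W"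
          show "T.subst (\<lambda>w. svconst 1) z = cfun \<alpha> W \<one>\<^bsub>sect X W\<^esub> z"
            unfolding T.subst_svconst[OF sub(2,3)[OF W]] cfun_one[OF chW z] by (rule svconst_hom)
        qed (use W in simp_all)
        then show "cfun \<beta> W \<one>\<^bsub>sect X W\<^esub> = \<one>\<^bsub>superfunctions (cpt \<beta> ` W)\<^esub>"
          by (simp add: superfunctions_def cut_def svconst_hom)
      qed
      show "bij_betw (cfun \<beta> W) (carrier (sect X W)) (carrier (superfunctions (cpt \<beta> ` W)))"
      proof -
        have "bij_betw (inv_into (carrier (superfunctions (cpt \<beta> ` W))) (\<Phi> W) \<circ> cfun \<alpha> W)
            (carrier (sect X W)) (carrier (superfunctions (cpt \<beta> ` W)))"
          by (rule bij_betw_trans[OF cfun_bij[OF chW] bij_betw_inv_into[OF bij\<Phi>[OF W]]])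
        then show ?thesis
          by (rule bij_betw_cong[THEN iffD1, rotated])
            (simp add: \<beta>_def W cpt[OF W(2), unfolded \<beta>_def, simplified])
      qed
    qed
    show "cfun \<beta> W ` par X p W \<subseteq> superfunction_parity p (cpt \<beta> ` W)" for p
    proof
      fix f assume "f \<in> cfun \<beta> W ` par X p W"
      then obtain s where s: "s \<in> par X p W" "f = cfun \<beta> W s" by blast
      have car: "s \<in> carrier (sect X W)" using par_closed[OF W(1) s(1)] .
      define k :: "'n superval" where "k = svconst (if p then - 1 else 1)"
      have "cfun \<beta> W s = cut (cpt \<beta> ` W) (\<lambda>w. k * svinvol (cfun \<beta> W s w))"
      proof (rule lift[OF W car])
        show "svhol (cpt \<beta> ` W) (\<lambda>w. k * svinvol (cfun \<beta> W s w))" by (intro svhol_intros hol\<beta> car)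
        fix z assume z: "z \<in> cpt \<alpha> ` W"
        have "T.subst (\<lambda>w. k * svinvol (cfun \<beta> W s w)) z = k * svinvol (cfun \<alpha> W s z)"
          unfolding T.subst_mult[OF sub(2,3)[OF W] svhol_const svhol_svinvol[OF cf_hol[OF W car]] z]
            T.subst_svinvol[OF sub(2,3)[OF W] cf_hol[OF W car] z] subst[OF W car z] k_def
            T.subst_svconst[OF sub(2,3)[OF W]] by simp
        then show "T.subst (\<lambda>w. k * svinvol (cfun \<beta> W s w)) z = cfun \<alpha> W s z"
          using s(1) z by (auto simp: par_iff[OF chW] k_def svconst_hom)
      qed
      then have "cfun \<beta> W s w = k * svinvol (cfun \<beta> W s w)" if "w \<in> cpt \<beta> ` W" for w
        using that by (metis cut_def)
      note eq = this
      have "cfun \<beta> W s w \<in> sv_parity p" if w: "w \<in> cpt \<beta> ` W" for w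
      proof -
        have k: "k = (if p then - 1 else 1)" by (simp add: k_def svconst_hom)
        have "svinvol (cfun \<beta> W s w) = svinvol (k * svinvol (cfun \<beta> W s w))"
          by (rule arg_cong[OF eq[OF w]])
        also have "\<dots> = k * cfun \<beta> W s w" by (simp add: k)
        finally show ?thesis by (cases p) (simp_all add: k sv_parity_even_iff sv_parity_odd_iff)
      qed
      then show "f \<in> superfunction_parity p (cpt \<beta> ` W)"
        using cf(1)[OF W car] s(2) by (simp add: superfunction_parity_def)
    qed
    show "cfun \<beta> W (scalar X W a) = cut (cpt \<beta> ` W) (\<lambda>_. svconst a)" for a
      using W by (intro lift) (simp_all add: T.subst_svconst[OF sub(2,3)[OF W]] cfun_scalar[OF chW])
    fix W' s assume "opn W' \<and> W' \<subseteq> W \<and> s \<in> carrier (sect X W)"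
    then have W': "opn W'" "W' \<subseteq> W" "W' \<subseteq> U" and s: "s \<in> carrier (sect X W)" using W by auto
    show "cfun \<beta> W' (res X W W' s) = cut (cpt \<beta> ` W') (cfun \<beta> W s)"
    proof (rule lift[OF W'(1,3)])
      show "res X W W' s \<in> carrier (sect X W')" using W W' s by simp
      show "svhol (cpt \<beta> ` W') (cfun \<beta> W s)" using svhol_subset[OF hol\<beta>[OF s]] W' by blast
      fix z assume z: "z \<in> cpt \<alpha> ` W'"
      then show "T.subst (cfun \<beta> W s) z = cfun \<alpha> W' (res X W W' s) z"
        using subst[OF W s, of z] W' cfun_res[OF chW W'(1,2) s z] by auto
    qed
  qed
  have chU: "in_chart \<beta> U" using coord\<beta> opnU cdom by (simp add: in_chart_def)
  have VB: "?V \<subseteq> ?B" by (rule r')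
  have z\<beta>: "cfun \<alpha> U (zsec \<beta> U) z = F z" and t\<beta>: "cfun \<alpha> U (tsec \<beta> U) z = \<Psi> z" if z: "z \<in> ?V" for z
  proof -
    have zU: "z \<in> cpt \<alpha> ` U" using z U(2) by simp
    have "T.subst (cfun \<beta> U (zsec \<beta> U)) z = T.subst (\<lambda>w. svconst (gconst w)) z"
      by (rule T.subst_cong[OF sub(2,3)[OF opnU order.refl] zU]) (simp add: zsec(2)[OF chU] cpt[OF order.refl])
    then show "cfun \<alpha> U (zsec \<beta> U) z = F z"
      using subst[OF opnU order.refl zsec(1)[OF chU] zU] T.subst_z[OF sub(2,3)[OF opnU order.refl] zU] by simp
    have "T.subst (cfun \<beta> U (tsec \<beta> U)) z = T.subst (\<lambda>w. sv_theta) z"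
      by (rule T.subst_cong[OF sub(2,3)[OF opnU order.refl] zU]) (simp add: tsec(2)[OF chU] cpt[OF order.refl])
    then show "cfun \<alpha> U (tsec \<beta> U) z = \<Psi> z"
      using subst[OF opnU order.refl tsec(1)[OF chU] zU] T.subst_theta[OF sub(2,3)[OF opnU order.refl]] by simp
  qed
  have V: "open ?V" by simp
  have J: "cfun \<alpha> U (dsec \<alpha> U (tsec \<beta> U)) z = sD \<Psi> z" if z: "z \<in> ?V" for z
    using dsec(2)[OF U(1) tsec(1)[OF chU], of z] z U(2) sD_cong[OF V z t\<beta>] by simp
  have conf: "conf \<beta> \<alpha> U"
    unfolding conf_def
  proof (rule cfun_eqI[OF U(1) dsec(1)[OF U(1) zsec(1)[OF chU]]])
    show "tsec \<beta> U \<otimes>\<^bsub>sect X U\<^esub> dsec \<alpha> U (tsec \<beta> U) \<in> carrier (sect X U)"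
      using opnU tsec(1)[OF chU] dsec(1)[OF U(1) tsec(1)[OF chU]] by simp
    fix z assume z: "z \<in> cpt \<alpha> ` U"
    then have zV: "z \<in> ?V" using U(2) by simp
    have "cfun \<alpha> U (dsec \<alpha> U (zsec \<beta> U)) z = sD F z"
      unfolding dsec(2)[OF U(1) zsec(1)[OF chU] z] by (rule sD_cong[OF V zV z\<beta>])
    also have "\<dots> = \<Psi> z * sD \<Psi> z" using DF VB zV by blast
    finally show "cfun \<alpha> U (dsec \<alpha> U (zsec \<beta> U)) z =
        cfun \<alpha> U (tsec \<beta> U \<otimes>\<^bsub>sect X U\<^esub> dsec \<alpha> U (tsec \<beta> U)) z"
      using cfun_mult[OF U(1) tsec(1)[OF chU] dsec(1)[OF U(1) tsec(1)[OF chU]]] t\<beta>[OF zV] J[OF zV] by simp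
  qed
  have comp: "\<beta> \<in> compatible X"
  proof (rule compatibleI[OF coord\<beta>])
    fix \<kappa> assume \<kappa>: "\<kappa> \<in> sc_atlas X"
    let ?W = "cdom \<kappa> \<inter> cdom \<beta>"
    note c\<kappa> = atlas_compatible[OF \<kappa>]
    have W: "opn ?W" "?W \<subseteq> U" "?W \<subseteq> cdom \<alpha>" using compatible_opn[OF c\<kappa>] opnU Usub cdom by auto
    have ch: "in_chart \<beta> ?W" "in_chart \<alpha> ?W" "in_chart \<kappa> ?W"
      using W c\<kappa> \<alpha> in_chart_subset[OF chU] by (auto simp: compatible_in_chart)
    have "conf \<beta> \<alpha> ?W" using conf_subset[OF U(1) chU conf W(1,2)] .
    then have "conf \<alpha> \<beta> ?W" by (rule conf_sym[OF ch(2,1)])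
    moreover have "conf \<kappa> \<alpha> ?W" using compatible_conf[OF \<alpha> c\<kappa> W(1,3)] by simp
    ultimately show "conf \<kappa> \<beta> ?W" by (intro conf_trans[OF ch])
  qed
  have ov: "in_charts \<alpha> \<beta> U" using \<alpha> comp opnU Usub cdom by (simp add: in_charts_def)
  have "schw X \<beta> \<alpha> U = res X (cdom \<alpha>) U h"
  proof (rule cfun_eqI[OF U(1) schw_carrier[OF ov]])
    show "res X (cdom \<alpha>) U h \<in> carrier (sect X U)" using hcar opn\<alpha> opnU Usub by simp
    fix z assume z: "z \<in> cpt \<alpha> ` U"
    then have zV: "z \<in> ?V" using U(2) by simp
    have LJ: "cfun \<alpha> U (jac X \<alpha> \<beta> U) w = L w" if w: "w \<in> ?V" for w
    proof -
      have wU: "w \<in> cpt \<alpha> ` U" using w U(2) by simp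
      have "sD \<Psi> w * cfun \<alpha> U (jac X \<alpha> \<beta> U) w = 1"
        using arg_cong[OF jac_inverse[OF ov], of "\<lambda>s. cfun \<alpha> U s w"]
          cfun_mult[OF U(1) jac_carrier[OF ov] jac_carrier[OF in_charts_sym[OF ov]]]
          cfun_one[OF U(1) wU] J[OF w] by (simp add: jac_eq[OF ov])
      then have "L w * (sD \<Psi> w * cfun \<alpha> U (jac X \<alpha> \<beta> U) w) = L w" by simp
      moreover have "L w * sD \<Psi> w = 1"
        using L[of w] evL[of w] w VB S.even_central[of "L w" "sD \<Psi> w"] by auto
      ultimately show ?thesis by (simp flip: mult.assoc)
    qed
    have "cfun \<alpha> U (schw X \<beta> \<alpha> U) z = - (sD \<Psi> z * sD (sD (sD L)) z)"
      using schw_value[OF ov z] sD3_cong[OF V zV LJ] J[OF zV] by (simp add: jac_eq[OF ov])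
    also have "\<dots> = sD \<Psi> z * (?h z * L z)" using ode[of z] zV VB by auto
    also have "\<dots> = sD \<Psi> z * (L z * ?h z)"
      using evL[of z] zV VB S.even_central[of "L z" "?h z"] by auto
    also have "\<dots> = ?h z" using L[of z] zV VB by (auto simp flip: mult.assoc)
    finally show "cfun \<alpha> U (schw X \<beta> \<alpha> U) z = cfun \<alpha> U (res X (cdom \<alpha>) U h) z"
      using cfun_res[OF ch opnU Usub hcar z] by simp
  qed
  then show ?thesis using that[of \<beta>] comp xU Usub cdom by simp
qed


section \<open>The rank \<open>1|1\<close> bundle and its dual\<close>

declare opn_Int [simp] compatible_opn [simp]

lemma res_res' [simp]:
  assumes "opn U" "opn V" "opn W" "W \<subseteq> V" "V \<subseteq> U" "s \<in> carrier (sect X U)"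
  shows "res X V W (res X U V s) = res X U W s"
  by (rule res_res[OF assms])

text \<open>
  The gluing axiom indexes sections by open sets; here the same open set may occur for several indices.
\<close>

lemma glue_sections:
  assumes D: "\<And>i. i \<in> I \<Longrightarrow> opn (D i)" and s: "\<And>i. i \<in> I \<Longrightarrow> s i \<in> carrier (sect X (D i))"
    and agree: "\<And>i j. i \<in> I \<Longrightarrow> j \<in> I \<Longrightarrow> res X (D i) (D i \<inter> D j) (s i) = res X (D j) (D i \<inter> D j) (s j)"
  obtains t where "t \<in> carrier (sect X (\<Union>i\<in>I. D i))" "\<And>i. i \<in> I \<Longrightarrow> res X (\<Union>i\<in>I. D i) (D i) t = s i"
proof -
  define f where "f S = s (SOME i. i \<in> I \<and> D i = S)" for S
  have f: "f (D i) = s i" if i: "i \<in> I" for i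
  proof -
    define j where "j = (SOME j. j \<in> I \<and> D j = D i)"
    have j: "j \<in> I" "D j = D i" using someI[of "\<lambda>j. j \<in> I \<and> D j = D i" i] i by (auto simp: j_def)
    have "res X (D i) (D i) (s i) = res X (D i) (D i) (s j)" using agree[OF i j(1)] j(2) by simp
    then show ?thesis using res_id[OF D[OF i]] s[OF i] s[OF j(1)] j(2) by (simp add: f_def j_def)
  qed
  have "\<exists>t\<in>carrier (sect X (\<Union>(D ` I))). \<forall>U\<in>D ` I. res X (\<Union>(D ` I)) U t = f U"
    by (rule sheaf_gluing) (use D s f agree in auto)
  then show ?thesis using that f by auto
qed

text \<open>
  The component of the other parity is locally zero, as the decomposition by parity is unique and
  compatible with restriction.
\<close>

lemma par_local:
  assumes U: "opn U" and s: "s \<in> carrier (sect X U)"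
    and loc: "\<And>x. x \<in> U \<Longrightarrow> \<exists>W. opn W \<and> x \<in> W \<and> W \<subseteq> U \<and> res X U W s \<in> par X p W"
  shows "s \<in> par X p U"
proof -
  interpret R: ring "sect X U" by (rule sect_ring[OF U])
  obtain a b where ab: "a \<in> par X False U" "b \<in> par X True U" "s = a \<oplus>\<^bsub>sect X U\<^esub> b"
    using par_decomp[OF U s] by auto
  have car: "a \<in> carrier (sect X U)" "b \<in> carrier (sect X U)" using ab par_closed[OF U] by auto
  have "(if p then a else b) = \<zero>\<^bsub>sect X U\<^esub>"
  proof (rule sect_local_eqI[OF U])
    fix x assume "x \<in> U"
    then obtain W where W: "opn W" "x \<in> W" "W \<subseteq> U" "res X U W s \<in> par X p W" using loc by blast
    interpret RW: ring "sect X W" by (rule sect_ring[OF W(1)])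
    have r: "res X U W a \<in> par X False W" "res X U W b \<in> par X True W"
      using res_parity[OF U W(1,3)] ab by auto
    have rs: "res X U W s = res X U W a \<oplus>\<^bsub>sect X W\<^esub> res X U W b" using ab(3) car U W by simp
    have z: "\<zero>\<^bsub>sect X W\<^esub> \<in> par X q W" for q
      using par_subgroup[OF W(1)] additive_subgroup.zero_closed by blast
    have rc: "res X U W a \<in> carrier (sect X W)" "res X U W b \<in> carrier (sect X W)" "res X U W s \<in> carrier (sect X W)"
      using car s U W by auto
    define P where "P = (\<lambda>(a', b'). a' \<in> par X False W \<and> b' \<in> par X True W \<and> res X U W s = a' \<oplus>\<^bsub>sect X W\<^esub> b')"
    have uniq: "\<exists>!ab. P ab" unfolding P_def by (rule par_decomp[OF W(1) rc(3)])
    have P1: "P (res X U W a, res X U W b)" using r rs by (simp add: P_def)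
    have P2: "P (if p then (\<zero>\<^bsub>sect X W\<^esub>, res X U W s) else (res X U W s, \<zero>\<^bsub>sect X W\<^esub>))"
      using z W(4) rc by (cases p) (simp_all add: P_def)
    have "(res X U W a, res X U W b) = (if p then (\<zero>\<^bsub>sect X W\<^esub>, res X U W s) else (res X U W s, \<zero>\<^bsub>sect X W\<^esub>))"
      using uniq P1 P2 by blast
    then have "res X U W (if p then a else b) = \<zero>\<^bsub>sect X W\<^esub>" by (cases p) auto
    then show "\<exists>W. opn W \<and> x \<in> W \<and> W \<subseteq> U \<and>
        res X U W (if p then a else b) = res X U W \<zero>\<^bsub>sect X U\<^esub>"
      using W U by auto
  qed (use car U in \<open>auto split: if_splits\<close>)
  then show ?thesis using ab car by (cases p) simp_all
qed

abbreviation K where "K c \<equiv> K_module c X"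
abbreviation N where "N c \<equiv> dual_module X (K c)"

context
  fixes c :: complex
begin

text \<open>The two entries \<open>c/3 \<sigma>\<close> and \<open>(D\<Psi>)\<^sup>3\<close> of the change of frame.\<close>

definition csw :: "('p, 's, 'n) superchart \<Rightarrow> ('p, 's, 'n) superchart \<Rightarrow> 'p set \<Rightarrow> 's" where
  "csw \<beta> \<alpha> W = scalar X W (gconst (c / 3)) \<otimes>\<^bsub>sect X W\<^esub> schw X \<beta> \<alpha> W"

definition jac3 :: "('p, 's, 'n) superchart \<Rightarrow> ('p, 's, 'n) superchart \<Rightarrow> 'p set \<Rightarrow> 's" where
  "jac3 \<beta> \<alpha> W = jac X \<beta> \<alpha> W [^]\<^bsub>sect X W\<^esub> (3::nat)"

context
  fixes \<alpha> \<beta> W assumes W: "in_charts \<alpha> \<beta> W"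
begin

lemma csw_par: "csw \<beta> \<alpha> W \<in> par X True W"
proof -
  have "scalar X W (gconst (c / 3)) \<in> par X False W"
    using scalar_parity[OF in_chartsD(4)[OF W], of _ False] by (simp add: gparity_even_iff)
  then show ?thesis using par_mult[OF in_chartsD(4)[OF W] _ schw_par[OF W]] by (fastforce simp: csw_def)
qed

lemma csw_carrier [simp]: "csw \<beta> \<alpha> W \<in> carrier (sect X W)"
  using par_closed[OF in_chartsD(4)[OF W] csw_par] .

lemma jac3_carrier [simp]: "jac3 \<beta> \<alpha> W \<in> carrier (sect X W)"
  using jac_carrier[OF W] in_chartsD(4)[OF W] by (simp add: jac3_def)

lemma csw_value: "z \<in> cpt \<alpha> ` W \<Longrightarrow> cfun \<alpha> W (csw \<beta> \<alpha> W) z =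
    svconst (gconst (c / 3)) * cfun \<alpha> W (schw X \<beta> \<alpha> W) z"
  using schw_carrier[OF W] in_chartsD[OF W] by (simp add: csw_def cfun_simps)

lemma jac3_par: "jac3 \<beta> \<alpha> W \<in> par X False W"
  using jac_value[OF W] jac3_carrier
  by (auto simp: par_iff[OF in_chartsD(1)[OF W]] jac3_def cfun_cube[OF in_chartsD(1)[OF W] jac_carrier[OF W]]
    power3_eq_cube)

lemma csw_zero_iff:
  assumes "c \<noteq> 0"
  shows "csw \<beta> \<alpha> W = \<zero>\<^bsub>sect X W\<^esub> \<longleftrightarrow> schw X \<beta> \<alpha> W = \<zero>\<^bsub>sect X W\<^esub>"
proof
  assume zero: "csw \<beta> \<alpha> W = \<zero>\<^bsub>sect X W\<^esub>"
  show "schw X \<beta> \<alpha> W = \<zero>\<^bsub>sect X W\<^esub>"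
  proof (rule cfun_eqI[OF in_chartsD(1)[OF W] schw_carrier[OF W]])
    fix z assume z: "z \<in> cpt \<alpha> ` W"
    have "svconst (gconst (3 / c)) * (svconst (gconst (c / 3)) * cfun \<alpha> W (schw X \<beta> \<alpha> W) z) = 0"
      using csw_value[OF z] zero by (simp add: cfun_zero[OF in_chartsD(1)[OF W]])
    then show "cfun \<alpha> W (schw X \<beta> \<alpha> W) z = cfun \<alpha> W \<zero>\<^bsub>sect X W\<^esub> z"
      using assms by (simp add: cfun_zero[OF in_chartsD(1)[OF W]] svconst_hom flip: mult.assoc svconst_hom(6) gconst_hom(2))
  qed (use in_chartsD[OF W] in simp)
next
  interpret R: ring "sect X W" using sect_ring in_chartsD(4)[OF W] by blast
  assume "schw X \<beta> \<alpha> W = \<zero>\<^bsub>sect X W\<^esub>"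
  then show "csw \<beta> \<alpha> W = \<zero>\<^bsub>sect X W\<^esub>" using in_chartsD(4)[OF W] by (simp add: csw_def)
qed

lemma csw_res:
  assumes "opn W'" "W' \<subseteq> W"
  shows "res X W W' (csw \<beta> \<alpha> W) = csw \<beta> \<alpha> W'" "res X W W' (jac3 \<beta> \<alpha> W) = jac3 \<beta> \<alpha> W'"
  using assms in_chartsD(4)[OF W] schw_carrier[OF W] jac_carrier[OF W]
  by (simp_all add: csw_def jac3_def schw_res[OF W] jac_res[OF W] res_scalar)

end

lemma csw_self:
  assumes W: "in_charts \<alpha> \<alpha> W"
  shows "csw \<alpha> \<alpha> W = \<zero>\<^bsub>sect X W\<^esub>" "jac3 \<alpha> \<alpha> W = \<one>\<^bsub>sect X W\<^esub>"
proof -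
  interpret R: ring "sect X W" using sect_ring in_chartsD(4)[OF W] by blast
  show "csw \<alpha> \<alpha> W = \<zero>\<^bsub>sect X W\<^esub>" "jac3 \<alpha> \<alpha> W = \<one>\<^bsub>sect X W\<^esub>"
    using in_chartsD(4)[OF W] by (simp_all add: csw_def jac3_def schw_self[OF W] jac_self[OF W])
qed

lemma csw_cocycle:
  assumes ab: "in_charts \<alpha> \<beta> W" and bc: "in_charts \<beta> \<gamma> W"
  shows "csw \<gamma> \<alpha> W = csw \<beta> \<alpha> W \<oplus>\<^bsub>sect X W\<^esub> csw \<gamma> \<beta> W \<otimes>\<^bsub>sect X W\<^esub> jac3 \<beta> \<alpha> W"
    "jac3 \<gamma> \<alpha> W = jac3 \<gamma> \<beta> W \<otimes>\<^bsub>sect X W\<^esub> jac3 \<beta> \<alpha> W"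
proof -
  have ac: "in_charts \<alpha> \<gamma> W" using ab bc by (simp add: in_charts_def)
  note \<alpha> = in_chartsD(1)[OF ab] and opn = in_chartsD(4)[OF ab]
  have J: "svinvol (cfun \<alpha> W (jac X \<beta> \<alpha> W) z) = cfun \<alpha> W (jac X \<beta> \<alpha> W) z" if "z \<in> cpt \<alpha> ` W" for z
    by (rule jac_value[OF ab that])
  have H: "svinvol (cfun \<alpha> W (jac X \<gamma> \<beta> W) z) = cfun \<alpha> W (jac X \<gamma> \<beta> W) z" if "z \<in> cpt \<alpha> ` W" for z
    using jac_par[OF bc] that by (auto simp: par_iff[OF \<alpha>])
  show "csw \<gamma> \<alpha> W = csw \<beta> \<alpha> W \<oplus>\<^bsub>sect X W\<^esub> csw \<gamma> \<beta> W \<otimes>\<^bsub>sect X W\<^esub> jac3 \<beta> \<alpha> W"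
  proof (rule cfun_eqI[OF \<alpha>])
    fix z assume z: "z \<in> cpt \<alpha> ` W"
    let ?k = "svconst (gconst (c / 3)) :: 'n superval" and ?J = "cfun \<alpha> W (jac X \<beta> \<alpha> W) z"
    have "?J ^ 3 * cfun \<alpha> W (schw X \<gamma> \<beta> W) z = cfun \<alpha> W (schw X \<gamma> \<beta> W) z * ?J ^ 3"
      by (rule S.even_central) (simp add: J[OF z] power3_eq_cube)
    then show "cfun \<alpha> W (csw \<gamma> \<alpha> W) z =
        cfun \<alpha> W (csw \<beta> \<alpha> W \<oplus>\<^bsub>sect X W\<^esub> csw \<gamma> \<beta> W \<otimes>\<^bsub>sect X W\<^esub> jac3 \<beta> \<alpha> W) z"
      using z opn csw_carrier[OF bc] csw_carrier[OF ab] schw_carrier[OF ab] schw_carrier[OF bc] jac_carrier[OF ab]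
        jac3_carrier[OF ab]
      by (simp add: csw_value[OF ab] csw_value[OF ac] schw_cocycle[OF ab bc] cfun_simps[OF \<alpha>] distrib_left)
        (simp add: csw_def jac3_def cfun_simps[OF \<alpha>] mult.assoc)
  qed (use opn csw_carrier ab bc ac jac3_carrier in simp_all)
  show "jac3 \<gamma> \<alpha> W = jac3 \<gamma> \<beta> W \<otimes>\<^bsub>sect X W\<^esub> jac3 \<beta> \<alpha> W"
  proof (rule cfun_eqI[OF \<alpha>])
    fix z assume z: "z \<in> cpt \<alpha> ` W"
    show "cfun \<alpha> W (jac3 \<gamma> \<alpha> W) z = cfun \<alpha> W (jac3 \<gamma> \<beta> W \<otimes>\<^bsub>sect X W\<^esub> jac3 \<beta> \<alpha> W) z"
      using opn jac_carrier[OF ab] jac_carrier[OF bc] J[OF z] H[OF z] jac3_carrier[OF ab] jac3_carrier[OF bc]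
      by (simp add: cfun_mult[OF \<alpha>]) (simp add: jac3_def jac_comp[OF ab bc] cfun_simps[OF \<alpha>] power3_eq_cube S.even_ac)
  qed (use opn jac3_carrier ab bc ac in simp_all)
qed

lemma jac3_inverse:
  assumes W: "in_charts \<alpha> \<beta> W"
  shows "jac3 \<beta> \<alpha> W \<otimes>\<^bsub>sect X W\<^esub> jac3 \<alpha> \<beta> W = \<one>\<^bsub>sect X W\<^esub>"
proof -
  have "in_charts \<beta> \<beta> W" using W by (simp add: in_charts_def)
  then show ?thesis using csw_cocycle(2)[OF in_charts_sym[OF W] W] csw_self by simp
qed

lemma in_charts_overlap:
  "opn U \<Longrightarrow> \<alpha> \<in> compatible X \<Longrightarrow> \<beta> \<in> compatible X \<Longrightarrow> in_charts \<alpha> \<beta> (U \<inter> cdom \<alpha> \<inter> cdom \<beta>)"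
  by (auto simp: in_charts_def)


lemma K_sect_iff: "m \<in> msect (K c) U \<longleftrightarrow>
    m \<in> (\<Pi>\<^sub>E \<alpha>\<in>compatible X. carrier (sect X (U \<inter> cdom \<alpha>)) \<times> carrier (sect X (U \<inter> cdom \<alpha>))) \<and>
    (\<forall>\<alpha>\<in>compatible X. \<forall>\<beta>\<in>compatible X.
      res X (U \<inter> cdom \<beta>) (U \<inter> cdom \<alpha> \<inter> cdom \<beta>) (fst (m \<beta>)) =
        res X (U \<inter> cdom \<alpha>) (U \<inter> cdom \<alpha> \<inter> cdom \<beta>) (fst (m \<alpha>)) \<oplus>\<^bsub>sect X (U \<inter> cdom \<alpha> \<inter> cdom \<beta>)\<^esub>
          csw \<beta> \<alpha> (U \<inter> cdom \<alpha> \<inter> cdom \<beta>) \<otimes>\<^bsub>sect X (U \<inter> cdom \<alpha> \<inter> cdom \<beta>)\<^esub>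
            res X (U \<inter> cdom \<alpha>) (U \<inter> cdom \<alpha> \<inter> cdom \<beta>) (snd (m \<alpha>)) \<and>
      res X (U \<inter> cdom \<beta>) (U \<inter> cdom \<alpha> \<inter> cdom \<beta>) (snd (m \<beta>)) =
        jac3 \<beta> \<alpha> (U \<inter> cdom \<alpha> \<inter> cdom \<beta>) \<otimes>\<^bsub>sect X (U \<inter> cdom \<alpha> \<inter> cdom \<beta>)\<^esub>
          res X (U \<inter> cdom \<alpha>) (U \<inter> cdom \<alpha> \<inter> cdom \<beta>) (snd (m \<alpha>)))"
  by (simp add: K_module_def Let_def csw_def jac3_def)

lemma K_carrier:
  assumes "m \<in> msect (K c) U" "\<alpha> \<in> compatible X"
  shows "fst (m \<alpha>) \<in> carrier (sect X (U \<inter> cdom \<alpha>))" "snd (m \<alpha>) \<in> carrier (sect X (U \<inter> cdom \<alpha>))"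
  using assms unfolding K_sect_iff by (auto simp: PiE_iff mem_Times_iff)

lemma K_change:
  assumes m: "m \<in> msect (K c) U" and U: "opn U" and ab: "\<alpha> \<in> compatible X" "\<beta> \<in> compatible X"
    and W: "opn W" "W \<subseteq> U" "W \<subseteq> cdom \<alpha>" "W \<subseteq> cdom \<beta>"
  shows "res X (U \<inter> cdom \<beta>) W (fst (m \<beta>)) = res X (U \<inter> cdom \<alpha>) W (fst (m \<alpha>)) \<oplus>\<^bsub>sect X W\<^esub>
      csw \<beta> \<alpha> W \<otimes>\<^bsub>sect X W\<^esub> res X (U \<inter> cdom \<alpha>) W (snd (m \<alpha>))"
    "res X (U \<inter> cdom \<beta>) W (snd (m \<beta>)) = jac3 \<beta> \<alpha> W \<otimes>\<^bsub>sect X W\<^esub> res X (U \<inter> cdom \<alpha>) W (snd (m \<alpha>))"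
proof -
  let ?O = "U \<inter> cdom \<alpha> \<inter> cdom \<beta>"
  have O: "opn ?O" "W \<subseteq> ?O" "in_charts \<alpha> \<beta> ?O" using U ab W in_charts_overlap by auto
  note car = K_carrier[OF m ab(1)] K_carrier[OF m ab(2)]
  have rel: "res X (U \<inter> cdom \<beta>) ?O (fst (m \<beta>)) = res X (U \<inter> cdom \<alpha>) ?O (fst (m \<alpha>)) \<oplus>\<^bsub>sect X ?O\<^esub>
      csw \<beta> \<alpha> ?O \<otimes>\<^bsub>sect X ?O\<^esub> res X (U \<inter> cdom \<alpha>) ?O (snd (m \<alpha>))"
    "res X (U \<inter> cdom \<beta>) ?O (snd (m \<beta>)) = jac3 \<beta> \<alpha> ?O \<otimes>\<^bsub>sect X ?O\<^esub> res X (U \<inter> cdom \<alpha>) ?O (snd (m \<alpha>))"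
    using m ab by (simp_all add: K_sect_iff)
  have sub: "?O \<subseteq> U \<inter> cdom \<alpha>" "?O \<subseteq> U \<inter> cdom \<beta>" by auto
  note r = csw_carrier[OF O(3)] jac3_carrier[OF O(3)] csw_res[OF O(3) W(1) O(2)]
  show "res X (U \<inter> cdom \<beta>) W (fst (m \<beta>)) = res X (U \<inter> cdom \<alpha>) W (fst (m \<alpha>)) \<oplus>\<^bsub>sect X W\<^esub>
      csw \<beta> \<alpha> W \<otimes>\<^bsub>sect X W\<^esub> res X (U \<inter> cdom \<alpha>) W (snd (m \<alpha>))"
    using arg_cong[OF rel(1), of "res X ?O W"] car U ab W(1) O(1,2) sub r by simp
  show "res X (U \<inter> cdom \<beta>) W (snd (m \<beta>)) = jac3 \<beta> \<alpha> W \<otimes>\<^bsub>sect X W\<^esub> res X (U \<inter> cdom \<alpha>) W (snd (m \<alpha>))"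
    using arg_cong[OF rel(2), of "res X ?O W"] car U ab W(1) O(1,2) sub r by simp
qed

lemma K_simps:
  "mplus (K c) U s t = (\<lambda>\<alpha>\<in>compatible X. (fst (s \<alpha>) \<oplus>\<^bsub>sect X (U \<inter> cdom \<alpha>)\<^esub> fst (t \<alpha>),
      snd (s \<alpha>) \<oplus>\<^bsub>sect X (U \<inter> cdom \<alpha>)\<^esub> snd (t \<alpha>)))"
  "mact (K c) U g s = (\<lambda>\<alpha>\<in>compatible X. (fst (s \<alpha>) \<otimes>\<^bsub>sect X (U \<inter> cdom \<alpha>)\<^esub> res X U (U \<inter> cdom \<alpha>) g,
      snd (s \<alpha>) \<otimes>\<^bsub>sect X (U \<inter> cdom \<alpha>)\<^esub> res X U (U \<inter> cdom \<alpha>) g))"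
  "mres (K c) U V s = (\<lambda>\<alpha>\<in>compatible X. (res X (U \<inter> cdom \<alpha>) (V \<inter> cdom \<alpha>) (fst (s \<alpha>)),
      res X (U \<inter> cdom \<alpha>) (V \<inter> cdom \<alpha>) (snd (s \<alpha>))))"
  by (simp_all add: K_module_def Let_def)

lemma K_par_iff: "m \<in> mpar (K c) p U \<longleftrightarrow> m \<in> msect (K c) U \<and>
    (\<forall>\<alpha>\<in>compatible X. fst (m \<alpha>) \<in> par X p (U \<inter> cdom \<alpha>) \<and> snd (m \<alpha>) \<in> par X (\<not> p) (U \<inter> cdom \<alpha>))"
  by (simp add: K_module_def Let_def)

lemma K_sectI:
  assumes ext: "m \<in> extensional (compatible X)"
    and "\<And>\<alpha>. \<alpha> \<in> compatible X \<Longrightarrow> fst (m \<alpha>) \<in> carrier (sect X (U \<inter> cdom \<alpha>))"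
      "\<And>\<alpha>. \<alpha> \<in> compatible X \<Longrightarrow> snd (m \<alpha>) \<in> carrier (sect X (U \<inter> cdom \<alpha>))"
    and "\<And>\<alpha> \<beta> W. \<alpha> \<in> compatible X \<Longrightarrow> \<beta> \<in> compatible X \<Longrightarrow> W = U \<inter> cdom \<alpha> \<inter> cdom \<beta> \<Longrightarrow>
      res X (U \<inter> cdom \<beta>) W (fst (m \<beta>)) = res X (U \<inter> cdom \<alpha>) W (fst (m \<alpha>)) \<oplus>\<^bsub>sect X W\<^esub>
          csw \<beta> \<alpha> W \<otimes>\<^bsub>sect X W\<^esub> res X (U \<inter> cdom \<alpha>) W (snd (m \<alpha>)) \<and>
      res X (U \<inter> cdom \<beta>) W (snd (m \<beta>)) = jac3 \<beta> \<alpha> W \<otimes>\<^bsub>sect X W\<^esub> res X (U \<inter> cdom \<alpha>) W (snd (m \<alpha>))"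
  shows "m \<in> msect (K c) U"
  using assms unfolding K_sect_iff by (auto simp: PiE_iff mem_Times_iff)

lemma mplus_closed:
  assumes U: "opn U" and m: "m \<in> msect (K c) U" "m' \<in> msect (K c) U"
  shows "mplus (K c) U m m' \<in> msect (K c) U"
proof (rule K_sectI)
  show "mplus (K c) U m m' \<in> extensional (compatible X)" by (simp add: K_simps)
  fix \<alpha> assume \<alpha>: "\<alpha> \<in> compatible X"
  note ca = K_carrier[OF m(1) \<alpha>] K_carrier[OF m(2) \<alpha>]
  then show "fst (mplus (K c) U m m' \<alpha>) \<in> carrier (sect X (U \<inter> cdom \<alpha>))"
    "snd (mplus (K c) U m m' \<alpha>) \<in> carrier (sect X (U \<inter> cdom \<alpha>))" using U \<alpha> by (simp_all add: K_simps)
  fix \<beta> W assume \<beta>: "\<beta> \<in> compatible X" and W: "W = U \<inter> cdom \<alpha> \<inter> cdom \<beta>"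
  note cb = K_carrier[OF m(1) \<beta>] K_carrier[OF m(2) \<beta>]
  have opn: "opn W" "W \<subseteq> U \<inter> cdom \<alpha>" "W \<subseteq> U \<inter> cdom \<beta>" and ch: "in_charts \<alpha> \<beta> W"
    using U \<alpha> \<beta> W in_charts_overlap by auto
  interpret R: ring "sect X W" by (rule sect_ring[OF opn(1)])
  have r: "res X (U \<inter> cdom \<alpha>) W (fst (m \<alpha>)) \<in> carrier (sect X W)" "res X (U \<inter> cdom \<alpha>) W (snd (m \<alpha>)) \<in> carrier (sect X W)"
    "res X (U \<inter> cdom \<alpha>) W (fst (m' \<alpha>)) \<in> carrier (sect X W)" "res X (U \<inter> cdom \<alpha>) W (snd (m' \<alpha>)) \<in> carrier (sect X W)"
    using ca U \<alpha> opn by simp_all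
  show "res X (U \<inter> cdom \<beta>) W (fst (mplus (K c) U m m' \<beta>)) = res X (U \<inter> cdom \<alpha>) W (fst (mplus (K c) U m m' \<alpha>)) \<oplus>\<^bsub>sect X W\<^esub>
          csw \<beta> \<alpha> W \<otimes>\<^bsub>sect X W\<^esub> res X (U \<inter> cdom \<alpha>) W (snd (mplus (K c) U m m' \<alpha>)) \<and>
      res X (U \<inter> cdom \<beta>) W (snd (mplus (K c) U m m' \<beta>)) = jac3 \<beta> \<alpha> W \<otimes>\<^bsub>sect X W\<^esub> res X (U \<inter> cdom \<alpha>) W (snd (mplus (K c) U m m' \<alpha>))"
    using U \<alpha> \<beta> opn ca cb r csw_carrier[OF ch] jac3_carrier[OF ch] K_change[OF m(1) U \<alpha> \<beta>, of W] K_change[OF m(2) U \<alpha> \<beta>, of W]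
    by (simp add: K_simps R.r_distr R.a_ac)
qed

lemma mact_closed:
  assumes U: "opn U" and m: "m \<in> msect (K c) U" and g: "g \<in> carrier (sect X U)"
  shows "mact (K c) U g m \<in> msect (K c) U"
proof (rule K_sectI)
  show "mact (K c) U g m \<in> extensional (compatible X)" by (simp add: K_simps)
  fix \<alpha> assume \<alpha>: "\<alpha> \<in> compatible X"
  note ca = K_carrier[OF m \<alpha>]
  then show "fst (mact (K c) U g m \<alpha>) \<in> carrier (sect X (U \<inter> cdom \<alpha>))"
    "snd (mact (K c) U g m \<alpha>) \<in> carrier (sect X (U \<inter> cdom \<alpha>))" using U \<alpha> g by (simp_all add: K_simps)
  fix \<beta> W assume \<beta>: "\<beta> \<in> compatible X" and W: "W = U \<inter> cdom \<alpha> \<inter> cdom \<beta>"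
  note cb = K_carrier[OF m \<beta>]
  have opn: "opn W" "W \<subseteq> U \<inter> cdom \<alpha>" "W \<subseteq> U \<inter> cdom \<beta>" and ch: "in_charts \<alpha> \<beta> W"
    using U \<alpha> \<beta> W in_charts_overlap by auto
  interpret R: ring "sect X W" by (rule sect_ring[OF opn(1)])
  have r: "res X (U \<inter> cdom \<alpha>) W (fst (m \<alpha>)) \<in> carrier (sect X W)" "res X (U \<inter> cdom \<alpha>) W (snd (m \<alpha>)) \<in> carrier (sect X W)"
    "res X U W g \<in> carrier (sect X W)"
    using ca U \<alpha> opn g by auto
  show "res X (U \<inter> cdom \<beta>) W (fst (mact (K c) U g m \<beta>)) = res X (U \<inter> cdom \<alpha>) W (fst (mact (K c) U g m \<alpha>)) \<oplus>\<^bsub>sect X W\<^esub>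
          csw \<beta> \<alpha> W \<otimes>\<^bsub>sect X W\<^esub> res X (U \<inter> cdom \<alpha>) W (snd (mact (K c) U g m \<alpha>)) \<and>
      res X (U \<inter> cdom \<beta>) W (snd (mact (K c) U g m \<beta>)) = jac3 \<beta> \<alpha> W \<otimes>\<^bsub>sect X W\<^esub> res X (U \<inter> cdom \<alpha>) W (snd (mact (K c) U g m \<alpha>))"
    using U \<alpha> \<beta> opn ca cb r g csw_carrier[OF ch] jac3_carrier[OF ch] K_change[OF m U \<alpha> \<beta>, of W]
    by (simp add: K_simps R.l_distr R.m_assoc)
qed

lemma mres_closed:
  assumes U: "opn U" and V: "opn V" "V \<subseteq> U" and m: "m \<in> msect (K c) U"
  shows "mres (K c) U V m \<in> msect (K c) V"
proof (rule K_sectI)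
  show "mres (K c) U V m \<in> extensional (compatible X)" by (simp add: K_simps)
  have sub: "V \<inter> cdom \<alpha> \<subseteq> U \<inter> cdom \<alpha>" for \<alpha> :: "('p, 's, 'n) superchart" using V by auto
  fix \<alpha> assume \<alpha>: "\<alpha> \<in> compatible X"
  note ca = K_carrier[OF m \<alpha>]
  then show "fst (mres (K c) U V m \<alpha>) \<in> carrier (sect X (V \<inter> cdom \<alpha>))"
    "snd (mres (K c) U V m \<alpha>) \<in> carrier (sect X (V \<inter> cdom \<alpha>))" using U V \<alpha> sub by (simp_all add: K_simps)
  fix \<beta> W assume \<beta>: "\<beta> \<in> compatible X" and W: "W = V \<inter> cdom \<alpha> \<inter> cdom \<beta>"
  note cb = K_carrier[OF m \<beta>]
  have opn: "opn W" "W \<subseteq> V \<inter> cdom \<alpha>" "W \<subseteq> V \<inter> cdom \<beta>" using V \<alpha> \<beta> W by auto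
  have WU: "W \<subseteq> U" "W \<subseteq> cdom \<alpha>" "W \<subseteq> cdom \<beta>" using opn V by auto
  show "res X (V \<inter> cdom \<beta>) W (fst (mres (K c) U V m \<beta>)) = res X (V \<inter> cdom \<alpha>) W (fst (mres (K c) U V m \<alpha>)) \<oplus>\<^bsub>sect X W\<^esub>
          csw \<beta> \<alpha> W \<otimes>\<^bsub>sect X W\<^esub> res X (V \<inter> cdom \<alpha>) W (snd (mres (K c) U V m \<alpha>)) \<and>
      res X (V \<inter> cdom \<beta>) W (snd (mres (K c) U V m \<beta>)) = jac3 \<beta> \<alpha> W \<otimes>\<^bsub>sect X W\<^esub> res X (V \<inter> cdom \<alpha>) W (snd (mres (K c) U V m \<alpha>))"
    using U V \<alpha> \<beta> opn ca cb sub WU K_change[OF m U \<alpha> \<beta> opn(1) WU]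
    by (simp add: K_simps)
qed

lemma vacuum_sect:
  assumes U: "opn U"
  shows "vacuum X U \<in> msect (K c) U" "vacuum X U \<in> mpar (K c) False U"
    "opn V \<Longrightarrow> V \<subseteq> U \<Longrightarrow> mres (K c) U V (vacuum X U) = vacuum X V"
proof -
  show sect: "vacuum X U \<in> msect (K c) U"
  proof (rule K_sectI)
    show "vacuum X U \<in> extensional (compatible X)" by (simp add: vacuum_def)
    fix \<alpha> assume \<alpha>: "\<alpha> \<in> compatible X"
    then show "fst (vacuum X U \<alpha>) \<in> carrier (sect X (U \<inter> cdom \<alpha>))" "snd (vacuum X U \<alpha>) \<in> carrier (sect X (U \<inter> cdom \<alpha>))"
      using U by (simp_all add: vacuum_def)
    fix \<beta> W assume \<beta>: "\<beta> \<in> compatible X" and W: "W = U \<inter> cdom \<alpha> \<inter> cdom \<beta>"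
    have opn: "opn W" "W \<subseteq> U \<inter> cdom \<alpha>" "W \<subseteq> U \<inter> cdom \<beta>" and ch: "in_charts \<alpha> \<beta> W"
      using U \<alpha> \<beta> W in_charts_overlap by auto
    interpret R: ring "sect X W" by (rule sect_ring[OF opn(1)])
    show "res X (U \<inter> cdom \<beta>) W (fst (vacuum X U \<beta>)) = res X (U \<inter> cdom \<alpha>) W (fst (vacuum X U \<alpha>)) \<oplus>\<^bsub>sect X W\<^esub>
          csw \<beta> \<alpha> W \<otimes>\<^bsub>sect X W\<^esub> res X (U \<inter> cdom \<alpha>) W (snd (vacuum X U \<alpha>)) \<and>
      res X (U \<inter> cdom \<beta>) W (snd (vacuum X U \<beta>)) = jac3 \<beta> \<alpha> W \<otimes>\<^bsub>sect X W\<^esub> res X (U \<inter> cdom \<alpha>) W (snd (vacuum X U \<alpha>))"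
      using U \<alpha> \<beta> opn csw_carrier[OF ch] jac3_carrier[OF ch] by (simp add: vacuum_def)
  qed
  have "\<one>\<^bsub>sect X W\<^esub> \<in> par X False W" "\<zero>\<^bsub>sect X W\<^esub> \<in> par X True W" if W: "opn W" for W
  proof -
    have "scalar X W 1 = \<one>\<^bsub>sect X W\<^esub>"
      using ring_hom_one[OF scalar_hom[OF W]] by (simp add: grassmann_ring_def)
    then show "\<one>\<^bsub>sect X W\<^esub> \<in> par X False W"
      using scalar_parity[OF W, of 1 False] by (simp add: gparity_even_iff)
    show "\<zero>\<^bsub>sect X W\<^esub> \<in> par X True W"
      using par_subgroup[OF W] additive_subgroup.zero_closed by blast
  qed
  then show "vacuum X U \<in> mpar (K c) False U" using U sect by (simp add: K_par_iff vacuum_def)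
  show "mres (K c) U V (vacuum X U) = vacuum X V" if V: "opn V" "V \<subseteq> U"
  proof
    fix \<alpha> :: "('p, 's, 'n) superchart"
    have "V \<inter> cdom \<alpha> \<subseteq> U \<inter> cdom \<alpha>" using V by auto
    then show "mres (K c) U V (vacuum X U) \<alpha> = vacuum X V \<alpha>" using U V by (simp add: K_simps vacuum_def restrict_def)
  qed
qed

lemma tau_value: "\<beta> \<in> compatible X \<Longrightarrow> tau c X \<alpha> \<beta> = (csw \<beta> \<alpha> (cdom \<alpha> \<inter> cdom \<beta>), jac3 \<beta> \<alpha> (cdom \<alpha> \<inter> cdom \<beta>))"
  by (simp add: tau_def Let_def csw_def jac3_def)

lemma tau_sect:
  assumes \<alpha>: "\<alpha> \<in> compatible X"
  shows "tau c X \<alpha> \<in> msect (K c) (cdom \<alpha>)" "tau c X \<alpha> \<in> mpar (K c) True (cdom \<alpha>)"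
proof -
  have ch: "in_charts \<alpha> \<beta> (cdom \<alpha> \<inter> cdom \<beta>)" if "\<beta> \<in> compatible X" for \<beta>
    using \<alpha> that by (simp add: in_charts_def)
  show sect: "tau c X \<alpha> \<in> msect (K c) (cdom \<alpha>)"
  proof (rule K_sectI)
    show "tau c X \<alpha> \<in> extensional (compatible X)" by (simp add: tau_def)
    fix \<beta> assume \<beta>: "\<beta> \<in> compatible X"
    then show "fst (tau c X \<alpha> \<beta>) \<in> carrier (sect X (cdom \<alpha> \<inter> cdom \<beta>))"
      "snd (tau c X \<alpha> \<beta>) \<in> carrier (sect X (cdom \<alpha> \<inter> cdom \<beta>))"
      using csw_carrier[OF ch[OF \<beta>]] jac3_carrier[OF ch[OF \<beta>]] by (simp_all add: tau_value)
    fix \<gamma> W assume \<gamma>: "\<gamma> \<in> compatible X" and W: "W = cdom \<alpha> \<inter> cdom \<beta> \<inter> cdom \<gamma>"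
    have opn: "opn W" "W \<subseteq> cdom \<alpha> \<inter> cdom \<beta>" "W \<subseteq> cdom \<alpha> \<inter> cdom \<gamma>"
      and chW: "in_charts \<alpha> \<beta> W" "in_charts \<beta> \<gamma> W" using \<alpha> \<beta> \<gamma> W by (auto simp: in_charts_def)
    show "res X (cdom \<alpha> \<inter> cdom \<gamma>) W (fst (tau c X \<alpha> \<gamma>)) = res X (cdom \<alpha> \<inter> cdom \<beta>) W (fst (tau c X \<alpha> \<beta>)) \<oplus>\<^bsub>sect X W\<^esub>
          csw \<gamma> \<beta> W \<otimes>\<^bsub>sect X W\<^esub> res X (cdom \<alpha> \<inter> cdom \<beta>) W (snd (tau c X \<alpha> \<beta>)) \<and>
      res X (cdom \<alpha> \<inter> cdom \<gamma>) W (snd (tau c X \<alpha> \<gamma>)) = jac3 \<gamma> \<beta> W \<otimes>\<^bsub>sect X W\<^esub> res X (cdom \<alpha> \<inter> cdom \<beta>) W (snd (tau c X \<alpha> \<beta>))"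
      using csw_res[OF ch[OF \<beta>] opn(1,2)] csw_res[OF ch[OF \<gamma>] opn(1,3)] csw_cocycle[OF chW]
      by (simp add: tau_value \<beta> \<gamma>)
  qed
  show "tau c X \<alpha> \<in> mpar (K c) True (cdom \<alpha>)"
    using sect csw_par[OF ch] jac3_par[OF ch] by (simp add: K_par_iff tau_value)
qed

text \<open>
  The component of a section in the chart \<open>\<alpha>\<close> determines its components in all other charts over
  \<open>cdom \<alpha>\<close>, by the change of frame.
\<close>

lemma frame_decomposition:
  assumes \<alpha>: "\<alpha> \<in> compatible X" and W: "opn W" "W \<subseteq> cdom \<alpha>" and m: "m \<in> msect (K c) W"
  shows "m = mplus (K c) W (mact (K c) W (fst (m \<alpha>)) (vacuum X W))
    (mact (K c) W (snd (m \<alpha>)) (mres (K c) (cdom \<alpha>) W (tau c X \<alpha>)))"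
proof
  have W\<alpha>: "W \<inter> cdom \<alpha> = W" using W by auto
  have car: "fst (m \<alpha>) \<in> carrier (sect X W)" "snd (m \<alpha>) \<in> carrier (sect X W)"
    using K_carrier[OF m \<alpha>] W\<alpha> by simp_all
  fix \<beta> :: "('p, 's, 'n) superchart"
  show "m \<beta> = mplus (K c) W (mact (K c) W (fst (m \<alpha>)) (vacuum X W))
    (mact (K c) W (snd (m \<alpha>)) (mres (K c) (cdom \<alpha>) W (tau c X \<alpha>))) \<beta>"
  proof (cases "\<beta> \<in> compatible X")
    case True
    let ?V = "W \<inter> cdom \<beta>"
    have V: "opn ?V" "?V \<subseteq> W" "?V \<subseteq> cdom \<alpha> \<inter> cdom \<beta>" "?V \<subseteq> cdom \<alpha>" using W True by auto
    interpret R: ring "sect X ?V" by (rule sect_ring[OF V(1)])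
    have ch: "in_charts \<alpha> \<beta> (cdom \<alpha> \<inter> cdom \<beta>)" "in_charts \<alpha> \<beta> ?V"
      using \<alpha> True V by (auto simp: in_charts_def)
    have r: "res X W ?V (fst (m \<alpha>)) \<in> carrier (sect X ?V)" "res X W ?V (snd (m \<alpha>)) \<in> carrier (sect X ?V)"
      using car W V by simp_all
    have "fst (m \<beta>) = res X W ?V (fst (m \<alpha>)) \<oplus>\<^bsub>sect X ?V\<^esub> csw \<beta> \<alpha> ?V \<otimes>\<^bsub>sect X ?V\<^esub> res X W ?V (snd (m \<alpha>))"
      "snd (m \<beta>) = jac3 \<beta> \<alpha> ?V \<otimes>\<^bsub>sect X ?V\<^esub> res X W ?V (snd (m \<alpha>))"
      using K_change[OF m W(1) \<alpha> True V(1,2,4)] K_carrier[OF m True] res_id[OF V(1)] W\<alpha> by simp_all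
    then show ?thesis
      using r csw_res[OF ch(1) V(1,3)] csw_carrier[OF ch(2)] jac3_carrier[OF ch(2)] True W
      by (simp add: K_simps vacuum_def tau_value prod_eq_iff)
  qed (use m in \<open>simp add: K_simps K_sect_iff PiE_def extensional_def\<close>)
qed

end


section \<open>Functionals and their values on the frame\<close>

context
  fixes c :: complex
begin

text \<open>
  A section of the dual over \<open>U\<close> is a family of maps, one for each open \<open>W \<subseteq> U\<close>, normalised to be undefined
  for other \<open>W\<close> and on arguments that are not sections. This is the normal form of an arbitrary family.
\<close>

definition functional :: "'p set \<Rightarrow> ('p set \<Rightarrow> (('p, 's, 'n) superchart \<Rightarrow> 's \<times> 's) \<Rightarrow> 's) \<Rightarrow>
    'p set \<Rightarrow> (('p, 's, 'n) superchart \<Rightarrow> 's \<times> 's) \<Rightarrow> 's" where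
  "functional U f W = (if opn W \<and> W \<subseteq> U then restrict (f W) (msect (K c) W) else undefined)"

lemma functional_value: "opn W \<Longrightarrow> W \<subseteq> U \<Longrightarrow> m \<in> msect (K c) W \<Longrightarrow> functional U f W m = f W m"
  by (simp add: functional_def)

lemma functional_cong:
  assumes "\<And>W m. opn W \<Longrightarrow> W \<subseteq> U \<Longrightarrow> m \<in> msect (K c) W \<Longrightarrow> f W m = g W m"
  shows "functional U f = functional U g"
  unfolding functional_def using assms by (intro ext) auto

lemma N_sect_iff: "f \<in> msect (N c) U \<longleftrightarrow> f = functional U f \<and>
    (\<forall>W. opn W \<and> W \<subseteq> U \<longrightarrow>
      (\<forall>m\<in>msect (K c) W. f W m \<in> carrier (sect X W)) \<and>
      (\<forall>m\<in>msect (K c) W. \<forall>m'\<in>msect (K c) W. f W (mplus (K c) W m m') = f W m \<oplus>\<^bsub>sect X W\<^esub> f W m') \<and>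
      (\<forall>g\<in>carrier (sect X W). \<forall>m\<in>msect (K c) W. f W (mact (K c) W g m) = f W m \<otimes>\<^bsub>sect X W\<^esub> g) \<and>
      (\<forall>W'. \<forall>m\<in>msect (K c) W. opn W' \<and> W' \<subseteq> W \<longrightarrow> f W' (mres (K c) W W' m) = res X W W' (f W m)))"
  by (simp add: dual_module_def Let_def functional_def[abs_def] Pi_iff)

lemma N_simps:
  "mplus (N c) U f f' = functional U (\<lambda>W m. f W m \<oplus>\<^bsub>sect X W\<^esub> f' W m)"
  "mact (N c) U g f = functional U (\<lambda>W m. res X U W g \<otimes>\<^bsub>sect X W\<^esub> f W m)"
  "mres (N c) U V f = functional V f"
  by (simp_all add: dual_module_def Let_def functional_def[abs_def])

lemma N_par_iff: "f \<in> mpar (N c) p U \<longleftrightarrow> f \<in> msect (N c) U \<and>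
    (\<forall>W q m. opn W \<and> W \<subseteq> U \<and> m \<in> mpar (K c) q W \<longrightarrow> f W m \<in> par X (p \<noteq> q) W)"
proof -
  have "mpar (N c) p U = {f \<in> msect (N c) U. \<forall>W q. opn W \<and> W \<subseteq> U \<longrightarrow> f W ` mpar (K c) q W \<subseteq> par X (p \<noteq> q) W}"
    by (simp add: dual_module_def Let_def)
  then show ?thesis by (simp add: image_subset_iff) (simp add: imp_conjL Ball_def)
qed

lemma N_sectI:
  assumes "\<And>W m. opn W \<Longrightarrow> W \<subseteq> U \<Longrightarrow> m \<in> msect (K c) W \<Longrightarrow> f W m \<in> carrier (sect X W)"
    and "\<And>W m m'. opn W \<Longrightarrow> W \<subseteq> U \<Longrightarrow> m \<in> msect (K c) W \<Longrightarrow> m' \<in> msect (K c) W \<Longrightarrow>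
      f W (mplus (K c) W m m') = f W m \<oplus>\<^bsub>sect X W\<^esub> f W m'"
    and "\<And>W g m. opn W \<Longrightarrow> W \<subseteq> U \<Longrightarrow> g \<in> carrier (sect X W) \<Longrightarrow> m \<in> msect (K c) W \<Longrightarrow>
      f W (mact (K c) W g m) = f W m \<otimes>\<^bsub>sect X W\<^esub> g"
    and "\<And>W W' m. opn W \<Longrightarrow> W \<subseteq> U \<Longrightarrow> m \<in> msect (K c) W \<Longrightarrow> opn W' \<Longrightarrow> W' \<subseteq> W \<Longrightarrow>
      f W' (mres (K c) W W' m) = res X W W' (f W m)"
  shows "functional U f \<in> msect (N c) U"
  unfolding N_sect_iff
proof (intro conjI allI impI ballI; (elim conjE)?)
  show "functional U f = functional U (functional U f)"
    by (rule functional_cong) (simp add: functional_value)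
  fix W assume W: "opn W" "W \<subseteq> U"
  fix m assume m: "m \<in> msect (K c) W"
  show "functional U f W m \<in> carrier (sect X W)" using assms(1) W m by (simp add: functional_value)
  show "functional U f W (mplus (K c) W m m') = functional U f W m \<oplus>\<^bsub>sect X W\<^esub> functional U f W m'"
    if "m' \<in> msect (K c) W" for m'
    using assms(2) W m that mplus_closed[OF W(1) m that] by (simp add: functional_value)
  show "functional U f W (mact (K c) W g m) = functional U f W m \<otimes>\<^bsub>sect X W\<^esub> g"
    if "g \<in> carrier (sect X W)" for g
    using assms(3) W m that mact_closed[OF W(1) m that] by (simp add: functional_value)
  show "functional U f W' (mres (K c) W W' m) = res X W W' (functional U f W m)" if "opn W'" "W' \<subseteq> W" for W'
  proof -
    have "W' \<subseteq> U" using that W by blast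
    then show ?thesis
      using assms(4)[OF W m that] W m that mres_closed[OF W(1) that m] by (simp add: functional_value)
  qed
qed

context
  fixes f U W assumes f: "f \<in> msect (N c) U" and W: "opn W" "W \<subseteq> U"
begin

lemma N_closed: "m \<in> msect (K c) W \<Longrightarrow> f W m \<in> carrier (sect X W)"
  using f W by (simp add: N_sect_iff)

lemma N_add: "m \<in> msect (K c) W \<Longrightarrow> m' \<in> msect (K c) W \<Longrightarrow> f W (mplus (K c) W m m') = f W m \<oplus>\<^bsub>sect X W\<^esub> f W m'"
  using f W by (simp add: N_sect_iff)

lemma N_linear: "g \<in> carrier (sect X W) \<Longrightarrow> m \<in> msect (K c) W \<Longrightarrow> f W (mact (K c) W g m) = f W m \<otimes>\<^bsub>sect X W\<^esub> g"
  using f W by (simp add: N_sect_iff)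

lemma N_natural: "m \<in> msect (K c) W \<Longrightarrow> opn W' \<Longrightarrow> W' \<subseteq> W \<Longrightarrow> f W' (mres (K c) W W' m) = res X W W' (f W m)"
  using f W by (simp add: N_sect_iff)

end

lemma N_functional: "f \<in> msect (N c) U \<Longrightarrow> functional U f = f"
  by (simp add: N_sect_iff)

lemma N_eqI:
  assumes "f \<in> msect (N c) U" "f' \<in> msect (N c) U"
    "\<And>W m. opn W \<Longrightarrow> W \<subseteq> U \<Longrightarrow> m \<in> msect (K c) W \<Longrightarrow> f W m = f' W m"
  shows "f = f'"
proof -
  have "f = functional U f" using assms(1) by (simp add: N_functional)
  also have "\<dots> = functional U f'" by (rule functional_cong[OF assms(3)])
  finally show ?thesis using assms(2) by (simp add: N_functional)
qed

lemma N_plus_closed: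
  assumes f: "f \<in> msect (N c) U" "f' \<in> msect (N c) U"
  shows "mplus (N c) U f f' \<in> msect (N c) U"
  unfolding N_simps
proof (rule N_sectI)
  fix W m assume W: "opn W" "W \<subseteq> U" and m: "m \<in> msect (K c) W"
  interpret R: ring "sect X W" by (rule sect_ring[OF W(1)])
  note c = N_closed[OF f(1) W] N_closed[OF f(2) W]
  show "f W m \<oplus>\<^bsub>sect X W\<^esub> f' W m \<in> carrier (sect X W)" using c m W by simp
  show "f W (mplus (K c) W m m') \<oplus>\<^bsub>sect X W\<^esub> f' W (mplus (K c) W m m') =
      (f W m \<oplus>\<^bsub>sect X W\<^esub> f' W m) \<oplus>\<^bsub>sect X W\<^esub> (f W m' \<oplus>\<^bsub>sect X W\<^esub> f' W m')" if "m' \<in> msect (K c) W" for m'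
    using c m that N_add[OF f(1) W m that] N_add[OF f(2) W m that] by (simp add: R.a_ac)
  show "f W (mact (K c) W g m) \<oplus>\<^bsub>sect X W\<^esub> f' W (mact (K c) W g m) = (f W m \<oplus>\<^bsub>sect X W\<^esub> f' W m) \<otimes>\<^bsub>sect X W\<^esub> g"
    if "g \<in> carrier (sect X W)" for g
    using c m that N_linear[OF f(1) W that m] N_linear[OF f(2) W that m] by (simp add: R.l_distr)
  show "f W' (mres (K c) W W' m) \<oplus>\<^bsub>sect X W'\<^esub> f' W' (mres (K c) W W' m) = res X W W' (f W m \<oplus>\<^bsub>sect X W\<^esub> f' W m)"
    if "opn W'" "W' \<subseteq> W" for W'
    using c m that W N_natural[OF f(1) W m that] N_natural[OF f(2) W m that] by simp
qed

lemma N_act_closed: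
  assumes U: "opn U" and f: "f \<in> msect (N c) U" and g: "g \<in> carrier (sect X U)"
  shows "mact (N c) U g f \<in> msect (N c) U"
  unfolding N_simps
proof (rule N_sectI)
  fix W m assume W: "opn W" "W \<subseteq> U" and m: "m \<in> msect (K c) W"
  interpret R: ring "sect X W" by (rule sect_ring[OF W(1)])
  note c = N_closed[OF f W]
  have gW: "res X U W g \<in> carrier (sect X W)" using U W g by simp
  show "res X U W g \<otimes>\<^bsub>sect X W\<^esub> f W m \<in> carrier (sect X W)" using c m W gW by simp
  show "res X U W g \<otimes>\<^bsub>sect X W\<^esub> f W (mplus (K c) W m m') =
      (res X U W g \<otimes>\<^bsub>sect X W\<^esub> f W m) \<oplus>\<^bsub>sect X W\<^esub> (res X U W g \<otimes>\<^bsub>sect X W\<^esub> f W m')" if "m' \<in> msect (K c) W" for m'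
    using c m that gW N_add[OF f W m that] by (simp add: R.r_distr)
  show "res X U W g \<otimes>\<^bsub>sect X W\<^esub> f W (mact (K c) W h m) = (res X U W g \<otimes>\<^bsub>sect X W\<^esub> f W m) \<otimes>\<^bsub>sect X W\<^esub> h"
    if "h \<in> carrier (sect X W)" for h
    using c m that gW N_linear[OF f W that m] by (simp add: R.m_assoc)
  show "res X U W' g \<otimes>\<^bsub>sect X W'\<^esub> f W' (mres (K c) W W' m) = res X W W' (res X U W g \<otimes>\<^bsub>sect X W\<^esub> f W m)"
    if "opn W'" "W' \<subseteq> W" for W'
    using c m that W U g gW N_natural[OF f W m that] by simp
qed

lemma N_res_closed:
  assumes f: "f \<in> msect (N c) U" and V: "opn V" "V \<subseteq> U"
  shows "mres (N c) U V f \<in> msect (N c) V"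
  unfolding N_simps
proof (rule N_sectI)
  fix W m assume W: "opn W" "W \<subseteq> V" and m: "m \<in> msect (K c) W"
  have WU: "W \<subseteq> U" using W V by blast
  show "f W m \<in> carrier (sect X W)" using N_closed[OF f W(1) WU m] .
  show "m' \<in> msect (K c) W \<Longrightarrow> f W (mplus (K c) W m m') = f W m \<oplus>\<^bsub>sect X W\<^esub> f W m'" for m'
    using N_add[OF f W(1) WU m] .
  show "g \<in> carrier (sect X W) \<Longrightarrow> f W (mact (K c) W g m) = f W m \<otimes>\<^bsub>sect X W\<^esub> g" for g
    using N_linear[OF f W(1) WU _ m] .
  show "opn W' \<Longrightarrow> W' \<subseteq> W \<Longrightarrow> f W' (mres (K c) W W' m) = res X W W' (f W m)" for W'
    using N_natural[OF f W(1) WU m] .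
qed

lemma mres_mres:
  assumes "opn U" "opn V" "opn W" "W \<subseteq> V" "V \<subseteq> U" "m \<in> msect (K c) U"
  shows "mres (K c) V W (mres (K c) U V m) = mres (K c) U W m"
proof
  fix \<alpha> :: "('p, 's, 'n) superchart"
  have sub: "W \<inter> cdom \<alpha> \<subseteq> V \<inter> cdom \<alpha>" "V \<inter> cdom \<alpha> \<subseteq> U \<inter> cdom \<alpha>" using assms by auto
  show "mres (K c) V W (mres (K c) U V m) \<alpha> = mres (K c) U W m \<alpha>"
    using assms K_carrier[OF assms(6)] sub by (simp add: K_simps restrict_def)
qed

definition tau_on :: "('p, 's, 'n) superchart \<Rightarrow> 'p set \<Rightarrow> ('p, 's, 'n) superchart \<Rightarrow> 's \<times> 's" where
  "tau_on \<alpha> W = mres (K c) (cdom \<alpha>) W (tau c X \<alpha>)"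

context
  fixes \<alpha> W assumes \<alpha>: "\<alpha> \<in> compatible X" and W: "opn W" "W \<subseteq> cdom \<alpha>"
begin

lemma tau_on_sect: "tau_on \<alpha> W \<in> msect (K c) W"
  unfolding tau_on_def using mres_closed tau_sect(1) \<alpha> W by simp

lemma tau_on_par: "tau_on \<alpha> W \<in> mpar (K c) True W"
proof -
  have "W \<inter> cdom \<beta> \<subseteq> cdom \<alpha> \<inter> cdom \<beta>" for \<beta> :: "('p, 's, 'n) superchart" using W by auto
  then show ?thesis
    using tau_on_sect tau_sect(2)[OF \<alpha>, of c] \<alpha> W res_parity
    by (simp add: K_par_iff) (simp add: tau_on_def K_simps)
qed

lemma tau_on_res: "opn W' \<Longrightarrow> W' \<subseteq> W \<Longrightarrow> mres (K c) W W' (tau_on \<alpha> W) = tau_on \<alpha> W'"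
  unfolding tau_on_def using mres_mres[OF _ W(1) _ _ W(2) tau_sect(1)[OF \<alpha>]] \<alpha> by simp

lemma tau_on_value:
  assumes \<beta>: "\<beta> \<in> compatible X" and sub: "W \<subseteq> cdom \<beta>"
  shows "tau_on \<alpha> W \<beta> = (csw c \<beta> \<alpha> W, jac3 \<beta> \<alpha> W)"
proof -
  have ch: "in_charts \<alpha> \<beta> (cdom \<alpha> \<inter> cdom \<beta>)" using \<alpha> \<beta> by (simp add: in_charts_def)
  have "W \<inter> cdom \<beta> = W" using sub by blast
  then show ?thesis
    using \<beta> csw_res[OF ch W(1)] W sub by (simp add: tau_on_def K_simps tau_value)
qed

lemma functional_formula:
  assumes f: "f \<in> msect (N c) U" "W \<subseteq> U" and m: "m \<in> msect (K c) W"
  shows "f W m = f W (vacuum X W) \<otimes>\<^bsub>sect X W\<^esub> fst (m \<alpha>) \<oplus>\<^bsub>sect X W\<^esub> f W (tau_on \<alpha> W) \<otimes>\<^bsub>sect X W\<^esub> snd (m \<alpha>)"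
proof -
  have "W \<inter> cdom \<alpha> = W" using W by blast
  then have car: "fst (m \<alpha>) \<in> carrier (sect X W)" "snd (m \<alpha>) \<in> carrier (sect X W)"
    using K_carrier[OF m \<alpha>] by simp_all
  note v = vacuum_sect(1)[OF W(1)]
  have "f W m = f W (mplus (K c) W (mact (K c) W (fst (m \<alpha>)) (vacuum X W)) (mact (K c) W (snd (m \<alpha>)) (tau_on \<alpha> W)))"
    unfolding tau_on_def using frame_decomposition[OF \<alpha> W m] by simp
  then show ?thesis
    using N_add[OF f(1) W(1) f(2)] N_linear[OF f(1) W(1) f(2)] mact_closed[OF W(1)] car v tau_on_sect by simp
qed

end

text \<open>
  The rule for values on \<open>\<tau>\<^sub>\<alpha>\<close> is dual to \<open>\<tau>\<^sub>\<alpha> = (D\<^sub>\<alpha>\<Psi>\<^bsub>\<beta>,\<alpha>\<^esub>)\<^sup>3 \<tau>\<^sub>\<beta> + c/3 \<sigma>(D\<^sub>\<alpha>\<Psi>\<^bsub>\<beta>,\<alpha>\<^esub>) |0\<rangle>\<^sub>\<beta>\<close>.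
\<close>

lemma tau_change:
  assumes W: "in_charts \<alpha> \<beta> W" and f: "f \<in> msect (N c) U" "W \<subseteq> U"
  shows "f W (tau_on \<alpha> W) = f W (vacuum X W) \<otimes>\<^bsub>sect X W\<^esub> csw c \<beta> \<alpha> W \<oplus>\<^bsub>sect X W\<^esub>
    f W (tau_on \<beta> W) \<otimes>\<^bsub>sect X W\<^esub> jac3 \<beta> \<alpha> W"
proof -
  have *: "\<alpha> \<in> compatible X" "\<beta> \<in> compatible X" "opn W" "W \<subseteq> cdom \<alpha>" "W \<subseteq> cdom \<beta>"
    using W by (auto simp: in_charts_def)
  show ?thesis
    using functional_formula[OF *(2,3,5) f tau_on_sect[OF *(1,3,4)]] tau_on_value[OF *(1,3,4,2,5)] by simp
qed

lemma functional_eqI: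
  assumes U: "opn U" and A: "A \<subseteq> compatible X" "U \<subseteq> (\<Union>\<alpha>\<in>A. cdom \<alpha>)"
    and f: "f \<in> msect (N c) U" and f': "f' \<in> msect (N c) U"
    and vac: "\<And>\<alpha>. \<alpha> \<in> A \<Longrightarrow> f (U \<inter> cdom \<alpha>) (vacuum X (U \<inter> cdom \<alpha>)) = f' (U \<inter> cdom \<alpha>) (vacuum X (U \<inter> cdom \<alpha>))"
    and tau: "\<And>\<alpha>. \<alpha> \<in> A \<Longrightarrow> f (U \<inter> cdom \<alpha>) (tau_on \<alpha> (U \<inter> cdom \<alpha>)) = f' (U \<inter> cdom \<alpha>) (tau_on \<alpha> (U \<inter> cdom \<alpha>))"
  shows "f = f'"
proof (rule N_eqI[OF f f'])
  fix W m assume W: "opn W" "W \<subseteq> U" and m: "m \<in> msect (K c) W"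
  show "f W m = f' W m"
  proof (rule sect_local_eqI[OF W(1) N_closed[OF f W m] N_closed[OF f' W m]])
    fix x assume x: "x \<in> W"
    then obtain \<alpha> where \<alpha>: "\<alpha> \<in> A" "x \<in> cdom \<alpha>" using A(2) W(2) by blast
    then have \<alpha>c: "\<alpha> \<in> compatible X" using A by blast
    let ?W = "W \<inter> cdom \<alpha>" and ?U = "U \<inter> cdom \<alpha>"
    have opn: "opn ?W" "?W \<subseteq> W" "?W \<subseteq> U" "?W \<subseteq> cdom \<alpha>" "?W \<subseteq> ?U" "opn ?U" "?U \<subseteq> U" "?U \<subseteq> cdom \<alpha>"
      using W U \<alpha>c by auto
    note mW = mres_closed[OF W(1) opn(1,2) m]
    have eq: "f ?W (vacuum X ?W) = f' ?W (vacuum X ?W)" "f ?W (tau_on \<alpha> ?W) = f' ?W (tau_on \<alpha> ?W)"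
      using N_natural[OF f opn(6,7) vacuum_sect(1)[OF opn(6)] opn(1,5)]
        N_natural[OF f' opn(6,7) vacuum_sect(1)[OF opn(6)] opn(1,5)] vacuum_sect(3)[OF opn(6,1,5)]
        N_natural[OF f opn(6,7) tau_on_sect[OF \<alpha>c opn(6,8)] opn(1,5)]
        N_natural[OF f' opn(6,7) tau_on_sect[OF \<alpha>c opn(6,8)] opn(1,5)]
        tau_on_res[OF \<alpha>c opn(6,8,1,5)] vac[OF \<alpha>(1)] tau[OF \<alpha>(1)] by simp_all
    have "f ?W (mres (K c) W ?W m) = f' ?W (mres (K c) W ?W m)"
      using functional_formula[OF \<alpha>c opn(1,4) f opn(3) mW] functional_formula[OF \<alpha>c opn(1,4) f' opn(3) mW] eq
      by simp
    then have "res X W ?W (f W m) = res X W ?W (f' W m)"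
      using N_natural[OF f W m opn(1,2)] N_natural[OF f' W m opn(1,2)] by simp
    then show "\<exists>W'. opn W' \<and> x \<in> W' \<and> W' \<subseteq> W \<and> res X W W' (f W m) = res X W W' (f' W m)"
      using opn(1,2) x \<alpha>(2) by (intro exI[of _ ?W]) auto
  qed
qed

text \<open>
  Values \<open>p\<close> on the vacuum and \<open>q\<close> on the \<open>\<tau>\<^sub>\<alpha>\<close> come from a functional as soon as they obey the change of
  frame: then the local expressions \<open>p a + q b\<close> for its value at \<open>|0\<rangle>\<^sub>\<alpha> a + \<tau>\<^sub>\<alpha> b\<close> agree on overlaps.
\<close>

lemma glue_functional:
  assumes U: "opn U" and A: "A \<subseteq> compatible X" "U \<subseteq> (\<Union>\<alpha>\<in>A. cdom \<alpha>)"
    and p: "\<And>\<alpha>. \<alpha> \<in> A \<Longrightarrow> p \<alpha> \<in> carrier (sect X (U \<inter> cdom \<alpha>))"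
    and q: "\<And>\<alpha>. \<alpha> \<in> A \<Longrightarrow> q \<alpha> \<in> carrier (sect X (U \<inter> cdom \<alpha>))"
    and compat: "\<And>\<alpha> \<beta> W. \<alpha> \<in> A \<Longrightarrow> \<beta> \<in> A \<Longrightarrow> W = U \<inter> cdom \<alpha> \<inter> cdom \<beta> \<Longrightarrow>
      res X (U \<inter> cdom \<alpha>) W (p \<alpha>) = res X (U \<inter> cdom \<beta>) W (p \<beta>) \<and>
      res X (U \<inter> cdom \<alpha>) W (q \<alpha>) = res X (U \<inter> cdom \<beta>) W (p \<beta>) \<otimes>\<^bsub>sect X W\<^esub> csw c \<beta> \<alpha> W \<oplus>\<^bsub>sect X W\<^esub>
        res X (U \<inter> cdom \<beta>) W (q \<beta>) \<otimes>\<^bsub>sect X W\<^esub> jac3 \<beta> \<alpha> W"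
  obtains f where "f \<in> msect (N c) U"
    "\<And>W m \<alpha>. opn W \<Longrightarrow> W \<subseteq> U \<Longrightarrow> m \<in> msect (K c) W \<Longrightarrow> \<alpha> \<in> A \<Longrightarrow>
      res X W (W \<inter> cdom \<alpha>) (f W m) =
        res X (U \<inter> cdom \<alpha>) (W \<inter> cdom \<alpha>) (p \<alpha>) \<otimes>\<^bsub>sect X (W \<inter> cdom \<alpha>)\<^esub> fst (m \<alpha>) \<oplus>\<^bsub>sect X (W \<inter> cdom \<alpha>)\<^esub>
        res X (U \<inter> cdom \<alpha>) (W \<inter> cdom \<alpha>) (q \<alpha>) \<otimes>\<^bsub>sect X (W \<inter> cdom \<alpha>)\<^esub> snd (m \<alpha>)"
proof -
  define l where "l \<alpha> W m =
      res X (U \<inter> cdom \<alpha>) (W \<inter> cdom \<alpha>) (p \<alpha>) \<otimes>\<^bsub>sect X (W \<inter> cdom \<alpha>)\<^esub> fst (m \<alpha>) \<oplus>\<^bsub>sect X (W \<inter> cdom \<alpha>)\<^esub>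
      res X (U \<inter> cdom \<alpha>) (W \<inter> cdom \<alpha>) (q \<alpha>) \<otimes>\<^bsub>sect X (W \<inter> cdom \<alpha>)\<^esub> snd (m \<alpha>)" for \<alpha> W m
  have Ac: "\<alpha> \<in> compatible X" if "\<alpha> \<in> A" for \<alpha> using A that by blast
  have sub: "W \<inter> cdom \<alpha> \<subseteq> U \<inter> cdom \<alpha>" if "W \<subseteq> U" for W \<alpha> using that by (auto simp: subset_eq)
  have pq: "res X (U \<inter> cdom \<alpha>) W (p \<alpha>) \<in> carrier (sect X W)" "res X (U \<inter> cdom \<alpha>) W (q \<alpha>) \<in> carrier (sect X W)"
    if "\<alpha> \<in> A" "opn W" "W \<subseteq> U" "W \<subseteq> cdom \<alpha>" for \<alpha> W
    using p[OF that(1)] q[OF that(1)] U Ac[OF that(1)] that by simp_all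
  have l_closed: "l \<alpha> W m \<in> carrier (sect X (W \<inter> cdom \<alpha>))"
    if "\<alpha> \<in> A" "opn W" "W \<subseteq> U" "m \<in> msect (K c) W" for \<alpha> W m
  proof -
    have "W \<inter> cdom \<alpha> \<subseteq> U" using that by blast
    then show ?thesis
      using pq[OF that(1), of "W \<inter> cdom \<alpha>"] K_carrier[OF that(4) Ac[OF that(1)]] that(2) Ac[OF that(1)]
      by (simp add: l_def)
  qed
  have uniq: "t = t'" if W: "opn W" "W \<subseteq> U" and t: "t \<in> carrier (sect X W)" "t' \<in> carrier (sect X W)"
    and eq: "\<And>\<alpha>. \<alpha> \<in> A \<Longrightarrow> res X W (W \<inter> cdom \<alpha>) t = res X W (W \<inter> cdom \<alpha>) t'" for W t t'
  proof (rule sect_local_eqI[OF W(1) t])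
    fix x assume x: "x \<in> W"
    then obtain \<alpha> where \<alpha>: "\<alpha> \<in> A" "x \<in> cdom \<alpha>" using A(2) W by blast
    then show "\<exists>V. opn V \<and> x \<in> V \<and> V \<subseteq> W \<and> res X W V t = res X W V t'"
      using eq[OF \<alpha>(1)] Ac[OF \<alpha>(1)] W x by (intro exI[of _ "W \<inter> cdom \<alpha>"]) auto
  qed
  have ex: "\<exists>t\<in>carrier (sect X W). \<forall>\<alpha>\<in>A. res X W (W \<inter> cdom \<alpha>) t = l \<alpha> W m"
    if W: "opn W" "W \<subseteq> U" and m: "m \<in> msect (K c) W" for W m
  proof -
    have cover: "(\<Union>\<alpha>\<in>A. W \<inter> cdom \<alpha>) = W" using A(2) W(2) by blast
    have agree: "res X (W \<inter> cdom \<alpha>) V (l \<alpha> W m) = res X (W \<inter> cdom \<beta>) V (l \<beta> W m)"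
      if ab: "\<alpha> \<in> A" "\<beta> \<in> A" and V: "V = (W \<inter> cdom \<alpha>) \<inter> (W \<inter> cdom \<beta>)" for \<alpha> \<beta> V
    proof -
      let ?O = "U \<inter> cdom \<alpha> \<inter> cdom \<beta>"
      note a = Ac[OF ab(1)] and b = Ac[OF ab(2)]
      have opn: "opn V" "V \<subseteq> W" "V \<subseteq> U" "V \<subseteq> cdom \<alpha>" "V \<subseteq> cdom \<beta>" "V \<subseteq> ?O" "opn ?O"
        using V W U a b by auto
      have ch: "in_charts \<alpha> \<beta> V" "in_charts \<alpha> \<beta> ?O" using opn a b by (auto simp: in_charts_def)
      interpret R: ring "sect X V" by (rule sect_ring[OF opn(1)])
      note car = K_carrier[OF m a] K_carrier[OF m b] p[OF ab(1)] p[OF ab(2)] q[OF ab(1)] q[OF ab(2)]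
      have subW: "W \<inter> cdom \<alpha> \<subseteq> U \<inter> cdom \<alpha>" "W \<inter> cdom \<beta> \<subseteq> U \<inter> cdom \<beta>" "W \<inter> cdom \<alpha> \<subseteq> U" "W \<inter> cdom \<beta> \<subseteq> U"
        using W by auto
      have subO: "?O \<subseteq> U \<inter> cdom \<alpha>" "?O \<subseteq> U \<inter> cdom \<beta>" by auto
      have A1: "res X (W \<inter> cdom \<alpha>) V (l \<alpha> W m) = res X (U \<inter> cdom \<alpha>) V (p \<alpha>) \<otimes>\<^bsub>sect X V\<^esub> res X (W \<inter> cdom \<alpha>) V (fst (m \<alpha>))
          \<oplus>\<^bsub>sect X V\<^esub> res X (U \<inter> cdom \<alpha>) V (q \<alpha>) \<otimes>\<^bsub>sect X V\<^esub> res X (W \<inter> cdom \<alpha>) V (snd (m \<alpha>))"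
        using car opn W U a b subW by (simp add: l_def)
      have B1: "res X (W \<inter> cdom \<beta>) V (l \<beta> W m) = res X (U \<inter> cdom \<beta>) V (p \<beta>) \<otimes>\<^bsub>sect X V\<^esub> res X (W \<inter> cdom \<beta>) V (fst (m \<beta>))
          \<oplus>\<^bsub>sect X V\<^esub> res X (U \<inter> cdom \<beta>) V (q \<beta>) \<otimes>\<^bsub>sect X V\<^esub> res X (W \<inter> cdom \<beta>) V (snd (m \<beta>))"
        using car opn W U a b subW by (simp add: l_def)
      have rp: "res X (U \<inter> cdom \<alpha>) V (p \<alpha>) = res X (U \<inter> cdom \<beta>) V (p \<beta>)"
        using arg_cong[OF compat[OF ab refl, THEN conjunct1], of "res X ?O V"] car opn U a b subO by simp
      have rq: "res X (U \<inter> cdom \<alpha>) V (q \<alpha>) = res X (U \<inter> cdom \<beta>) V (p \<beta>) \<otimes>\<^bsub>sect X V\<^esub> csw c \<beta> \<alpha> V \<oplus>\<^bsub>sect X V\<^esub>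
          res X (U \<inter> cdom \<beta>) V (q \<beta>) \<otimes>\<^bsub>sect X V\<^esub> jac3 \<beta> \<alpha> V"
        using arg_cong[OF compat[OF ab refl, THEN conjunct2], of "res X ?O V"] car opn U a b subO
          csw_res[OF ch(2) opn(1,6)] csw_carrier[OF ch(2)] jac3_carrier[OF ch(2)] by simp
      have r: "res X (W \<inter> cdom \<alpha>) V (fst (m \<alpha>)) \<in> carrier (sect X V)" "res X (W \<inter> cdom \<alpha>) V (snd (m \<alpha>)) \<in> carrier (sect X V)"
        using car opn W a by simp_all
      show ?thesis
        unfolding A1 B1 rp rq K_change[OF m W(1) a b opn(1,2,4,5)]
        using pq[OF ab(2) opn(1,3,5)] r csw_carrier[OF ch(1)] jac3_carrier[OF ch(1)]
        by (simp add: R.r_distr R.l_distr R.m_assoc R.a_assoc)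
    qed
    obtain t where "t \<in> carrier (sect X (\<Union>\<alpha>\<in>A. W \<inter> cdom \<alpha>))"
      "\<And>\<alpha>. \<alpha> \<in> A \<Longrightarrow> res X (\<Union>\<alpha>\<in>A. W \<inter> cdom \<alpha>) (W \<inter> cdom \<alpha>) t = l \<alpha> W m"
      using glue_sections[of A "\<lambda>\<alpha>. W \<inter> cdom \<alpha>" "\<lambda>\<alpha>. l \<alpha> W m"] l_closed[OF _ W m] agree W(1) Ac by auto
    then show ?thesis unfolding cover by blast
  qed
  define f where "f W m = (SOME t. t \<in> carrier (sect X W) \<and> (\<forall>\<alpha>\<in>A. res X W (W \<inter> cdom \<alpha>) t = l \<alpha> W m))" for W m
  have f: "f W m \<in> carrier (sect X W)" "\<And>\<alpha>. \<alpha> \<in> A \<Longrightarrow> res X W (W \<inter> cdom \<alpha>) (f W m) = l \<alpha> W m"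
    if W: "opn W" "W \<subseteq> U" and m: "m \<in> msect (K c) W" for W m
    using someI_ex[OF ex[OF W m, unfolded Bex_def]] unfolding f_def by blast+
  have "functional U f \<in> msect (N c) U"
  proof (rule N_sectI)
    fix W m assume W: "opn W" "W \<subseteq> U" and m: "m \<in> msect (K c) W"
    show fW: "f W m \<in> carrier (sect X W)" by (rule f(1)[OF W m])
    show "f W (mplus (K c) W m m') = f W m \<oplus>\<^bsub>sect X W\<^esub> f W m'" if m': "m' \<in> msect (K c) W" for m'
    proof (rule uniq[OF W])
      note mm = mplus_closed[OF W(1) m m']
      show "f W (mplus (K c) W m m') \<in> carrier (sect X W)" "f W m \<oplus>\<^bsub>sect X W\<^esub> f W m' \<in> carrier (sect X W)"
        using f(1)[OF W mm] f(1)[OF W m] f(1)[OF W m'] W by simp_all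
      fix \<alpha> assume \<alpha>: "\<alpha> \<in> A"
      have opn: "opn (W \<inter> cdom \<alpha>)" "W \<inter> cdom \<alpha> \<subseteq> U" using W Ac[OF \<alpha>] by auto
      interpret R: ring "sect X (W \<inter> cdom \<alpha>)" by (rule sect_ring[OF opn(1)])
      show "res X W (W \<inter> cdom \<alpha>) (f W (mplus (K c) W m m')) = res X W (W \<inter> cdom \<alpha>) (f W m \<oplus>\<^bsub>sect X W\<^esub> f W m')"
        using f[OF W m] f[OF W m'] f(2)[OF W mm \<alpha>] \<alpha> W opn Ac[OF \<alpha>] pq[OF \<alpha> opn]
          K_carrier[OF m Ac[OF \<alpha>]] K_carrier[OF m' Ac[OF \<alpha>]]
        by (simp add: l_def K_simps R.r_distr R.a_ac)
    qed
    show "f W (mact (K c) W g m) = f W m \<otimes>\<^bsub>sect X W\<^esub> g" if g: "g \<in> carrier (sect X W)" for g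
    proof (rule uniq[OF W])
      note mm = mact_closed[OF W(1) m g]
      show "f W (mact (K c) W g m) \<in> carrier (sect X W)" "f W m \<otimes>\<^bsub>sect X W\<^esub> g \<in> carrier (sect X W)"
        using f(1)[OF W mm] f(1)[OF W m] g W by simp_all
      fix \<alpha> assume \<alpha>: "\<alpha> \<in> A"
      have opn: "opn (W \<inter> cdom \<alpha>)" "W \<inter> cdom \<alpha> \<subseteq> U" using W Ac[OF \<alpha>] by auto
      interpret R: ring "sect X (W \<inter> cdom \<alpha>)" by (rule sect_ring[OF opn(1)])
      show "res X W (W \<inter> cdom \<alpha>) (f W (mact (K c) W g m)) = res X W (W \<inter> cdom \<alpha>) (f W m \<otimes>\<^bsub>sect X W\<^esub> g)"
        using f[OF W m] f(2)[OF W mm \<alpha>] \<alpha> W opn Ac[OF \<alpha>] pq[OF \<alpha> opn] g K_carrier[OF m Ac[OF \<alpha>]]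
        by (simp add: l_def K_simps R.l_distr R.m_assoc)
    qed
    show "f W' (mres (K c) W W' m) = res X W W' (f W m)" if W': "opn W'" "W' \<subseteq> W" for W'
    proof (rule uniq)
      show W'U: "opn W'" "W' \<subseteq> U" using W W' by auto
      note mm = mres_closed[OF W(1) W' m]
      show "f W' (mres (K c) W W' m) \<in> carrier (sect X W')" "res X W W' (f W m) \<in> carrier (sect X W')"
        using f(1)[OF W'U mm] f(1)[OF W m] W W' by simp_all
      fix \<alpha> assume \<alpha>: "\<alpha> \<in> A"
      have opn: "opn (W \<inter> cdom \<alpha>)" "W \<inter> cdom \<alpha> \<subseteq> U" "W \<inter> cdom \<alpha> \<subseteq> U \<inter> cdom \<alpha>" "opn (W' \<inter> cdom \<alpha>)"
        "W' \<inter> cdom \<alpha> \<subseteq> W \<inter> cdom \<alpha>" "W' \<inter> cdom \<alpha> \<subseteq> W" "opn (U \<inter> cdom \<alpha>)" "W' \<inter> cdom \<alpha> \<subseteq> U \<inter> cdom \<alpha>"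
        using W W' U Ac[OF \<alpha>] by auto
      have "res X W' (W' \<inter> cdom \<alpha>) (f W' (mres (K c) W W' m)) = l \<alpha> W' (mres (K c) W W' m)"
        by (rule f(2)[OF W'U mm \<alpha>])
      also have "\<dots> = res X (W \<inter> cdom \<alpha>) (W' \<inter> cdom \<alpha>) (l \<alpha> W m)"
        using K_carrier[OF m Ac[OF \<alpha>]] p[OF \<alpha>] q[OF \<alpha>] opn Ac[OF \<alpha>] by (simp add: l_def K_simps)
      also have "\<dots> = res X W (W' \<inter> cdom \<alpha>) (f W m)"
        using f(2)[OF W m \<alpha>, symmetric] fW W opn by simp
      also have "\<dots> = res X W' (W' \<inter> cdom \<alpha>) (res X W W' (f W m))"
        using fW W W' opn by simp
      finally show "res X W' (W' \<inter> cdom \<alpha>) (f W' (mres (K c) W W' m)) = res X W' (W' \<inter> cdom \<alpha>) (res X W W' (f W m))" .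
    qed
  qed
  then show ?thesis
    by (rule that) (simp add: functional_value f(2) l_def)
qed

lemma glued_parity:
  assumes U: "opn U" and A: "A \<subseteq> compatible X" "U \<subseteq> (\<Union>\<alpha>\<in>A. cdom \<alpha>)"
    and p: "\<And>\<alpha>. \<alpha> \<in> A \<Longrightarrow> p \<alpha> \<in> par X e (U \<inter> cdom \<alpha>)"
    and q: "\<And>\<alpha>. \<alpha> \<in> A \<Longrightarrow> q \<alpha> \<in> par X (\<not> e) (U \<inter> cdom \<alpha>)"
    and f: "f \<in> msect (N c) U"
    and val: "\<And>W m \<alpha>. opn W \<Longrightarrow> W \<subseteq> U \<Longrightarrow> m \<in> msect (K c) W \<Longrightarrow> \<alpha> \<in> A \<Longrightarrow>
      res X W (W \<inter> cdom \<alpha>) (f W m) =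
        res X (U \<inter> cdom \<alpha>) (W \<inter> cdom \<alpha>) (p \<alpha>) \<otimes>\<^bsub>sect X (W \<inter> cdom \<alpha>)\<^esub> fst (m \<alpha>) \<oplus>\<^bsub>sect X (W \<inter> cdom \<alpha>)\<^esub>
        res X (U \<inter> cdom \<alpha>) (W \<inter> cdom \<alpha>) (q \<alpha>) \<otimes>\<^bsub>sect X (W \<inter> cdom \<alpha>)\<^esub> snd (m \<alpha>)"
  shows "f \<in> mpar (N c) e U"
  unfolding N_par_iff
proof (intro conjI allI impI; (elim conjE)?)
  fix W q' m assume W: "opn W" "W \<subseteq> U" and m: "m \<in> mpar (K c) q' W"
  then have ms: "m \<in> msect (K c) W" by (simp add: K_par_iff)
  show "f W m \<in> par X (e \<noteq> q') W"
  proof (rule par_local[OF W(1) N_closed[OF f W ms]])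
    fix x assume x: "x \<in> W"
    then obtain \<alpha> where \<alpha>: "\<alpha> \<in> A" "x \<in> cdom \<alpha>" using A(2) W by blast
    then have ac: "\<alpha> \<in> compatible X" using A by blast
    let ?W = "W \<inter> cdom \<alpha>"
    have opn: "opn ?W" "?W \<subseteq> U \<inter> cdom \<alpha>" "opn (U \<inter> cdom \<alpha>)" using W U ac by auto
    have "res X (U \<inter> cdom \<alpha>) ?W (p \<alpha>) \<otimes>\<^bsub>sect X ?W\<^esub> fst (m \<alpha>) \<in> par X (e \<noteq> q') ?W"
      using res_parity[OF opn(3,1,2) p[OF \<alpha>(1)]] m ac by (intro par_mult opn) (simp_all add: K_par_iff)
    moreover have "res X (U \<inter> cdom \<alpha>) ?W (q \<alpha>) \<otimes>\<^bsub>sect X ?W\<^esub> snd (m \<alpha>) \<in> par X ((\<not> e) \<noteq> (\<not> q')) ?W"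
      using res_parity[OF opn(3,1,2) q[OF \<alpha>(1)]] m ac by (intro par_mult opn) (simp_all add: K_par_iff)
    ultimately have "res X W ?W (f W m) \<in> par X (e \<noteq> q') ?W"
      unfolding val[OF W ms \<alpha>(1)] using par_subgroup[OF opn(1)]
      by (cases e; cases q') (auto simp: additive_subgroup.a_closed)
    then show "\<exists>V. opn V \<and> x \<in> V \<and> V \<subseteq> W \<and> res X W V (f W m) \<in> par X (e \<noteq> q') V"
      using opn x \<alpha>(2) by (intro exI[of _ ?W]) auto
  qed
qed (rule f)

end


section \<open>The extension\<close>

lemma cover_compatible: "opn U \<Longrightarrow> U \<subseteq> (\<Union>\<alpha>\<in>compatible X. cdom \<alpha>)"
proof
  fix x assume "opn U" "x \<in> U"
  then have "x \<in> topspace (space_of X)" using openin_subset by blast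
  then obtain \<kappa> where "\<kappa> \<in> sc_atlas X" "x \<in> cdom \<kappa>" using atlas_cover by blast
  then show "x \<in> (\<Union>\<alpha>\<in>compatible X. cdom \<alpha>)" using atlas_compatible by blast
qed

lemma cover_eqI:
  assumes W: "opn W" and A: "A \<subseteq> compatible X" "W \<subseteq> (\<Union>\<alpha>\<in>A. cdom \<alpha>)"
    and t: "t \<in> carrier (sect X W)" "t' \<in> carrier (sect X W)"
    and eq: "\<And>\<alpha>. \<alpha> \<in> A \<Longrightarrow> res X W (W \<inter> cdom \<alpha>) t = res X W (W \<inter> cdom \<alpha>) t'"
  shows "t = t'"
proof (rule sect_local_eqI[OF W t])
  fix x assume x: "x \<in> W"
  then obtain \<alpha> where \<alpha>: "\<alpha> \<in> A" "x \<in> cdom \<alpha>" using A(2) by blast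
  moreover have "opn (W \<inter> cdom \<alpha>)" using W A(1) \<alpha>(1) by auto
  ultimately show "\<exists>V. opn V \<and> x \<in> V \<and> V \<subseteq> W \<and> res X W V t = res X W V t'"
    using eq[OF \<alpha>(1)] x by (intro exI[of _ "W \<inter> cdom \<alpha>"]) auto
qed

lemma par_const:
  assumes "opn W"
  shows "\<zero>\<^bsub>sect X W\<^esub> \<in> par X p W" "\<one>\<^bsub>sect X W\<^esub> \<in> par X False W"
proof -
  show "\<zero>\<^bsub>sect X W\<^esub> \<in> par X p W" using par_subgroup[OF assms] additive_subgroup.zero_closed by blast
  have "scalar X W 1 = \<one>\<^bsub>sect X W\<^esub>"
    using ring_hom_one[OF scalar_hom[OF assms]] by (simp add: grassmann_ring_def)
  then show "\<one>\<^bsub>sect X W\<^esub> \<in> par X False W"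
    using scalar_parity[OF assms, of 1 False] by (simp add: gparity_even_iff)
qed

abbreviation B where "B \<equiv> berezinian_power 3 X"

lemma B_sect_iff: "w \<in> msect B U \<longleftrightarrow>
    w \<in> (\<Pi>\<^sub>E \<alpha>\<in>compatible X. carrier (sect X (U \<inter> cdom \<alpha>))) \<and>
    (\<forall>\<alpha>\<in>compatible X. \<forall>\<beta>\<in>compatible X.
      res X (U \<inter> cdom \<alpha>) (U \<inter> cdom \<alpha> \<inter> cdom \<beta>) (w \<alpha>) =
        res X (U \<inter> cdom \<beta>) (U \<inter> cdom \<alpha> \<inter> cdom \<beta>) (w \<beta>) \<otimes>\<^bsub>sect X (U \<inter> cdom \<alpha> \<inter> cdom \<beta>)\<^esub>
          jac3 \<beta> \<alpha> (U \<inter> cdom \<alpha> \<inter> cdom \<beta>))"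
  by (simp add: berezinian_power_def Let_def jac3_def)

lemma B_simps:
  "mplus B U w w' = (\<lambda>\<alpha>\<in>compatible X. w \<alpha> \<oplus>\<^bsub>sect X (U \<inter> cdom \<alpha>)\<^esub> w' \<alpha>)"
  "mact B U g w = (\<lambda>\<alpha>\<in>compatible X. res X U (U \<inter> cdom \<alpha>) g \<otimes>\<^bsub>sect X (U \<inter> cdom \<alpha>)\<^esub> w \<alpha>)"
  "mres B U V w = (\<lambda>\<alpha>\<in>compatible X. res X (U \<inter> cdom \<alpha>) (V \<inter> cdom \<alpha>) (w \<alpha>))"
  by (simp_all add: berezinian_power_def Let_def)

lemma B_par_iff: "w \<in> mpar B p U \<longleftrightarrow> w \<in> msect B U \<and>
    (\<forall>\<alpha>\<in>compatible X. w \<alpha> \<in> par X (\<not> p) (U \<inter> cdom \<alpha>))"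
  by (simp add: berezinian_power_def Let_def)

lemma B_carrier: "w \<in> msect B U \<Longrightarrow> \<alpha> \<in> compatible X \<Longrightarrow> w \<alpha> \<in> carrier (sect X (U \<inter> cdom \<alpha>))"
  unfolding B_sect_iff by (auto simp: PiE_iff)

lemma B_change: "w \<in> msect B U \<Longrightarrow> \<alpha> \<in> compatible X \<Longrightarrow> \<beta> \<in> compatible X \<Longrightarrow> W = U \<inter> cdom \<alpha> \<inter> cdom \<beta> \<Longrightarrow>
    res X (U \<inter> cdom \<alpha>) W (w \<alpha>) = res X (U \<inter> cdom \<beta>) W (w \<beta>) \<otimes>\<^bsub>sect X W\<^esub> jac3 \<beta> \<alpha> W"
  unfolding B_sect_iff by blast

lemma B_sectI:
  assumes "w \<in> extensional (compatible X)"
    and "\<And>\<alpha>. \<alpha> \<in> compatible X \<Longrightarrow> w \<alpha> \<in> carrier (sect X (U \<inter> cdom \<alpha>))"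
    and "\<And>\<alpha> \<beta> W. \<alpha> \<in> compatible X \<Longrightarrow> \<beta> \<in> compatible X \<Longrightarrow> W = U \<inter> cdom \<alpha> \<inter> cdom \<beta> \<Longrightarrow>
      res X (U \<inter> cdom \<alpha>) W (w \<alpha>) = res X (U \<inter> cdom \<beta>) W (w \<beta>) \<otimes>\<^bsub>sect X W\<^esub> jac3 \<beta> \<alpha> W"
  shows "w \<in> msect B U"
  unfolding B_sect_iff PiE_iff
  by (intro conjI ballI assms(1) assms(2) assms(3)[OF _ _ refl])

lemma overlap_facts:
  assumes "opn U" "\<alpha> \<in> compatible X" "\<beta> \<in> compatible X" "W = U \<inter> cdom \<alpha> \<inter> cdom \<beta>"
  shows "opn W" "W \<subseteq> U \<inter> cdom \<alpha>" "W \<subseteq> U \<inter> cdom \<beta>" "in_charts \<alpha> \<beta> W" "opn (U \<inter> cdom \<alpha>)" "opn (U \<inter> cdom \<beta>)"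
  unfolding assms(4) using assms(1-3) by (auto simp: in_charts_def)

lemma B_plus_closed:
  assumes U: "opn U" and w: "w \<in> msect B U" "w' \<in> msect B U"
  shows "mplus B U w w' \<in> msect B U"
proof (rule B_sectI)
  fix \<alpha> \<beta> W assume ab: "\<alpha> \<in> compatible X" "\<beta> \<in> compatible X" and W: "W = U \<inter> cdom \<alpha> \<inter> cdom \<beta>"
  note O = overlap_facts[OF U ab W]
  interpret R: ring "sect X W" by (rule sect_ring[OF O(1)])
  have r: "res X (U \<inter> cdom \<beta>) W (w \<beta>) \<in> carrier (sect X W)" "res X (U \<inter> cdom \<beta>) W (w' \<beta>) \<in> carrier (sect X W)"
    using B_carrier[OF w(1) ab(2)] B_carrier[OF w(2) ab(2)] O by simp_all
  show "res X (U \<inter> cdom \<alpha>) W (mplus B U w w' \<alpha>) = res X (U \<inter> cdom \<beta>) W (mplus B U w w' \<beta>) \<otimes>\<^bsub>sect X W\<^esub> jac3 \<beta> \<alpha> W"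
    using B_carrier[OF w(1)] B_carrier[OF w(2)] B_change[OF w(1) ab W] B_change[OF w(2) ab W] ab O r
      jac3_carrier[OF O(4)]
    by (simp add: B_simps R.l_distr)
qed (use U B_carrier w in \<open>simp_all add: B_simps\<close>)

lemma B_act_closed:
  assumes U: "opn U" and w: "w \<in> msect B U" and g: "g \<in> carrier (sect X U)"
  shows "mact B U g w \<in> msect B U"
proof (rule B_sectI)
  fix \<alpha> \<beta> W assume ab: "\<alpha> \<in> compatible X" "\<beta> \<in> compatible X" and W: "W = U \<inter> cdom \<alpha> \<inter> cdom \<beta>"
  note O = overlap_facts[OF U ab W]
  interpret R: ring "sect X W" by (rule sect_ring[OF O(1)])
  have WU: "W \<subseteq> U" using W by auto
  have r: "res X (U \<inter> cdom \<beta>) W (w \<beta>) \<in> carrier (sect X W)" "res X U W g \<in> carrier (sect X W)"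
    using B_carrier[OF w ab(2)] O WU g U by simp_all
  show "res X (U \<inter> cdom \<alpha>) W (mact B U g w \<alpha>) = res X (U \<inter> cdom \<beta>) W (mact B U g w \<beta>) \<otimes>\<^bsub>sect X W\<^esub> jac3 \<beta> \<alpha> W"
    using B_carrier[OF w] B_change[OF w ab W] ab O r jac3_carrier[OF O(4)] g U
    by (simp add: B_simps R.m_assoc)
qed (use U B_carrier w g in \<open>simp_all add: B_simps\<close>)

lemma B_res_closed:
  assumes U: "opn U" and V: "opn V" "V \<subseteq> U" and w: "w \<in> msect B U"
  shows "mres B U V w \<in> msect B V"
proof (rule B_sectI)
  have sub: "V \<inter> cdom \<alpha> \<subseteq> U \<inter> cdom \<alpha>" for \<alpha> :: "('p, 's, 'n) superchart" using V by auto
  fix \<alpha> assume \<alpha>: "\<alpha> \<in> compatible X"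
  show "mres B U V w \<alpha> \<in> carrier (sect X (V \<inter> cdom \<alpha>))"
    using B_carrier[OF w \<alpha>] U V \<alpha> sub by (simp add: B_simps)
  fix \<beta> W assume \<beta>: "\<beta> \<in> compatible X" and W: "W = V \<inter> cdom \<alpha> \<inter> cdom \<beta>"
  note O = overlap_facts[OF V(1) \<alpha> \<beta> W]
  let ?O = "U \<inter> cdom \<alpha> \<inter> cdom \<beta>"
  note OU = overlap_facts[OF U \<alpha> \<beta> refl]
  have WO: "W \<subseteq> ?O" using W V by auto
  have car: "w \<alpha> \<in> carrier (sect X (U \<inter> cdom \<alpha>))" "w \<beta> \<in> carrier (sect X (U \<inter> cdom \<beta>))"
    using B_carrier[OF w] \<alpha> \<beta> by auto
  have "res X ?O W (res X (U \<inter> cdom \<alpha>) ?O (w \<alpha>)) =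
      res X ?O W (res X (U \<inter> cdom \<beta>) ?O (w \<beta>) \<otimes>\<^bsub>sect X ?O\<^esub> jac3 \<beta> \<alpha> ?O)"
    using B_change[OF w \<alpha> \<beta> refl] by simp
  also have "res X ?O W (res X (U \<inter> cdom \<alpha>) ?O (w \<alpha>)) = res X (U \<inter> cdom \<alpha>) W (w \<alpha>)"
    by (rule res_res[OF OU(5,1) O(1) WO OU(2) car(1)])
  also have "res X ?O W (res X (U \<inter> cdom \<beta>) ?O (w \<beta>) \<otimes>\<^bsub>sect X ?O\<^esub> jac3 \<beta> \<alpha> ?O) =
      res X ?O W (res X (U \<inter> cdom \<beta>) ?O (w \<beta>)) \<otimes>\<^bsub>sect X W\<^esub> res X ?O W (jac3 \<beta> \<alpha> ?O)"
    by (rule res_simps(5)[OF OU(1) O(1) WO res_simps(3)[OF OU(6,1,3) car(2)] jac3_carrier[OF OU(4)]])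
  also have "res X ?O W (res X (U \<inter> cdom \<beta>) ?O (w \<beta>)) = res X (U \<inter> cdom \<beta>) W (w \<beta>)"
    by (rule res_res[OF OU(6,1) O(1) WO OU(3) car(2)])
  also have "res X ?O W (jac3 \<beta> \<alpha> ?O) = jac3 \<beta> \<alpha> W" by (rule csw_res(2)[OF OU(4) O(1) WO])
  finally have "res X (U \<inter> cdom \<alpha>) W (w \<alpha>) = res X (U \<inter> cdom \<beta>) W (w \<beta>) \<otimes>\<^bsub>sect X W\<^esub> jac3 \<beta> \<alpha> W" .
  moreover have "res X (V \<inter> cdom \<gamma>) W (mres B U V w \<gamma>) = res X (U \<inter> cdom \<gamma>) W (w \<gamma>)"
    if "\<gamma> \<in> compatible X" "w \<gamma> \<in> carrier (sect X (U \<inter> cdom \<gamma>))" "W \<subseteq> V \<inter> cdom \<gamma>" for \<gamma>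
    using that sub[of \<gamma>] O(1) U V by (simp add: B_simps)
  ultimately show "res X (V \<inter> cdom \<alpha>) W (mres B U V w \<alpha>) = res X (V \<inter> cdom \<beta>) W (mres B U V w \<beta>) \<otimes>\<^bsub>sect X W\<^esub> jac3 \<beta> \<alpha> W"
    using \<alpha> \<beta> car O by simp
qed (simp add: B_simps)

context
  fixes c :: complex
begin

text \<open>
  The value of \<open>ber_incl\<close> is given by a definite description. The section that it describes exists: it is the
  value of the functional glued from \<open>0\<close> on the vacuum and \<open>w\<^sub>\<alpha>\<close> on \<open>\<tau>\<^sub>\<alpha>\<close>.
\<close>

lemma ber_incl_value:
  assumes U: "opn U" and w: "w \<in> msect B U"
  shows "ber_incl c X U w \<in> msect (N c) U"
    "\<And>W m \<alpha>. opn W \<Longrightarrow> W \<subseteq> U \<Longrightarrow> m \<in> msect (K c) W \<Longrightarrow> \<alpha> \<in> compatible X \<Longrightarrow>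
      res X W (W \<inter> cdom \<alpha>) (ber_incl c X U w W m) =
        res X (U \<inter> cdom \<alpha>) (W \<inter> cdom \<alpha>) (w \<alpha>) \<otimes>\<^bsub>sect X (W \<inter> cdom \<alpha>)\<^esub> snd (m \<alpha>)"
    "w \<in> mpar B p U \<Longrightarrow> ber_incl c X U w \<in> mpar (N c) p U"
proof -
  let ?A = "compatible X" and ?p = "\<lambda>\<alpha>. \<zero>\<^bsub>sect X (U \<inter> cdom \<alpha>)\<^esub>"
  note cover = order.refl[of ?A] cover_compatible[OF U]
  have compat: "res X (U \<inter> cdom \<alpha>) W (?p \<alpha>) = res X (U \<inter> cdom \<beta>) W (?p \<beta>) \<and>
      res X (U \<inter> cdom \<alpha>) W (w \<alpha>) = res X (U \<inter> cdom \<beta>) W (?p \<beta>) \<otimes>\<^bsub>sect X W\<^esub> csw c \<beta> \<alpha> W \<oplus>\<^bsub>sect X W\<^esub>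
        res X (U \<inter> cdom \<beta>) W (w \<beta>) \<otimes>\<^bsub>sect X W\<^esub> jac3 \<beta> \<alpha> W"
    if ab: "\<alpha> \<in> ?A" "\<beta> \<in> ?A" and W: "W = U \<inter> cdom \<alpha> \<inter> cdom \<beta>" for \<alpha> \<beta> W
  proof -
    note O = overlap_facts[OF U ab W]
    interpret R: ring "sect X W" by (rule sect_ring[OF O(1)])
    have "res X (U \<inter> cdom \<beta>) W (w \<beta>) \<in> carrier (sect X W)" using B_carrier[OF w ab(2)] O by simp
    then show ?thesis
      using B_change[OF w ab W] O csw_carrier[OF O(4)] jac3_carrier[OF O(4)] by simp
  qed
  obtain f where f: "f \<in> msect (N c) U" and val: "\<And>W m \<alpha>. opn W \<Longrightarrow> W \<subseteq> U \<Longrightarrow> m \<in> msect (K c) W \<Longrightarrow> \<alpha> \<in> ?A \<Longrightarrow>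
      res X W (W \<inter> cdom \<alpha>) (f W m) =
        res X (U \<inter> cdom \<alpha>) (W \<inter> cdom \<alpha>) (?p \<alpha>) \<otimes>\<^bsub>sect X (W \<inter> cdom \<alpha>)\<^esub> fst (m \<alpha>) \<oplus>\<^bsub>sect X (W \<inter> cdom \<alpha>)\<^esub>
        res X (U \<inter> cdom \<alpha>) (W \<inter> cdom \<alpha>) (w \<alpha>) \<otimes>\<^bsub>sect X (W \<inter> cdom \<alpha>)\<^esub> snd (m \<alpha>)"
  proof (rule glue_functional[OF U cover, of ?p w c])
    show "?p \<alpha> \<in> carrier (sect X (U \<inter> cdom \<alpha>))" if "\<alpha> \<in> ?A" for \<alpha> using U that by simp
    show "w \<alpha> \<in> carrier (sect X (U \<inter> cdom \<alpha>))" if "\<alpha> \<in> ?A" for \<alpha> by (rule B_carrier[OF w that])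
  qed (rule compat, assumption+, rule that)
  have val': "res X W (W \<inter> cdom \<alpha>) (f W m) =
        res X (U \<inter> cdom \<alpha>) (W \<inter> cdom \<alpha>) (w \<alpha>) \<otimes>\<^bsub>sect X (W \<inter> cdom \<alpha>)\<^esub> snd (m \<alpha>)"
    if W: "opn W" "W \<subseteq> U" and m: "m \<in> msect (K c) W" and \<alpha>: "\<alpha> \<in> ?A" for W m \<alpha>
  proof -
    have opn: "opn (W \<inter> cdom \<alpha>)" "W \<inter> cdom \<alpha> \<subseteq> U \<inter> cdom \<alpha>" "opn (U \<inter> cdom \<alpha>)" using W U \<alpha> by auto
    interpret R: ring "sect X (W \<inter> cdom \<alpha>)" by (rule sect_ring[OF opn(1)])
    show ?thesis
      using val[OF W m \<alpha>] K_carrier[OF m \<alpha>] B_carrier[OF w \<alpha>] opn by simp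
  qed
  have "ber_incl c X U w = functional c U (\<lambda>W s. THE t. t \<in> carrier (sect X W) \<and> (\<forall>\<alpha>\<in>?A.
            res X W (W \<inter> cdom \<alpha>) t =
              res X (U \<inter> cdom \<alpha>) (W \<inter> cdom \<alpha>) (w \<alpha>) \<otimes>\<^bsub>sect X (W \<inter> cdom \<alpha>)\<^esub> snd (s \<alpha>)))"
    using U w by (simp add: ber_incl_def functional_def[abs_def])
  also have "\<dots> = functional c U f"
  proof (rule functional_cong)
    fix W m assume W: "opn W" "W \<subseteq> U" and m: "m \<in> msect (K c) W"
    show "(THE t. t \<in> carrier (sect X W) \<and> (\<forall>\<alpha>\<in>?A. res X W (W \<inter> cdom \<alpha>) t =
        res X (U \<inter> cdom \<alpha>) (W \<inter> cdom \<alpha>) (w \<alpha>) \<otimes>\<^bsub>sect X (W \<inter> cdom \<alpha>)\<^esub> snd (m \<alpha>))) = f W m"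
    proof (rule the_equality)
      show "f W m \<in> carrier (sect X W) \<and> (\<forall>\<alpha>\<in>?A. res X W (W \<inter> cdom \<alpha>) (f W m) =
        res X (U \<inter> cdom \<alpha>) (W \<inter> cdom \<alpha>) (w \<alpha>) \<otimes>\<^bsub>sect X (W \<inter> cdom \<alpha>)\<^esub> snd (m \<alpha>))"
        using N_closed[OF f W m] val'[OF W m] by blast
      show "t = f W m" if "t \<in> carrier (sect X W) \<and> (\<forall>\<alpha>\<in>?A. res X W (W \<inter> cdom \<alpha>) t =
        res X (U \<inter> cdom \<alpha>) (W \<inter> cdom \<alpha>) (w \<alpha>) \<otimes>\<^bsub>sect X (W \<inter> cdom \<alpha>)\<^esub> snd (m \<alpha>))" for t
      proof (rule cover_eqI[OF W(1) order.refl cover_compatible[OF W(1)] conjunct1[OF that] N_closed[OF f W m]])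
        fix \<alpha> assume \<alpha>: "\<alpha> \<in> ?A"
        show "res X W (W \<inter> cdom \<alpha>) t = res X W (W \<inter> cdom \<alpha>) (f W m)"
          using bspec[OF conjunct2[OF that] \<alpha>] val'[OF W m \<alpha>] by (rule trans[OF _ sym])
      qed
    qed
  qed
  also have "\<dots> = f" by (rule N_functional[OF f])
  finally have eq: "ber_incl c X U w = f" .
  show "ber_incl c X U w \<in> msect (N c) U" using eq f by simp
  show "\<And>W m \<alpha>. opn W \<Longrightarrow> W \<subseteq> U \<Longrightarrow> m \<in> msect (K c) W \<Longrightarrow> \<alpha> \<in> compatible X \<Longrightarrow>
      res X W (W \<inter> cdom \<alpha>) (ber_incl c X U w W m) =
        res X (U \<inter> cdom \<alpha>) (W \<inter> cdom \<alpha>) (w \<alpha>) \<otimes>\<^bsub>sect X (W \<inter> cdom \<alpha>)\<^esub> snd (m \<alpha>)"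
    unfolding eq by (rule val')
  show "ber_incl c X U w \<in> mpar (N c) p U" if "w \<in> mpar B p U"
    unfolding eq
  proof (rule glued_parity[OF U cover, of ?p p w f c])
    show "?p \<alpha> \<in> par X p (U \<inter> cdom \<alpha>)" if "\<alpha> \<in> ?A" for \<alpha> using U that by (simp add: par_const)
    show "w \<alpha> \<in> par X (\<not> p) (U \<inter> cdom \<alpha>)" if "\<alpha> \<in> ?A" for \<alpha> using \<open>w \<in> mpar B p U\<close> that by (simp add: B_par_iff)
  qed (rule f, rule val)
qed

lemma ber_incl_eqI:
  assumes U: "opn U" and w: "w \<in> msect B U" and f: "f \<in> msect (N c) U"
    and val: "\<And>W m \<alpha>. opn W \<Longrightarrow> W \<subseteq> U \<Longrightarrow> m \<in> msect (K c) W \<Longrightarrow> \<alpha> \<in> compatible X \<Longrightarrow>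
      res X W (W \<inter> cdom \<alpha>) (f W m) =
        res X (U \<inter> cdom \<alpha>) (W \<inter> cdom \<alpha>) (w \<alpha>) \<otimes>\<^bsub>sect X (W \<inter> cdom \<alpha>)\<^esub> snd (m \<alpha>)"
  shows "ber_incl c X U w = f"
proof (rule N_eqI[OF ber_incl_value(1)[OF U w] f])
  fix W m assume W: "opn W" "W \<subseteq> U" and m: "m \<in> msect (K c) W"
  show "ber_incl c X U w W m = f W m"
  proof (rule cover_eqI[OF W(1) order.refl cover_compatible[OF W(1)] N_closed[OF ber_incl_value(1)[OF U w] W m]
        N_closed[OF f W m]])
    fix \<alpha> assume \<alpha>: "\<alpha> \<in> compatible X"
    show "res X W (W \<inter> cdom \<alpha>) (ber_incl c X U w W m) = res X W (W \<inter> cdom \<alpha>) (f W m)"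
      unfolding ber_incl_value(2)[OF U w W m \<alpha>] val[OF W m \<alpha>] ..
  qed
qed

lemma ber_incl_morphism: "ber_incl c X \<in> even_morphisms X B (N c)"
  unfolding even_morphisms_def mem_Collect_eq
proof (intro conjI allI impI ballI; (elim conjE)?)
  show "ber_incl c X U = undefined" if "\<not> opn U" for U using that by (simp add: ber_incl_def)
  fix U assume U: "opn U"
  show "ber_incl c X U \<in> extensional (msect B U)" using U by (simp add: ber_incl_def)
  show "ber_incl c X U \<in> msect B U \<rightarrow> msect (N c) U" using ber_incl_value(1)[OF U] by blast
  show "ber_incl c X U ` mpar B p U \<subseteq> mpar (N c) p U" for p
    using ber_incl_value(3)[OF U] by (auto simp: B_par_iff)
  fix w assume w: "w \<in> msect B U"
  note f = ber_incl_value(1)[OF U w]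
  show "ber_incl c X U (mplus B U w w') = mplus (N c) U (ber_incl c X U w) (ber_incl c X U w')"
    if w': "w' \<in> msect B U" for w'
  proof (rule ber_incl_eqI[OF U B_plus_closed[OF U w w']])
    note f' = ber_incl_value(1)[OF U w']
    show "mplus (N c) U (ber_incl c X U w) (ber_incl c X U w') \<in> msect (N c) U" by (rule N_plus_closed[OF f f'])
    fix W m \<alpha> assume W: "opn W" "W \<subseteq> U" and m: "m \<in> msect (K c) W" and \<alpha>: "\<alpha> \<in> compatible X"
    have opn: "opn (W \<inter> cdom \<alpha>)" "W \<inter> cdom \<alpha> \<subseteq> U \<inter> cdom \<alpha>" "opn (U \<inter> cdom \<alpha>)" using W U \<alpha> by auto
    interpret R: ring "sect X (W \<inter> cdom \<alpha>)" by (rule sect_ring[OF opn(1)])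
    show "res X W (W \<inter> cdom \<alpha>) (mplus (N c) U (ber_incl c X U w) (ber_incl c X U w') W m) =
        res X (U \<inter> cdom \<alpha>) (W \<inter> cdom \<alpha>) (mplus B U w w' \<alpha>) \<otimes>\<^bsub>sect X (W \<inter> cdom \<alpha>)\<^esub> snd (m \<alpha>)"
      using W opn \<alpha> N_closed[OF f W m] N_closed[OF f' W m] ber_incl_value(2)[OF U w W m \<alpha>]
        ber_incl_value(2)[OF U w' W m \<alpha>] K_carrier[OF m \<alpha>] B_carrier[OF w \<alpha>] B_carrier[OF w' \<alpha>]
      by (simp add: N_simps functional_value[OF W m] B_simps R.l_distr)
  qed
  show "ber_incl c X U (mact B U g w) = mact (N c) U g (ber_incl c X U w)" if g: "g \<in> carrier (sect X U)" for g
  proof (rule ber_incl_eqI[OF U B_act_closed[OF U w g]])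
    show "mact (N c) U g (ber_incl c X U w) \<in> msect (N c) U" by (rule N_act_closed[OF U f g])
    fix W m \<alpha> assume W: "opn W" "W \<subseteq> U" and m: "m \<in> msect (K c) W" and \<alpha>: "\<alpha> \<in> compatible X"
    have opn: "opn (W \<inter> cdom \<alpha>)" "W \<inter> cdom \<alpha> \<subseteq> U \<inter> cdom \<alpha>" "opn (U \<inter> cdom \<alpha>)" "W \<inter> cdom \<alpha> \<subseteq> W"
      "U \<inter> cdom \<alpha> \<subseteq> U" "W \<inter> cdom \<alpha> \<subseteq> U"
      using W U \<alpha> by auto
    interpret R: ring "sect X (W \<inter> cdom \<alpha>)" by (rule sect_ring[OF opn(1)])
    show "res X W (W \<inter> cdom \<alpha>) (mact (N c) U g (ber_incl c X U w) W m) =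
        res X (U \<inter> cdom \<alpha>) (W \<inter> cdom \<alpha>) (mact B U g w \<alpha>) \<otimes>\<^bsub>sect X (W \<inter> cdom \<alpha>)\<^esub> snd (m \<alpha>)"
      using W U opn \<alpha> g N_closed[OF f W m] ber_incl_value(2)[OF U w W m \<alpha>] K_carrier[OF m \<alpha>] B_carrier[OF w \<alpha>]
      by (simp add: N_simps functional_value[OF W m] B_simps R.m_assoc)
  qed
  show "ber_incl c X V (mres B U V w) = mres (N c) U V (ber_incl c X U w)" if V: "opn V" "V \<subseteq> U" for V
  proof (rule ber_incl_eqI[OF V(1) B_res_closed[OF U V w]])
    show "mres (N c) U V (ber_incl c X U w) \<in> msect (N c) V" by (rule N_res_closed[OF f V])
    fix W m \<alpha> assume W: "opn W" "W \<subseteq> V" and m: "m \<in> msect (K c) W" and \<alpha>: "\<alpha> \<in> compatible X"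
    have WU: "W \<subseteq> U" using W V by blast
    have opn: "opn (W \<inter> cdom \<alpha>)" "W \<inter> cdom \<alpha> \<subseteq> V \<inter> cdom \<alpha>" "opn (U \<inter> cdom \<alpha>)" "opn (V \<inter> cdom \<alpha>)"
      "V \<inter> cdom \<alpha> \<subseteq> U \<inter> cdom \<alpha>" using W V U \<alpha> by auto
    show "res X W (W \<inter> cdom \<alpha>) (mres (N c) U V (ber_incl c X U w) W m) =
        res X (V \<inter> cdom \<alpha>) (W \<inter> cdom \<alpha>) (mres B U V w \<alpha>) \<otimes>\<^bsub>sect X (W \<inter> cdom \<alpha>)\<^esub> snd (m \<alpha>)"
      using opn \<alpha> ber_incl_value(2)[OF U w W(1) WU m \<alpha>] B_carrier[OF w \<alpha>]
      by (simp add: N_simps functional_value[OF W m] B_simps)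
  qed
qed

lemma vac_eval_value: "opn U \<Longrightarrow> f \<in> msect (N c) U \<Longrightarrow> vac_eval c X U f = f U (vacuum X U)"
  by (simp add: vac_eval_def)

lemma structure_simps:
  "msect (structure_module X) U = carrier (sect X U)" "mplus (structure_module X) U = add (sect X U)"
  "mzero (structure_module X) U = \<zero>\<^bsub>sect X U\<^esub>" "mact (structure_module X) U = mult (sect X U)"
  "mpar (structure_module X) p U = par X p U" "mres (structure_module X) U V = res X U V"
  by (simp_all add: structure_module_def)

lemma vac_eval_morphism: "vac_eval c X \<in> even_morphisms X (N c) (structure_module X)"
  unfolding even_morphisms_def mem_Collect_eq structure_simps
proof (intro conjI allI impI ballI; (elim conjE)?)
  show "vac_eval c X U = undefined" if "\<not> opn U" for U using that by (simp add: vac_eval_def)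
  fix U assume U: "opn U"
  note v = vacuum_sect(1)[OF U]
  show "vac_eval c X U \<in> extensional (msect (N c) U)" using U by (simp add: vac_eval_def)
  show "vac_eval c X U \<in> msect (N c) U \<rightarrow> carrier (sect X U)"
    using N_closed[OF _ U order.refl v] vac_eval_value[OF U] by auto
  show "vac_eval c X U ` mpar (N c) p U \<subseteq> par X p U" for p
  proof
    fix t assume "t \<in> vac_eval c X U ` mpar (N c) p U"
    then obtain f where f: "f \<in> mpar (N c) p U" "t = vac_eval c X U f" by blast
    then have fs: "f \<in> msect (N c) U" by (simp add: N_par_iff)
    have "f U (vacuum X U) \<in> par X (p \<noteq> False) U"
      using f(1) U vacuum_sect(2)[OF U] unfolding N_par_iff by blast
    then show "t \<in> par X p U" using f(2) vac_eval_value[OF U fs] by simp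
  qed
  fix f assume f: "f \<in> msect (N c) U"
  show "vac_eval c X U (mplus (N c) U f f') = vac_eval c X U f \<oplus>\<^bsub>sect X U\<^esub> vac_eval c X U f'"
    if f': "f' \<in> msect (N c) U" for f'
    using vac_eval_value[OF U N_plus_closed[OF f f']] vac_eval_value[OF U f] vac_eval_value[OF U f']
    by (simp add: N_simps functional_value[OF U order.refl v])
  show "vac_eval c X U (mact (N c) U g f) = g \<otimes>\<^bsub>sect X U\<^esub> vac_eval c X U f" if g: "g \<in> carrier (sect X U)" for g
    using vac_eval_value[OF U N_act_closed[OF U f g]] vac_eval_value[OF U f] res_id[OF U g]
    by (simp add: N_simps functional_value[OF U order.refl v])
  show "vac_eval c X V (mres (N c) U V f) = res X U V (vac_eval c X U f)" if V: "opn V" "V \<subseteq> U" for V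
    using vac_eval_value[OF V(1) N_res_closed[OF f V]] vac_eval_value[OF U f]
      N_natural[OF f U order.refl v V] vacuum_sect(3)[OF U V]
    by (simp add: N_simps functional_value[OF V(1) order.refl vacuum_sect(1)[OF V(1)]])
qed

lemma tau_on_self:
  assumes \<alpha>: "\<alpha> \<in> compatible X" and W: "opn W" "W \<subseteq> cdom \<alpha>"
  shows "tau_on c \<alpha> W \<alpha> = (\<zero>\<^bsub>sect X W\<^esub>, \<one>\<^bsub>sect X W\<^esub>)"
proof -
  have "in_charts \<alpha> \<alpha> W" using \<alpha> W by (simp add: in_charts_def)
  then show ?thesis using tau_on_value[OF \<alpha> W \<alpha> W(2), of c] csw_self by simp
qed

lemma ber_incl_inj:
  assumes U: "opn U"
  shows "inj_on (ber_incl c X U) (msect B U)"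
proof (rule inj_onI)
  fix w w' assume w: "w \<in> msect B U" and w': "w' \<in> msect B U" and eq: "ber_incl c X U w = ber_incl c X U w'"
  show "w = w'"
  proof (rule extensionalityI[of _ "compatible X"])
    show "w \<in> extensional (compatible X)" "w' \<in> extensional (compatible X)"
      using w w' by (auto simp: B_sect_iff PiE_def)
    fix \<alpha> assume \<alpha>: "\<alpha> \<in> compatible X"
    let ?W = "U \<inter> cdom \<alpha>"
    have W: "opn ?W" "?W \<subseteq> U" "?W \<subseteq> cdom \<alpha>" using U \<alpha> by auto
    interpret R: ring "sect X ?W" by (rule sect_ring[OF W(1)])
    have WW: "?W \<inter> cdom \<alpha> = ?W" by auto
    note t = tau_on_sect[OF \<alpha> W(1,3), of c]
    have "v \<alpha> = res X ?W ?W (ber_incl c X U v ?W (tau_on c \<alpha> ?W))" if v: "v \<in> msect B U" for v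
      using ber_incl_value(2)[OF U v W(1,2) t \<alpha>] B_carrier[OF v \<alpha>] res_id[OF W(1)] tau_on_self[OF \<alpha> W(1,3)] WW
      by simp
    from this[OF w] this[OF w'] show "w \<alpha> = w' \<alpha>" unfolding eq by (rule trans[OF _ sym])
  qed
qed

text \<open>
  For a functional that vanishes on the vacuum, the Schwarzian drops out of the change of its values on
  \<open>\<tau>\<^sub>\<alpha>\<close>, and what remains is the transition rule of the cube of the Berezinian bundle.
\<close>

lemma ber_incl_image:
  assumes U: "opn U"
  shows "ber_incl c X U ` msect B U = {f \<in> msect (N c) U. vac_eval c X U f = \<zero>\<^bsub>sect X U\<^esub>}"
proof (intro equalityI subsetI)
  fix f assume "f \<in> ber_incl c X U ` msect B U"
  then obtain w where w: "w \<in> msect B U" "f = ber_incl c X U w" by blast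
  note v = vacuum_sect(1)[OF U]
  have f: "f \<in> msect (N c) U" using ber_incl_value(1)[OF U w(1)] w(2) by simp
  have "f U (vacuum X U) = \<zero>\<^bsub>sect X U\<^esub>"
  proof (rule cover_eqI[OF U order.refl cover_compatible[OF U] N_closed[OF f U order.refl v]])
    fix \<alpha> assume \<alpha>: "\<alpha> \<in> compatible X"
    have W: "opn (U \<inter> cdom \<alpha>)" "U \<inter> cdom \<alpha> \<subseteq> U" using U \<alpha> by auto
    interpret R: ring "sect X (U \<inter> cdom \<alpha>)" by (rule sect_ring[OF W(1)])
    show "res X U (U \<inter> cdom \<alpha>) (f U (vacuum X U)) = res X U (U \<inter> cdom \<alpha>) \<zero>\<^bsub>sect X U\<^esub>"
      using ber_incl_value(2)[OF U w(1) U order.refl v \<alpha>] B_carrier[OF w(1) \<alpha>] U W \<alpha>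
      by (simp add: w(2) vacuum_def)
  qed (use U in simp)
  then show "f \<in> {f \<in> msect (N c) U. vac_eval c X U f = \<zero>\<^bsub>sect X U\<^esub>}"
    using f vac_eval_value[OF U f] by simp
next
  fix f assume "f \<in> {f \<in> msect (N c) U. vac_eval c X U f = \<zero>\<^bsub>sect X U\<^esub>}"
  then have f: "f \<in> msect (N c) U" and zero: "f U (vacuum X U) = \<zero>\<^bsub>sect X U\<^esub>" using vac_eval_value[OF U] by auto
  have vac: "f W (vacuum X W) = \<zero>\<^bsub>sect X W\<^esub>" if W: "opn W" "W \<subseteq> U" for W
    using N_natural[OF f U order.refl vacuum_sect(1)[OF U] W] vacuum_sect(3)[OF U W] zero U W by simp
  define w where "w = (\<lambda>\<alpha>\<in>compatible X. f (U \<inter> cdom \<alpha>) (tau_on c \<alpha> (U \<inter> cdom \<alpha>)))"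
  have closed: "f (U \<inter> cdom \<alpha>) (tau_on c \<alpha> (U \<inter> cdom \<alpha>)) \<in> carrier (sect X (U \<inter> cdom \<alpha>))" if \<alpha>: "\<alpha> \<in> compatible X" for \<alpha>
    using N_closed[OF f, of "U \<inter> cdom \<alpha>"] tau_on_sect[OF \<alpha>, of "U \<inter> cdom \<alpha>" c] U \<alpha> by simp
  have w_res: "res X (U \<inter> cdom \<alpha>) W (w \<alpha>) = f W (tau_on c \<alpha> W)"
    if \<alpha>: "\<alpha> \<in> compatible X" and W: "opn W" "W \<subseteq> U \<inter> cdom \<alpha>" for \<alpha> W
  proof -
    have O: "opn (U \<inter> cdom \<alpha>)" "U \<inter> cdom \<alpha> \<subseteq> U" "U \<inter> cdom \<alpha> \<subseteq> cdom \<alpha>" using U \<alpha> by auto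
    show ?thesis
      using N_natural[OF f O(1,2) tau_on_sect[OF \<alpha> O(1,3)] W] tau_on_res[OF \<alpha> O(1,3) W, of c] \<alpha>
      by (simp add: w_def)
  qed
  have w: "w \<in> msect B U"
  proof (rule B_sectI)
    show "w \<in> extensional (compatible X)" by (simp add: w_def)
    show "w \<alpha> \<in> carrier (sect X (U \<inter> cdom \<alpha>))" if "\<alpha> \<in> compatible X" for \<alpha>
      using that closed by (simp add: w_def)
    fix \<alpha> \<beta> W assume ab: "\<alpha> \<in> compatible X" "\<beta> \<in> compatible X" and W: "W = U \<inter> cdom \<alpha> \<inter> cdom \<beta>"
    note O = overlap_facts[OF U ab W]
    interpret R: ring "sect X W" by (rule sect_ring[OF O(1)])
    have WU: "W \<subseteq> U" "W \<subseteq> cdom \<beta>" using W by auto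
    have "f W (tau_on c \<beta> W) \<in> carrier (sect X W)"
      by (rule N_closed[OF f O(1) WU(1) tau_on_sect[OF ab(2) O(1) WU(2)]])
    then show "res X (U \<inter> cdom \<alpha>) W (w \<alpha>) = res X (U \<inter> cdom \<beta>) W (w \<beta>) \<otimes>\<^bsub>sect X W\<^esub> jac3 \<beta> \<alpha> W"
      using tau_change[OF O(4) f WU(1)] vac[OF O(1) WU(1)] csw_carrier[OF O(4)] jac3_carrier[OF O(4)]
      by (simp add: w_res[OF ab(1) O(1,2)] w_res[OF ab(2) O(1,3)])
  qed
  have "ber_incl c X U w = f"
  proof (rule ber_incl_eqI[OF U w f])
    fix W m \<alpha> assume W: "opn W" "W \<subseteq> U" and m: "m \<in> msect (K c) W" and \<alpha>: "\<alpha> \<in> compatible X"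
    let ?W = "W \<inter> cdom \<alpha>"
    have O: "opn ?W" "?W \<subseteq> W" "?W \<subseteq> U" "?W \<subseteq> cdom \<alpha>" "?W \<subseteq> U \<inter> cdom \<alpha>" using W \<alpha> by auto
    interpret R: ring "sect X ?W" by (rule sect_ring[OF O(1)])
    note mW = mres_closed[OF W(1) O(1,2) m]
    have WW: "?W \<inter> cdom \<alpha> = ?W" by auto
    have val: "fst (mres (K c) W ?W m \<alpha>) = fst (m \<alpha>)" "snd (mres (K c) W ?W m \<alpha>) = snd (m \<alpha>)"
      using \<alpha> K_carrier[OF m \<alpha>] res_id[OF O(1)] by (simp_all add: K_simps WW)
    have "f ?W (tau_on c \<alpha> ?W) \<in> carrier (sect X ?W)"
      by (rule N_closed[OF f O(1,3) tau_on_sect[OF \<alpha> O(1,4)]])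
    then have "f ?W (mres (K c) W ?W m) = f ?W (tau_on c \<alpha> ?W) \<otimes>\<^bsub>sect X ?W\<^esub> snd (m \<alpha>)"
      using functional_formula[OF \<alpha> O(1,4) f O(3) mW] vac[OF O(1,3)] val K_carrier[OF m \<alpha>] by simp
    then show "res X W ?W (f W m) = res X (U \<inter> cdom \<alpha>) ?W (w \<alpha>) \<otimes>\<^bsub>sect X ?W\<^esub> snd (m \<alpha>)"
      using N_natural[OF f W m O(1,2)] w_res[OF \<alpha> O(1,5)] by simp
  qed
  then show "f \<in> ber_incl c X U ` msect B U" using w by blast
qed

text \<open>
  On the domain of a single chart there is no gluing condition, so \<open>|0\<rangle>\<^sub>\<alpha> \<mapsto> t\<close>, \<open>\<tau>\<^sub>\<alpha> \<mapsto> 0\<close> defines a functional.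
\<close>

lemma vac_eval_locally_surj:
  assumes U: "opn U" and t: "t \<in> carrier (sect X U)" and x: "x \<in> U"
  shows "\<exists>V. opn V \<and> x \<in> V \<and> V \<subseteq> U \<and> res X U V t \<in> vac_eval c X V ` msect (N c) V"
proof -
  obtain \<alpha> where \<alpha>: "\<alpha> \<in> compatible X" "x \<in> cdom \<alpha>" using cover_compatible[OF U] x by blast
  let ?V = "U \<inter> cdom \<alpha>"
  have V: "opn ?V" "?V \<subseteq> U" "?V \<inter> cdom \<alpha> = ?V" "?V \<subseteq> (\<Union>\<alpha>\<in>{\<alpha>}. cdom \<alpha>)" "{\<alpha>} \<subseteq> compatible X" using U \<alpha> by auto
  interpret R: ring "sect X ?V" by (rule sect_ring[OF V(1)])
  define p where "p = res X U ?V t"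
  have p: "p \<in> carrier (sect X ?V)" using t U V by (simp add: p_def)
  have ch: "in_charts \<alpha> \<alpha> ?V" using \<alpha> V by (simp add: in_charts_def)
  obtain f where f: "f \<in> msect (N c) ?V" and val: "\<And>W m \<beta>. opn W \<Longrightarrow> W \<subseteq> ?V \<Longrightarrow> m \<in> msect (K c) W \<Longrightarrow> \<beta> \<in> {\<alpha>} \<Longrightarrow>
      res X W (W \<inter> cdom \<beta>) (f W m) =
        res X (?V \<inter> cdom \<beta>) (W \<inter> cdom \<beta>) p \<otimes>\<^bsub>sect X (W \<inter> cdom \<beta>)\<^esub> fst (m \<beta>) \<oplus>\<^bsub>sect X (W \<inter> cdom \<beta>)\<^esub>
        res X (?V \<inter> cdom \<beta>) (W \<inter> cdom \<beta>) \<zero>\<^bsub>sect X ?V\<^esub> \<otimes>\<^bsub>sect X (W \<inter> cdom \<beta>)\<^esub> snd (m \<beta>)"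
  proof (rule glue_functional[OF V(1,5,4), of "\<lambda>_. p" "\<lambda>_. \<zero>\<^bsub>sect X ?V\<^esub>" c])
    fix \<beta> \<gamma> W assume "\<beta> \<in> {\<alpha>}" "\<gamma> \<in> {\<alpha>}" and W: "W = ?V \<inter> cdom \<beta> \<inter> cdom \<gamma>"
    then have *: "\<beta> = \<alpha>" "\<gamma> = \<alpha>" "W = ?V" by auto
    show "res X (?V \<inter> cdom \<beta>) W p = res X (?V \<inter> cdom \<gamma>) W p \<and>
        res X (?V \<inter> cdom \<beta>) W \<zero>\<^bsub>sect X ?V\<^esub> =
        res X (?V \<inter> cdom \<gamma>) W p \<otimes>\<^bsub>sect X W\<^esub> csw c \<gamma> \<beta> W \<oplus>\<^bsub>sect X W\<^esub>
        res X (?V \<inter> cdom \<gamma>) W \<zero>\<^bsub>sect X ?V\<^esub> \<otimes>\<^bsub>sect X W\<^esub> jac3 \<gamma> \<beta> W"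
      unfolding * V(3) using p V(1) csw_self[OF ch] by simp
  qed (use p V(3) in simp, use V(1,3) in simp, rule that)
  have "f ?V (vacuum X ?V) = p"
    using val[OF V(1) order.refl vacuum_sect(1)[OF V(1)], of \<alpha>] p V(3) res_id[OF V(1)] \<alpha>(1)
      N_closed[OF f V(1) order.refl vacuum_sect(1)[OF V(1)]]
    by (simp add: vacuum_def)
  then have "res X U ?V t = vac_eval c X ?V f" using vac_eval_value[OF V(1) f] by (simp add: p_def)
  then show ?thesis using f V x \<alpha>(2) by (intro exI[of _ ?V]) blast
qed

theorem dual_extension:
  "extension X B (N c) (structure_module X) (ber_incl c X) (vac_eval c X)"
  unfolding extension_def structure_simps
  by (intro conjI allI impI ballI ber_incl_morphism vac_eval_morphism ber_incl_inj ber_incl_image vac_eval_locally_surj)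

end


section \<open>Splittings and normalised functionals\<close>

abbreviation T where "T \<equiv> topspace (space_of X)"

lemma opn_subset_T: "opn W \<Longrightarrow> W \<subseteq> T"
  by (rule openin_subset)

text \<open>
  A splitting is multiplication of one functional, the image of the global section \<open>1\<close>. The functionals
  that arise are even and take the value \<open>1\<close> on the vacuum.
\<close>

definition normalized_functionals where
  "normalized_functionals c = {\<omega> \<in> mpar (N c) False T. \<omega> T (vacuum X T) = \<one>\<^bsub>sect X T\<^esub>}"

context
  fixes c :: complex and \<omega> assumes \<omega>: "\<omega> \<in> normalized_functionals c"
begin

lemma normalized_sect: "\<omega> \<in> msect (N c) T"
  using \<omega> by (simp add: normalized_functionals_def N_par_iff)

lemma normalized_parity: "opn W \<Longrightarrow> m \<in> mpar (K c) q W \<Longrightarrow> \<omega> W m \<in> par X q W"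
  using \<omega> opn_subset_T[of W] by (simp add: normalized_functionals_def N_par_iff)

lemma normalized_closed: "opn W \<Longrightarrow> m \<in> msect (K c) W \<Longrightarrow> \<omega> W m \<in> carrier (sect X W)"
  using N_closed[OF normalized_sect] opn_subset_T by blast

lemma normalized_vacuum:
  assumes W: "opn W"
  shows "\<omega> W (vacuum X W) = \<one>\<^bsub>sect X W\<^esub>"
proof -
  have T: "opn T" by simp
  have "\<omega> W (vacuum X W) = res X T W (\<omega> T (vacuum X T))"
    using N_natural[OF normalized_sect T order.refl vacuum_sect(1)[OF T] W opn_subset_T[OF W]]
      vacuum_sect(3)[OF T W opn_subset_T[OF W]] by simp
  then show ?thesis using \<omega> W opn_subset_T[OF W] by (simp add: normalized_functionals_def)
qed

lemma normalized_res_sect: "opn U \<Longrightarrow> functional c U \<omega> \<in> msect (N c) U"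
  using N_res_closed[OF normalized_sect _ opn_subset_T] by (simp add: N_simps)

lemma act_value:
  assumes "opn W" "W \<subseteq> U" "m \<in> msect (K c) W"
  shows "mact (N c) U t (functional c U \<omega>) W m = res X U W t \<otimes>\<^bsub>sect X W\<^esub> \<omega> W m"
  using assms by (simp add: N_simps functional_value)

lemma act_sect: "opn U \<Longrightarrow> t \<in> carrier (sect X U) \<Longrightarrow> mact (N c) U t (functional c U \<omega>) \<in> msect (N c) U"
  by (rule N_act_closed[OF _ normalized_res_sect])

lemma act_eqI:
  assumes U: "opn U" and f: "f \<in> msect (N c) U" and t: "t \<in> carrier (sect X U)"
    and eq: "\<And>W m. opn W \<Longrightarrow> W \<subseteq> U \<Longrightarrow> m \<in> msect (K c) W \<Longrightarrow> f W m = res X U W t \<otimes>\<^bsub>sect X W\<^esub> \<omega> W m"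
  shows "mact (N c) U t (functional c U \<omega>) = f"
proof (rule N_eqI[OF act_sect[OF U t] f])
  fix W m assume W: "opn W" "W \<subseteq> U" and m: "m \<in> msect (K c) W"
  show "mact (N c) U t (functional c U \<omega>) W m = f W m"
    unfolding act_value[OF W m] by (rule eq[OF W m, symmetric])
qed

definition splitting_of where
  "splitting_of U = (if opn U then \<lambda>t\<in>carrier (sect X U). mact (N c) U t (functional c U \<omega>) else undefined)"

lemma splitting_of_value:
  "opn U \<Longrightarrow> t \<in> carrier (sect X U) \<Longrightarrow> splitting_of U t = mact (N c) U t (functional c U \<omega>)"
  by (simp add: splitting_of_def)

lemma splitting_of_one: "splitting_of T \<one>\<^bsub>sect X T\<^esub> = \<omega>"
proof -
  have T: "opn T" by simp
  have one: "\<one>\<^bsub>sect X T\<^esub> \<in> carrier (sect X T)" by simp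
  show ?thesis
    unfolding splitting_of_value[OF T one]
  proof (rule act_eqI[OF T normalized_sect one])
    fix W m assume W: "opn W" "W \<subseteq> T" and m: "m \<in> msect (K c) W"
    interpret R: ring "sect X W" by (rule sect_ring[OF W(1)])
    show "\<omega> W m = res X T W \<one>\<^bsub>sect X T\<^esub> \<otimes>\<^bsub>sect X W\<^esub> \<omega> W m"
      using W normalized_closed[OF W(1) m] by simp
  qed
qed

lemma splitting_of_morphism: "splitting_of \<in> even_morphisms X (structure_module X) (N c)"
  unfolding even_morphisms_def mem_Collect_eq structure_simps
proof (intro conjI allI impI ballI; (elim conjE)?)
  show "splitting_of U = undefined" if "\<not> opn U" for U using that by (simp add: splitting_of_def)
  fix U assume U: "opn U"
  show "splitting_of U \<in> extensional (carrier (sect X U))" using U by (simp add: splitting_of_def)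
  show "splitting_of U \<in> carrier (sect X U) \<rightarrow> msect (N c) U"
    using act_sect[OF U] splitting_of_value[OF U] by auto
  show "splitting_of U ` par X p U \<subseteq> mpar (N c) p U" for p
  proof
    fix f assume "f \<in> splitting_of U ` par X p U"
    then obtain t where t: "t \<in> par X p U" "f = splitting_of U t" by blast
    have tc: "t \<in> carrier (sect X U)" using par_closed[OF U t(1)] .
    have f: "f = mact (N c) U t (functional c U \<omega>)" using t(2) splitting_of_value[OF U tc] by simp
    show "f \<in> mpar (N c) p U"
      unfolding N_par_iff
    proof (intro conjI allI impI; (elim conjE)?)
      show "f \<in> msect (N c) U" unfolding f by (rule act_sect[OF U tc])
      fix W q m assume W: "opn W" "W \<subseteq> U" and m: "m \<in> mpar (K c) q W"
      have ms: "m \<in> msect (K c) W" using m by (simp add: K_par_iff)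
      show "f W m \<in> par X (p \<noteq> q) W"
        unfolding f act_value[OF W ms]
        by (rule par_mult[OF W(1) res_parity[OF U W t(1)] normalized_parity[OF W(1) m]])
    qed
  qed
  fix t assume t: "t \<in> carrier (sect X U)"
  note f = act_sect[OF U t]
  show "splitting_of U (t \<oplus>\<^bsub>sect X U\<^esub> t') = mplus (N c) U (splitting_of U t) (splitting_of U t')"
    if t': "t' \<in> carrier (sect X U)" for t'
  proof -
    have s: "t \<oplus>\<^bsub>sect X U\<^esub> t' \<in> carrier (sect X U)" using U t t' by simp
    show ?thesis
      unfolding splitting_of_value[OF U t] splitting_of_value[OF U t'] splitting_of_value[OF U s]
    proof (rule act_eqI[OF U N_plus_closed[OF f act_sect[OF U t']] s])
      fix W m assume W: "opn W" "W \<subseteq> U" and m: "m \<in> msect (K c) W"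
      interpret R: ring "sect X W" by (rule sect_ring[OF W(1)])
      let ?f = "mact (N c) U t (functional c U \<omega>)" and ?f' = "mact (N c) U t' (functional c U \<omega>)"
      have "mplus (N c) U ?f ?f' W m = ?f W m \<oplus>\<^bsub>sect X W\<^esub> ?f' W m"
        by (simp only: N_simps(1) functional_value[OF W m])
      then show "mplus (N c) U ?f ?f' W m = res X U W (t \<oplus>\<^bsub>sect X U\<^esub> t') \<otimes>\<^bsub>sect X W\<^esub> \<omega> W m"
        unfolding act_value[OF W m] using U W t t' normalized_closed[OF W(1) m] by (simp add: R.l_distr)
    qed
  qed
  show "splitting_of U (g \<otimes>\<^bsub>sect X U\<^esub> t) = mact (N c) U g (splitting_of U t)"
    if g: "g \<in> carrier (sect X U)" for g
  proof -
    have s: "g \<otimes>\<^bsub>sect X U\<^esub> t \<in> carrier (sect X U)" using U t g by simp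
    show ?thesis
      unfolding splitting_of_value[OF U t] splitting_of_value[OF U s]
    proof (rule act_eqI[OF U N_act_closed[OF U f g] s])
      fix W m assume W: "opn W" "W \<subseteq> U" and m: "m \<in> msect (K c) W"
      interpret R: ring "sect X W" by (rule sect_ring[OF W(1)])
      let ?f = "mact (N c) U t (functional c U \<omega>)"
      have "mact (N c) U g ?f W m = res X U W g \<otimes>\<^bsub>sect X W\<^esub> ?f W m"
        by (simp only: N_simps(2)[of _ U g ?f] functional_value[OF W m])
      then show "mact (N c) U g ?f W m = res X U W (g \<otimes>\<^bsub>sect X U\<^esub> t) \<otimes>\<^bsub>sect X W\<^esub> \<omega> W m"
        unfolding act_value[OF W m] using U W t g normalized_closed[OF W(1) m] by (simp add: R.m_assoc)
    qed
  qed
  show "splitting_of V (res X U V t) = mres (N c) U V (splitting_of U t)" if V: "opn V" "V \<subseteq> U" for V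
  proof -
    have s: "res X U V t \<in> carrier (sect X V)" using U V t by simp
    show ?thesis
      unfolding splitting_of_value[OF U t] splitting_of_value[OF V(1) s]
    proof (rule act_eqI[OF V(1) N_res_closed[OF f V] s])
      fix W m assume W: "opn W" "W \<subseteq> V" and m: "m \<in> msect (K c) W"
      have WU: "W \<subseteq> U" using W V by blast
      have "mres (N c) U V (mact (N c) U t (functional c U \<omega>)) W m = res X U W t \<otimes>\<^bsub>sect X W\<^esub> \<omega> W m"
        unfolding N_simps(3) functional_value[OF W m] by (rule act_value[OF W(1) WU m])
      then show "mres (N c) U V (mact (N c) U t (functional c U \<omega>)) W m =
          res X V W (res X U V t) \<otimes>\<^bsub>sect X W\<^esub> \<omega> W m"
        using res_res[OF U V(1) W(1,2) V(2) t] by simp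
    qed
  qed
qed

lemma splitting_of_splitting: "splitting_of \<in> splittings X (N c) (structure_module X) (vac_eval c X)"
  unfolding splittings_def mem_Collect_eq structure_simps
proof (intro conjI allI impI ballI splitting_of_morphism)
  fix U t assume U: "opn U" and t: "t \<in> carrier (sect X U)"
  interpret R: ring "sect X U" by (rule sect_ring[OF U])
  note v = vacuum_sect(1)[OF U]
  show "vac_eval c X U (splitting_of U t) = t"
    unfolding splitting_of_value[OF U t] vac_eval_value[OF U act_sect[OF U t]] act_value[OF U order.refl v]
      normalized_vacuum[OF U]
    using res_id[OF U t] t by simp
qed

end

context
  fixes c :: complex and s assumes s: "s \<in> splittings X (N c) (structure_module X) (vac_eval c X)"
begin

lemma splitting_props:
  assumes U: "opn U"
  shows "t \<in> carrier (sect X U) \<Longrightarrow> s U t \<in> msect (N c) U"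
    "t \<in> par X p U \<Longrightarrow> s U t \<in> mpar (N c) p U"
    "g \<in> carrier (sect X U) \<Longrightarrow> t \<in> carrier (sect X U) \<Longrightarrow> s U (g \<otimes>\<^bsub>sect X U\<^esub> t) = mact (N c) U g (s U t)"
    "t \<in> carrier (sect X U) \<Longrightarrow> opn V \<Longrightarrow> V \<subseteq> U \<Longrightarrow> s V (res X U V t) = functional c V (s U t)"
    "t \<in> carrier (sect X U) \<Longrightarrow> vac_eval c X U (s U t) = t"
    "s U \<in> extensional (carrier (sect X U))"
proof -
  have m: "s \<in> even_morphisms X (structure_module X) (N c)"
    and q: "\<forall>U. opn U \<longrightarrow> (\<forall>t\<in>carrier (sect X U). vac_eval c X U (s U t) = t)"
    using s by (simp_all add: splittings_def structure_simps)
  note body = mp[OF spec[OF conjunct2[OF m[unfolded even_morphisms_def mem_Collect_eq structure_simps]], of U] U]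
  note b = body[THEN conjunct1] body[THEN conjunct2, THEN conjunct1] body[THEN conjunct2, THEN conjunct2, THEN conjunct1]
    body[THEN conjunct2, THEN conjunct2, THEN conjunct2, THEN conjunct2, THEN conjunct1]
    body[THEN conjunct2, THEN conjunct2, THEN conjunct2, THEN conjunct2, THEN conjunct2]
  show "t \<in> carrier (sect X U) \<Longrightarrow> s U t \<in> msect (N c) U" by (rule funcset_mem[OF b(2)])
  show "t \<in> par X p U \<Longrightarrow> s U t \<in> mpar (N c) p U"
    using spec[OF b(3), of p] by (rule subsetD[OF _ imageI])
  show "g \<in> carrier (sect X U) \<Longrightarrow> t \<in> carrier (sect X U) \<Longrightarrow> s U (g \<otimes>\<^bsub>sect X U\<^esub> t) = mact (N c) U g (s U t)"
    by (rule b(4)[rule_format])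
  show "t \<in> carrier (sect X U) \<Longrightarrow> opn V \<Longrightarrow> V \<subseteq> U \<Longrightarrow> s V (res X U V t) = functional c V (s U t)"
    by (rule b(5)[rule_format, OF _ conjI, unfolded N_simps(3)])
  show "t \<in> carrier (sect X U) \<Longrightarrow> vac_eval c X U (s U t) = t" by (rule q[rule_format, OF U])
  show "s U \<in> extensional (carrier (sect X U))" by (rule b(1))
qed

lemma splitting_one: "s T \<one>\<^bsub>sect X T\<^esub> \<in> normalized_functionals c"
proof -
  have T: "opn T" by simp
  have one: "\<one>\<^bsub>sect X T\<^esub> \<in> carrier (sect X T)" by simp
  note P = splitting_props[OF T]
  show "s T \<one>\<^bsub>sect X T\<^esub> \<in> normalized_functionals c"
    using P(2)[OF par_const(2)[OF T]] P(5)[OF one] vac_eval_value[OF T P(1)[OF one]]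
    by (simp add: normalized_functionals_def)
qed

lemma splitting_one_res:
  assumes U: "opn U"
  shows "s U \<one>\<^bsub>sect X U\<^esub> = functional c U (s T \<one>\<^bsub>sect X T\<^esub>)"
proof -
  have T: "opn T" by simp
  have one: "\<one>\<^bsub>sect X T\<^esub> \<in> carrier (sect X T)" by simp
  show ?thesis
    using splitting_props(4)[OF T one U opn_subset_T[OF U]] unfolding res_simps(2)[OF T U opn_subset_T[OF U]] .
qed

lemma splitting_eq: "s = splitting_of c (s T \<one>\<^bsub>sect X T\<^esub>)"
proof (rule ext)
  fix U
  show "s U = splitting_of c (s T \<one>\<^bsub>sect X T\<^esub>) U"
  proof (cases "opn U")
    case True
    interpret R: ring "sect X U" by (rule sect_ring[OF True])
    show ?thesis
    proof (rule extensionalityI[OF splitting_props(6)[OF True]])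
      show "splitting_of c (s T \<one>\<^bsub>sect X T\<^esub>) U \<in> extensional (carrier (sect X U))"
        using True by (simp add: splitting_of_def[OF splitting_one])
      fix t assume t: "t \<in> carrier (sect X U)"
      have "s U t = mact (N c) U t (s U \<one>\<^bsub>sect X U\<^esub>)"
        using splitting_props(3)[OF True t, of "\<one>\<^bsub>sect X U\<^esub>"] t by simp
      then show "s U t = splitting_of c (s T \<one>\<^bsub>sect X T\<^esub>) U t"
        unfolding splitting_one_res[OF True] splitting_of_value[OF splitting_one True t] .
    qed
  next
    case False
    have "s \<in> even_morphisms X (structure_module X) (N c)" using s by (simp add: splittings_def)
    then have "s U = undefined" using False by (simp add: even_morphisms_def)
    then show ?thesis using False by (simp add: splitting_of_def[OF splitting_one])
  qed
qed

end

lemma splittings_bij: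
  "bij_betw (\<lambda>s. s T \<one>\<^bsub>sect X T\<^esub>) (splittings X (N c) (structure_module X) (vac_eval c X))
    (normalized_functionals c)"
proof (rule bij_betw_byWitness[where f' = "splitting_of c"])
  show "\<forall>s\<in>splittings X (N c) (structure_module X) (vac_eval c X). splitting_of c (s T \<one>\<^bsub>sect X T\<^esub>) = s"
    using splitting_eq[symmetric] by blast
  show "\<forall>\<omega>\<in>normalized_functionals c. splitting_of c \<omega> T \<one>\<^bsub>sect X T\<^esub> = \<omega>"
    using splitting_of_one by blast
  show "(\<lambda>s. s T \<one>\<^bsub>sect X T\<^esub>) ` splittings X (N c) (structure_module X) (vac_eval c X) \<subseteq> normalized_functionals c"
    using splitting_one by blast
  show "splitting_of c ` normalized_functionals c \<subseteq> splittings X (N c) (structure_module X) (vac_eval c X)"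
    using splitting_of_splitting by blast
qed


section \<open>Normalised functionals and superprojective structures\<close>

definition functional_atlas where
  "functional_atlas c \<omega> = {\<alpha> \<in> compatible X. \<omega> (cdom \<alpha>) (tau c X \<alpha>) = \<zero>\<^bsub>sect X (cdom \<alpha>)\<^esub>}"

lemma splitting_atlas_eq:
  assumes s: "s \<in> splittings X (N c) (structure_module X) (vac_eval c X)"
  shows "splitting_atlas c X s = functional_atlas c (s T \<one>\<^bsub>sect X T\<^esub>)"
proof -
  have "s (cdom \<alpha>) \<one>\<^bsub>sect X (cdom \<alpha>)\<^esub> (cdom \<alpha>) (tau c X \<alpha>) = s T \<one>\<^bsub>sect X T\<^esub> (cdom \<alpha>) (tau c X \<alpha>)"
    if \<alpha>: "\<alpha> \<in> compatible X" for \<alpha> :: "('p, 's, 'n) superchart"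
    unfolding splitting_one_res[OF s compatible_opn[OF \<alpha>]]
    by (rule functional_value[OF compatible_opn[OF \<alpha>] order.refl tau_sect(1)[OF \<alpha>]])
  then show ?thesis unfolding splitting_atlas_def functional_atlas_def by (intro Collect_cong conj_cong refl) simp
qed

lemma tau_on_cdom:
  assumes \<alpha>: "\<alpha> \<in> compatible X"
  shows "tau_on c \<alpha> (cdom \<alpha>) = tau c X \<alpha>"
proof
  fix \<beta> :: "('p, 's, 'n) superchart"
  show "tau_on c \<alpha> (cdom \<alpha>) \<beta> = tau c X \<alpha> \<beta>"
  proof (cases "\<beta> \<in> compatible X")
    case True
    have O: "opn (cdom \<alpha> \<inter> cdom \<beta>)" using \<alpha> True by auto
    show ?thesis
      using True K_carrier[OF tau_sect(1)[OF \<alpha>, of c] True] res_id[OF O] by (simp add: tau_on_def K_simps)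
  next
    case False
    then show ?thesis by (simp add: tau_on_def K_simps tau_def)
  qed
qed

context
  fixes c :: complex and \<omega> assumes \<omega>: "\<omega> \<in> normalized_functionals c"
begin

lemma tau_value_closed:
  "\<alpha> \<in> compatible X \<Longrightarrow> opn W \<Longrightarrow> W \<subseteq> cdom \<alpha> \<Longrightarrow> \<omega> W (tau_on c \<alpha> W) \<in> carrier (sect X W)"
  using normalized_closed[OF \<omega>] tau_on_sect by blast

lemma tau_value_res:
  assumes "\<alpha> \<in> compatible X" "opn W" "W \<subseteq> cdom \<alpha>" "opn W'" "W' \<subseteq> W"
  shows "res X W W' (\<omega> W (tau_on c \<alpha> W)) = \<omega> W' (tau_on c \<alpha> W')"
  using N_natural[OF normalized_sect[OF \<omega>] assms(2) opn_subset_T[OF assms(2)] tau_on_sect[OF assms(1-3)] assms(4,5)]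
    tau_on_res[OF assms, of c] by simp

text \<open>
  The values \<open>h\<^sub>\<alpha>\<close> on \<open>\<tau>\<^sub>\<alpha>\<close> transform by \<open>h\<^sub>\<alpha> = c/3 \<sigma>(D\<^sub>\<alpha>\<Psi>\<^bsub>\<beta>,\<alpha>\<^esub>) + h\<^sub>\<beta> (D\<^sub>\<alpha>\<Psi>\<^bsub>\<beta>,\<alpha>\<^esub>)\<^sup>3\<close>, the rule for a
  super projective connection.
\<close>

lemma tau_value_change:
  assumes W: "in_charts \<alpha> \<beta> W"
  shows "\<omega> W (tau_on c \<alpha> W) = csw c \<beta> \<alpha> W \<oplus>\<^bsub>sect X W\<^esub> \<omega> W (tau_on c \<beta> W) \<otimes>\<^bsub>sect X W\<^esub> jac3 \<beta> \<alpha> W"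
proof -
  note O = in_chartsD(4)[OF W]
  interpret R: ring "sect X W" by (rule sect_ring[OF O])
  show ?thesis
    using tau_change[OF W normalized_sect[OF \<omega>] opn_subset_T[OF O]] normalized_vacuum[OF \<omega> O] csw_carrier[OF W]
    by simp
qed

lemma functional_atlas_zero:
  assumes "\<alpha> \<in> functional_atlas c \<omega>" "opn W" "W \<subseteq> cdom \<alpha>"
  shows "\<omega> W (tau_on c \<alpha> W) = \<zero>\<^bsub>sect X W\<^esub>"
proof -
  have \<alpha>: "\<alpha> \<in> compatible X" "\<omega> (cdom \<alpha>) (tau c X \<alpha>) = \<zero>\<^bsub>sect X (cdom \<alpha>)\<^esub>"
    using assms(1) by (simp_all add: functional_atlas_def)
  show ?thesis
    using tau_value_res[OF \<alpha>(1) compatible_opn[OF \<alpha>(1)] order.refl assms(2,3)] assms compatible_opn[OF \<alpha>(1)]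
    by (simp add: tau_on_cdom \<alpha>)
qed

text \<open>
  In coordinates \<open>\<beta>\<close> with \<open>\<sigma>(D\<^sub>\<alpha>\<Psi>\<^bsub>\<beta>,\<alpha>\<^esub>) = 3/c h\<^sub>\<alpha>\<close> the rule leaves \<open>h\<^sub>\<beta> (D\<^sub>\<alpha>\<Psi>\<^bsub>\<beta>,\<alpha>\<^esub>)\<^sup>3 = 0\<close>, and the Jacobian
  factor is invertible.
\<close>

lemma functional_atlas_covers:
  assumes c: "c \<noteq> 0" and x: "x \<in> T"
  obtains \<beta> where "\<beta> \<in> functional_atlas c \<omega>" "x \<in> cdom \<beta>"
proof -
  obtain \<alpha> where \<alpha>: "\<alpha> \<in> compatible X" "x \<in> cdom \<alpha>" using atlas_cover[OF x] atlas_compatible by blast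
  note O = compatible_opn[OF \<alpha>(1)]
  define t where "t = \<omega> (cdom \<alpha>) (tau_on c \<alpha> (cdom \<alpha>))"
  have tp: "t \<in> par X True (cdom \<alpha>)"
    unfolding t_def by (rule normalized_parity[OF \<omega> O tau_on_par[OF \<alpha>(1) O order.refl]])
  have tc: "t \<in> carrier (sect X (cdom \<alpha>))" by (rule par_closed[OF O tp])
  define h where "h = scalar X (cdom \<alpha>) (gconst (3 / c)) \<otimes>\<^bsub>sect X (cdom \<alpha>)\<^esub> t"
  have "scalar X (cdom \<alpha>) (gconst (3 / c)) \<in> par X False (cdom \<alpha>)"
    using scalar_parity[OF O, of _ False] by (simp add: gparity_even_iff)
  from par_mult[OF O this tp] have h: "h \<in> par X True (cdom \<alpha>)" by (simp add: h_def)
  obtain \<beta> where \<beta>: "\<beta> \<in> compatible X" "x \<in> cdom \<beta>" "cdom \<beta> \<subseteq> cdom \<alpha>"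
      "schw X \<beta> \<alpha> (cdom \<beta>) = res X (cdom \<alpha>) (cdom \<beta>) h"
    by (rule chart_with_schwarzian[OF \<alpha> h])
  let ?W = "cdom \<beta>"
  note W = compatible_opn[OF \<beta>(1)]
  interpret R: ring "sect X ?W" by (rule sect_ring[OF W])
  have ch: "in_charts \<alpha> \<beta> ?W" using \<alpha> \<beta> W by (simp add: in_charts_def)
  have ta: "\<omega> ?W (tau_on c \<alpha> ?W) = res X (cdom \<alpha>) ?W t"
    unfolding t_def by (rule tau_value_res[OF \<alpha>(1) O order.refl W \<beta>(3), symmetric])
  have "scalar X ?W (gconst (c / 3)) \<otimes>\<^bsub>sect X ?W\<^esub> scalar X ?W (gconst (3 / c)) = scalar X ?W (gconst (c / 3) * gconst (3 / c))"
    using ring_hom_mult[OF scalar_hom[OF W], of "gconst (c / 3)" "gconst (3 / c)"] by (simp add: grassmann_ring_def)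
  also have "gconst (c / 3) * gconst (3 / c) = (1 :: 'n grassmann)" using c by (simp flip: gconst_hom(2))
  also have "scalar X ?W 1 = \<one>\<^bsub>sect X ?W\<^esub>"
    using ring_hom_one[OF scalar_hom[OF W]] by (simp add: grassmann_ring_def)
  finally have inv: "scalar X ?W (gconst (c / 3)) \<otimes>\<^bsub>sect X ?W\<^esub> scalar X ?W (gconst (3 / c)) = \<one>\<^bsub>sect X ?W\<^esub>" .
  have rt: "res X (cdom \<alpha>) ?W t \<in> carrier (sect X ?W)" using tc O W \<beta>(3) by simp
  have sc: "scalar X ?W (gconst y) \<in> carrier (sect X ?W)" for y using W by simp
  have "csw c \<beta> \<alpha> ?W = scalar X ?W (gconst (c / 3)) \<otimes>\<^bsub>sect X ?W\<^esub>
      (scalar X ?W (gconst (3 / c)) \<otimes>\<^bsub>sect X ?W\<^esub> res X (cdom \<alpha>) ?W t)"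
    using O W \<beta>(3) tc by (simp add: csw_def \<beta>(4) h_def res_scalar)
  also have "\<dots> = res X (cdom \<alpha>) ?W t"
    unfolding R.m_assoc[OF sc sc rt, symmetric] inv using rt by simp
  finally have csw: "csw c \<beta> \<alpha> ?W = res X (cdom \<alpha>) ?W t" .
  let ?b = "\<omega> ?W (tau_on c \<beta> ?W)"
  have b: "?b \<in> carrier (sect X ?W)" by (rule tau_value_closed[OF \<beta>(1) W order.refl])
  note j = jac3_carrier[OF ch] jac3_carrier[OF in_charts_sym[OF ch]]
  have "res X (cdom \<alpha>) ?W t = res X (cdom \<alpha>) ?W t \<oplus>\<^bsub>sect X ?W\<^esub> ?b \<otimes>\<^bsub>sect X ?W\<^esub> jac3 \<beta> \<alpha> ?W"
    using tau_value_change[OF ch] csw ta by simp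
  from this[symmetric] have zero: "?b \<otimes>\<^bsub>sect X ?W\<^esub> jac3 \<beta> \<alpha> ?W = \<zero>\<^bsub>sect X ?W\<^esub>"
    by (rule R.add.l_cancel_one[OF rt R.m_closed[OF b j(1)], THEN iffD1])
  have "?b = (?b \<otimes>\<^bsub>sect X ?W\<^esub> jac3 \<beta> \<alpha> ?W) \<otimes>\<^bsub>sect X ?W\<^esub> jac3 \<alpha> \<beta> ?W"
    unfolding R.m_assoc[OF b j] jac3_inverse[OF ch] using b by simp
  then have "?b = \<zero>\<^bsub>sect X ?W\<^esub>" unfolding zero using j(2) by simp
  then have "\<beta> \<in> functional_atlas c \<omega>" using \<beta>(1) by (simp add: functional_atlas_def tau_on_cdom)
  then show ?thesis using that \<beta>(2) by blast
qed

lemma functional_atlas_cover_eq: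
  assumes c: "c \<noteq> 0"
  shows "(\<Union>\<alpha>\<in>functional_atlas c \<omega>. cdom \<alpha>) = T"
proof (intro equalityI subsetI)
  fix x assume "x \<in> (\<Union>\<alpha>\<in>functional_atlas c \<omega>. cdom \<alpha>)"
  then obtain \<alpha> where "\<alpha> \<in> compatible X" "x \<in> cdom \<alpha>" by (auto simp: functional_atlas_def)
  then show "x \<in> T" using opn_subset_T[OF compatible_opn] by blast
next
  fix x assume "x \<in> T"
  from functional_atlas_covers[OF c this] show "x \<in> (\<Union>\<alpha>\<in>functional_atlas c \<omega>. cdom \<alpha>)" by blast
qed

lemma functional_atlas_superprojective:
  assumes c: "c \<noteq> 0"
  shows "superprojective_atlas X (functional_atlas c \<omega>)"
  unfolding superprojective_atlas_def
proof (intro conjI ballI functional_atlas_cover_eq[OF c])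
  show "functional_atlas c \<omega> \<subseteq> compatible X" by (auto simp: functional_atlas_def)
  fix \<alpha> \<beta> assume ab: "\<alpha> \<in> functional_atlas c \<omega>" "\<beta> \<in> functional_atlas c \<omega>"
  then have cab: "\<alpha> \<in> compatible X" "\<beta> \<in> compatible X" by (simp_all add: functional_atlas_def)
  let ?W = "cdom \<alpha> \<inter> cdom \<beta>"
  have ch: "in_charts \<alpha> \<beta> ?W" using cab by (simp add: in_charts_def)
  note W = in_chartsD(4)[OF ch]
  interpret R: ring "sect X ?W" by (rule sect_ring[OF W])
  have "csw c \<beta> \<alpha> ?W = \<zero>\<^bsub>sect X ?W\<^esub>"
    using tau_value_change[OF ch] functional_atlas_zero[OF ab(1) W] functional_atlas_zero[OF ab(2) W]
      csw_carrier[OF ch] jac3_carrier[OF ch] by simp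
  then show "superprojective_transition X \<beta> \<alpha>"
    unfolding superprojective_transition_iff[OF cab] csw_zero_iff[OF ch c] .
qed

text \<open>
  If \<open>\<beta>\<close> is related to a member \<open>\<alpha>\<close> of the atlas by a fractional linear transformation, both terms of the
  rule for \<open>h\<^sub>\<beta>\<close> vanish on the overlap. As the atlas covers the curve, \<open>h\<^sub>\<beta> = 0\<close>.
\<close>

lemma functional_atlas_maximal:
  assumes c: "c \<noteq> 0" and S: "superprojective_atlas X S" "functional_atlas c \<omega> \<subseteq> S"
  shows "S = functional_atlas c \<omega>"
proof (rule equalityI[OF subsetI S(2)])
  fix \<beta> assume \<beta>S: "\<beta> \<in> S"
  then have \<beta>: "\<beta> \<in> compatible X" using S(1) by (auto simp: superprojective_atlas_def)
  note O = compatible_opn[OF \<beta>]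
  have "\<omega> (cdom \<beta>) (tau_on c \<beta> (cdom \<beta>)) = \<zero>\<^bsub>sect X (cdom \<beta>)\<^esub>"
  proof (rule sect_local_eqI[OF O tau_value_closed[OF \<beta> O order.refl] sect_closed(1)[OF O]])
    fix x assume x: "x \<in> cdom \<beta>"
    then have "x \<in> T" using opn_subset_T[OF O] by blast
    then obtain \<alpha> where \<alpha>: "\<alpha> \<in> functional_atlas c \<omega>" "x \<in> cdom \<alpha>" by (rule functional_atlas_covers[OF c])
    then have \<alpha>c: "\<alpha> \<in> compatible X" by (simp add: functional_atlas_def)
    let ?W = "cdom \<beta> \<inter> cdom \<alpha>"
    have ch: "in_charts \<beta> \<alpha> ?W" using \<alpha>c \<beta> by (simp add: in_charts_def)
    note W = in_chartsD(4)[OF ch]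
    interpret R: ring "sect X ?W" by (rule sect_ring[OF W])
    have "superprojective_transition X \<alpha> \<beta>" using S \<beta>S \<alpha>(1) unfolding superprojective_atlas_def by blast
    then have "csw c \<alpha> \<beta> ?W = \<zero>\<^bsub>sect X ?W\<^esub>"
      unfolding superprojective_transition_iff[OF \<beta> \<alpha>c] csw_zero_iff[OF ch c] .
    then have "\<omega> ?W (tau_on c \<beta> ?W) = \<zero>\<^bsub>sect X ?W\<^esub>"
      using tau_value_change[OF ch] functional_atlas_zero[OF \<alpha>(1) W] jac3_carrier[OF ch] by simp
    then have "res X (cdom \<beta>) ?W (\<omega> (cdom \<beta>) (tau_on c \<beta> (cdom \<beta>))) = res X (cdom \<beta>) ?W \<zero>\<^bsub>sect X (cdom \<beta>)\<^esub>"
      using tau_value_res[OF \<beta> O order.refl W] O W by simp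
    then show "\<exists>V. opn V \<and> x \<in> V \<and> V \<subseteq> cdom \<beta> \<and>
        res X (cdom \<beta>) V (\<omega> (cdom \<beta>) (tau_on c \<beta> (cdom \<beta>))) = res X (cdom \<beta>) V \<zero>\<^bsub>sect X (cdom \<beta>)\<^esub>"
      using W x \<alpha>(2) by (intro exI[of _ ?W]) auto
  qed
  then show "\<beta> \<in> functional_atlas c \<omega>" using \<beta> by (simp add: functional_atlas_def tau_on_cdom)
qed

lemma functional_atlas_structure: "c \<noteq> 0 \<Longrightarrow> functional_atlas c \<omega> \<in> superprojective_structures X"
  unfolding superprojective_structures_def mem_Collect_eq
  using functional_atlas_superprojective functional_atlas_maximal by blast

end

text \<open>
  On the charts of its atlas the functional has the values \<open>1\<close> and \<open>0\<close> on the frame, and these charts cover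
  the curve.
\<close>

lemma functional_atlas_inj:
  assumes c: "c \<noteq> 0"
  shows "inj_on (functional_atlas c) (normalized_functionals c)"
proof (rule inj_onI)
  fix \<omega> \<omega>' assume \<omega>: "\<omega> \<in> normalized_functionals c" and \<omega>': "\<omega>' \<in> normalized_functionals c"
    and eq: "functional_atlas c \<omega> = functional_atlas c \<omega>'"
  have T: "opn T" by simp
  have A: "functional_atlas c \<omega> \<subseteq> compatible X" by (auto simp: functional_atlas_def)
  show "\<omega> = \<omega>'"
  proof (rule functional_eqI[OF T A equalityD2[OF functional_atlas_cover_eq[OF \<omega> c]] normalized_sect[OF \<omega>]
      normalized_sect[OF \<omega>']])
    fix \<alpha> assume \<alpha>: "\<alpha> \<in> functional_atlas c \<omega>"
    then have "\<alpha> \<in> compatible X" by (simp add: functional_atlas_def)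
    then have W: "opn (T \<inter> cdom \<alpha>)" "T \<inter> cdom \<alpha> \<subseteq> cdom \<alpha>" by auto
    show "\<omega> (T \<inter> cdom \<alpha>) (vacuum X (T \<inter> cdom \<alpha>)) = \<omega>' (T \<inter> cdom \<alpha>) (vacuum X (T \<inter> cdom \<alpha>))"
      unfolding normalized_vacuum[OF \<omega> W(1)] normalized_vacuum[OF \<omega>' W(1)] ..
    show "\<omega> (T \<inter> cdom \<alpha>) (tau_on c \<alpha> (T \<inter> cdom \<alpha>)) = \<omega>' (T \<inter> cdom \<alpha>) (tau_on c \<alpha> (T \<inter> cdom \<alpha>))"
      unfolding functional_atlas_zero[OF \<omega> \<alpha> W] functional_atlas_zero[OF \<omega>' \<alpha>[unfolded eq] W] ..
  qed
qed

text \<open>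
  On a superprojective atlas the Schwarzians vanish, so that the functionals \<open>|0\<rangle>\<^sub>\<alpha> \<mapsto> 1\<close>, \<open>\<tau>\<^sub>\<alpha> \<mapsto> 0\<close>
  agree on overlaps.
\<close>

lemma functional_of_superprojective_atlas:
  assumes c: "c \<noteq> 0" and A: "superprojective_atlas X A"
  obtains \<omega> where "\<omega> \<in> normalized_functionals c" "A \<subseteq> functional_atlas c \<omega>"
proof -
  have T: "opn T" by simp
  interpret RT: ring "sect X T" by (rule sect_ring[OF T])
  have Ac: "A \<subseteq> compatible X" "T \<subseteq> (\<Union>\<alpha>\<in>A. cdom \<alpha>)"
    and trans: "\<And>\<alpha> \<beta>. \<alpha> \<in> A \<Longrightarrow> \<beta> \<in> A \<Longrightarrow> superprojective_transition X \<beta> \<alpha>"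
    using A by (auto simp: superprojective_atlas_def)
  let ?p = "\<lambda>\<alpha>. \<one>\<^bsub>sect X (T \<inter> cdom \<alpha>)\<^esub>" and ?q = "\<lambda>\<alpha>. \<zero>\<^bsub>sect X (T \<inter> cdom \<alpha>)\<^esub>"
  have Tc: "T \<inter> cdom \<alpha> = cdom \<alpha>" "opn (cdom \<alpha>)" "\<alpha> \<in> compatible X" if "\<alpha> \<in> A" for \<alpha>
    using Ac(1) that opn_subset_T[OF compatible_opn[of \<alpha>]] by auto
  obtain f where f: "f \<in> msect (N c) T" and val: "\<And>W m \<alpha>. opn W \<Longrightarrow> W \<subseteq> T \<Longrightarrow> m \<in> msect (K c) W \<Longrightarrow> \<alpha> \<in> A \<Longrightarrow>
      res X W (W \<inter> cdom \<alpha>) (f W m) =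
        res X (T \<inter> cdom \<alpha>) (W \<inter> cdom \<alpha>) (?p \<alpha>) \<otimes>\<^bsub>sect X (W \<inter> cdom \<alpha>)\<^esub> fst (m \<alpha>) \<oplus>\<^bsub>sect X (W \<inter> cdom \<alpha>)\<^esub>
        res X (T \<inter> cdom \<alpha>) (W \<inter> cdom \<alpha>) (?q \<alpha>) \<otimes>\<^bsub>sect X (W \<inter> cdom \<alpha>)\<^esub> snd (m \<alpha>)"
  proof (rule glue_functional[OF T Ac, of ?p ?q c])
    show "?p \<alpha> \<in> carrier (sect X (T \<inter> cdom \<alpha>))" "?q \<alpha> \<in> carrier (sect X (T \<inter> cdom \<alpha>))" if "\<alpha> \<in> A" for \<alpha>
      using Tc[OF that] by simp_all
    fix \<alpha> \<beta> W assume ab: "\<alpha> \<in> A" "\<beta> \<in> A" and W: "W = T \<inter> cdom \<alpha> \<inter> cdom \<beta>"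
    have W': "W = cdom \<alpha> \<inter> cdom \<beta>" using W Tc(1)[OF ab(1)] by simp
    have O: "opn W" "W \<subseteq> cdom \<alpha>" "W \<subseteq> cdom \<beta>" unfolding W' using Tc[OF ab(1)] Tc[OF ab(2)] by auto
    have ch: "in_charts \<alpha> \<beta> W" using O Tc[OF ab(1)] Tc[OF ab(2)] by (simp add: in_charts_def)
    interpret R: ring "sect X W" by (rule sect_ring[OF O(1)])
    have "schw X \<beta> \<alpha> W = \<zero>\<^bsub>sect X W\<^esub>"
      using trans[OF ab] unfolding superprojective_transition_iff[OF Tc(3)[OF ab(1)] Tc(3)[OF ab(2)]] W' .
    then have "csw c \<beta> \<alpha> W = \<zero>\<^bsub>sect X W\<^esub>" unfolding csw_zero_iff[OF ch c] .
    then show "res X (T \<inter> cdom \<alpha>) W (?p \<alpha>) = res X (T \<inter> cdom \<beta>) W (?p \<beta>) \<and>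
      res X (T \<inter> cdom \<alpha>) W (?q \<alpha>) = res X (T \<inter> cdom \<beta>) W (?p \<beta>) \<otimes>\<^bsub>sect X W\<^esub> csw c \<beta> \<alpha> W \<oplus>\<^bsub>sect X W\<^esub>
        res X (T \<inter> cdom \<beta>) W (?q \<beta>) \<otimes>\<^bsub>sect X W\<^esub> jac3 \<beta> \<alpha> W"
      unfolding Tc(1)[OF ab(1)] Tc(1)[OF ab(2)]
      using O Tc(2)[OF ab(1)] Tc(2)[OF ab(2)] jac3_carrier[OF ch] by simp
  qed (rule that)
  have "f \<in> mpar (N c) False T"
  proof (rule glued_parity[OF T Ac, of ?p False ?q f c])
    show "?p \<alpha> \<in> par X False (T \<inter> cdom \<alpha>)" "?q \<alpha> \<in> par X (\<not> False) (T \<inter> cdom \<alpha>)" if "\<alpha> \<in> A" for \<alpha>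
      using Tc[OF that] by (simp_all add: par_const)
  qed (rule f, rule val)
  moreover have "f T (vacuum X T) = \<one>\<^bsub>sect X T\<^esub>"
  proof (rule cover_eqI[OF T Ac N_closed[OF f T order.refl vacuum_sect(1)[OF T]] RT.one_closed])
    fix \<alpha> assume \<alpha>: "\<alpha> \<in> A"
    interpret R: ring "sect X (cdom \<alpha>)" by (rule sect_ring[OF Tc(2)[OF \<alpha>]])
    have sub: "cdom \<alpha> \<subseteq> T" using Tc(2)[OF \<alpha>] by (rule opn_subset_T)
    show "res X T (T \<inter> cdom \<alpha>) (f T (vacuum X T)) = res X T (T \<inter> cdom \<alpha>) \<one>\<^bsub>sect X T\<^esub>"
      unfolding val[OF T order.refl vacuum_sect(1)[OF T] \<alpha>] unfolding Tc(1)[OF \<alpha>]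
      using Tc[OF \<alpha>] sub by (simp add: vacuum_def)
  qed
  ultimately have \<omega>: "f \<in> normalized_functionals c" by (simp add: normalized_functionals_def)
  have "A \<subseteq> functional_atlas c f"
  proof
    fix \<alpha> assume \<alpha>: "\<alpha> \<in> A"
    note C = Tc[OF \<alpha>]
    interpret R: ring "sect X (cdom \<alpha>)" by (rule sect_ring[OF C(2)])
    have ch: "in_charts \<alpha> \<alpha> (cdom \<alpha>)" using C by (simp add: in_charts_def)
    note t = tau_sect(1)[OF C(3), of c]
    have "f (cdom \<alpha>) (tau c X \<alpha>) = res X (cdom \<alpha>) (cdom \<alpha> \<inter> cdom \<alpha>) (f (cdom \<alpha>) (tau c X \<alpha>))"
      using res_id[OF C(2) normalized_closed[OF \<omega> C(2) t]] by simp
    also have "\<dots> = \<zero>\<^bsub>sect X (cdom \<alpha>)\<^esub>"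
      unfolding val[OF C(2) opn_subset_T[OF C(2)] t \<alpha>] unfolding C(1)
      using C csw_self[OF ch] by (simp add: tau_value)
    finally show "\<alpha> \<in> functional_atlas c f" using C(3) by (simp add: functional_atlas_def)
  qed
  with \<omega> show ?thesis by (rule that)
qed

theorem functional_atlas_bij:
  assumes c: "c \<noteq> 0"
  shows "bij_betw (functional_atlas c) (normalized_functionals c) (superprojective_structures X)"
  unfolding bij_betw_def
proof (intro conjI functional_atlas_inj[OF c] equalityI subsetI)
  fix A assume "A \<in> functional_atlas c ` normalized_functionals c"
  then show "A \<in> superprojective_structures X" using functional_atlas_structure[OF _ c] by blast
next
  fix A assume "A \<in> superprojective_structures X"
  then have A: "superprojective_atlas X A" "\<And>S. superprojective_atlas X S \<Longrightarrow> A \<subseteq> S \<Longrightarrow> S = A"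
    unfolding superprojective_structures_def by blast+
  obtain \<omega> where \<omega>: "\<omega> \<in> normalized_functionals c" "A \<subseteq> functional_atlas c \<omega>"
    by (rule functional_of_superprojective_atlas[OF c A(1)])
  have "functional_atlas c \<omega> = A" by (rule A(2)[OF functional_atlas_superprojective[OF \<omega>(1) c] \<omega>(2)])
  then show "A \<in> functional_atlas c ` normalized_functionals c" using \<omega>(1) by blast
qed

theorem splitting_atlas_bij:
  assumes c: "c \<noteq> 0"
  shows "bij_betw (splitting_atlas c X) (splittings X (N c) (structure_module X) (vac_eval c X))
    (superprojective_structures X)"
proof -
  have "bij_betw (functional_atlas c \<circ> (\<lambda>s. s T \<one>\<^bsub>sect X T\<^esub>))
      (splittings X (N c) (structure_module X) (vac_eval c X)) (superprojective_structures X)"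
    by (rule bij_betw_trans[OF splittings_bij functional_atlas_bij[OF c]])
  then show ?thesis
    by (rule bij_betw_cong[THEN iffD1, rotated]) (simp add: splitting_atlas_eq)
qed

end

theorem theorem3p3p7:
  fixes X :: "('p, 's, 'n::len0) supercurve" and c :: complex
  assumes "superconformal_curve X" and "c \<noteq> 0"
  shows "extension X (berezinian_power 3 X) (dual_module X (K_module c X)) (structure_module X)
           (ber_incl c X) (vac_eval c X) \<and>
         bij_betw (splitting_atlas c X)
           (splittings X (dual_module X (K_module c X)) (structure_module X) (vac_eval c X))
           (superprojective_structures X)"
proof -
  interpret superconformal_curve X by (rule assms(1))
  show ?thesis using dual_extension[of c] splitting_atlas_bij[OF assms(2)] by blast
qed

end
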